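(* Let $1<p<\infty$, let $\Omega\subset\mathbb{R}^d$ be open and let $f\in(L^p(\Omega))'$. Then $$\|f\|_{(W^{1,p}_0(\Omega))'}\le\liminf_{\varepsilon\to0}\|f\|_{(W^p_{\nu_\varepsilon,0}(\Omega|\mathbb{R}^d))'}.$$ If $\Omega$ is a $W^{1,p}$-extension domain, then $$\|f\|_{(W^{1,p}(\Omega))'}\le\liminf_{\varepsilon\to0}\|f\|_{(W^p_{\nu_\varepsilon}(\Omega))'}.$$ If in addition $\Omega$ is bounded Lipschitz, then $$\|f\|_{(W^{1,p}(\Omega))'}=\lim_{\varepsilon\to0}\|f\|_{(W^p_{\nu_\varepsilon}(\Omega))'}\quad\text{and}\quad\|f\|_{(W^{1,p}_0(\Omega))'}=\lim_{\varepsilon\to0}\|f\|_{(W^p_{\nu_\varepsilon,0}(\Omega|\mathbb{R}^d))'}.$$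
   Context: Kernels: $(\nu_\varepsilon)_{\varepsilon>0}$ is a family of radial measurable functions $\nu_\varepsilon:\mathbb{R}^d\setminus\{0\}\to[0,\infty)$, $d\ge1$, with $\int_{\mathbb{R}^d}(1\wedge|h|^p)\nu_\varepsilon(h)\,dh=1$ and $\lim_{\varepsilon\to0}\int_{|h|>\delta}\nu_\varepsilon(h)\,dh=0$ for every $\delta>0$. If $d=1$, assume in addition that there are $c_0,\theta_0\in(0,1)$ with $\inf_{\theta_0\le\theta\le1}\nu_\varepsilon(\theta x)\ge c_0\,\nu_\varepsilon(x)$ for all $x\neq0$ and $\varepsilon\in(0,1)$. $K_{d,p}=\frac{1}{|\mathbb{S}^{d-1}|}\int_{\mathbb{S}^{d-1}}|w_d|^p\,d\sigma_{d-1}(w)$, $\Omega^c=\mathbb{R}^d\setminus\Omega$. $W^{1,p}(\Omega)$ and $W^{1,p}_0(\Omega)$ carry the norm $\|u\|^*_{W^{1,p}(\Omega)}=(\|u\|_{L^p(\Omega)}^p+K_{d,p}\|\nabla u\|_{L^p(\Omega)}^p)^{1/p}$. $W^p_{\nu_\varepsilon}(\Omega)=\{u\in L^p(\Omega):\iint_{\Omega\times\Omega}|u(x)-u(y)|^p\nu_\varepsilon(x-y)\,dy\,dx<\infty\}$ with norm $\big(\|u\|_{L^p(\Omega)}^p+\iint_{\Omega\times\Omega}|u(x)-u(y)|^p\nu_\varepsilon(x-y)\,dy\,dx\big)^{1/p}$. $W^p_{\nu_\varepsilon,0}(\Omega|\mathbb{R}^d)$ is the space of measurable $u:\mathbb{R}^d\to\mathbb{R}$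 with $u=0$ a.e. on $\Omega^c$, $u|_\Omega\in L^p(\Omega)$, and $\iint_{(\Omega^c\times\Omega^c)^c}|u(x)-u(y)|^p\nu_\varepsilon(x-y)\,dy\,dx<\infty$, with norm $\big(\|u\|_{L^p(\Omega)}^p+\iint_{(\Omega^c\times\Omega^c)^c}|u(x)-u(y)|^p\nu_\varepsilon(x-y)\,dy\,dx\big)^{1/p}$. Each dual norm is taken with respect to the indicated norm, $f$ acting on the smaller spaces through their inclusion into $L^p(\Omega)$. $\Omega$ is a $W^{1,p}$-extension domain if there is a bounded linear operator $E:W^{1,p}(\Omega)\to W^{1,p}(\mathbb{R}^d)$ with $Eu|_\Omega=u$. *)

theory Defs
  imports "HOL-Analysis.Analysis"
begin

text \<open>
  The space \<open>\<real>\<^sup>d\<close>, \<open>d \<ge> 1\<close>, is an arbitrary type of class \<^class>\<open>euclidean_space\<close>.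
  Elements of \<open>L\<^sup>p(\<Omega>)\<close> are represented by total functions of which only the restriction to
  \<open>\<Omega>\<close> matters; functions that agree a.e. on \<open>\<Omega>\<close> are not identified, but have distance zero.
\<close>

definition Lp :: "real \<Rightarrow> 'a::euclidean_space set \<Rightarrow> ('a \<Rightarrow> 'b::euclidean_space) set" where
  "Lp p \<Omega> = {u \<in> borel_measurable (lebesgue_on \<Omega>).
               integrable (lebesgue_on \<Omega>) (\<lambda>x. norm (u x) powr p)}"

definition Lp_norm :: "real \<Rightarrow> 'a::euclidean_space set \<Rightarrow> ('a \<Rightarrow> 'b::euclidean_space) \<Rightarrow> real" where
  "Lp_norm p \<Omega> u = (\<integral>x. norm (u x) powr p \<partial>lebesgue_on \<Omega>) powr (1 / p)"

text \<open>
  Linearity and boundedness force a functional below to take equal values on functions that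
  agree a.e. on \<open>\<Omega>\<close>, so it is a functional on the quotient space.
\<close>

definition Lp_dual :: "real \<Rightarrow> 'a::euclidean_space set \<Rightarrow> (('a \<Rightarrow> real) \<Rightarrow> real) set" where
  "Lp_dual p \<Omega> = {f.
     (\<forall>u\<in>Lp p \<Omega>. \<forall>v\<in>Lp p \<Omega>. f (\<lambda>x. u x + v x) = f u + f v) \<and>
     (\<forall>c. \<forall>u\<in>Lp p \<Omega>. f (\<lambda>x. c * u x) = c * f u) \<and>
     (\<exists>C. \<forall>u\<in>Lp p \<Omega>. \<bar>f u\<bar> \<le> C * Lp_norm p \<Omega> u)}"

definition dual_norm ::
    "('a \<Rightarrow> real) set \<Rightarrow> (('a \<Rightarrow> real) \<Rightarrow> real) \<Rightarrow> (('a \<Rightarrow> real) \<Rightarrow> real) \<Rightarrow> ereal" where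
  "dual_norm X N f = (SUP u\<in>{u \<in> X. N u \<le> 1}. ereal \<bar>f u\<bar>)"


primrec Ck :: "nat \<Rightarrow> ('a::euclidean_space \<Rightarrow> real) \<Rightarrow> bool" where
  "Ck 0 \<phi> \<longleftrightarrow> continuous_on UNIV \<phi>"
| "Ck (Suc k) \<phi> \<longleftrightarrow> (\<forall>x. \<phi> differentiable (at x)) \<and>
                  (\<forall>b\<in>Basis. Ck k (\<lambda>x. frechet_derivative \<phi> (at x) b))"

definition test_functions :: "'a::euclidean_space set \<Rightarrow> ('a \<Rightarrow> real) set" where
  "test_functions \<Omega> = {\<phi>. (\<forall>k. Ck k \<phi>) \<and>
     compact (closure {x. \<phi> x \<noteq> 0}) \<and> closure {x. \<phi> x \<noteq> 0} \<subseteq> \<Omega>}"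

definition is_weak_gradient ::
    "'a::euclidean_space set \<Rightarrow> ('a \<Rightarrow> real) \<Rightarrow> ('a \<Rightarrow> 'a) \<Rightarrow> bool" where
  "is_weak_gradient \<Omega> u g \<longleftrightarrow>
     (\<forall>K. compact K \<and> K \<subseteq> \<Omega> \<longrightarrow> integrable (lebesgue_on K) g) \<and>
     (\<forall>\<phi>\<in>test_functions \<Omega>. \<forall>b\<in>Basis.
        (\<integral>x. u x * frechet_derivative \<phi> (at x) b \<partial>lebesgue_on \<Omega>)
          = - (\<integral>x. (g x \<bullet> b) * \<phi> x \<partial>lebesgue_on \<Omega>))"

text \<open>The weak gradient is unique up to a null set, so the choice is immaterial in \<open>L\<^sup>p\<close>.\<close>

definition weak_gradient :: "'a::euclidean_space set \<Rightarrow> ('a \<Rightarrow> real) \<Rightarrow> 'a \<Rightarrow> 'a" where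
  "weak_gradient \<Omega> u = (SOME g. is_weak_gradient \<Omega> u g)"

definition W1p :: "real \<Rightarrow> 'a::euclidean_space set \<Rightarrow> ('a \<Rightarrow> real) set" where
  "W1p p \<Omega> = {u \<in> Lp p \<Omega>. \<exists>g\<in>Lp p \<Omega>. is_weak_gradient \<Omega> u g}"

text \<open>
  Surface measure on the unit sphere:
  \<open>\<sigma>(A) = d \<cdot> |{x. 0 < |x| \<le> 1 \<and> x / |x| \<in> A}|\<close>; for \<open>d = 1\<close> it is the counting measure
  on the two unit vectors.
\<close>

definition sphere_measure :: "'a::euclidean_space measure" where
  "sphere_measure =
     scale_measure (ennreal (real DIM('a)))
       (distr (restrict_space lborel (cball 0 1 - {0})) (restrict_space borel (sphere 0 1)) sgn)"

text \<open>
  The constant \<open>K\<^bsub>d,p\<^esub>\<close>, with \<open>w \<bullet> e\<close> for a basis vector \<open>e\<close> as the coordinate \<open>w\<^sub>d\<close>; by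
  rotation invariance the value does not depend on \<open>e\<close>.
\<close>

definition K_const :: "'a::euclidean_space \<Rightarrow> real \<Rightarrow> real" where
  "K_const e p =
     (\<integral>w. \<bar>w \<bullet> e\<bar> powr p \<partial>sphere_measure) / measure (sphere_measure :: 'a measure) (sphere 0 1)"

definition W1p_norm :: "'a::euclidean_space \<Rightarrow> real \<Rightarrow> 'a set \<Rightarrow> ('a \<Rightarrow> real) \<Rightarrow> real" where
  "W1p_norm e p \<Omega> u =
     (Lp_norm p \<Omega> u powr p + K_const e p * Lp_norm p \<Omega> (weak_gradient \<Omega> u) powr p) powr (1 / p)"

text \<open>\<open>W\<^sub>0\<^sup>1\<^sup>,\<^sup>p(\<Omega>)\<close> is the closure of the test functions in \<open>W\<^sup>1\<^sup>,\<^sup>p(\<Omega>)\<close>.\<close>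

definition W1p_zero :: "'a::euclidean_space \<Rightarrow> real \<Rightarrow> 'a set \<Rightarrow> ('a \<Rightarrow> real) set" where
  "W1p_zero e p \<Omega> = {u \<in> W1p p \<Omega>.
     \<forall>\<eta>>0. \<exists>\<phi>\<in>test_functions \<Omega>. W1p_norm e p \<Omega> (\<lambda>x. u x - \<phi> x) < \<eta>}"

text \<open>The operator acts on equivalence classes, hence the a.e. equalities.\<close>

definition W1p_extension_domain :: "'a::euclidean_space \<Rightarrow> real \<Rightarrow> 'a set \<Rightarrow> bool" where
  "W1p_extension_domain e p \<Omega> \<longleftrightarrow> (\<exists>E :: ('a \<Rightarrow> real) \<Rightarrow> 'a \<Rightarrow> real.
     (\<forall>u\<in>W1p p \<Omega>. E u \<in> W1p p UNIV \<and> (AE x in lebesgue_on \<Omega>. E u x = u x)) \<and>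
     (\<forall>u\<in>W1p p \<Omega>. \<forall>v\<in>W1p p \<Omega>. AE x in lebesgue. E (\<lambda>y. u y + v y) x = E u x + E v x) \<and>
     (\<forall>c. \<forall>u\<in>W1p p \<Omega>. AE x in lebesgue. E (\<lambda>y. c * u y) x = c * E u x) \<and>
     (\<exists>C. \<forall>u\<in>W1p p \<Omega>. W1p_norm e p UNIV (E u) \<le> C * W1p_norm e p \<Omega> u))"

text \<open>
  Near each boundary point, \<open>\<Omega>\<close> is the part of a ball lying above the graph of a Lipschitz
  function on the hyperplane orthogonal to a unit vector \<open>n\<close>.
\<close>

definition Lipschitz_boundary :: "'a::euclidean_space set \<Rightarrow> bool" where
  "Lipschitz_boundary \<Omega> \<longleftrightarrow> (\<forall>x\<in>frontier \<Omega>. \<exists>r>0. \<exists>n. norm n = 1 \<and>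
     (\<exists>\<gamma> :: 'a \<Rightarrow> real. \<exists>L. L-lipschitz_on {z. z \<bullet> n = 0} \<gamma> \<and>
        \<Omega> \<inter> ball x r = {y \<in> ball x r. \<gamma> (y - (y \<bullet> n) *\<^sub>R n) < y \<bullet> n}))"


text \<open>
  Kernels live on \<open>\<real>\<^sup>d \<setminus> {0}\<close>; nothing is assumed of the value at \<open>0\<close>, which never contributes
  to the integrals below since it is always multiplied by \<open>0\<close>.
\<close>

definition kernel_family :: "real \<Rightarrow> (real \<Rightarrow> 'a::euclidean_space \<Rightarrow> real) \<Rightarrow> bool" where
  "kernel_family p \<nu> \<longleftrightarrow>
     (\<forall>\<epsilon>>0.
        \<nu> \<epsilon> \<in> borel_measurable (lebesgue_on (- {0})) \<and>
        (\<forall>h. h \<noteq> 0 \<longrightarrow> 0 \<le> \<nu> \<epsilon> h) \<and>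
        (\<forall>h k. h \<noteq> 0 \<and> norm h = norm k \<longrightarrow> \<nu> \<epsilon> h = \<nu> \<epsilon> k) \<and>
        (\<integral>\<^sup>+h. ennreal (min 1 (norm h powr p) * \<nu> \<epsilon> h) \<partial>lebesgue) = 1) \<and>
     (\<forall>\<delta>>0. ((\<lambda>\<epsilon>. \<integral>\<^sup>+h\<in>{h. norm h > \<delta>}. ennreal (\<nu> \<epsilon> h) \<partial>lebesgue) \<longlongrightarrow> 0) (at_right 0)) \<and>
     (DIM('a) = 1 \<longrightarrow>
        (\<exists>c\<in>{0<..<1}. \<exists>\<theta>\<^sub>0\<in>{0<..<1}. \<forall>x. x \<noteq> 0 \<longrightarrow> (\<forall>\<epsilon>\<in>{0<..<1}.
           (INF \<theta>\<in>{\<theta>\<^sub>0..1}. \<nu> \<epsilon> (\<theta> *\<^sub>R x)) \<ge> c * \<nu> \<epsilon> x)))"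

definition energy ::
    "real \<Rightarrow> ('a::euclidean_space \<Rightarrow> real) \<Rightarrow> ('a \<times> 'a) set \<Rightarrow> ('a \<Rightarrow> real) \<Rightarrow> ennreal" where
  "energy p \<kappa> D u =
     (\<integral>\<^sup>+x. (\<integral>\<^sup>+y. ennreal (\<bar>u x - u y\<bar> powr p * \<kappa> (x - y)) * indicator D (x, y) \<partial>lebesgue)
        \<partial>lebesgue)"

definition W\<nu> :: "real \<Rightarrow> ('a::euclidean_space \<Rightarrow> real) \<Rightarrow> 'a set \<Rightarrow> ('a \<Rightarrow> real) set" where
  "W\<nu> p \<kappa> \<Omega> = {u \<in> Lp p \<Omega>. energy p \<kappa> (\<Omega> \<times> \<Omega>) u < \<infinity>}"

definition W\<nu>_norm :: "real \<Rightarrow> ('a::euclidean_space \<Rightarrow> real) \<Rightarrow> 'a set \<Rightarrow> ('a \<Rightarrow> real) \<Rightarrow> real" where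
  "W\<nu>_norm p \<kappa> \<Omega> u =
     (Lp_norm p \<Omega> u powr p + enn2real (energy p \<kappa> (\<Omega> \<times> \<Omega>) u)) powr (1 / p)"

definition W\<nu>_zero :: "real \<Rightarrow> ('a::euclidean_space \<Rightarrow> real) \<Rightarrow> 'a set \<Rightarrow> ('a \<Rightarrow> real) set" where
  "W\<nu>_zero p \<kappa> \<Omega> = {u \<in> borel_measurable lebesgue.
     (AE x in lebesgue. x \<in> - \<Omega> \<longrightarrow> u x = 0) \<and> u \<in> Lp p \<Omega> \<and>
     energy p \<kappa> (- ((- \<Omega>) \<times> (- \<Omega>))) u < \<infinity>}"

definition W\<nu>_zero_norm :: "real \<Rightarrow> ('a::euclidean_space \<Rightarrow> real) \<Rightarrow> 'a set \<Rightarrow> ('a \<Rightarrow> real) \<Rightarrow> real" where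
  "W\<nu>_zero_norm p \<kappa> \<Omega> u =
     (Lp_norm p \<Omega> u powr p + enn2real (energy p \<kappa> (- ((- \<Omega>) \<times> (- \<Omega>))) u)) powr (1 / p)"

end

theory Submission
imports Defs
begin

text \<open>
Write \<open>K\<close> for \<open>K_const e p\<close>. Both halves compare the energy of a concentrating kernel with
\<open>K \<parallel>\<nabla>u\<parallel>\<^sup>p\<close>; the comparison rests on the identity
\<open>\<integral> \<nu>(h) |g \<bullet> h|\<^sup>p dh = K |g|\<^sup>p \<integral> \<nu>(h) |h|\<^sup>p dh\<close> for radial \<open>\<nu>\<close>
(\<open>radial_directional_integral\<close>). By Fubini an energy over \<open>D\<close> is an average over \<open>h\<close>, weighted by
\<open>\<nu>\<close>, of the \<open>L\<^sup>p\<close> size of the increment \<open>u(x) - u(x - h)\<close> on \<open>D\<close> (\<open>osc\<close>, \<open>energy_eq_osc\<close>).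

Lower bound. If \<open>v\<close> has a weak gradient on the whole space, its increments are \<open>\<nabla>v \<bullet> h + o(|h|)\<close> in
\<open>L\<^sup>p\<close>, so \<open>limsup\<close> of the energies is at most \<open>K \<parallel>\<nabla>v\<parallel>\<^sup>p\<close> (\<open>energy_upper\<close>). A function \<open>v\<close> in the
open Sobolev unit ball is therefore in the nonlocal unit balls for all small \<open>\<epsilon>\<close>, which gives the two \<open>liminf\<close>
inequalities: for \<open>W\<^sub>0\<^sup>1\<^sup>,\<^sup>p\<close> take \<open>v\<close> a multiple of a test function, and on an extension domain
restrict an extension of \<open>u\<close> to the whole space.

Upper bound. Let \<open>u\<^sub>n\<close> have nonlocal norm at most 1 with \<open>f u\<^sub>n \<ge> L\<close>, along kernels that concentrate at 0.
Mollification averages translates, so it does not increase the energy; for a fixed mollification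
scale a Taylor expansion gives \<open>K \<parallel>\<nabla>(u\<^sub>n * \<rho>)\<parallel>\<^sup>p\<close>, on interior parts of \<open>\<Omega>\<close>, as a lower bound for the energy
(\<open>energy_lower\<close>). Instead of weak compactness, uniform convexity of \<open>L\<^sup>p\<close> is used: a decreasing sequence of
nonempty bounded midpoint-closed sets has elements converging in norm
(\<open>midpoint_closed_family_convergent\<close>). It is applied twice, to the functions (\<open>sobolev_limit\<close>) and to
gradients of mollifications (\<open>bounded_mollified_imp_wgrad\<close>), and produces \<open>w\<close> with Sobolev norm at most 1 and
\<open>f w \<ge> L\<close>. In the zero case \<open>w\<close> is a Sobolev function on the whole space vanishing off \<open>\<Omega>\<close>, and the
Lipschitz boundary makes it a limit of test functions (\<open>approximable_Lipschitz\<close>): translate it inwards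
in each chart and mollify.

All estimates are made for Borel functions that vanish off \<open>\<Omega>\<close>, which represent the classes in \<open>L\<^sup>p(\<Omega>)\<close>
(\<open>rep\<close>), and for \<open>p\<close>-th powers of norms in the extended nonnegative reals (\<open>Lpow\<close>).
\<close>

abbreviation Borel :: "('a::topological_space => 'b::topological_space) set" where
 "Borel \<equiv> borel_measurable borel"

section \<open>Powers of norms and uniform convexity\<close>

text \<open>
The derivative of the difference changes sign exactly at \<open>m\<close>.
\<close>
lemma powr_above_tangent:
 fixes t m p :: real
 assumes p: "1 < p" and t: "0 <= t" and m: "0 < m"
 shows "m powr p + p * m powr (p - 1) * (t - m) <= t powr p"
  and "t \<noteq> m ==> m powr p + p * m powr (p - 1) * (t - m) < t powr p"
proof -
 have strict: "m powr p + p * m powr (p - 1) * (t - m) < t powr p" if ne: "t \<noteq> m"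
 proof -
  define g where "g = (%x::real. x powr p - p * m powr (p - 1) * x)"
  define g' where "g' = (%x::real. p * x powr (p - 1) - p * m powr (p - 1))"
  have der: "(g has_real_derivative g' x) (at x)" if "x > 0" for x
   unfolding g_def g'_def using that
   by (auto intro!: derivative_eq_intros)
  have cont: "continuous_on S g" if "S \<subseteq> {0..}" for S
   unfolding g_def using p that by (intro continuous_intros continuous_on_powr') auto
  have "g m < g t"
  proof (cases "t < m")
   case True
   show ?thesis
   proof (rule DERIV_neg_imp_decreasing_open[OF True])
    fix x assume x: "t < x" "x < m"
    have "x powr (p - 1) < m powr (p - 1)" using x t p by (intro powr_less_mono2) auto
    then show "\<exists>y. (g has_real_derivative y) (at x) & y < 0"
     using der[of x] x t p by (intro exI[of _ "g' x"]) (auto simp: g'_def)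
   qed (use cont t in auto)
  next
   case False
   then have lt: "m < t" using ne by auto
   show ?thesis
   proof (rule DERIV_pos_imp_increasing_open[OF lt])
    fix x assume x: "m < x" "x < t"
    have "m powr (p - 1) < x powr (p - 1)" using x m p by (intro powr_less_mono2) auto
    then show "\<exists>y. (g has_real_derivative y) (at x) & 0 < y"
     using der[of x] x m p by (intro exI[of _ "g' x"]) (auto simp: g'_def)
   qed (use cont m in auto)
  qed
  then show ?thesis
   unfolding g_def using m p by (simp add: algebra_simps)
 qed
 show "t \<noteq> m ==> m powr p + p * m powr (p - 1) * (t - m) < t powr p"
  by (rule strict)
 show "m powr p + p * m powr (p - 1) * (t - m) <= t powr p"
  using strict by (cases "t = m") auto
qed

lemma powr_convex_comb:
 fixes s t x y p :: real
 assumes p: "1 < p" and "0 <= s" "0 <= t" "s + t = 1" "0 <= x" "0 <= y"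
 shows "(s * x + t * y) powr p <= s * x powr p + t * y powr p"
proof (cases "s * x + t * y = 0")
 case True
 then show ?thesis using assms by simp
next
 case False
 define m where "m = s * x + t * y"
 have "0 <= m" using assms unfolding m_def by simp
 then have m: "0 < m" using False unfolding m_def by simp
 have "s * (m powr p + p * m powr (p - 1) * (x - m)) <= s * x powr p"
  using powr_above_tangent(1)[OF p _ m, of x] assms by (intro mult_left_mono) auto
 moreover have "t * (m powr p + p * m powr (p - 1) * (y - m)) <= t * y powr p"
  using powr_above_tangent(1)[OF p _ m, of y] assms by (intro mult_left_mono) auto
 moreover have "s * (m powr p + p * m powr (p - 1) * (x - m)) + t * (m powr p + p * m powr (p - 1) * (y - m))
  = (s + t) * m powr p + p * m powr (p - 1) * (s * x + t * y - (s + t) * m)"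
  by (simp add: algebra_simps)
 ultimately show ?thesis using assms by (simp add: m_def)
qed

text \<open>
Split \<open>a + b\<close> as a convex combination of \<open>a / s\<close> and \<open>b / t\<close> with \<open>s\<close> close to 1. The factor of
the main term is as close to 1 as desired, so perturbations cost nothing in the limit.
\<close>
lemma norm_add_powr_le:
 fixes \<eta> p :: real
 assumes p: "1 < p" and \<eta>: "0 < \<eta>"
 shows "\<exists>C\<ge>0. \<forall>a b :: 'b::real_normed_vector.
   norm (a + b) powr p <= (1 + \<eta>) * norm a powr p + C * norm b powr p"
proof -
 have "((%t. (1 - t) powr (1 - p)) \<longlongrightarrow> (1 - 0) powr (1 - p)) (at_right (0::real))"
  by (intro tendsto_intros) auto
 then have "eventually (%t. (1 - t) powr (1 - p) < 1 + \<eta>) (at_right (0::real))"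
  using \<eta> by (intro order_tendstoD(2)) auto
 moreover have "eventually (%t. t : {0<..<1}) (at_right (0::real))"
  by (rule eventually_at_right_real) simp
 ultimately have "eventually (%t. (1 - t) powr (1 - p) < 1 + \<eta> & t : {0<..<1}) (at_right (0::real))"
  by eventually_elim auto
 then obtain t :: real where t: "(1 - t) powr (1 - p) < 1 + \<eta>" "0 < t" "t < 1"
  using eventually_happens'[OF trivial_limit_at_right_real] by force
 have main: "norm (a + b) powr p <= (1 + \<eta>) * norm a powr p + t powr (1 - p) * norm b powr p"
  for a b :: 'b
 proof -
  have "norm (a + b) powr p <= (norm a + norm b) powr p"
   using p by (intro powr_mono2 norm_triangle_ineq) auto
  also have "norm a + norm b = (1 - t) * (norm a / (1 - t)) + t * (norm b / t)"
   using t by simp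
  also have "... powr p <= (1 - t) * (norm a / (1 - t)) powr p + t * (norm b / t) powr p"
   using t p by (intro powr_convex_comb) auto
  also have "... = (1 - t) powr (1 - p) * norm a powr p + t powr (1 - p) * norm b powr p"
   using t by (simp add: powr_divide powr_diff)
  also have "... <= (1 + \<eta>) * norm a powr p + t powr (1 - p) * norm b powr p"
   using t by (intro add_right_mono mult_right_mono) auto
  finally show ?thesis .
 qed
 show ?thesis
  using main by (intro exI[of _ "t powr (1 - p)"]) auto
qed

lemma norm_midpoint_powr_le:
 fixes a b :: "'b::real_normed_vector"
 assumes p: "1 < p"
 shows "norm ((1/2) *\<^sub>R (a + b)) powr p <= (norm a powr p + norm b powr p) / 2"
proof -
 have "norm ((1/2) *\<^sub>R (a + b)) <= 1/2 * norm a + 1/2 * norm b"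
  using norm_triangle_ineq[of a b] by simp
 then have "norm ((1/2) *\<^sub>R (a + b)) powr p <= (1/2 * norm a + 1/2 * norm b) powr p"
  using p by (intro powr_mono2) auto
 also have "... <= 1/2 * norm a powr p + 1/2 * norm b powr p"
  using p by (intro powr_convex_comb) auto
 finally show ?thesis by simp
qed

lemma norm_midpoint_powr_less:
 fixes a b :: "'b::real_inner"
 assumes p: "1 < p" and ne: "a \<noteq> b"
 shows "norm ((1/2) *\<^sub>R (a + b)) powr p < (norm a powr p + norm b powr p) / 2"
proof (cases "norm a = norm b")
 case True
 have "norm (a + b) < norm a + norm b"
 proof (rule ccontr)
  assume "\<not> ?thesis"
  then have "norm (a + b) = norm a + norm b" using norm_triangle_ineq[of a b] by linarith
  then have "norm a *\<^sub>R b = norm b *\<^sub>R a" by (simp add: norm_triangle_eq)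
  then show False using True ne by (metis norm_eq_zero scaleR_cancel_left)
 qed
 then have "norm ((1/2) *\<^sub>R (a + b)) powr p < norm a powr p"
  using p True by (intro powr_less_mono2) auto
 then show ?thesis using True by simp
next
 case False
 define m where "m = (norm a + norm b) / 2"
 have m: "0 < m"
  using False norm_ge_zero[of a] norm_ge_zero[of b] unfolding m_def
  by (smt (verit) half_gt_zero)
 have nm: "norm a \<noteq> m" "norm b \<noteq> m" using False by (auto simp: m_def)
 have le: "norm ((1/2) *\<^sub>R (a + b)) powr p <= m powr p"
  using p norm_triangle_ineq[of a b] by (intro powr_mono2) (auto simp: m_def)
 have "m powr p + p * m powr (p - 1) * (norm a - m) < norm a powr p"
  "m powr p + p * m powr (p - 1) * (norm b - m) < norm b powr p"
  using nm by (auto intro!: powr_above_tangent(2)[OF p _ m])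
 then have "2 * m powr p + p * m powr (p - 1) * (norm a + norm b - 2 * m) < norm a powr p + norm b powr p"
  by (simp add: algebra_simps)
 moreover have "norm a + norm b - 2 * m = 0" by (simp add: m_def)
 ultimately have "2 * m powr p < norm a powr p + norm b powr p" by simp
 with le show ?thesis by simp
qed

lemma continuous_on_norm_powr:
 fixes f :: "'c::topological_space => 'b::real_normed_vector"
 assumes "0 < p" "continuous_on S f"
 shows "continuous_on S (%x. norm (f x) powr p)"
 using assms by (intro continuous_on_powr' continuous_intros) auto

text \<open>
Both sides are homogeneous of degree \<open>p\<close>, so take unit pairs. Where the left side is at least the \<open>\<eta>\<close> term,
which is a compact set off the diagonal, strict convexity bounds the convexity defect away from 0.
\<close>
lemma uniform_convexity_powr:
 fixes \<eta> p :: real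
 assumes p: "1 < p" and \<eta>: "0 < \<eta>"
 shows "\<exists>C\<ge>0. \<forall>a b :: 'b::euclidean_space.
   norm (a - b) powr p <= \<eta> * (norm a powr p + norm b powr p)
    + C * ((norm a powr p + norm b powr p) / 2 - norm ((1/2) *\<^sub>R (a + b)) powr p)"
proof -
 define D where "D = (%z :: 'b \<times> 'b. (norm (fst z) powr p + norm (snd z) powr p) / 2
   - norm ((1/2) *\<^sub>R (fst z + snd z)) powr p)"
 define Q where "Q = (%z :: 'b \<times> 'b. norm (fst z - snd z) powr p
   - \<eta> * (norm (fst z) powr p + norm (snd z) powr p))"
 have D0: "0 <= D z" for z using norm_midpoint_powr_le[OF p] by (simp add: D_def)
 have cD: "continuous_on S D" and cQ: "continuous_on S Q" for S
 proof -
  have "continuous_on S (%z :: 'b \<times> 'b. norm (fst z) powr p)"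
   "continuous_on S (%z :: 'b \<times> 'b. norm (snd z) powr p)"
   "continuous_on S (%z :: 'b \<times> 'b. norm (fst z - snd z) powr p)"
   "continuous_on S (%z :: 'b \<times> 'b. norm ((1/2) *\<^sub>R (fst z + snd z)) powr p)"
   using p by (auto intro!: continuous_on_norm_powr continuous_on_fst continuous_on_snd
    continuous_on_diff continuous_on_add continuous_on_scaleR continuous_on_id continuous_on_const
    simp del: scaleR_right_distrib norm_scaleR)
  then show "continuous_on S D" "continuous_on S Q"
   unfolding D_def Q_def
   by (auto intro!: continuous_on_diff continuous_on_add continuous_on_mult continuous_on_divide
     continuous_on_const simp del: scaleR_right_distrib norm_scaleR)
 qed
 define T where "T = sphere 0 1 \<inter> {z. 0 <= Q z}"
 have "closed {z. 0 <= Q z}"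
  using cQ[of UNIV] by (intro closed_Collect_le continuous_intros) auto
 then have T: "compact T" unfolding T_def by (intro compact_Int_closed) auto
 have "\<exists>C\<ge>0. \<forall>z\<in>T. Q z <= C * D z"
 proof (cases "T = {}")
  case True then show ?thesis by auto
 next
  case False
  obtain z0 where z0: "z0 : T" "!!z. z : T ==> D z0 <= D z"
   using continuous_attains_inf[OF T False cD] by auto
  obtain z1 where z1: "z1 : T" "!!z. z : T ==> Q z <= Q z1"
   using continuous_attains_sup[OF T False cQ] by auto
  have "0 < D z0"
  proof (cases "fst z0 = snd z0")
   case True
   have "z0 \<noteq> 0" using z0(1) by (auto simp: T_def)
   then have "fst z0 \<noteq> 0" using True by (metis prod.collapse zero_prod_def)
   then have "Q z0 < 0" unfolding Q_def using True \<eta> by simp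
   then show ?thesis using z0(1) by (simp add: T_def)
  next
   case False
   then show ?thesis using norm_midpoint_powr_less[OF p False] by (simp add: D_def)
  qed
  moreover have "0 <= Q z1" using z1 by (auto simp: T_def)
  ultimately have C0: "0 <= Q z1 / D z0" and e: "Q z1 = Q z1 / D z0 * D z0" by auto
  have "Q z <= Q z1 / D z0 * D z" if "z : T" for z
   using z1(2)[OF that] e mult_left_mono[OF z0(2)[OF that] C0] by linarith
  with C0 show ?thesis by blast
 qed
 then obtain C where C: "0 <= C" "!!z. z : T ==> Q z <= C * D z" by blast
 have hom: "D (c *\<^sub>R z) = c powr p * D z" "Q (c *\<^sub>R z) = c powr p * Q z" if "0 <= c" for c z
 proof -
  have e: "norm (c *\<^sub>R x) powr p = c powr p * norm x powr p" for x :: 'b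
   using that by (simp add: powr_mult)
  have m: "(1/2) *\<^sub>R (c *\<^sub>R x + c *\<^sub>R y) = c *\<^sub>R ((1/2) *\<^sub>R (x + y))"
   "c *\<^sub>R x - c *\<^sub>R y = c *\<^sub>R (x - y)" for x y :: 'b
   by (simp_all add: scaleR_right_distrib scaleR_right_diff_distrib)
  show "D (c *\<^sub>R z) = c powr p * D z"
   unfolding D_def fst_scaleR snd_scaleR m e right_diff_distrib by (simp add: distrib_left)
  show "Q (c *\<^sub>R z) = c powr p * Q z"
   unfolding Q_def fst_scaleR snd_scaleR m e right_diff_distrib by (simp add: algebra_simps)
 qed
 have main: "Q z <= C * D z" for z
 proof (cases "z = 0 \<or> Q z < 0")
  case True
  then show ?thesis using C(1) D0[of z] p
   by (auto simp: Q_def D_def intro: order_trans[of _ 0])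
 next
  case False
  define w where "w = (1 / norm z) *\<^sub>R z"
  have zw: "z = norm z *\<^sub>R w" using False by (simp add: w_def)
  have "0 <= Q w" unfolding w_def using False by (subst hom) auto
  then have "w : T" using False by (auto simp: T_def w_def)
  then have "Q w <= C * D w" by (rule C(2))
  then have "norm z powr p * Q w <= norm z powr p * (C * D w)" by (intro mult_left_mono) auto
  then show ?thesis
   using hom[of "norm z" w] unfolding zw[symmetric] by (simp add: algebra_simps)
 qed
 have "norm (a - b) powr p <= \<eta> * (norm a powr p + norm b powr p)
    + C * ((norm a powr p + norm b powr p) / 2 - norm ((1/2) *\<^sub>R (a + b)) powr p)" for a b :: 'b
  using main[of "(a, b)"] unfolding Q_def D_def by simp
 then show ?thesis using C(1) by blast
qed

text \<open>
The tangent of \<open>t powr p\<close> at the mean of the norm of \<open>f\<close> is integrated.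
\<close>
lemma jensen_norm_powr:
 fixes f :: "'c => 'b::euclidean_space"
 assumes M: "emeasure M (space M) = 1" and p: "1 < p" and f: "f : borel_measurable M"
 shows "ennreal (norm (\<integral>x. f x \<partial>M) powr p) <= (\<integral>\<^sup>+x. ennreal (norm (f x) powr p) \<partial>M)"
proof (cases "integrable M f & integrable M (%x. norm (f x) powr p)")
 case False
 then consider "\<not> integrable M f" | "\<not> integrable M (%x. norm (f x) powr p)" by blast
 then show ?thesis
 proof cases
  case 1
  then show ?thesis using p by (simp add: not_integrable_integral_eq)
 next
  case 2
  then have "\<not> (\<integral>\<^sup>+x. ennreal (norm (f x) powr p) \<partial>M) < \<infinity>"
   using f by (simp add: integrable_iff_bounded)
  then have "(\<integral>\<^sup>+x. ennreal (norm (f x) powr p) \<partial>M) = \<infinity>"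
   unfolding not_less by (simp add: top_unique)
  then show ?thesis by simp
 qed
next
 case True
 interpret finite_measure M by standard (simp add: M)
 have M1: "measure M (space M) = 1" using M by (simp add: measure_def)
 define m where "m = (\<integral>x. norm (f x) \<partial>M)"
 have m0: "0 <= m" unfolding m_def by simp
 have le: "norm (\<integral>x. f x \<partial>M) powr p <= m powr p"
  unfolding m_def using p by (intro powr_mono2 integral_norm_bound) auto
 have "m powr p <= (\<integral>x. norm (f x) powr p \<partial>M)"
 proof (cases "m = 0")
  case True
  then show ?thesis using p by simp
 next
  case False
  have "(\<integral>x. m powr p + p * m powr (p - 1) * (norm (f x) - m) \<partial>M) <= (\<integral>x. norm (f x) powr p \<partial>M)"
   using True False m0 p by (intro integral_mono powr_above_tangent(1)) auto
  also have "(\<integral>x. m powr p + p * m powr (p - 1) * (norm (f x) - m) \<partial>M) = m powr p"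
   using True M1 by (simp add: m_def)
  finally show ?thesis .
 qed
 with le have "norm (\<integral>x. f x \<partial>M) powr p <= (\<integral>x. norm (f x) powr p \<partial>M)" by linarith
 then show ?thesis using True by (subst nn_integral_eq_integral) (auto simp: ennreal_leI)
qed

lemma nn_integral_cmult_add:
 fixes F G :: "'c => ennreal"
 assumes "F : borel_measurable M" "G : borel_measurable M"
 shows "(\<integral>\<^sup>+x. c * (F x + G x) \<partial>M) = c * ((\<integral>\<^sup>+x. F x \<partial>M) + (\<integral>\<^sup>+x. G x \<partial>M))"
 using assms by (simp add: nn_integral_cmult nn_integral_add)

lemma nn_integral_add_cmult:
 fixes F G :: "'c => ennreal"
 assumes "F : borel_measurable M" "G : borel_measurable M"
 shows "(\<integral>\<^sup>+x. c * F x + d * G x \<partial>M) = c * (\<integral>\<^sup>+x. F x \<partial>M) + d * (\<integral>\<^sup>+x. G x \<partial>M)"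
 using assms by (simp add: nn_integral_cmult nn_integral_add)

definition Lpow :: "real => 'a::euclidean_space set => ('a => 'b::euclidean_space) => ennreal" where
 "Lpow p A u = (\<integral>\<^sup>+x\<in>A. ennreal (norm (u x) powr p) \<partial>lborel)"

lemma Lpow_mono_set: "A \<subseteq> B ==> Lpow p A u <= Lpow p B u"
 unfolding Lpow_def by (intro nn_integral_mono) (auto simp: indicator_def)

lemma Lpow_mono:
 assumes "1 < p" "!!x. x : A ==> norm (u x) <= norm (v x)"
 shows "Lpow p A u <= Lpow p A v"
 unfolding Lpow_def using assms
 by (intro nn_integral_mono) (auto simp: indicator_def intro!: ennreal_leI powr_mono2)

lemma Lpow_cong_AE:
 assumes "AE x in lborel. x : A --> u x = v x"
 shows "Lpow p A u = Lpow p A v"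
 unfolding Lpow_def using assms
 by (intro nn_integral_cong_AE) (auto simp: indicator_def)

lemma Lpow_uminus: "Lpow p A (%x. - u x) = Lpow p A u"
 unfolding Lpow_def by simp

lemma Lpow_minus_commute: "Lpow p A (%x. u x - v x) = Lpow p A (%x. v x - u x)"
 unfolding Lpow_def by (simp add: norm_minus_commute)

lemma Lpow_scaleR:
 assumes "u : Borel" "A : sets borel"
 shows "Lpow p A (%x. c *\<^sub>R u x) = ennreal (\<bar>c\<bar> powr p) * Lpow p A u"
 unfolding Lpow_def using assms
 by (subst nn_integral_cmult[symmetric]) (auto simp: powr_mult ennreal_mult mult_ac)

lemma Lpow_indicator:
 "1 < p ==> Lpow p UNIV (%x. indicator A x *\<^sub>R u x) = Lpow p A u"
 unfolding Lpow_def by (intro nn_integral_cong) (auto simp: indicator_def)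

lemma Lpow_add_le:
 fixes \<eta> p :: real
 assumes p: "1 < p" and \<eta>: "0 < \<eta>"
 shows "\<exists>C\<ge>0. \<forall>A\<in>sets borel. \<forall>u\<in>Borel. \<forall>v\<in>Borel.
   Lpow p A (%x::'a::euclidean_space. u x + v x :: 'b::euclidean_space)
    <= ennreal (1 + \<eta>) * Lpow p A u + ennreal C * Lpow p A v"
proof -
 obtain C where C: "C \<ge> 0" "!!a b :: 'b.
   norm (a + b) powr p <= (1 + \<eta>) * norm a powr p + C * norm b powr p"
  using norm_add_powr_le[OF p \<eta>] by blast
 have "Lpow p A (%x. u x + v x) <= ennreal (1 + \<eta>) * Lpow p A u + ennreal C * Lpow p A v"
  if [measurable]: "A : sets borel" "u : Borel" "v : Borel"
  for A and u v :: "'a => 'b"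
 proof -
  have pt: "ennreal (norm (a + b) powr p) <= ennreal (1 + \<eta>) * ennreal (norm a powr p)
    + ennreal C * ennreal (norm b powr p)" for a b :: 'b
   using C(1) \<eta>
   by (subst ennreal_mult[symmetric], simp, simp, subst ennreal_mult[symmetric], simp, simp,
     subst ennreal_plus[symmetric], simp, simp) (rule ennreal_leI[OF C(2)])
  have "Lpow p A (%x. u x + v x) \<le>
   (\<integral>\<^sup>+x. ennreal (1 + \<eta>) * (ennreal (norm (u x) powr p) * indicator A x)
     + ennreal C * (ennreal (norm (v x) powr p) * indicator A x) \<partial>lborel)"
   unfolding Lpow_def
  proof (intro nn_integral_mono)
   fix x show "ennreal (norm (u x + v x) powr p) * indicator A x \<le>
     ennreal (1 + \<eta>) * (ennreal (norm (u x) powr p) * indicator A x)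
     + ennreal C * (ennreal (norm (v x) powr p) * indicator A x)"
    using pt[of "u x" "v x"] by (cases "x : A") (simp_all only: indicator_simps mult_1_right mult_zero_right add_0_right zero_le order_refl simp_thms)
  qed
  also have "... = ennreal (1 + \<eta>) * Lpow p A u + ennreal C * Lpow p A v"
   unfolding Lpow_def
   by (rule nn_integral_add_cmult) measurable
  finally show ?thesis .
 qed
 with C(1) show ?thesis by blast
qed

lemma Lpow_midpoint_le:
 fixes u v :: "'a::euclidean_space => 'b::euclidean_space"
 assumes p: "1 < p" and [measurable]: "A : sets borel" "u : Borel" "v : Borel"
 shows "Lpow p A (%x. (1/2) *\<^sub>R (u x + v x)) <= ennreal (1/2) * (Lpow p A u + Lpow p A v)"
proof -
 have r: "x <= 1 / 2 * (y + z)" if "x <= (y + z) / 2" for x y z :: real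
  using that by simp
 have pt: "ennreal (norm ((1/2) *\<^sub>R (a + b)) powr p)
   <= ennreal (1/2) * (ennreal (norm a powr p) + ennreal (norm b powr p))" for a b :: 'b
  using r[OF norm_midpoint_powr_le[OF p, of a b]]
  by (subst ennreal_plus[symmetric], simp, simp, subst ennreal_mult[symmetric], simp, simp)
    (rule ennreal_leI)
 have "Lpow p A (%x. (1/2) *\<^sub>R (u x + v x)) \<le>
   (\<integral>\<^sup>+x. ennreal (1/2) * (ennreal (norm (u x) powr p) * indicator A x
     + ennreal (norm (v x) powr p) * indicator A x) \<partial>lborel)"
  unfolding Lpow_def
 proof (intro nn_integral_mono)
  fix x show "ennreal (norm ((1/2) *\<^sub>R (u x + v x)) powr p) * indicator A x
   <= ennreal (1/2) * (ennreal (norm (u x) powr p) * indicator A x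
     + ennreal (norm (v x) powr p) * indicator A x)"
   using pt[of "u x" "v x"]
   by (cases "x : A") (simp_all only: indicator_simps mult_1_right mult_zero_right add_0_right zero_le order_refl simp_thms)
 qed
 also have "... = ennreal (1/2) * (Lpow p A u + Lpow p A v)"
  unfolding Lpow_def
  by (rule nn_integral_cmult_add) measurable
 finally show ?thesis .
qed

text \<open>
Two functions whose midpoint has nearly the mean of their \<open>p\<close>-th powers are close; this
turns a minimising sequence into a Cauchy sequence.
\<close>
lemma Lpow_uniform_convexity:
 fixes \<eta> p :: real
 assumes p: "1 < p" and \<eta>: "0 < \<eta>"
 shows "\<exists>C\<ge>0. \<forall>u\<in>Borel. \<forall>v\<in>Borel.
   Lpow p UNIV (%x::'a::euclidean_space. u x - v x :: 'b::euclidean_space)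
    + ennreal C * Lpow p UNIV (%x. (1/2) *\<^sub>R (u x + v x))
   <= ennreal (\<eta> + C / 2) * (Lpow p UNIV u + Lpow p UNIV v)"
proof -
 obtain C where C: "C \<ge> 0" "!!a b :: 'b.
   norm (a - b) powr p <= \<eta> * (norm a powr p + norm b powr p)
    + C * ((norm a powr p + norm b powr p) / 2 - norm ((1/2) *\<^sub>R (a + b)) powr p)"
  using uniform_convexity_powr[OF p \<eta>] by blast
 have "Lpow p UNIV (%x. u x - v x) + ennreal C * Lpow p UNIV (%x. (1/2) *\<^sub>R (u x + v x))
   <= ennreal (\<eta> + C / 2) * (Lpow p UNIV u + Lpow p UNIV v)"
  if [measurable]: "u : Borel" "v : Borel"
  for u v :: "'a => 'b"
 proof -
  have pt: "ennreal (norm (a - b) powr p) + ennreal C * ennreal (norm ((1/2) *\<^sub>R (a + b)) powr p)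
   <= ennreal (\<eta> + C / 2) * (ennreal (norm a powr p) + ennreal (norm b powr p))" for a b :: 'b
  proof -
   have r: "x + C * w <= (\<eta> + C / 2) * (y + z)"
    if "x <= \<eta> * (y + z) + C * ((y + z) / 2 - w)" for x y z w :: real
    using that by (simp add: field_simps)
   show ?thesis
    using C(1) \<eta>
    by (subst ennreal_mult[symmetric], simp, simp, subst ennreal_plus[symmetric], simp, simp,
      subst ennreal_plus[symmetric], simp, simp, subst ennreal_mult[symmetric], simp, simp)
     (rule ennreal_leI[OF r[OF C(2)[of a b]]])
  qed
  have "Lpow p UNIV (%x. u x - v x) + ennreal C * Lpow p UNIV (%x. (1/2) *\<^sub>R (u x + v x))
   = (\<integral>\<^sup>+x. ennreal (norm (u x - v x) powr p) +
     ennreal C * ennreal (norm ((1/2) *\<^sub>R (u x + v x)) powr p) \<partial>lborel)"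
   unfolding Lpow_def indicator_UNIV mult_1_right
   using nn_integral_add_cmult[where M=lborel and c=1 and d="ennreal C"
    and F="%x. ennreal (norm (u x - v x) powr p)"
    and G="%x. ennreal (norm ((1/2) *\<^sub>R (u x + v x)) powr p)"]
   by (simp del: norm_scaleR scaleR_right_distrib)
  also have "... <= (\<integral>\<^sup>+x. ennreal (\<eta> + C / 2) * (ennreal (norm (u x) powr p) + ennreal (norm (v x) powr p)) \<partial>lborel)"
   by (intro nn_integral_mono pt)
  also have "... = ennreal (\<eta> + C / 2) * (Lpow p UNIV u + Lpow p UNIV v)"
   unfolding Lpow_def indicator_UNIV mult_1_right
   by (rule nn_integral_cmult_add) measurable
  finally show ?thesis .
 qed
 with C(1) show ?thesis by blast
qed

section \<open>Completeness and midpoint-closed families\<close>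

lemma Lpow_Fatou:
 assumes p: "1 < p" and [measurable]: "A : sets borel" "!!k. v k : Borel"
  and lim: "AE x in lborel. x : A --> (%k. v k x) \<longlonglongrightarrow> w x"
  and bd: "eventually (%k. Lpow p A (v k) <= c) sequentially"
 shows "Lpow p A w <= c"
proof -
 have "Lpow p A w <= (\<integral>\<^sup>+x. liminf (%k. ennreal (norm (v k x) powr p) * indicator A x) \<partial>lborel)"
  unfolding Lpow_def
 proof (intro nn_integral_mono_AE, use lim in eventually_elim)
  fix x assume x: "x : A --> (%k. v k x) \<longlonglongrightarrow> w x"
  show "ennreal (norm (w x) powr p) * indicator A x
    <= liminf (%k. ennreal (norm (v k x) powr p) * indicator A x)"
  proof (cases "x : A")
   case True
   with x have "(%k. v k x) \<longlonglongrightarrow> w x" by blast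
   then have "(%k. norm (v k x) powr p) \<longlonglongrightarrow> norm (w x) powr p"
    using p by (intro tendsto_powr' tendsto_norm tendsto_const) auto
   from lim_imp_Liminf[OF sequentially_bot tendsto_ennrealI[OF this]]
   show ?thesis using True by simp
  qed simp
 qed
 also have "... <= liminf (%k. Lpow p A (v k))"
  unfolding Lpow_def by (rule nn_integral_liminf) measurable
 also have "... <= limsup (%k. Lpow p A (v k))" by (rule Liminf_le_Limsup) simp
 also have "... <= c" using bd by (rule Limsup_bounded)
 finally show ?thesis .
qed

lemma Lpow_summable_AE_tendsto_0:
 assumes p: "1 < p" and [measurable]: "!!k. v k : Borel"
  and bd: "!!k. Lpow p UNIV (v k) <= ennreal ((1/2) ^ k)"
 shows "AE x in lborel. (%k. v k x) \<longlonglongrightarrow> 0"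
proof -
 have "(\<integral>\<^sup>+x. (\<Sum>k. ennreal (norm (v k x) powr p)) \<partial>lborel) = (\<Sum>k. Lpow p UNIV (v k))"
  unfolding Lpow_def by (subst nn_integral_suminf) auto
 also have "... <= (\<Sum>k. ennreal ((1/2) ^ k))"
  by (intro suminf_le bd) auto
 also have "... = ennreal (\<Sum>k. (1/2) ^ k)"
  by (subst suminf_ennreal2) (auto intro: summable_geometric)
 finally have "(\<integral>\<^sup>+x. (\<Sum>k. ennreal (norm (v k x) powr p)) \<partial>lborel) \<noteq> \<infinity>"
  by (auto simp: top_unique)
 then have "AE x in lborel. (\<Sum>k. ennreal (norm (v k x) powr p)) \<noteq> \<infinity>"
  by (intro nn_integral_noteq_infinite) auto
 then show ?thesis
 proof eventually_elim
  case (elim x)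
  then have "summable (%k. norm (v k x) powr p)"
   by (intro summable_suminf_not_top) auto
  then have "(%k. norm (v k x) powr p) \<longlonglongrightarrow> 0" by (rule summable_LIMSEQ_zero)
  then have "(%k. (norm (v k x) powr p) powr (1 / p)) \<longlonglongrightarrow> 0 powr (1 / p)"
   using p by (intro tendsto_powr' tendsto_const) auto
  then have "(%k. norm (v k x)) \<longlonglongrightarrow> 0"
   using p by (simp add: powr_powr)
  then show ?case by (simp add: tendsto_norm_zero_iff)
 qed
qed

lemma fast_subsequence:
 assumes "!!k. \<exists>N. \<forall>n\<ge>N. P k n"
 shows "\<exists>r. strict_mono r & (\<forall>k::nat. \<forall>n\<ge>r k. P k (n::nat))"
proof -
 obtain N where N: "!!k n. N k <= n ==> P k n" using assms by metis
 define r where "r = (%k. k + (\<Sum>j\<le>k. N j))"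
 have "strict_mono r" unfolding strict_mono_Suc_iff r_def by auto
 moreover have "N k <= r k" for k
  unfolding r_def using member_le_sum[of k "{..k}" N] by auto
 ultimately show ?thesis using N by (intro exI[of _ r]) (auto intro: order_trans)
qed

lemma Lpow_tendsto_0_AE_subseq:
 assumes p: "1 < p" and [measurable]: "!!k. v k : Borel"
  and lim: "(%n. Lpow p UNIV (v n)) \<longlonglongrightarrow> 0"
 obtains r :: "nat => nat" where "strict_mono r" "AE x in lborel. (%k. v (r k) x) \<longlonglongrightarrow> 0"
proof -
 have "\<exists>N. \<forall>n\<ge>N. Lpow p UNIV (v n) <= ennreal ((1/2) ^ k)" for k
 proof -
  have "eventually (%n. Lpow p UNIV (v n) < ennreal ((1/2) ^ k)) sequentially"
   using lim by (rule order_tendstoD(2)) simp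
  then show ?thesis unfolding eventually_sequentially by (meson less_imp_le)
 qed
 from fast_subsequence[of "%k n. Lpow p UNIV (v n) <= ennreal ((1/2) ^ k)", OF this] obtain r where
  r: "strict_mono r" "!!k n. r k <= n ==> Lpow p UNIV (v n) <= ennreal ((1/2) ^ k)" by blast
 have "AE x in lborel. (%k. v (r k) x) \<longlonglongrightarrow> 0"
  by (rule Lpow_summable_AE_tendsto_0[OF p]) (auto intro: r(2))
 with r(1) show ?thesis by (rule that)
qed

text \<open>
A subsequence with geometrically small increments converges a.e., and Fatou carries the
estimates to the limit.
\<close>
lemma Lpow_complete:
 fixes u :: "nat => 'a::euclidean_space => 'b::euclidean_space"
 assumes p: "1 < p" and [measurable]: "!!k. u k : Borel"
  and cauchy: "!!\<eta>. 0 < \<eta> ==> \<exists>N. \<forall>m\<ge>N. \<forall>n\<ge>N. Lpow p UNIV (%x. u m x - u n x) <= ennreal \<eta>"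
 obtains w where "w : Borel" "(%n. Lpow p UNIV (%x. u n x - w x)) \<longlonglongrightarrow> 0"
proof -
 have "\<exists>N. \<forall>n\<ge>N. \<forall>m\<ge>n. Lpow p UNIV (%x. u m x - u n x) <= ennreal ((1/2) ^ k / 2 powr (k * p))" for k :: nat
 proof -
  have "(0::real) < (1/2) ^ k / 2 powr (k * p)" by simp
  from cauchy[OF this] show ?thesis by (meson order_trans)
 qed
 from fast_subsequence[of "%k n. \<forall>m\<ge>n. Lpow p UNIV (%x. u m x - u n x) <= ennreal ((1/2) ^ k / 2 powr (k * p))", OF this]
 obtain r where r: "strict_mono r"
  "!!k n m. r k <= n ==> n <= m ==> Lpow p UNIV (%x. u m x - u n x) <= ennreal ((1/2) ^ k / 2 powr (k * p))"
  by blast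
 have "AE x in lborel. (%k. 2 ^ k *\<^sub>R (u (r (Suc k)) x - u (r k) x)) \<longlonglongrightarrow> 0"
 proof (rule Lpow_summable_AE_tendsto_0[OF p])
  fix k
  have "Lpow p UNIV (%x. 2 ^ k *\<^sub>R (u (r (Suc k)) x - u (r k) x))
    = ennreal (\<bar>2 ^ k\<bar> powr p) * Lpow p UNIV (%x. u (r (Suc k)) x - u (r k) x)"
   by (rule Lpow_scaleR) auto
  also have "... <= ennreal (\<bar>2 ^ k\<bar> powr p) * ennreal ((1/2) ^ k / 2 powr (k * p))"
   using r(1) by (intro mult_left_mono r(2)) (auto simp: strict_mono_less_eq)
  also have "... = ennreal ((1/2) ^ k)"
   by (subst ennreal_mult[symmetric]) (auto simp: powr_powr simp flip: powr_realpow)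
  finally show "Lpow p UNIV (%x. 2 ^ k *\<^sub>R (u (r (Suc k)) x - u (r k) x)) <= ennreal ((1/2) ^ k)" .
 qed auto
 then have conv: "AE x in lborel. convergent (%k. u (r k) x)"
 proof eventually_elim
  case (elim x)
  then have "Bseq (%k. 2 ^ k *\<^sub>R (u (r (Suc k)) x - u (r k) x))"
   using convergent_imp_Bseq convergentI by blast
  then obtain B where B: "!!k. norm (2 ^ k *\<^sub>R (u (r (Suc k)) x - u (r k) x)) <= B"
   by (auto simp: Bseq_def)
  have "summable (%k. u (r (Suc k)) x - u (r k) x)"
  proof (rule summable_comparison_test')
   show "summable (%k. B * (1/2) ^ k)" by (intro summable_mult summable_geometric) auto
   fix k :: nat
   show "norm (u (r (Suc k)) x - u (r k) x) <= B * (1/2) ^ k"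
    using B[of k] unfolding norm_scaleR by (simp add: field_simps)
  qed
  then have "(%k. \<Sum>j<k. u (r (Suc j)) x - u (r j) x) \<longlonglongrightarrow> (\<Sum>j. u (r (Suc j)) x - u (r j) x)"
   by (rule summable_LIMSEQ)
  then have "(%k. u (r k) x - u (r 0) x) \<longlonglongrightarrow> (\<Sum>j. u (r (Suc j)) x - u (r j) x)"
   by (simp add: sum_lessThan_telescope[of "%k. u (r k) x"])
  then have "(%k. u (r k) x - u (r 0) x + u (r 0) x) \<longlonglongrightarrow> (\<Sum>j. u (r (Suc j)) x - u (r j) x) + u (r 0) x"
   by (intro tendsto_intros)
  then show ?case by (auto simp: convergent_def)
 qed
 define w where "w = (%x. lim (%k. u (r k) x))"
 have [measurable]: "w : Borel"
  unfolding w_def by (rule borel_measurable_lim_metric) auto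
 have "(%n. Lpow p UNIV (%x. u n x - w x)) \<longlonglongrightarrow> 0"
 proof (rule order_tendstoI)
  fix a :: ennreal assume "0 < a"
  then obtain \<eta> where \<eta>: "0 < ennreal \<eta>" "ennreal \<eta> < a"
   using dense[of 0 a] by (metis ennreal_cases not_le top_greatest)
  then have "0 < \<eta>" by simp
  from cauchy[OF this] obtain N where N: "!!m n. N <= m ==> N <= n ==> Lpow p UNIV (%x. u m x - u n x) <= ennreal \<eta>"
   by blast
  have "Lpow p UNIV (%x. u n x - w x) <= ennreal \<eta>" if n: "N <= n" for n
  proof (rule Lpow_Fatou[OF p])
   show "AE x in lborel. x : UNIV --> (%k. u n x - u (r k) x) \<longlonglongrightarrow> u n x - w x"
    using conv by eventually_elim (auto intro!: tendsto_diff simp: w_def convergent_LIMSEQ_iff)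
   show "eventually (%k. Lpow p UNIV (%x. u n x - u (r k) x) <= ennreal \<eta>) sequentially"
    unfolding eventually_sequentially using N n seq_suble[OF r(1)]
    by (intro exI[of _ N]) (meson order_trans)
  qed auto
  then show "eventually (%n. Lpow p UNIV (%x. u n x - w x) < a) sequentially"
   using \<eta> unfolding eventually_sequentially by (intro exI[of _ N]) (auto intro: le_less_trans)
 qed simp
 with \<open>w : Borel\<close> show ?thesis by (rule that)
qed

text \<open>
A substitute for weak compactness. Let \<open>I k\<close> be the infimum of the \<open>p\<close>-th powers over \<open>C k\<close>. It increases to
a finite limit, and midpoints of elements of \<open>C k\<close> stay in \<open>C k\<close>, so near-minimisers form a Cauchy
sequence by uniform convexity.
\<close>
lemma midpoint_closed_family_convergent:
 fixes C :: "nat => ('a::euclidean_space => 'b::euclidean_space) set"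
 assumes p: "1 < p" and dec: "!!k. C (Suc k) \<subseteq> C k" and ne: "!!k. C k \<noteq> {}"
  and mid: "!!k u v. u : C k ==> v : C k ==> (%x. (1/2) *\<^sub>R (u x + v x)) : C k"
  and meas: "C 0 \<subseteq> Borel"
  and bd: "!!u. u : C 0 ==> Lpow p UNIV u <= ennreal M"
 obtains s w where "!!k. s k : C k" "w : Borel"
  "(%n. Lpow p UNIV (%x. s n x - w x)) \<longlonglongrightarrow> 0"
proof -
 have decs: "C l \<subseteq> C k" if "k <= l" for k l
  using lift_Suc_antimono_le[of C, OF dec that] .
 have M: "0 <= M \<or> C 0 \<subseteq> {u. Lpow p UNIV u = 0}"
  using bd by (cases "0 <= M") (auto simp: ennreal_neg)
 define N where "N = (%u :: 'a => 'b. enn2real (Lpow p UNIV u))"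
 have m [measurable]: "u : Borel" if "u : C k" for u k using that decs[of 0 k] meas by auto
 have N: "Lpow p UNIV u = ennreal (N u)" "0 <= N u" if "u : C k" for u k
 proof -
  have "Lpow p UNIV u <= ennreal M" using bd[of u] that decs[of 0 k] by auto
  then have "Lpow p UNIV u < top" by (simp add: le_less_trans)
  then show "Lpow p UNIV u = ennreal (N u)" "0 <= N u" by (simp_all add: N_def)
 qed
 define M' where "M' = max M 0"
 have NM: "N u <= M'" if "u : C k" for u k
 proof -
  have "Lpow p UNIV u <= ennreal M'" using bd[of u] that decs[of 0 k]
   by (intro order_trans[OF bd[of u] ennreal_leI]) (auto simp: M'_def)
  then show ?thesis using N[OF that] by (simp add: M'_def)
 qed
 define d where "d = (%k. Inf (N ` C k))"
 have bdd: "bdd_below (N ` C k)" for k using N(2) by (intro bdd_belowI[of _ 0]) auto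
 have dle: "d k <= N u" if "u : C k" for u k unfolding d_def using that bdd by (intro cInf_lower) auto
 have dM: "d k <= M'" for k using dle NM ne[of k] by (meson ex_in_conv order_trans)
 have dmono: "d k <= d l" if "k <= l" for k l
  unfolding d_def using bdd ne decs[OF that] by (intro cInf_superset_mono) auto
 then have "incseq d" by (simp add: incseq_def)
 then obtain D where D: "d \<longlonglongrightarrow> D" "!!k. d k <= D"
  using incseq_convergent[of d M'] dM by blast
 have "\<exists>u\<in>C k. N u < d k + 1 / real (Suc k)" for k
 proof -
  have "\<exists>y\<in>N ` C k. y < d k + 1 / real (Suc k)"
   unfolding d_def using ne bdd by (intro cInf_lessD) auto
  then show ?thesis by blast
 qed
 then obtain s where s: "!!k. s k : C k" "!!k. N (s k) < d k + 1 / real (Suc k)" by metis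
 have [measurable]: "s k : Borel" for k using m s by blast
 have cauchy: "\<exists>n0. \<forall>m\<ge>n0. \<forall>n\<ge>n0. Lpow p UNIV (%x. s m x - s n x) <= ennreal \<eta>" if \<eta>: "0 < \<eta>" for \<eta> :: real
 proof -
  define \<theta> where "\<theta> = \<eta> / (4 * M' + 1)"
  have M'0: "0 <= M'" by (simp add: M'_def)
  have \<theta>: "0 < \<theta>" "\<theta> * (2 * M') <= \<eta> / 2" using \<eta> M'0 by (auto simp: \<theta>_def field_simps)
  obtain K where K: "0 <= K" "!!u v. u : Borel ==> v : Borel ==>
    Lpow p UNIV (%x::'a. u x - v x :: 'b) + ennreal K * Lpow p UNIV (%x. (1/2) *\<^sub>R (u x + v x))
     <= ennreal (\<theta> + K / 2) * (Lpow p UNIV u + Lpow p UNIV v)"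
   using Lpow_uniform_convexity[OF p \<theta>(1)] by blast
  have "(%k. K * (D - d k + 1 / real (Suc k))) \<longlonglongrightarrow> K * (D - D + 0)"
   by (intro tendsto_intros D LIMSEQ_Suc[OF lim_inverse_n'])
  then have "eventually (%k. K * (D - d k + 1 / real (Suc k)) < \<eta> / 2) sequentially"
   using \<eta> by (intro order_tendstoD(2)) auto
  then obtain n0 where n0: "!!k. n0 <= k ==> K * (D - d k + 1 / real (Suc k)) < \<eta> / 2"
   by (auto simp: eventually_sequentially)
  have le: "Lpow p UNIV (%x. s k x - s l x) <= ennreal \<eta>" if kl: "n0 <= k" "k <= l" for k l
  proof -
   define y where "y = (%x. (1/2) *\<^sub>R (s k x + s l x))"
   have sl: "s l : C k" using s decs kl by blast
   have y: "y : C k" unfolding y_def by (rule mid[OF s(1) sl])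
   define L where "L = Lpow p UNIV (%x. s k x - s l x)"
   have ineq: "L + ennreal K * ennreal (N y) <= ennreal (\<theta> + K / 2) * (ennreal (N (s k)) + ennreal (N (s l)))"
    using K(2)[of "s k" "s l"] unfolding y_def[symmetric] L_def N(1)[OF y] N(1)[OF s(1)] by simp
   have ineq': "L + ennreal K * ennreal (N y) <= ennreal ((\<theta> + K / 2) * (N (s k) + N (s l)))"
    using ineq K(1) \<theta> N(2)[OF s(1)] by (simp add: ennreal_mult flip: ennreal_plus)
   then have "L < top" using le_less_trans[OF _ ennreal_less_top] by fastforce
   then obtain t where t: "0 <= t" "L = ennreal t" by (cases L) auto
   have "t + K * N y <= (\<theta> + K / 2) * (N (s k) + N (s l))"
    using ineq' K(1) \<theta> N(2)[OF s(1)] N(2)[OF y] t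
    by (simp flip: ennreal_plus ennreal_mult)
   then have "t <= \<theta> * (N (s k) + N (s l)) + K * ((N (s k) + N (s l)) / 2 - N y)"
    by (simp add: algebra_simps add_divide_distrib)
   moreover have "\<theta> * (N (s k) + N (s l)) <= \<theta> * (2 * M')"
    using \<theta> NM[OF s(1), of k] NM[OF s(1), of l] by (intro mult_left_mono) auto
   moreover have "K * ((N (s k) + N (s l)) / 2 - N y) <= K * (D - d k + 1 / real (Suc k))"
   proof (intro mult_left_mono K(1))
    have ar: "(x + x') / 2 - z <= E - c + a" if "b <= a" "x < c + a" "x' < c' + b" "c <= z" "c <= E" "c' <= E"
     for x x' z E c c' a b :: real
     using that by (simp add: field_simps)
    have "1 / real (Suc l) <= 1 / real (Suc k)" using kl by (simp add: field_simps)
    then show "(N (s k) + N (s l)) / 2 - N y <= D - d k + 1 / real (Suc k)"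
     using ar[OF _ s(2)[of k] s(2)[of l] dle[OF y] D(2)[of k] D(2)[of l]] by blast
   qed
   ultimately have "t <= \<eta>" using \<theta>(2) n0[OF kl(1)] by linarith
   then show ?thesis using t unfolding L_def by (simp add: ennreal_leI)
  qed
  have "Lpow p UNIV (%x. s k x - s l x) <= ennreal \<eta>" if "n0 <= k" "n0 <= l" for k l
   using le[of k l] le[of l k] that Lpow_minus_commute[of p UNIV "s k" "s l"] by (cases "k <= l") auto
  then show ?thesis by blast
 qed
 obtain w where "w : Borel" "(%n. Lpow p UNIV (%x. s n x - w x)) \<longlonglongrightarrow> 0"
  by (rule Lpow_complete[OF p _ cauchy]) auto
 with s(1) show ?thesis by (rule that)
qed

section \<open>Translations\<close>

lemma ennreal_lincomb:
 assumes "0 <= a" "0 <= b" "0 <= c" "0 <= d"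
 shows "ennreal c * ennreal a + ennreal d * ennreal b = ennreal (c * a + d * b)"
 using assms by (simp add: ennreal_mult ennreal_plus)

lemma Lpow_add_le2:
 fixes p :: real
 assumes p: "1 < p"
 shows "\<exists>C\<ge>0. \<forall>u v. u : Borel --> v : Borel -->
   Lpow p UNIV (%x::'a::euclidean_space. u x + v x :: 'b::euclidean_space)
    <= ennreal 2 * Lpow p UNIV u + ennreal C * Lpow p UNIV v"
proof -
 obtain C where C: "C \<ge> 0" "\<forall>A\<in>sets borel. \<forall>u\<in>Borel. \<forall>v\<in>Borel.
   Lpow p A (%x::'a. u x + v x :: 'b) <= ennreal (1 + 1) * Lpow p A u + ennreal C * Lpow p A v"
  using Lpow_add_le[OF p zero_less_one] by blast
 from C(2)[THEN bspec, of UNIV] C(1) show ?thesis by auto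
qed

lemma nn_integral_translate:
 fixes f :: "'a::euclidean_space => ennreal"
 assumes [measurable]: "f : Borel"
 shows "(\<integral>\<^sup>+x. f (x + h) \<partial>lborel) = (\<integral>\<^sup>+x. f x \<partial>lborel)"
proof -
 have "(\<integral>\<^sup>+x. f x \<partial>lborel) = (\<integral>\<^sup>+x. f x \<partial>(distr lborel borel ((+) h)))"
  by (simp add: lborel_distr_plus)
 also have "... = (\<integral>\<^sup>+x. f (x + h) \<partial>lborel)"
  by (subst nn_integral_distr) (auto simp: add.commute)
 finally show ?thesis ..
qed

lemma lborel_distr_diff: "distr lborel borel (%x. h - x) = (lborel :: 'a::euclidean_space measure)"
 using lborel_affine[of "-1" h] by (simp add: density_1)

lemma nn_integral_reflect:
 fixes f :: "'a::euclidean_space => ennreal"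
 assumes [measurable]: "f : Borel"
 shows "(\<integral>\<^sup>+x. f (h - x) \<partial>lborel) = (\<integral>\<^sup>+x. f x \<partial>lborel)"
proof -
 have "(\<integral>\<^sup>+x. f x \<partial>lborel) = (\<integral>\<^sup>+x. f x \<partial>(distr lborel borel (%x. h - x)))"
  by (simp add: lborel_distr_diff)
 also have "... = (\<integral>\<^sup>+x. f (h - x) \<partial>lborel)"
  by (subst nn_integral_distr) auto
 finally show ?thesis ..
qed

lemma integral_translate:
 fixes f :: "'a::euclidean_space => 'b::euclidean_space"
 assumes [measurable]: "f : Borel"
 shows "(\<integral>x. f (x + h) \<partial>lborel) = (\<integral>x. f x \<partial>lborel)"
proof -
 have "(\<integral>x. f x \<partial>lborel) = (\<integral>x. f x \<partial>(distr lborel borel ((+) h)))"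
  by (simp add: lborel_distr_plus)
 also have "... = (\<integral>x. f (x + h) \<partial>lborel)"
  by (subst integral_distr) (auto simp: add.commute)
 finally show ?thesis ..
qed

lemma integral_reflect:
 fixes f :: "'a::euclidean_space => 'b::euclidean_space"
 assumes [measurable]: "f : Borel"
 shows "(\<integral>x. f (h - x) \<partial>lborel) = (\<integral>x. f x \<partial>lborel)"
proof -
 have "(\<integral>x. f x \<partial>lborel) = (\<integral>x. f x \<partial>(distr lborel borel (%x. h - x)))"
  by (simp add: lborel_distr_diff)
 also have "... = (\<integral>x. f (h - x) \<partial>lborel)"
  by (subst integral_distr) auto
 finally show ?thesis ..
qed

lemma Lpow_translate:
 assumes [measurable]: "u : Borel"
 shows "Lpow p UNIV (%x. u (x + h)) = Lpow p UNIV u"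
 unfolding Lpow_def indicator_UNIV mult_1_right by (rule nn_integral_translate) measurable

lemma Lpow_dominated_tendsto_0:
 fixes v :: "nat => 'a::euclidean_space => 'b::euclidean_space" and g :: "'a => 'c::euclidean_space"
 assumes p: "1 < p" and [measurable]: "A : sets borel" "!!k. v k : Borel"
   "g : Borel"
  and lim: "AE x in lborel. x : A --> (%k. v k x) \<longlonglongrightarrow> 0"
  and dom: "!!k. AE x in lborel. x : A --> norm (v k x) <= norm (g x)"
  and fin: "Lpow p A g < \<infinity>"
 shows "(%k. Lpow p A (v k)) \<longlonglongrightarrow> 0"
proof -
 have "(%k. \<integral>\<^sup>+x. ennreal (norm (v k x) powr p) * indicator A x \<partial>lborel) \<longlonglongrightarrow> (\<integral>\<^sup>+x. 0 \<partial>(lborel :: 'a measure))"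
 proof (rule nn_integral_dominated_convergence)
  show "(\<integral>\<^sup>+x. ennreal (norm (g x) powr p) * indicator A x \<partial>lborel) < \<infinity>"
   using fin by (simp add: Lpow_def)
  show "AE x in lborel. ennreal (norm (v j x) powr p) * indicator A x
    <= ennreal (norm (g x) powr p) * indicator A x" for j
   using dom[of j]
  proof eventually_elim
   case (elim x)
   then show ?case using p by (auto simp: indicator_def intro!: ennreal_leI powr_mono2)
  qed
  show "AE x in lborel. (%k. ennreal (norm (v k x) powr p) * indicator A x) \<longlonglongrightarrow> 0"
   using lim
  proof eventually_elim
   case (elim x)
   show ?case
   proof (cases "x : A")
    case True
    with elim have "(%k. v k x) \<longlonglongrightarrow> 0" by blast
    then have "(%k. norm (v k x) powr p) \<longlonglongrightarrow> norm (0::'b) powr p"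
     using p by (intro tendsto_powr' tendsto_norm tendsto_const) auto
    from tendsto_ennrealI[OF this] show ?thesis using True p by simp
   qed simp
  qed
 qed measurable
 then show ?thesis by (simp add: Lpow_def)
qed

lemma Lpow_bounded_support_finite:
 fixes u :: "'a::euclidean_space => 'b::euclidean_space"
 assumes p: "1 < p" and bd: "!!x. norm (u x) <= B" and supp: "!!x. x ~: S ==> u x = 0" and S: "bounded S"
 shows "Lpow p A u < \<infinity>"
proof -
 obtain R where R: "S \<subseteq> cball 0 R" using S unfolding bounded_iff by (force simp: subset_iff)
 have "Lpow p A u <= (\<integral>\<^sup>+x. ennreal (B powr p) * indicator (cball (0::'a) R) x \<partial>lborel)"
  unfolding Lpow_def
 proof (intro nn_integral_mono)
  fix x
  have "norm (u x) powr p <= B powr p" using bd p by (intro powr_mono2) auto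
  then show "ennreal (norm (u x) powr p) * indicator A x <= ennreal (B powr p) * indicator (cball 0 R) x"
   using supp[of x] R p by (cases "x : S") (auto simp: indicator_def intro!: ennreal_leI)
 qed
 also have "... = ennreal (B powr p) * emeasure lborel (cball (0::'a) R)"
  by (rule nn_integral_cmult_indicator) simp
 also have "... < \<infinity>"
  using emeasure_lborel_cball_finite[of "0::'a" R] by (simp add: ennreal_mult_less_top)
 finally show ?thesis .
qed

text \<open>
Truncate \<open>u\<close> to a bounded function supported in a ball. That is an a.e. limit of continuous functions;
projecting their values to the truncation ball and cutting them off permits dominated convergence.
\<close>
lemma Lpow_dense_continuous:
 fixes u :: "'a::euclidean_space => 'b::euclidean_space"
 assumes p: "1 < p" and u [measurable]: "u : Borel" and fin: "Lpow p UNIV u < \<infinity>" and \<eta>: "0 < \<eta>"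
 shows "\<exists>v R. continuous_on UNIV v & (\<forall>x. R < norm x --> v x = 0) & Lpow p UNIV (%x. u x - v x) <= ennreal \<eta>"
proof -
 obtain C where C: "C \<ge> 0" "!!v w. v : Borel ==> w : Borel ==>
   Lpow p UNIV (%x::'a. v x + w x :: 'b) <= ennreal 2 * Lpow p UNIV v + ennreal C * Lpow p UNIV w"
  using Lpow_add_le2[OF p] by blast
 define t where "t = (%n::nat. %x. if norm x <= n & norm (u x) <= n then u x else 0)"
 have [measurable]: "t n : Borel" for n unfolding t_def by measurable
 have "(%n. Lpow p UNIV (%x. u x - t n x)) \<longlonglongrightarrow> 0"
 proof (rule Lpow_dominated_tendsto_0[OF p _ _ u _ _ fin])
  show "AE x in lborel. x : UNIV --> (%n. u x - t n x) \<longlonglongrightarrow> 0"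
  proof (intro AE_I2 impI tendsto_eventually)
   fix x
   show "\<forall>\<^sub>F n in sequentially. u x - t n x = 0"
    using eventually_ge_at_top[of "nat \<lceil>max (norm x) (norm (u x))\<rceil>"]
    by eventually_elim (auto simp: t_def nat_le_iff ceiling_le_iff)
  qed
 qed (auto simp: t_def)
 then have "eventually (%n. Lpow p UNIV (%x. u x - t n x) < ennreal (\<eta> / 4)) sequentially"
  using \<eta> by (intro order_tendstoD(2)) auto
 then obtain n where n: "Lpow p UNIV (%x. u x - t n x) <= ennreal (\<eta> / 4)"
  using eventually_happens'[OF sequentially_bot] less_imp_le by meson
 have "t n : borel_measurable lebesgue" by (intro measurable_completion) measurable
 then have "t n measurable_on UNIV"
  by (simp add: measurable_on_iff_borel_measurable lebesgue_on_UNIV_eq)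
 then obtain N F where NF: "negligible N" "!!k. continuous_on UNIV (F k)"
   "!!x. x ~: N ==> (%k. F k x) \<longlonglongrightarrow> t n x"
  unfolding measurable_on_def by auto
 define c where "c = (%x::'a. max 0 (min 1 (real n + 1 - norm x)))"
 define G where "G = (%k x. c x *\<^sub>R closest_point (cball 0 (real n)) (F k x))"
 have cc: "continuous_on S (closest_point (cball (0::'b) (real n)))" for S
  by (rule continuous_on_closest_point) auto
 have contc: "continuous_on UNIV c" unfolding c_def by (intro continuous_intros)
 have contG: "continuous_on UNIV (G k)" for k
  unfolding G_def using contc NF(2)[of k]
  by (intro continuous_on_scaleR continuous_on_compose2[OF cc, of UNIV]) auto
 then have [measurable]: "G k : Borel" for k
  by (rule borel_measurable_continuous_onI)
 have cl: "norm (closest_point (cball (0::'b) (real n)) y) <= real n" for y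
  using closest_point_in_set[of "cball (0::'b) (real n)" y] by simp
 have c01: "0 <= c x" "c x <= 1" "norm x <= n ==> c x = 1" "real n + 1 < norm x ==> c x = 0" for x
  by (auto simp: c_def)
 have "(%k. Lpow p UNIV (%x. t n x - G k x)) \<longlonglongrightarrow> 0"
 proof (rule Lpow_dominated_tendsto_0[OF p])
  have "AE x in lborel. x ~: N"
   using NF(1) by (metis AE_not_in AE_completion_iff negligible_iff_null_sets)
  then show "AE x in lborel. x : UNIV --> (%k. t n x - G k x) \<longlonglongrightarrow> 0"
  proof eventually_elim
   case (elim x)
   have "(%k. closest_point (cball 0 (real n)) (F k x)) \<longlonglongrightarrow> closest_point (cball 0 (real n)) (t n x)"
    by (rule continuous_on_tendsto_compose[OF cc[of UNIV] NF(3)[OF elim]]) auto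
   then have "(%k. G k x) \<longlonglongrightarrow> c x *\<^sub>R closest_point (cball 0 (real n)) (t n x)"
    unfolding G_def by (intro tendsto_intros)
   also have "closest_point (cball 0 (real n)) (t n x) = t n x"
    by (rule closest_point_self) (auto simp: t_def)
   also have "c x *\<^sub>R t n x = t n x" using c01(3)[of x] by (auto simp: t_def)
   finally have "(%k. t n x - G k x) \<longlonglongrightarrow> t n x - t n x" by (intro tendsto_intros)
   then show ?case by simp
  qed
  show "AE x in lborel. x : UNIV --> norm (t n x - G k x) \<le>
    norm (indicator (cball (0::'a) (real n + 1)) x * (2 * real n))" for k
  proof (intro AE_I2 impI)
   fix x :: 'a
   have "norm (t n x - G k x) <= norm (t n x) + norm (G k x)" by (rule norm_triangle_ineq4)
   also have "norm (G k x) <= 1 * real n"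
    unfolding G_def norm_scaleR using c01[of x] cl by (intro mult_mono) auto
   also have "norm (t n x) <= n" by (auto simp: t_def)
   finally show "norm (t n x - G k x) <= norm (indicator (cball (0::'a) (real n + 1)) x * (2 * real n))"
    using c01(4)[of x] by (auto simp: indicator_def t_def G_def)
  qed
  show "Lpow p UNIV (%x. indicator (cball (0::'a) (real n + 1)) x * (2 * real n)) < \<infinity>"
   by (rule Lpow_bounded_support_finite[OF p, of _ "2 * real n" "cball 0 (real n + 1)"])
    (auto simp: indicator_def)
  show "(%x. indicator (cball (0::'a) (real n + 1)) x * (2 * real n)) : Borel"
   by (intro borel_measurable_times borel_measurable_indicator borel_measurable_const) auto
 qed auto
 then have "eventually (%k. Lpow p UNIV (%x. t n x - G k x) < ennreal (\<eta> / (2 * (C + 1)))) sequentially"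
  using \<eta> C by (intro order_tendstoD(2)) (auto simp: zero_less_divide_iff)
 then obtain k where k: "Lpow p UNIV (%x. t n x - G k x) <= ennreal (\<eta> / (2 * (C + 1)))"
  using eventually_happens'[OF sequentially_bot] less_imp_le by meson
 have "Lpow p UNIV (%x. u x - G k x) = Lpow p UNIV (%x. (u x - t n x) + (t n x - G k x))" by simp
 also have "... <= ennreal 2 * Lpow p UNIV (%x. u x - t n x) + ennreal C * Lpow p UNIV (%x. t n x - G k x)"
  by (rule C(2)) auto
 also have "... <= ennreal 2 * ennreal (\<eta> / 4) + ennreal C * ennreal (\<eta> / (2 * (C + 1)))"
  using n k by (intro add_mono mult_left_mono) auto
 also have "... = ennreal (2 * (\<eta> / 4) + C * (\<eta> / (2 * (C + 1))))"
  using C \<eta> by (intro ennreal_lincomb) auto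
 also have "... <= ennreal \<eta>" using C \<eta> by (intro ennreal_leI) (simp add: field_simps)
 finally have "Lpow p UNIV (%x. u x - G k x) <= ennreal \<eta>" .
 moreover have "\<forall>x. real n + 1 < norm x --> G k x = 0" using c01(4) by (simp add: G_def)
 ultimately show ?thesis using contG by blast
qed

text \<open>
True for continuous functions of compact support by uniform continuity, and stable under \<open>L\<^sup>p\<close>
approximation because translations preserve \<open>Lpow\<close>.
\<close>
lemma Lpow_translation_continuous:
 fixes u :: "'a::euclidean_space => 'b::euclidean_space"
 assumes p: "1 < p" and u [measurable]: "u : Borel" and fin: "Lpow p UNIV u < \<infinity>" and \<eta>: "0 < \<eta>"
 shows "\<exists>\<delta>>0. \<forall>h. norm h < \<delta> --> Lpow p UNIV (%x. u (x + h) - u x) <= ennreal \<eta>"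
proof -
 obtain C where C: "C \<ge> 0" "!!v w. v : Borel ==> w : Borel ==>
   Lpow p UNIV (%x::'a. v x + w x :: 'b) <= ennreal 2 * Lpow p UNIV v + ennreal C * Lpow p UNIV w"
  using Lpow_add_le2[OF p] by blast
 define e where "e = \<eta> / (4 * (1 + C))"
 have "e * (4 * (1 + C)) = \<eta>" using C by (simp add: e_def)
 then have "4 * e + 4 * C * e <= \<eta>" by (simp add: algebra_simps)
 moreover have "0 < e" using \<eta> C by (simp add: e_def)
 ultimately have e: "0 < e" "4 * e + 4 * C * e <= \<eta>" by auto
 obtain v R where v: "continuous_on UNIV v" "!!x. R < norm x ==> v x = 0"
   "Lpow p UNIV (%x. u x - v x) <= ennreal e"
  using Lpow_dense_continuous[OF p u fin e(1)] by blast
 have [measurable]: "v : Borel" using v(1) by (rule borel_measurable_continuous_onI)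
 define V where "V = measure lborel (cball (0::'a) (R + 1))"
 have V: "emeasure lborel (cball (0::'a) (R + 1)) = ennreal V"
  unfolding V_def using emeasure_lborel_cball_finite[of "0::'a" "R + 1"]
  by (intro emeasure_eq_ennreal_measure) simp
 define s where "s = (e / (V + 1)) powr (1 / p)"
 have V0: "0 <= V" by (simp add: V_def)
 have s: "0 < s" "s powr p * V <= e" using e V0 p
  by (auto simp: s_def powr_powr field_simps)
 have "uniformly_continuous_on (cball 0 (R + 2)) v"
  using v(1) by (intro compact_uniformly_continuous) (auto intro: continuous_on_subset)
 then obtain \<delta> where \<delta>: "0 < \<delta>" "!!x y. x : cball 0 (R + 2) ==> y : cball 0 (R + 2) ==> dist y x < \<delta> ==> dist (v y) (v x) < s"
  using s(1) unfolding uniformly_continuous_on_def by meson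
 have "Lpow p UNIV (%x. u (x + h) - u x) <= ennreal \<eta>" if h: "norm h < min \<delta> 1" for h
 proof -
  have "Lpow p UNIV (%x. v (x + h) - v x) <= (\<integral>\<^sup>+x. ennreal (s powr p) * indicator (cball (0::'a) (R + 1)) x \<partial>lborel)"
   unfolding Lpow_def
  proof (intro nn_integral_mono)
   fix x :: 'a
   show "ennreal (norm (v (x + h) - v x) powr p) * indicator UNIV x
     <= ennreal (s powr p) * indicator (cball 0 (R + 1)) x"
   proof (cases "norm x <= R + 1")
    case True
    then have "norm (x + h) <= R + 2" using h norm_triangle_ineq[of x h] by simp
    moreover have "dist (x + h) x < \<delta>" using h by (simp add: dist_norm)
    ultimately have "dist (v (x + h)) (v x) < s"
     using True by (intro \<delta>(2)) (auto simp only: mem_cball_0)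
    then show ?thesis using True p s(1) by (auto simp: dist_norm intro!: ennreal_leI powr_mono2)
   next
    case False
    then have "R < norm (x + h)" using h norm_triangle_ineq4[of "x + h" h] by simp
    then show ?thesis using False p v(2) by simp
   qed
  qed
  also have "... = ennreal (s powr p) * ennreal V" by (subst nn_integral_cmult_indicator) (simp_all add: V)
  also have "... <= ennreal e" using s by (subst ennreal_mult[symmetric]) (auto simp: V0 intro: ennreal_leI)
  finally have b: "Lpow p UNIV (%x. v (x + h) - v x) <= ennreal e" .
  have a: "Lpow p UNIV (%x. u (x + h) - v (x + h)) <= ennreal e"
   using v(3) Lpow_translate[of "%x. u x - v x" p h] by simp
  have a': "Lpow p UNIV (%x. v x - u x) <= ennreal e" using v(3) by (subst Lpow_minus_commute)
  have "Lpow p UNIV (%x. u (x + h) - u x)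
    = Lpow p UNIV (%x. ((u (x + h) - v (x + h)) + (v x - u x)) + (v (x + h) - v x))"
   by (simp add: algebra_simps)
  also have "... <= ennreal 2 * Lpow p UNIV (%x. (u (x + h) - v (x + h)) + (v x - u x))
    + ennreal C * Lpow p UNIV (%x. v (x + h) - v x)"
   by (rule C(2)) auto
  also have "... <= ennreal 2 * (ennreal 2 * ennreal e + ennreal C * ennreal e) + ennreal C * ennreal e"
   using a a' b by (intro add_mono mult_left_mono order_trans[OF C(2)]) auto
  also have "... = ennreal (2 * (2 * e + C * e) + C * e)"
  proof -
   have "ennreal 2 * ennreal e + ennreal C * ennreal e = ennreal (2 * e + C * e)"
    using C e by (intro ennreal_lincomb) auto
   moreover have "ennreal 2 * ennreal (2 * e + C * e) + ennreal C * ennreal e = ennreal (2 * (2 * e + C * e) + C * e)"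
    using C e by (intro ennreal_lincomb) auto
   ultimately show ?thesis by (simp only:)
  qed
  also have "... <= ennreal \<eta>"
  proof (rule ennreal_leI)
   have "0 <= C * e" using C e by simp
   then show "2 * (2 * e + C * e) + C * e <= \<eta>" using e(2) by (simp add: algebra_simps)
  qed
  finally show ?thesis .
 qed
 then show ?thesis using \<delta>(1) by (intro exI[of _ "min \<delta> 1"]) auto
qed

section \<open>Smooth functions and test functions\<close>

definition smooth :: "('a::euclidean_space => real) => bool" where
 "smooth \<phi> \<longleftrightarrow> (\<forall>k. Ck k \<phi>)"

abbreviation partial :: "'a::euclidean_space => ('a => real) => 'a => real" where
 "partial b \<phi> \<equiv> (%x. frechet_derivative \<phi> (at x) b)"

lemma frechet_derivative_eqI:
 "(f has_derivative f') (at x) ==> frechet_derivative f (at x) = f'"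
 using frechet_derivative_at by metis

text \<open>
The iterated definition of smoothness is inconvenient to verify directly; a class of differentiable
functions that is stable under partial derivatives consists of smooth functions.
\<close>
lemma smooth_coinduct:
 assumes "\<phi> : S"
  and diff: "!!\<psi> x. \<psi> : S ==> \<psi> differentiable (at x)"
  and step: "!!\<psi> b. \<psi> : S ==> b : Basis ==> partial b \<psi> : S"
 shows "smooth \<phi>"
proof -
 have "Ck k \<psi>" if "\<psi> : S" for k \<psi>
  using that
 proof (induction k arbitrary: \<psi>)
  case 0
  then show ?case using diff
   by (auto intro!: differentiable_imp_continuous_on simp: differentiable_on_def differentiable_at_withinI)
 next
  case (Suc k)
  then show ?case using diff step by auto
 qed
 with assms(1) show ?thesis by (auto simp: smooth_def)
qed

lemma smooth_differentiable: "smooth \<phi> ==> \<phi> differentiable (at x)"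
 unfolding smooth_def using Ck.simps(2) by blast

lemma smooth_partial: "smooth \<phi> ==> b : Basis ==> smooth (partial b \<phi>)"
 unfolding smooth_def using Ck.simps(2) by blast

lemma smooth_has_derivative: "smooth \<phi> ==> (\<phi> has_derivative frechet_derivative \<phi> (at x)) (at x)"
 using smooth_differentiable frechet_derivative_works by blast

lemma smooth_continuous: "smooth \<phi> ==> continuous_on S \<phi>"
 by (intro differentiable_imp_continuous_on)
   (auto simp: differentiable_on_def intro: differentiable_at_withinI smooth_differentiable)

lemma smooth_borel [measurable]: "smooth \<phi> ==> \<phi> : Borel"
 using smooth_continuous by (rule borel_measurable_continuous_onI)

text \<open>
The powers of \<open>1 / t\<close> are included so that the family is closed under differentiation.
\<close>
definition flat_exp :: "nat => real => real" where
 "flat_exp m t = (if 0 < t then exp (- 1 / t) / t ^ m else 0)"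

lemma flat_exp_tendsto_0: "(flat_exp m \<longlongrightarrow> 0) (at 0)"
proof -
 have "((%s::real. s ^ m / exp s) \<longlongrightarrow> 0) at_top" by (rule tendsto_power_div_exp_0)
 then have "((%t::real. (inverse t) ^ m / exp (inverse t)) \<longlongrightarrow> 0) (at_right 0)"
  by (rule filterlim_compose[OF _ filterlim_inverse_at_top_right])
 then have "(flat_exp m \<longlongrightarrow> 0) (at_right 0)"
 proof (rule Lim_transform_eventually)
  show "\<forall>\<^sub>F t in at_right 0. (inverse t) ^ m / exp (inverse t) = flat_exp m t"
   using eventually_at_right_less[of 0]
   by eventually_elim (auto simp: flat_exp_def exp_minus field_simps)
 qed
 moreover have "(flat_exp m \<longlongrightarrow> 0) (at_left 0)"
 proof (rule Lim_transform_eventually[OF tendsto_const])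
  show "\<forall>\<^sub>F t in at_left 0. 0 = flat_exp m t"
   unfolding eventually_at_filter by (auto simp: flat_exp_def)
 qed
 ultimately show ?thesis by (simp add: filterlim_split_at)
qed

lemma flat_exp_DERIV:
 "(flat_exp m has_real_derivative (- real m * flat_exp (Suc m) t + flat_exp (m + 2) t)) (at t)"
proof (cases t "0::real" rule: linorder_cases)
 case less
 have "((%_. 0) has_real_derivative 0) (at t)" by simp
 moreover have "\<forall>\<^sub>F s in nhds t. s : {..<0}" using less by (intro eventually_nhds_in_open) auto
 then have "\<forall>\<^sub>F s in nhds t. flat_exp m s = 0" by eventually_elim (auto simp: flat_exp_def)
 ultimately have "(flat_exp m has_real_derivative 0) (at t)"
  by (subst DERIV_cong_ev[OF refl _ refl]) auto
 then show ?thesis using less by (simp add: flat_exp_def)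
next
 case greater
 have "((%s. exp (- 1 / s) / s ^ m) has_real_derivative
   (- real m * flat_exp (Suc m) t + flat_exp (m + 2) t)) (at t)"
  using greater
  apply (auto intro!: derivative_eq_intros simp: flat_exp_def)
  apply (cases m)
   apply (auto simp: field_simps power2_eq_square)
  done
 moreover have "\<forall>\<^sub>F s in nhds t. s : {0<..}" using greater by (intro eventually_nhds_in_open) auto
 then have "\<forall>\<^sub>F s in nhds t. flat_exp m s = exp (- 1 / s) / s ^ m" by eventually_elim (auto simp: flat_exp_def)
 ultimately show ?thesis
  by (subst DERIV_cong_ev[OF refl _ refl]) auto
next
 case equal
 have "((%y. (flat_exp m y - flat_exp m 0) / (y - 0)) \<longlongrightarrow> 0) (at 0)"
  by (rule Lim_transform_eventually[OF flat_exp_tendsto_0[of "Suc m"]])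
    (auto simp: flat_exp_def intro!: always_eventually)
 then show ?thesis using equal by (simp add: has_field_derivative_iff flat_exp_def[of _ 0])
qed

text \<open>
The closure used to show that the bump function and products are smooth by \<open>smooth_coinduct\<close>: the generators
are such that partial derivatives stay inside.
\<close>
inductive_set smooth_alg :: "('a::euclidean_space => real) set" where
 base: "smooth f ==> f : smooth_alg"
| const: "(%_. c) : smooth_alg"
| coord: "(%x. x \<bullet> c) : smooth_alg"
| add: "f : smooth_alg ==> g : smooth_alg ==> (%x. f x + g x) : smooth_alg"
| mult: "f : smooth_alg ==> g : smooth_alg ==> (%x. f x * g x) : smooth_alg"
| comp: "f : smooth_alg ==> (%x. flat_exp m (f x)) : smooth_alg"

lemma partial_add:
 assumes "f differentiable (at x)" "g differentiable (at x)"
 shows "frechet_derivative (%x. f x + g x) (at x) b = frechet_derivative f (at x) b + frechet_derivative g (at x) b"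
 using has_derivative_add[OF assms[unfolded frechet_derivative_works]]
 by (simp add: frechet_derivative_eqI)

lemma partial_mult:
 fixes f g :: "'a::euclidean_space => real"
 assumes "f differentiable (at x)" "g differentiable (at x)"
 shows "frechet_derivative (%x. f x * g x) (at x) b
  = f x * frechet_derivative g (at x) b + frechet_derivative f (at x) b * g x"
 using has_derivative_mult[OF assms[unfolded frechet_derivative_works]]
 by (simp add: frechet_derivative_eqI)

lemma smooth_alg_smooth:
 assumes "f : smooth_alg" shows "smooth f"
proof (rule smooth_coinduct[OF assms])
 fix \<psi> :: "'a => real" assume "\<psi> : smooth_alg"
 then have "(\<forall>x. \<psi> differentiable (at x)) & (\<forall>b\<in>Basis. partial b \<psi> : smooth_alg)"
 proof induction
  case (base f)
  then show ?case
   by (blast intro: smooth_alg.base[OF smooth_partial] smooth_differentiable)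
 next
  case (const c)
  have "(%_::'a. 0::real) : smooth_alg" by (rule smooth_alg.const)
  then show ?case by simp
 next
  case (coord c)
  have "frechet_derivative (%x::'a. x \<bullet> c) (at x) = (%x. x \<bullet> c)" for x
   by (rule frechet_derivative_eqI) (auto intro!: derivative_eq_intros)
  then show ?case by (auto intro: smooth_alg.const)
 next
  case (add f g)
  have "(%x. frechet_derivative f (at x) b + frechet_derivative g (at x) b) : smooth_alg" if "b : Basis" for b
   by (rule smooth_alg.add) (use add that in blast)+
  moreover have "(%x. f x + g x) differentiable (at x)" for x
   using add by (intro differentiable_add) auto
  ultimately show ?case using add by (simp add: partial_add)
 next
  case (mult f g)
  have "(%x. f x * frechet_derivative g (at x) b + frechet_derivative f (at x) b * g x) : smooth_alg"
   if "b : Basis" for b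
   by (rule smooth_alg.add[OF smooth_alg.mult smooth_alg.mult]) (use mult that in blast)+
  moreover have "(%x. f x * g x) differentiable (at x)" for x
   using mult by (intro differentiable_mult) auto
  ultimately show ?case using mult by (simp add: partial_mult)
 next
  case (comp f m)
  have der: "((%x. flat_exp m (f x)) has_derivative
    (%v. (- real m * flat_exp (Suc m) (f x) + flat_exp (m + 2) (f x)) * frechet_derivative f (at x) v)) (at x)" for x
  proof -
   have "f differentiable (at x)" using comp by blast
   then have "(f has_derivative frechet_derivative f (at x)) (at x)" using frechet_derivative_works by blast
   from has_derivative_compose[OF this flat_exp_DERIV[unfolded has_field_derivative_def, of m "f x"]]
   show ?thesis by simp
  qed
  have "(%x. (- real m * flat_exp (Suc m) (f x) + flat_exp (m + 2) (f x)) * frechet_derivative f (at x) b) : smooth_alg"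
   if "b : Basis" for b
   by (rule smooth_alg.mult[OF smooth_alg.add[OF smooth_alg.mult[OF smooth_alg.const smooth_alg.comp] smooth_alg.comp]])
    (use comp that in blast)+
  moreover have "(%x. flat_exp m (f x)) differentiable (at x)" for x
   using der differentiable_def by blast
  ultimately show ?case by (simp add: frechet_derivative_eqI[OF der])
 qed
 then show "\<psi> differentiable (at x)" "b : Basis ==> partial b \<psi> : smooth_alg" for x b by blast+
qed

lemma smooth_const: "smooth (%_. c)"
 by (rule smooth_alg_smooth[OF smooth_alg.const])

lemma smooth_add: "smooth f ==> smooth g ==> smooth (%x. f x + g x)"
 by (rule smooth_alg_smooth[OF smooth_alg.add[OF smooth_alg.base smooth_alg.base]])

lemma smooth_mult: "smooth f ==> smooth g ==> smooth (%x. f x * g x)"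
 by (rule smooth_alg_smooth[OF smooth_alg.mult[OF smooth_alg.base smooth_alg.base]])

lemma smooth_affine:
 assumes "smooth f" shows "smooth (%x. f (a + c *\<^sub>R x))"
proof (rule smooth_coinduct)
 let ?S = "{%x. d * f (a + c *\<^sub>R x) | d f. smooth f}"
 have "(%x. f (a + c *\<^sub>R x)) = (%x. 1 * f (a + c *\<^sub>R x))" by simp
 then show "(%x. f (a + c *\<^sub>R x)) : ?S" using assms by blast
 have der: "((%x. d * f (a + c *\<^sub>R x)) has_derivative
   (%v. (d * c) * frechet_derivative f (at (a + c *\<^sub>R x)) v)) (at x)"
  if "smooth f" for d x and f :: "'a => real"
 proof -
  have "((%x. a + c *\<^sub>R x) has_derivative (%v. c *\<^sub>R v)) (at x)" by (auto intro!: derivative_eq_intros)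
  note has_derivative_mult_right[OF has_derivative_compose[OF this smooth_has_derivative[OF that]], of d]
  moreover have "linear (frechet_derivative f (at (a + c *\<^sub>R x)))"
   using smooth_has_derivative[OF that] has_derivative_linear by blast
  ultimately show ?thesis by (simp add: linear_cmul mult.assoc)
 qed
 fix \<psi> assume "\<psi> : ?S"
 then obtain d g where g: "smooth g" "\<psi> = (%x. d * g (a + c *\<^sub>R x))" by blast
 show "\<psi> differentiable (at x)" for x unfolding g(2) using der[OF g(1)] differentiable_def by blast
 show "partial b \<psi> : ?S" if "b : Basis" for b
  unfolding g(2) frechet_derivative_eqI[OF der[OF g(1)]] using smooth_partial[OF g(1) that]
  by (intro CollectI exI[of _ "d * c"] exI[of _ "partial b g"]) simp
qed

definition bump :: "'a::euclidean_space => real" where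
 "bump x = flat_exp 0 (1 - x \<bullet> x)"

lemma smooth_bump: "smooth bump"
proof -
 have "(%x::'a. \<Sum>b\<in>B. (x \<bullet> b) * (x \<bullet> b)) : smooth_alg" if "finite B" for B
  using that
 proof induction
  case empty
  show ?case using smooth_alg.const[of 0] by simp
 next
  case (insert b F)
  have "(%x::'a. (x \<bullet> b) * (x \<bullet> b) + (\<Sum>b\<in>F. (x \<bullet> b) * (x \<bullet> b))) : smooth_alg"
   by (rule smooth_alg.add[OF smooth_alg.mult[OF smooth_alg.coord smooth_alg.coord] insert.IH])
  then show ?case using insert.hyps by simp
 qed
 then have "(%x::'a. flat_exp 0 (1 + (-1) * (\<Sum>b\<in>Basis. (x \<bullet> b) * (x \<bullet> b)))) : smooth_alg"
  by (intro smooth_alg.comp smooth_alg.add smooth_alg.mult smooth_alg.const) auto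
 moreover have "(%x::'a. flat_exp 0 (1 + (-1) * (\<Sum>b\<in>Basis. (x \<bullet> b) * (x \<bullet> b)))) = bump"
  unfolding bump_def by (intro ext) (simp add: euclidean_inner[symmetric])
 ultimately show ?thesis using smooth_alg_smooth by metis
qed

lemma bump_pos_iff: "0 < bump x \<longleftrightarrow> norm x < 1" and bump_nonneg: "0 <= bump x"
 and bump_le_1: "bump x <= 1"
 by (auto simp: bump_def flat_exp_def dot_square_norm abs_square_less_1 power_less_one_iff power_le_one)

lemma integrable_smooth_compact:
 assumes "smooth \<phi>" "bounded S" "!!x. x ~: S ==> \<phi> x = 0"
 shows "integrable lborel \<phi>"
proof -
 obtain R where R: "!!x. x : S ==> norm x <= R" using assms(2) by (auto simp: bounded_iff)
 have "set_integrable lborel (cball 0 R) \<phi>"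
  unfolding set_integrable_def
  using borel_integrable_compact[OF compact_cball smooth_continuous[OF assms(1)], of 0 R]
  by (simp add: indicator_scaleR_eq_if)
 moreover have "(%x. indicator (cball 0 R) x *\<^sub>R \<phi> x) = \<phi>"
 proof
  show "indicator (cball 0 R) x *\<^sub>R \<phi> x = \<phi> x" for x
   using assms(3)[of x] R[of x] by (auto simp: indicator_def)
 qed
 ultimately show ?thesis by (simp only: set_integrable_def)
qed

definition mollifier :: "real => 'a::euclidean_space => real" where
 "mollifier \<delta> x = bump ((1 / \<delta>) *\<^sub>R x) / (\<integral>y. bump ((1 / \<delta>) *\<^sub>R y) \<partial>(lborel :: 'a measure))"

lemma mollifier:
 fixes \<delta> :: real
 assumes \<delta>: "0 < \<delta>"
 shows smooth_mollifier: "smooth (mollifier \<delta> :: 'a::euclidean_space => real)"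
  and mollifier_nonneg: "!!x :: 'a. 0 <= mollifier \<delta> x"
  and mollifier_eq_0: "!!x :: 'a. \<delta> <= norm x ==> mollifier \<delta> x = 0"
  and integrable_mollifier: "integrable lborel (mollifier \<delta> :: 'a => real)"
  and integral_mollifier: "(\<integral>x. mollifier \<delta> x \<partial>(lborel :: 'a measure)) = 1"
proof -
 let ?b = "%x :: 'a. bump ((1 / \<delta>) *\<^sub>R x)"
 have sb: "smooth ?b" using smooth_affine[OF smooth_bump, of 0 "1 / \<delta>"] by simp
 have b0: "?b x = 0" if "\<delta> <= norm x" for x
 proof -
  have "\<not> norm ((1 / \<delta>) *\<^sub>R x) < 1" using that \<delta> by simp
  then have "\<not> 0 < ?b x" by (simp only: bump_pos_iff not_False_eq_True)
  then show ?thesis using bump_nonneg[of "(1 / \<delta>) *\<^sub>R x"] by linarith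
 qed
 have bpos: "0 < ?b x" if "norm x < \<delta>" for x
  using that \<delta> by (subst bump_pos_iff) simp
 have ib: "integrable lborel ?b"
  by (rule integrable_smooth_compact[OF sb, of "ball 0 \<delta>"]) (use b0 in auto)
 define Z where "Z = (\<integral>y. ?b y \<partial>lborel)"
 have "0 < Z"
 proof -
  have "Z \<noteq> 0"
  proof
   assume "Z = 0"
   then have "AE x in lborel. ?b x = 0"
    unfolding Z_def using ib bump_nonneg by (subst (asm) integral_nonneg_eq_0_iff_AE) auto
   then have "AE x in lborel. x ~: ball (0::'a) \<delta>"
   proof eventually_elim
    case (elim x)
    then show ?case using bpos[of x] by (cases "norm x < \<delta>") auto
   qed
   then have "emeasure lborel (ball (0::'a) \<delta>) = 0"
    by (subst (asm) AE_iff_null) (auto simp: null_sets_def ball_def)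
   then show False using open_not_negligible[of "ball (0::'a) \<delta>"] \<delta>
    by (auto simp: negligible_iff_null_sets null_sets_def)
  qed
  moreover have "0 <= Z" unfolding Z_def using bump_nonneg by (intro integral_nonneg_AE) auto
  ultimately show ?thesis by simp
 qed
 have m: "mollifier \<delta> = (%x :: 'a. ?b x * (1 / Z))" by (auto simp: mollifier_def Z_def)
 show "smooth (mollifier \<delta> :: 'a => real)"
  unfolding m using sb smooth_const by (rule smooth_mult)
 show "!!x :: 'a. 0 <= mollifier \<delta> x" unfolding m using \<open>0 < Z\<close> bump_nonneg by (intro mult_nonneg_nonneg) auto
 show "!!x :: 'a. \<delta> <= norm x ==> mollifier \<delta> x = 0" unfolding m using b0 by simp
 show "integrable lborel (mollifier \<delta> :: 'a => real)" unfolding m using ib by simp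
 show "(\<integral>x. mollifier \<delta> x \<partial>(lborel :: 'a measure)) = 1"
  unfolding m using \<open>0 < Z\<close> by (simp add: Z_def[symmetric])
qed

lemma test_functions_iff:
 "\<phi> : test_functions \<O> \<longleftrightarrow> smooth \<phi> & (\<exists>K. compact K & K \<subseteq> \<O> & (\<forall>x. x ~: K --> \<phi> x = 0))"
proof
 assume a: "\<phi> : test_functions \<O>"
 have "\<phi> x = 0" if "x ~: closure {x. \<phi> x \<noteq> 0}" for x
  using that closure_subset[of "{x. \<phi> x \<noteq> 0}"] by blast
 then show "smooth \<phi> & (\<exists>K. compact K & K \<subseteq> \<O> & (\<forall>x. x ~: K --> \<phi> x = 0))"
  using a unfolding test_functions_def smooth_def by blast
next
 assume R: "smooth \<phi> & (\<exists>K. compact K & K \<subseteq> \<O> & (\<forall>x. x ~: K --> \<phi> x = 0))"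
 then obtain K where K: "compact K" "K \<subseteq> \<O>" "!!x. x ~: K ==> \<phi> x = 0" by blast
 have sub: "closure {x. \<phi> x \<noteq> 0} \<subseteq> K"
  using K(3) compact_imp_closed[OF K(1)] by (intro closure_minimal) auto
 then have "compact (closure {x. \<phi> x \<noteq> 0})"
  using K(1) compact_Int_closed[OF K(1) closed_closure[of "{x. \<phi> x \<noteq> 0}"]] by (simp add: Int_absorb1)
 then show "\<phi> : test_functions \<O>" using R sub K(2) by (auto simp: test_functions_def smooth_def)
qed

lemma partial_eq_0_outside:
 assumes "closed K" "!!x. x ~: K ==> \<phi> x = 0" "x ~: K"
 shows "frechet_derivative \<phi> (at x) = (%_. 0)"
proof (rule frechet_derivative_eqI)
 have "((%_. 0) has_derivative (%_. 0)) (at x)" by simp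
 then show "(\<phi> has_derivative (%_. 0)) (at x)"
  using assms has_derivative_transform_within_open[of "%_. 0" "%_. 0" x UNIV "- K" \<phi>]
  by (auto simp: open_Compl)
qed

lemma test_functions_partial:
 assumes "\<phi> : test_functions \<O>" "b : Basis" shows "partial b \<phi> : test_functions \<O>"
proof -
 obtain K where "smooth \<phi>" "compact K" "K \<subseteq> \<O>" "!!x. x ~: K ==> \<phi> x = 0"
  using assms(1) unfolding test_functions_iff by blast
 then show ?thesis unfolding test_functions_iff
  using smooth_partial[OF \<open>smooth \<phi>\<close> assms(2)] partial_eq_0_outside[OF compact_imp_closed[OF \<open>compact K\<close>], of \<phi>]
  by (intro conjI exI[of _ K]) auto
qed

lemma test_functions_mono: "\<O> \<subseteq> \<O>' ==> \<phi> : test_functions \<O> ==> \<phi> : test_functions \<O>'"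
 by (auto simp: test_functions_def)

lemma test_functions_bounded:
 assumes "\<phi> : test_functions \<O>" shows "\<exists>B\<ge>0. \<forall>x. \<bar>\<phi> x\<bar> <= B"
proof -
 obtain K where K: "smooth \<phi>" "compact K" "!!x. x ~: K ==> \<phi> x = 0"
  using assms unfolding test_functions_iff by blast
 have "bounded (\<phi> ` K)" using K by (intro compact_imp_bounded compact_continuous_image smooth_continuous)
 then obtain B where "\<forall>x\<in>K. \<bar>\<phi> x\<bar> <= B" by (auto simp: bounded_iff)
 then have "\<forall>x. \<bar>\<phi> x\<bar> <= max B 0" using K(3) by (metis abs_zero max.cobounded2 max.coboundedI1)
 then show ?thesis by (intro exI[of _ "max B 0"]) auto
qed

definition grad :: "('a::euclidean_space => real) => 'a => 'a" where
 "grad \<phi> x = (\<Sum>b\<in>Basis. frechet_derivative \<phi> (at x) b *\<^sub>R b)"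

lemma grad_inner_Basis: "b : Basis ==> grad \<phi> x \<bullet> b = frechet_derivative \<phi> (at x) b"
 by (simp add: grad_def inner_sum_left inner_Basis if_distrib cong: if_cong)

lemma grad_inner:
 assumes "\<phi> differentiable (at x)"
 shows "frechet_derivative \<phi> (at x) h = grad \<phi> x \<bullet> h"
proof -
 interpret linear "frechet_derivative \<phi> (at x)"
  using assms by (rule linear_frechet_derivative)
 have "frechet_derivative \<phi> (at x) h = frechet_derivative \<phi> (at x) (\<Sum>b\<in>Basis. (h \<bullet> b) *\<^sub>R b)"
  by (simp add: euclidean_representation)
 also have "... = (\<Sum>b\<in>Basis. (h \<bullet> b) * frechet_derivative \<phi> (at x) b)"
  by (simp add: sum scale)
 also have "... = grad \<phi> x \<bullet> h"
  by (simp add: grad_def inner_sum_left inner_commute[of h] mult.commute)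
 finally show ?thesis .
qed

lemma smooth_has_derivative_grad: "smooth \<phi> ==> (\<phi> has_derivative (%h. grad \<phi> x \<bullet> h)) (at x)"
 using smooth_has_derivative[of \<phi> x] grad_inner[OF smooth_differentiable, of \<phi> x]
 by (metis (no_types, lifting) ext)

lemma test_functions_Lipschitz:
 assumes "\<phi> : test_functions \<O>" shows "\<exists>L\<ge>0. \<forall>x y. \<bar>\<phi> x - \<phi> y\<bar> <= L * norm (x - y)"
proof -
 have s: "smooth \<phi>" using assms by (simp add: test_functions_iff)
 have "\<forall>b\<in>Basis. \<exists>B\<ge>0. \<forall>x. \<bar>frechet_derivative \<phi> (at x) b\<bar> <= B"
  using test_functions_bounded[OF test_functions_partial[OF assms]] by blast
 then obtain B where B: "!!b. b : Basis ==> 0 <= B b" "!!b x. b : Basis ==> \<bar>frechet_derivative \<phi> (at x) b\<bar> <= B b"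
  by metis
 define L where "L = (\<Sum>b\<in>Basis. B b)"
 have gL: "norm (grad \<phi> x) <= L" for x
  unfolding L_def by (rule order_trans[OF norm_le_l1]) (auto intro!: sum_mono simp: grad_inner_Basis B)
 have "norm (\<phi> x - \<phi> y) <= L * norm (x - y)" for x y
 proof (rule differentiable_bound[of UNIV])
  show "(\<phi> has_derivative (%h. grad \<phi> x \<bullet> h)) (at x within UNIV)" for x
   using smooth_has_derivative_grad[OF s] by simp
  show "onorm (%h. grad \<phi> x \<bullet> h) <= L" for x
  proof (rule onorm_le)
   fix h
   have "norm (grad \<phi> x \<bullet> h) <= norm (grad \<phi> x) * norm h"
    using Cauchy_Schwarz_ineq2 by (simp add: norm_mult)
   also have "... <= L * norm h" using gL by (intro mult_right_mono) auto
   finally show "norm (grad \<phi> x \<bullet> h) <= L * norm h" .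
  qed
 qed auto
 then show ?thesis using B(1) by (intro exI[of _ L]) (auto simp: L_def sum_nonneg)
qed

lemma test_functions_grad_Lipschitz:
 assumes "\<phi> : test_functions \<O>" shows "\<exists>L\<ge>0. \<forall>x y. norm (grad \<phi> x - grad \<phi> y) <= L * norm (x - y)"
proof -
 have "\<forall>b\<in>Basis. \<exists>L\<ge>0. \<forall>x y. \<bar>frechet_derivative \<phi> (at x) b - frechet_derivative \<phi> (at y) b\<bar> <= L * norm (x - y)"
  using test_functions_Lipschitz[OF test_functions_partial[OF assms]] by blast
 then obtain B where B: "!!b. b : Basis ==> 0 <= B b"
   "!!b x y. b : Basis ==> \<bar>frechet_derivative \<phi> (at x) b - frechet_derivative \<phi> (at y) b\<bar> <= B b * norm (x - y)"
  by metis
 have "norm (grad \<phi> x - grad \<phi> y) <= (\<Sum>b\<in>Basis. B b) * norm (x - y)" for x y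
  unfolding sum_distrib_right
  by (rule order_trans[OF norm_le_l1]) (auto intro!: sum_mono simp: inner_diff_left grad_inner_Basis B)
 then show ?thesis using B(1) by (intro exI[of _ "\<Sum>b\<in>Basis. B b"]) (auto simp: sum_nonneg)
qed

text \<open>
Partial derivatives of test functions are again test functions, so the gradient is Lipschitz.
\<close>
lemma test_functions_taylor:
 assumes "\<phi> : test_functions \<O>"
 shows "\<exists>L\<ge>0. \<forall>x h. \<bar>\<phi> (x + h) - \<phi> x - grad \<phi> x \<bullet> h\<bar> <= L * (norm h)\<^sup>2"
proof -
 have s: "smooth \<phi>" using assms by (simp add: test_functions_iff)
 obtain L where L: "0 <= L" "!!x y. norm (grad \<phi> x - grad \<phi> y) <= L * norm (x - y)"
  using test_functions_grad_Lipschitz[OF assms] by blast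
 have "\<bar>\<phi> (x + h) - \<phi> x - grad \<phi> x \<bullet> h\<bar> <= L * (norm h)\<^sup>2" for x h
 proof -
  let ?g = "%y. \<phi> y - grad \<phi> x \<bullet> y"
  have "norm (?g (x + h) - ?g x) <= (L * norm h) * norm (x + h - x)"
  proof (rule differentiable_bound[of "cball x (norm h)"])
   fix y assume y: "y : cball x (norm h)"
   show "(?g has_derivative (%k. grad \<phi> y \<bullet> k - grad \<phi> x \<bullet> k)) (at y within cball x (norm h))"
    using has_derivative_at_withinI[OF smooth_has_derivative_grad[OF s], of y "cball x (norm h)"]
    by (auto intro!: derivative_eq_intros)
   show "onorm (%k. grad \<phi> y \<bullet> k - grad \<phi> x \<bullet> k) <= L * norm h"
   proof (rule onorm_le)
    fix k
    have "norm (grad \<phi> y \<bullet> k - grad \<phi> x \<bullet> k) <= norm (grad \<phi> y - grad \<phi> x) * norm k"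
     using Cauchy_Schwarz_ineq2[of "grad \<phi> y - grad \<phi> x" k] by (simp add: inner_diff_left)
    also have "... <= (L * norm h) * norm k"
     using y L(1) by (intro mult_right_mono order_trans[OF L(2)] mult_left_mono) (auto simp: dist_norm norm_minus_commute)
    finally show "norm (grad \<phi> y \<bullet> k - grad \<phi> x \<bullet> k) <= L * norm h * norm k" .
   qed
  qed (auto simp: dist_norm)
  then show ?thesis by (simp add: inner_add_right power2_eq_square algebra_simps)
 qed
 then show ?thesis using L(1) by blast
qed

section \<open>Mollification\<close>

lemma measurable_cball [measurable]: "cball a R : sets borel"
 by simp

text \<open>
Local integrability in a form that needs no case distinction on integrability of real functions.
\<close>
definition loc_int :: "('a::euclidean_space => 'b::euclidean_space) => bool" where
 "loc_int u \<longleftrightarrow> u : Borel & (\<forall>R. (\<integral>\<^sup>+x\<in>cball 0 R. ennreal (norm (u x)) \<partial>lborel) < \<infinity>)"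

definition conv :: "('a::euclidean_space => real) => ('a => 'b::euclidean_space) => 'a => 'b" where
 "conv \<phi> u x = (\<integral>y. \<phi> (x - y) *\<^sub>R u y \<partial>lborel)"

lemma loc_int_borel: "loc_int u ==> u : Borel"
 by (simp add: loc_int_def)

lemma loc_int_cball:
 assumes "loc_int u" shows "(\<integral>\<^sup>+x\<in>cball a R. ennreal (norm (u x)) \<partial>lborel) < \<infinity>"
proof -
 have "norm x <= norm a + R" if "x : cball a R" for x
  using that norm_triangle_ineq2[of x a] by (simp add: dist_norm norm_minus_commute)
 then have "(\<integral>\<^sup>+x\<in>cball a R. ennreal (norm (u x)) \<partial>lborel) <= (\<integral>\<^sup>+x\<in>cball 0 (norm a + R). ennreal (norm (u x)) \<partial>lborel)"
  by (intro nn_integral_mono) (auto simp: indicator_def)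
 also have "... < \<infinity>" using assms by (simp add: loc_int_def)
 finally show ?thesis .
qed

text \<open>
Since \<open>t \<le> 1 + t powr p\<close>.
\<close>
lemma nn_integral_cball_le_Lpow:
 fixes u :: "'a::euclidean_space => 'b::euclidean_space"
 assumes p: "1 < p" and [measurable]: "u : Borel"
 shows "(\<integral>\<^sup>+x\<in>cball a R. ennreal (norm (u x)) \<partial>lborel) <= emeasure lborel (cball a R) + Lpow p UNIV u"
proof -
 have le: "t <= 1 + t powr p" if "0 <= t" for t :: real
 proof (cases "t <= 1")
  case False
  then have "t powr 1 <= t powr p" using p by (intro powr_mono) auto
  then show ?thesis using False by simp
 qed (use that in \<open>simp add: add_increasing2\<close>)
 have "(\<integral>\<^sup>+x\<in>cball a R. ennreal (norm (u x)) \<partial>lborel)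
   <= (\<integral>\<^sup>+x. indicator (cball a R) x + ennreal (norm (u x) powr p) \<partial>lborel)"
 proof (intro nn_integral_mono)
  fix x
  have "ennreal (norm (u x)) <= ennreal (1 + norm (u x) powr p)" by (intro ennreal_leI le) simp
  also have "... = 1 + ennreal (norm (u x) powr p)" by (simp add: ennreal_plus)
  finally show "ennreal (norm (u x)) * indicator (cball a R) x <= indicator (cball a R) x + ennreal (norm (u x) powr p)"
   by (cases "x : cball a R") (simp_all del: mem_cball)
 qed
 also have "... = emeasure lborel (cball a R) + Lpow p UNIV u"
  by (subst nn_integral_add) (auto simp: Lpow_def)
 finally show ?thesis .
qed

lemma Lpow_finite_loc_int:
 fixes u :: "'a::euclidean_space => 'b::euclidean_space"
 assumes p: "1 < p" and [measurable]: "u : Borel" and "Lpow p UNIV u < \<infinity>"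
 shows "loc_int u"
proof -
 have "(\<integral>\<^sup>+x\<in>cball 0 R. ennreal (norm (u x)) \<partial>lborel) < \<infinity>" for R
  using assms(3) emeasure_lborel_cball_finite[of "0::'a" R]
  by (intro le_less_trans[OF nn_integral_cball_le_Lpow[OF p assms(2)]]) simp
 then show ?thesis by (simp add: loc_int_def)
qed

lemma integrable_mult_loc_int:
 fixes u :: "'a::euclidean_space => 'b::euclidean_space"
 assumes u: "loc_int u" and [measurable]: "\<psi> : Borel"
  and B: "!!y. \<bar>\<psi> y\<bar> <= B" and S: "!!y. y ~: cball a R ==> \<psi> y = 0"
 shows "integrable lborel (%y. \<psi> y *\<^sub>R u y)"
  and "norm (\<integral>y. \<psi> y *\<^sub>R u y \<partial>lborel) <= B * enn2real (\<integral>\<^sup>+x\<in>cball a R. ennreal (norm (u x)) \<partial>lborel)"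
proof -
 have [measurable]: "u : Borel" using u by (rule loc_int_borel)
 have B0: "0 <= B" using B[of undefined] by linarith
 define I where "I = (\<integral>\<^sup>+x\<in>cball a R. ennreal (norm (u x)) \<partial>lborel)"
 have I: "I < \<infinity>" unfolding I_def by (rule loc_int_cball[OF u])
 have le: "(\<integral>\<^sup>+y. ennreal (norm (\<psi> y *\<^sub>R u y)) \<partial>lborel) <= ennreal B * I"
 proof -
  have "(\<integral>\<^sup>+y. ennreal (norm (\<psi> y *\<^sub>R u y)) \<partial>lborel)
    <= (\<integral>\<^sup>+y. ennreal B * (ennreal (norm (u y)) * indicator (cball a R) y) \<partial>lborel)"
  proof (intro nn_integral_mono)
   fix y
   show "ennreal (norm (\<psi> y *\<^sub>R u y)) <= ennreal B * (ennreal (norm (u y)) * indicator (cball a R) y)"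
   proof (cases "y : cball a R")
    case True
    have "norm (\<psi> y *\<^sub>R u y) <= B * norm (u y)"
     using B[of y] by (simp add: mult_right_mono)
    then have "ennreal (norm (\<psi> y *\<^sub>R u y)) <= ennreal (B * norm (u y))" by (rule ennreal_leI)
    also have "... = ennreal B * ennreal (norm (u y))" using B0 by (intro ennreal_mult) auto
    finally show ?thesis using True by simp
   qed (use S[of y] in simp)
  qed
  also have "... = ennreal B * I" unfolding I_def by (rule nn_integral_cmult) measurable
  finally show ?thesis .
 qed
 have fin: "ennreal B * I < \<infinity>" using I by (simp add: ennreal_mult_less_top)
 show int: "integrable lborel (%y. \<psi> y *\<^sub>R u y)"
  unfolding integrable_iff_bounded using le fin by (auto intro: le_less_trans)
 have "norm (\<integral>y. \<psi> y *\<^sub>R u y \<partial>lborel) <= (\<integral>y. norm (\<psi> y *\<^sub>R u y) \<partial>lborel)"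
  by (rule integral_norm_bound)
 also have "... = enn2real (\<integral>\<^sup>+y. ennreal (norm (\<psi> y *\<^sub>R u y)) \<partial>lborel)"
  by (rule integral_eq_nn_integral) auto
 also have "... <= enn2real (ennreal B * I)" using le fin by (intro enn2real_mono) auto
 also have "... = B * enn2real I" using B0 by (simp add: enn2real_mult)
 finally show "norm (\<integral>y. \<psi> y *\<^sub>R u y \<partial>lborel) <= B * enn2real (\<integral>\<^sup>+x\<in>cball a R. ennreal (norm (u x)) \<partial>lborel)"
  by (simp add: I_def)
qed

lemma test_functions_support:
 assumes "\<phi> : test_functions \<O>"
 obtains B R where "0 <= B" "0 < R" "!!x. \<bar>\<phi> x\<bar> <= B" "!!x. R < norm x ==> \<phi> x = 0" "smooth \<phi>"
proof -
 obtain K where K: "smooth \<phi>" "compact K" "!!x. x ~: K ==> \<phi> x = 0"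
  using assms unfolding test_functions_iff by blast
 obtain R where R: "0 < R" "!!x. x : K ==> norm x <= R"
  using compact_imp_bounded[OF K(2)] unfolding bounded_pos by blast
 obtain B where B: "0 <= B" "!!x. \<bar>\<phi> x\<bar> <= B" using test_functions_bounded[OF assms] by blast
 have "\<phi> x = 0" if "R < norm x" for x using R(2)[of x] K(3)[of x] that by force
 with B R(1) K(1) show ?thesis using that by blast
qed

lemma integrable_conv:
 assumes "\<phi> : test_functions \<O>" "loc_int u"
 shows "integrable lborel (%y. \<phi> (x - y) *\<^sub>R u y)"
proof -
 obtain B R where BR: "0 <= B" "0 < R" "!!x. \<bar>\<phi> x\<bar> <= B" "!!x. R < norm x ==> \<phi> x = 0" "smooth \<phi>"
  using test_functions_support[OF assms(1)] by blast
 have [measurable]: "\<phi> : Borel" using BR(5) by (rule smooth_borel)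
 show ?thesis
  by (rule integrable_mult_loc_int(1)[OF assms(2), of _ B x R]) (auto simp: BR dist_norm)
qed

lemma conv_reflect:
 assumes "\<phi> : Borel" "u : Borel"
 shows "conv \<phi> u x = (\<integral>y. \<phi> y *\<^sub>R u (x - y) \<partial>lborel)"
proof -
 have "(%y. \<phi> y *\<^sub>R u (x - y)) : Borel" using assms by measurable
 from integral_reflect[OF this, of x] show ?thesis by (simp add: conv_def)
qed

lemma borel_measurable_conv:
 assumes [measurable]: "\<phi> : Borel" "u : Borel"
 shows "conv \<phi> u : Borel"
proof -
 have "(%x. \<integral>y. \<phi> (x - y) *\<^sub>R u y \<partial>lborel) : Borel"
  by (rule lborel.borel_measurable_lebesgue_integral) measurable
 then show ?thesis by (simp add: conv_def[abs_def])
qed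

lemma mollifier_test: "0 < \<delta> ==> ball 0 \<delta>' \<subseteq> \<O> ==> \<delta> < \<delta>' ==> mollifier \<delta> : test_functions \<O>"
 unfolding test_functions_iff
 by (intro conjI smooth_mollifier exI[of _ "cball 0 \<delta>"]) (auto intro: mollifier_eq_0)

lemma mollifier_test_UNIV: "0 < \<delta> ==> mollifier \<delta> : test_functions UNIV"
 by (rule mollifier_test[of _ "\<delta> + 1"]) auto

lemma borel_mollifier [measurable]: "0 < \<delta> ==> mollifier \<delta> : Borel"
 using smooth_mollifier smooth_borel by blast

lemma jensen_mollifier:
 fixes u :: "'a::euclidean_space => 'b::euclidean_space"
 assumes p: "1 < p" and \<delta>: "0 < \<delta>" and [measurable]: "u : Borel"
 shows "ennreal (norm (\<integral>y. mollifier \<delta> y *\<^sub>R u y \<partial>lborel) powr p)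
   <= (\<integral>\<^sup>+y. ennreal (mollifier \<delta> y) * ennreal (norm (u y) powr p) \<partial>lborel)"
proof -
 note [measurable] = borel_mollifier[OF \<delta>]
 let ?M = "density lborel (%y :: 'a. ennreal (mollifier \<delta> y))"
 have "emeasure ?M (space ?M) = (\<integral>\<^sup>+y. ennreal (mollifier \<delta> y) \<partial>(lborel :: 'a measure))"
  by (simp add: emeasure_density)
 also have "... = 1"
  using integrable_mollifier[OF \<delta>] integral_mollifier[OF \<delta>] mollifier_nonneg[OF \<delta>]
  by (subst nn_integral_eq_integral) auto
 finally have M1: "emeasure ?M (space ?M) = 1" .
 have "ennreal (norm (\<integral>y. u y \<partial>?M) powr p) <= (\<integral>\<^sup>+y. ennreal (norm (u y) powr p) \<partial>?M)"
  by (rule jensen_norm_powr[OF M1 p]) measurable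
 then show ?thesis
  using mollifier_nonneg[OF \<delta>] by (subst (asm) integral_density) (auto simp: nn_integral_density)
qed

lemma nn_integral_mollifier_swap:
 fixes F :: "'a::euclidean_space => 'a => ennreal"
 assumes \<delta>: "0 < \<delta>" and F [measurable]: "(%(x, y). F x y) : borel_measurable (borel \<Otimes>\<^sub>M borel)"
  and bd: "!!y. norm y < \<delta> ==> (\<integral>\<^sup>+x. F x y \<partial>lborel) <= c"
 shows "(\<integral>\<^sup>+x. (\<integral>\<^sup>+y. ennreal (mollifier \<delta> y) * F x y \<partial>lborel) \<partial>lborel) <= c"
proof -
 note [measurable] = borel_mollifier[OF \<delta>]
 have "(\<integral>\<^sup>+x. (\<integral>\<^sup>+y. ennreal (mollifier \<delta> y) * F x y \<partial>lborel) \<partial>lborel)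
   = (\<integral>\<^sup>+y. (\<integral>\<^sup>+x. ennreal (mollifier \<delta> y) * F x y \<partial>lborel) \<partial>lborel)"
  by (rule lborel_pair.Fubini'[symmetric]) measurable
 also have "... = (\<integral>\<^sup>+y. ennreal (mollifier \<delta> y) * (\<integral>\<^sup>+x. F x y \<partial>lborel) \<partial>lborel)"
  by (intro nn_integral_cong nn_integral_cmult) measurable
 also have "... <= (\<integral>\<^sup>+y. ennreal (mollifier \<delta> y) * c \<partial>(lborel :: 'a measure))"
 proof (intro nn_integral_mono)
  fix y
  show "ennreal (mollifier \<delta> y) * (\<integral>\<^sup>+x. F x y \<partial>lborel) <= ennreal (mollifier \<delta> y) * c"
   using bd[of y] mollifier_eq_0[OF \<delta>, of y] by (cases "norm y < \<delta>") (auto intro: mult_left_mono)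
 qed
 also have "... = (\<integral>\<^sup>+y. ennreal (mollifier \<delta> y) \<partial>(lborel :: 'a measure)) * c"
  by (rule nn_integral_multc) measurable
 also have "(\<integral>\<^sup>+y. ennreal (mollifier \<delta> y) \<partial>(lborel :: 'a measure)) = 1"
  using integrable_mollifier[OF \<delta>] integral_mollifier[OF \<delta>] mollifier_nonneg[OF \<delta>]
  by (subst nn_integral_eq_integral) auto
 finally show ?thesis by simp
qed

text \<open>
A mollification is an average of translates, so Jensen and Tonelli apply. The set \<open>B\<close> contains all the
points at which values of \<open>u\<close> enter the mollification on \<open>A\<close>.
\<close>
lemma Lpow_conv_mollifier_le:
 fixes u :: "'a::euclidean_space => 'b::euclidean_space"
 assumes p: "1 < p" and \<delta>: "0 < \<delta>" and [measurable]: "u : Borel" "A : sets borel" "B : sets borel"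
  and AB: "!!x y. x : A ==> norm y < \<delta> ==> x - y : B"
 shows "Lpow p A (conv (mollifier \<delta>) u) <= Lpow p B u"
proof -
 note [measurable] = borel_mollifier[OF \<delta>]
 have "Lpow p A (conv (mollifier \<delta>) u) \<le>
  (\<integral>\<^sup>+x. (\<integral>\<^sup>+y. ennreal (mollifier \<delta> y) * (ennreal (norm (u (x - y)) powr p) * indicator A x) \<partial>lborel) \<partial>lborel)"
  unfolding Lpow_def
 proof (intro nn_integral_mono)
  fix x
  show "ennreal (norm (conv (mollifier \<delta>) u x) powr p) * indicator A x
   <= (\<integral>\<^sup>+y. ennreal (mollifier \<delta> y) * (ennreal (norm (u (x - y)) powr p) * indicator A x) \<partial>lborel)"
   using jensen_mollifier[OF p \<delta>, of "%y. u (x - y)"]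
   by (cases "x : A") (simp_all add: conv_reflect)
 qed
 also have "... <= Lpow p B u"
 proof (rule nn_integral_mollifier_swap[OF \<delta>])
  fix y :: 'a assume y: "norm y < \<delta>"
  have "(\<integral>\<^sup>+x. ennreal (norm (u (x - y)) powr p) * indicator A x \<partial>lborel)
    <= (\<integral>\<^sup>+x. ennreal (norm (u (x + - y)) powr p) * indicator B (x + - y) \<partial>lborel)"
   using AB[OF _ y] by (intro nn_integral_mono) (auto simp: indicator_def)
  also have "... = Lpow p B u"
   unfolding Lpow_def
   by (rule nn_integral_translate[of "%x. ennreal (norm (u x) powr p) * indicator B x"]) measurable
  finally show "(\<integral>\<^sup>+x. ennreal (norm (u (x - y)) powr p) * indicator A x \<partial>lborel) <= Lpow p B u" .
 qed measurable
 finally show ?thesis .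
qed

text \<open>
The error is at most an average of \<open>L\<^sup>p\<close> moduli of continuity of \<open>u\<close>.
\<close>
lemma Lpow_conv_mollifier_approx:
 fixes u :: "'a::euclidean_space => 'b::euclidean_space"
 assumes p: "1 < p" and u [measurable]: "u : Borel" and fin: "Lpow p UNIV u < \<infinity>" and \<eta>: "0 < \<eta>"
 shows "\<exists>\<delta>\<^sub>0>0. \<forall>\<delta>. 0 < \<delta> & \<delta> < \<delta>\<^sub>0 --> Lpow p UNIV (%x. conv (mollifier \<delta>) u x - u x) <= ennreal \<eta>"
proof -
 have loc: "loc_int u" using Lpow_finite_loc_int[OF p u fin] .
 obtain d where d: "0 < d" "!!h. norm h < d ==> Lpow p UNIV (%x. u (x + h) - u x) <= ennreal \<eta>"
  using Lpow_translation_continuous[OF p u fin \<eta>] by blast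
 have "Lpow p UNIV (%x. conv (mollifier \<delta>) u x - u x) <= ennreal \<eta>" if \<delta>: "0 < \<delta>" "\<delta> < d" for \<delta>
 proof -
  note [measurable] = borel_mollifier[OF \<delta>(1)]
  have eq: "conv (mollifier \<delta>) u x - u x = (\<integral>y. mollifier \<delta> y *\<^sub>R (u (x - y) - u x) \<partial>lborel)" for x
  proof -
   have "integrable lborel (%y. mollifier \<delta> (x - y) *\<^sub>R u y)"
    by (rule integrable_conv[OF mollifier_test_UNIV[OF \<delta>(1)] loc])
   then have "integrable (distr lborel borel (%y. x - y)) (%y. mollifier \<delta> (x - y) *\<^sub>R u y)"
    by (simp add: lborel_distr_diff)
   then have "integrable lborel (%y. mollifier \<delta> y *\<^sub>R u (x - y))"
    by (subst (asm) integrable_distr_eq) auto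
   moreover have "integrable lborel (%y :: 'a. mollifier \<delta> y *\<^sub>R u x)"
    using integrable_mollifier[OF \<delta>(1)] by (rule integrable_scaleR_left)
   ultimately have "(\<integral>y. mollifier \<delta> y *\<^sub>R u (x - y) - mollifier \<delta> y *\<^sub>R u x \<partial>lborel)
     = (\<integral>y. mollifier \<delta> y *\<^sub>R u (x - y) \<partial>lborel) - (\<integral>y. mollifier \<delta> y *\<^sub>R u x \<partial>(lborel :: 'a measure))"
    by (rule Bochner_Integration.integral_diff)
   also have "(\<integral>y. mollifier \<delta> y *\<^sub>R u x \<partial>(lborel :: 'a measure)) = u x"
    using Bochner_Integration.integral_scaleR_left[of "u x" lborel "mollifier \<delta> :: 'a => real"]
     integrable_mollifier[OF \<delta>(1), where 'a='a] integral_mollifier[OF \<delta>(1), where 'a='a] by simp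
   finally show ?thesis by (simp add: conv_reflect scaleR_diff_right)
  qed
  have "Lpow p UNIV (%x. conv (mollifier \<delta>) u x - u x) \<le>
   (\<integral>\<^sup>+x. (\<integral>\<^sup>+y. ennreal (mollifier \<delta> y) * ennreal (norm (u (x - y) - u x) powr p) \<partial>lborel) \<partial>lborel)"
   unfolding Lpow_def indicator_UNIV mult_1_right eq
   by (intro nn_integral_mono jensen_mollifier[OF p \<delta>(1)]) measurable
  also have "... <= ennreal \<eta>"
  proof (rule nn_integral_mollifier_swap[OF \<delta>(1)])
   fix y :: 'a assume "norm y < \<delta>"
   then show "(\<integral>\<^sup>+x. ennreal (norm (u (x - y) - u x) powr p) \<partial>lborel) <= ennreal \<eta>"
    using d(2)[of "- y"] \<delta> by (simp add: Lpow_def)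
  qed measurable
  finally show ?thesis .
 qed
 then show ?thesis using d(1) by blast
qed

lemma has_derivative_of_quadratic_bound:
 fixes f :: "'a::euclidean_space => real"
 assumes "bounded_linear D" and C: "0 <= C" "!!h. norm h <= 1 ==> \<bar>f (x + h) - f x - D h\<bar> <= C * (norm h)\<^sup>2"
 shows "(f has_derivative D) (at x)"
 unfolding has_derivative_at
proof (intro conjI assms(1))
 show "(%h. norm (f (x + h) - f x - D h) / norm h) \<midarrow>0\<rightarrow> 0"
 proof (rule Lim_null_comparison)
  have "\<forall>\<^sub>F h in at 0. dist h (0::'a) < 1" unfolding eventually_at by (auto intro: exI[of _ 1])
  then show "\<forall>\<^sub>F h in at 0. norm (norm (f (x + h) - f x - D h) / norm h) <= C * norm h"
  proof eventually_elim
   case (elim h)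
   then show ?case using C(2)[of h]
    by (cases "h = 0") (auto simp: divide_le_eq power2_eq_square mult.assoc)
  qed
  have "((%h::'a. C * norm h) \<longlongrightarrow> C * norm (0::'a)) (at 0)" by (intro tendsto_intros)
  then show "((%h::'a. C * norm h) \<longlongrightarrow> 0) (at 0)" by simp
 qed
qed

text \<open>
The expansion of the test function is inserted into the convolution. The constants do not depend on \<open>u\<close>,
which makes the expansion uniform over bounded families.
\<close>
lemma conv_taylor:
 assumes \<phi>: "\<phi> : test_functions \<O>"
 obtains C R where "0 <= C" "!!u :: 'a::euclidean_space => real. !!x h. loc_int u ==> norm h <= 1 ==>
   \<bar>conv \<phi> u (x + h) - conv \<phi> u x - (\<Sum>b\<in>Basis. conv (partial b \<phi>) u x *\<^sub>R b) \<bullet> h\<bar>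
    <= C * enn2real (\<integral>\<^sup>+y\<in>cball x R. ennreal \<bar>u y\<bar> \<partial>lborel) * (norm h)\<^sup>2"
proof -
 obtain B R where BR: "0 <= B" "0 < R" "!!x. \<bar>\<phi> x\<bar> <= B" "!!x. R < norm x ==> \<phi> x = 0" "smooth \<phi>"
  using test_functions_support[OF \<phi>] by blast
 obtain L where L: "0 <= L" "!!x h. \<bar>\<phi> (x + h) - \<phi> x - grad \<phi> x \<bullet> h\<bar> <= L * (norm h)\<^sup>2"
  using test_functions_taylor[OF \<phi>] by blast
 have [measurable]: "\<phi> : Borel" using BR(5) by (rule smooth_borel)
 have mp [measurable]: "partial b \<phi> : Borel" if "b : Basis" for b
  using smooth_partial[OF BR(5) that] by (rule smooth_borel)
 have [measurable]: "grad \<phi> : Borel"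
  unfolding grad_def[abs_def] by (intro borel_measurable_sum borel_measurable_scaleR mp borel_measurable_const)
 have grad0: "grad \<phi> x = 0" if "R < norm x" for x
  using partial_eq_0_outside[of "cball 0 R" \<phi> x] BR(4) that by (simp add: grad_def)
 have "\<bar>conv \<phi> u (x + h) - conv \<phi> u x - (\<Sum>b\<in>Basis. conv (partial b \<phi>) u x *\<^sub>R b) \<bullet> h\<bar>
    <= L * enn2real (\<integral>\<^sup>+y\<in>cball x (R + 1). ennreal \<bar>u y\<bar> \<partial>lborel) * (norm h)\<^sup>2"
  if u: "loc_int u" and h: "norm h <= 1" for u :: "'a => real" and x h
 proof -
  have i1: "integrable lborel (%y. \<phi> (x' - y) *\<^sub>R u y)" for x' by (rule integrable_conv[OF \<phi> u])
  have i2: "integrable lborel (%y. frechet_derivative \<phi> (at (x - y)) b *\<^sub>R u y)" if "b : Basis" for b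
   by (rule integrable_conv[OF test_functions_partial[OF \<phi> that] u])
  have "(\<Sum>b\<in>Basis. conv (partial b \<phi>) u x *\<^sub>R b) \<bullet> h
    = (\<Sum>b\<in>Basis. \<integral>y. (frechet_derivative \<phi> (at (x - y)) b *\<^sub>R u y) * (b \<bullet> h) \<partial>lborel)"
   unfolding conv_def inner_sum_left by (intro sum.cong refl) (simp add: i2[simplified])
  also have "... = (\<integral>y. (\<Sum>b\<in>Basis. (frechet_derivative \<phi> (at (x - y)) b *\<^sub>R u y) * (b \<bullet> h)) \<partial>lborel)"
   by (rule Bochner_Integration.integral_sum[symmetric]) (use i2 in auto)
  also have "... = (\<integral>y. (grad \<phi> (x - y) \<bullet> h) *\<^sub>R u y \<partial>lborel)"
   by (intro Bochner_Integration.integral_cong refl)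
     (simp add: grad_def inner_sum_left sum_distrib_right sum_distrib_left mult_ac)
  finally have g: "(\<Sum>b\<in>Basis. conv (partial b \<phi>) u x *\<^sub>R b) \<bullet> h = (\<integral>y. (grad \<phi> (x - y) \<bullet> h) *\<^sub>R u y \<partial>lborel)" .
  have i3: "integrable lborel (%y. (grad \<phi> (x - y) \<bullet> h) *\<^sub>R u y)"
  proof -
   have "integrable lborel (%y. \<Sum>b\<in>Basis. (frechet_derivative \<phi> (at (x - y)) b *\<^sub>R u y) * (b \<bullet> h))"
    using i2 by (intro Bochner_Integration.integrable_sum) auto
   then show ?thesis by (simp add: grad_def inner_sum_left sum_distrib_right sum_distrib_left mult_ac)
  qed
  have "conv \<phi> u (x + h) - conv \<phi> u x - (\<Sum>b\<in>Basis. conv (partial b \<phi>) u x *\<^sub>R b) \<bullet> h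
    = (\<integral>y. (\<phi> (x - y + h) - \<phi> (x - y) - grad \<phi> (x - y) \<bullet> h) *\<^sub>R u y \<partial>lborel)"
   unfolding g unfolding conv_def
   using i1[of "x + h"] i1[of x] i3
   by (simp add: scaleR_diff_left left_diff_distrib add_diff_eq diff_add_eq)
  also have "norm ... <= (L * (norm h)\<^sup>2) * enn2real (\<integral>\<^sup>+y\<in>cball x (R + 1). ennreal (norm (u y)) \<partial>lborel)"
  proof (rule integrable_mult_loc_int(2)[OF u])
   show "\<bar>\<phi> (x - y + h) - \<phi> (x - y) - grad \<phi> (x - y) \<bullet> h\<bar> <= L * (norm h)\<^sup>2" for y by (rule L(2))
   show "\<phi> (x - y + h) - \<phi> (x - y) - grad \<phi> (x - y) \<bullet> h = 0" if "y ~: cball x (R + 1)" for y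
   proof -
    have "R + 1 < norm (x - y)" using that by (simp add: dist_norm)
    moreover have "norm (x - y) <= norm (x - y + h) + norm h"
     using norm_triangle_ineq4[of "x - y + h" h] by simp
    ultimately show ?thesis using h by (simp add: BR(4) grad0)
   qed
  qed measurable
  finally show ?thesis by (simp add: mult_ac)
 qed
 with L(1) show ?thesis by (rule that[of L "R + 1"])
qed

lemma conv_has_derivative:
 fixes u :: "'a::euclidean_space => real"
 assumes \<phi>: "\<phi> : test_functions \<O>" and u: "loc_int u"
 shows "(conv \<phi> u has_derivative (%h. (\<Sum>b\<in>Basis. conv (partial b \<phi>) u x *\<^sub>R b) \<bullet> h)) (at x)"
proof -
 obtain C R where CR: "0 <= C" "!!u :: 'a => real. !!x h. loc_int u ==> norm h <= 1 ==>
   \<bar>conv \<phi> u (x + h) - conv \<phi> u x - (\<Sum>b\<in>Basis. conv (partial b \<phi>) u x *\<^sub>R b) \<bullet> h\<bar>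
    <= C * enn2real (\<integral>\<^sup>+y\<in>cball x R. ennreal \<bar>u y\<bar> \<partial>lborel) * (norm h)\<^sup>2"
  using conv_taylor[OF \<phi>] by blast
 show ?thesis
  by (rule has_derivative_of_quadratic_bound[OF bounded_linear_inner_right _ CR(2)[OF u]]) (use CR(1) in simp_all)
qed

lemma partial_conv:
 fixes u :: "'a::euclidean_space => real"
 assumes \<phi>: "\<phi> : test_functions \<O>" and u: "loc_int u" and b: "b : Basis"
 shows "frechet_derivative (conv \<phi> u) (at x) b = conv (partial b \<phi>) u x"
 unfolding frechet_derivative_eqI[OF conv_has_derivative[OF \<phi> u]]
 using b by (simp add: inner_sum_left inner_Basis if_distrib cong: if_cong)

lemma grad_conv:
 fixes u :: "'a::euclidean_space => real"
 assumes \<phi>: "\<phi> : test_functions \<O>" and u: "loc_int u"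
 shows "grad (conv \<phi> u) x = (\<Sum>b\<in>Basis. conv (partial b \<phi>) u x *\<^sub>R b)"
 unfolding grad_def by (intro sum.cong refl) (simp add: partial_conv[OF \<phi> u])

text \<open>
Derivatives fall on the test function, so the convolutions of \<open>u\<close> with test functions are stable under
partial derivatives.
\<close>
lemma smooth_conv:
 fixes u :: "'a::euclidean_space => real"
 assumes \<phi>: "\<phi> : test_functions \<O>" and u: "loc_int u"
 shows "smooth (conv \<phi> u)"
proof (rule smooth_coinduct)
 let ?S = "{conv \<psi> u | \<psi>. \<psi> : test_functions \<O>}"
 show "conv \<phi> u : ?S" using \<phi> by blast
 fix v assume "v : ?S"
 then obtain \<psi> where \<psi>: "\<psi> : test_functions \<O>" "v = conv \<psi> u" by blast
 show "v differentiable (at x)" for x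
  unfolding \<psi>(2) using conv_has_derivative[OF \<psi>(1) u] differentiable_def by blast
 show "partial b v : ?S" if b: "b : Basis" for b
  unfolding \<psi>(2) partial_conv[OF \<psi>(1) u b] using test_functions_partial[OF \<psi>(1) b] by blast
qed

section \<open>Borel representatives and weak gradients\<close>

text \<open>
A Borel function zero off \<open>\<O>\<close> that stands for the class of \<open>u\<close> on \<open>\<O>\<close>. Elements of \<open>L\<^sup>p(\<O>)\<close> are only Lebesgue
measurable, while Fubini for \<open>lborel\<close> asks for Borel functions.
\<close>
definition rep :: "'a::euclidean_space set => ('a => 'b::euclidean_space) => ('a => 'b) => bool" where
 "rep \<O> u u' \<longleftrightarrow> u' : Borel & (\<forall>x. x ~: \<O> --> u' x = 0) &
   (AE x in lborel. indicator \<O> x *\<^sub>R u x = u' x)"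

lemma rep_borel [measurable_dest]: "rep \<O> u u' ==> u' : Borel"
 by (simp add: rep_def)

lemma rep_measurable:
 assumes "rep \<O> u u'" "\<O> : sets borel"
 shows "(%x. indicator \<O> x *\<^sub>R u x) : borel_measurable lebesgue" "u : borel_measurable (lebesgue_on \<O>)"
proof -
 have "u' : borel_measurable lebesgue" using rep_borel[OF assms(1)] by (simp add: measurable_completion)
 moreover have "AE x in lebesgue. u' x = indicator \<O> x *\<^sub>R u x"
  using assms(1) by (auto simp: rep_def intro: AE_completion)
 ultimately show "(%x. indicator \<O> x *\<^sub>R u x) : borel_measurable lebesgue"
  by (rule borel_measurable_AE)
 then show "u : borel_measurable (lebesgue_on \<O>)"
  using assms(2) by (subst borel_measurable_restrict_space_iff) auto
qed

lemma ex_rep: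
 fixes u :: "'a::euclidean_space => 'b::euclidean_space"
 assumes \<O> [measurable]: "\<O> : sets borel" and u: "u : borel_measurable (lebesgue_on \<O>)"
 obtains u' where "rep \<O> u u'"
proof -
 have m: "(%x. indicator \<O> x *\<^sub>R u x) : borel_measurable lebesgue"
  using u \<O> by (subst (asm) borel_measurable_restrict_space_iff) auto
 have "\<exists>v\<in>borel_measurable lborel. AE x in lborel. (indicator \<O> x *\<^sub>R u x) \<bullet> b = v x" for b
  by (rule completion_ex_borel_measurable_real[OF borel_measurable_inner[OF m borel_measurable_const]])
 then obtain v where v: "!!b. v b : borel_measurable lborel" "!!b. AE x in lborel. (indicator \<O> x *\<^sub>R u x) \<bullet> b = v b x"
  by metis
 have [measurable]: "v b : Borel" for b using v(1)[of b] by simp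
 define u' where "u' = (%x. indicator \<O> x *\<^sub>R (\<Sum>b\<in>Basis. v b x *\<^sub>R b))"
 have "AE x in lborel. \<forall>b\<in>Basis. (indicator \<O> x *\<^sub>R u x) \<bullet> b = v b x"
  by (rule AE_finite_allI) (use v(2) in auto)
 then have "AE x in lborel. indicator \<O> x *\<^sub>R u x = u' x"
 proof eventually_elim
  case (elim x)
  have "indicator \<O> x *\<^sub>R u x = (\<Sum>b\<in>Basis. ((indicator \<O> x *\<^sub>R u x) \<bullet> b) *\<^sub>R b)"
   by (rule euclidean_representation[symmetric])
  also have "... = (\<Sum>b\<in>Basis. v b x *\<^sub>R b)" using elim by (intro sum.cong) auto
  finally have "indicator \<O> x *\<^sub>R u x = (\<Sum>b\<in>Basis. v b x *\<^sub>R b)" .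
  then show ?case unfolding u'_def by (auto simp: indicator_def)
 qed
 moreover have "u' : Borel" unfolding u'_def by measurable
 moreover have "\<forall>x. x ~: \<O> --> u' x = 0" by (simp add: u'_def)
 ultimately show ?thesis using that by (auto simp: rep_def)
qed

lemma rep_nn_integral:
 fixes u :: "'a::euclidean_space => 'b::euclidean_space"
 assumes r: "rep \<O> u u'" and \<O> [measurable]: "\<O> : sets borel" and p: "1 < p"
 shows "(\<integral>\<^sup>+x. ennreal (norm (u x) powr p) \<partial>lebesgue_on \<O>) = Lpow p UNIV u'"
proof -
 have ae: "AE x in lebesgue. indicator \<O> x *\<^sub>R u x = u' x"
  using r by (auto simp: rep_def intro: AE_completion)
 have "(\<integral>\<^sup>+x. ennreal (norm (u x) powr p) \<partial>lebesgue_on \<O>)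
   = (\<integral>\<^sup>+x. ennreal (norm (u x) powr p) * indicator \<O> x \<partial>lebesgue)"
  by (rule nn_integral_restrict_space) simp
 also have "... = (\<integral>\<^sup>+x. ennreal (norm (u' x) powr p) \<partial>lebesgue)"
 proof (intro nn_integral_cong_AE, use ae in eventually_elim)
  case (elim x)
  then show ?case using p by (cases "x : \<O>") (auto simp flip: elim)
 qed
 also have "... = Lpow p UNIV u'"
  by (simp add: Lpow_def nn_integral_completion)
 finally show ?thesis .
qed

lemma Lp_iff_rep:
 fixes u :: "'a::euclidean_space => 'b::euclidean_space"
 assumes r: "rep \<O> u u'" and \<O>: "\<O> : sets borel" and p: "1 < p"
 shows "u : Lp p \<O> \<longleftrightarrow> Lpow p UNIV u' < \<infinity>"
proof -
 have m [measurable]: "u : borel_measurable (lebesgue_on \<O>)" using rep_measurable[OF r \<O>] by blast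
 have "(%x. norm (u x) powr p) : borel_measurable (lebesgue_on \<O>)" by measurable
 then show ?thesis
  using m rep_nn_integral[OF r \<O> p] by (simp add: Lp_def integrable_iff_bounded)
qed

lemma rep_Lp_norm:
 fixes u :: "'a::euclidean_space => 'b::euclidean_space"
 assumes r: "rep \<O> u u'" and \<O>: "\<O> : sets borel" and p: "1 < p" and fin: "Lpow p UNIV u' < \<infinity>"
 shows "ennreal (Lp_norm p \<O> u powr p) = Lpow p UNIV u'"
proof -
 have [measurable]: "u : borel_measurable (lebesgue_on \<O>)" using rep_measurable[OF r \<O>] by blast
 have "Lp_norm p \<O> u powr p = (\<integral>x. norm (u x) powr p \<partial>lebesgue_on \<O>)"
  using p by (simp add: Lp_norm_def powr_powr powr_one' integral_nonneg_AE)
 also have "... = enn2real (\<integral>\<^sup>+x. ennreal (norm (u x) powr p) \<partial>lebesgue_on \<O>)"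
  by (rule integral_eq_nn_integral) auto
 finally show ?thesis using fin by (simp add: rep_nn_integral[OF r \<O> p])
qed

lemma rep_integral:
 fixes u :: "'a::euclidean_space => 'b::euclidean_space"
 assumes r: "rep \<O> u u'" and \<O> [measurable]: "\<O> : sets borel" and \<psi> [measurable]: "\<psi> : Borel"
 shows "(\<integral>x. \<psi> x *\<^sub>R u x \<partial>lebesgue_on \<O>) = (\<integral>x. \<psi> x *\<^sub>R u' x \<partial>lborel)"
  and "integrable (lebesgue_on \<O>) (%x. \<psi> x *\<^sub>R u x) \<longleftrightarrow> integrable lborel (%x. \<psi> x *\<^sub>R u' x)"
proof -
 have [measurable]: "u' : Borel" using r by (rule rep_borel)
 have m: "(%x. indicator \<O> x *\<^sub>R u x) : borel_measurable lebesgue" using rep_measurable[OF r \<O>] by blast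
 have [measurable]: "\<psi> : borel_measurable lebesgue" by (simp add: measurable_completion)
 have m2: "(%x. \<psi> x *\<^sub>R (indicator \<O> x *\<^sub>R u x)) : borel_measurable lebesgue"
  using m by measurable
 have m3: "(%x. \<psi> x *\<^sub>R u' x) : borel_measurable lebesgue" by (rule measurable_completion) measurable
 have eq: "indicator \<O> x *\<^sub>R (\<psi> x *\<^sub>R u x) = \<psi> x *\<^sub>R (indicator \<O> x *\<^sub>R u x)" for x by simp
 have ae: "AE x in lebesgue. \<psi> x *\<^sub>R (indicator \<O> x *\<^sub>R u x) = \<psi> x *\<^sub>R u' x"
 proof -
  have "AE x in lebesgue. indicator \<O> x *\<^sub>R u x = u' x"
   using r by (auto simp: rep_def intro: AE_completion)
  then show ?thesis by eventually_elim (simp only:)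
 qed
 have "(\<integral>x. \<psi> x *\<^sub>R u x \<partial>lebesgue_on \<O>) = (\<integral>x. \<psi> x *\<^sub>R (indicator \<O> x *\<^sub>R u x) \<partial>lebesgue)"
  by (subst integral_restrict_space) (simp, simp only: eq)
 also have "... = (\<integral>x. \<psi> x *\<^sub>R u' x \<partial>lebesgue)" by (rule integral_cong_AE[OF m2 m3 ae])
 also have "... = (\<integral>x. \<psi> x *\<^sub>R u' x \<partial>lborel)" by (rule integral_completion) measurable
 finally show "(\<integral>x. \<psi> x *\<^sub>R u x \<partial>lebesgue_on \<O>) = (\<integral>x. \<psi> x *\<^sub>R u' x \<partial>lborel)" .
 have "integrable (lebesgue_on \<O>) (%x. \<psi> x *\<^sub>R u x) \<longleftrightarrow> integrable lebesgue (%x. \<psi> x *\<^sub>R (indicator \<O> x *\<^sub>R u x))"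
  by (subst integrable_restrict_space) (simp, simp only: eq)
 also have "... \<longleftrightarrow> integrable lebesgue (%x. \<psi> x *\<^sub>R u' x)" by (rule integrable_cong_AE[OF m2 m3 ae])
 also have "... \<longleftrightarrow> integrable lborel (%x. \<psi> x *\<^sub>R u' x)" by (rule integrable_completion) measurable
 finally show "integrable (lebesgue_on \<O>) (%x. \<psi> x *\<^sub>R u x) \<longleftrightarrow> integrable lborel (%x. \<psi> x *\<^sub>R u' x)" .
qed

lemma rep_self: "u : Borel ==> \<O> : sets borel ==> rep \<O> u (%x. indicator \<O> x *\<^sub>R u x)"
 unfolding rep_def by (intro conjI allI impI AE_I2 refl) auto

lemma rep_lincomb:
 assumes "rep \<O> u u'" "rep \<O> v v'"
 shows "rep \<O> (%x. a *\<^sub>R u x + b *\<^sub>R v x) (%x. a *\<^sub>R u' x + b *\<^sub>R v' x)"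
proof -
 have [measurable]: "u' : Borel" "v' : Borel"
  using assms by (auto simp: rep_def)
 have "AE x in lborel. indicator \<O> x *\<^sub>R u x = u' x" "AE x in lborel. indicator \<O> x *\<^sub>R v x = v' x"
  using assms by (auto simp: rep_def)
 then have "AE x in lborel. indicator \<O> x *\<^sub>R (a *\<^sub>R u x + b *\<^sub>R v x) = a *\<^sub>R u' x + b *\<^sub>R v' x"
  by eventually_elim (auto simp: indicator_def)
 moreover have "\<forall>x. x ~: \<O> --> a *\<^sub>R u' x + b *\<^sub>R v' x = 0"
  using assms by (auto simp: rep_def)
 ultimately show ?thesis by (simp add: rep_def)
qed

lemma rep_inner:
 assumes "rep \<O> u u'" shows "rep \<O> (%x. u x \<bullet> b) (%x. u' x \<bullet> b)"
proof -
 have "u' : Borel" using assms by (auto simp: rep_def)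
 moreover have "AE x in lborel. indicator \<O> x *\<^sub>R u x = u' x" using assms by (auto simp: rep_def)
 then have "AE x in lborel. indicator \<O> x *\<^sub>R (u x \<bullet> b) = u' x \<bullet> b"
  by eventually_elim (metis inner_scaleR_left real_scaleR_def)
 ultimately show ?thesis using assms by (auto simp: rep_def)
qed

text \<open>
The weak gradient identity for representatives, with integrals over the whole space.
\<close>
definition wgrad :: "'a::euclidean_space set => ('a => real) => ('a => 'a) => bool" where
 "wgrad \<O> u g \<longleftrightarrow> loc_int u & loc_int g & (\<forall>\<phi>\<in>test_functions \<O>. \<forall>b\<in>Basis.
   (\<integral>x. frechet_derivative \<phi> (at x) b *\<^sub>R u x \<partial>lborel) = - (\<integral>x. \<phi> x *\<^sub>R (g x \<bullet> b) \<partial>lborel))"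

lemma loc_int_compact:
 assumes u: "loc_int u" and K: "compact K"
 shows "integrable lborel (%x. indicator K x *\<^sub>R u x)"
proof -
 obtain R where "K \<subseteq> cball 0 R"
  using compact_imp_bounded[OF K] unfolding bounded_iff by (force simp: subset_iff)
 moreover have "indicator K : Borel"
  using compact_imp_closed[OF K] by (intro borel_measurable_indicator) simp
 ultimately show ?thesis
  by (intro integrable_mult_loc_int(1)[OF u, where B=1 and a=0 and R=R]) (auto split: split_indicator)
qed

lemma is_weak_gradient_iff_wgrad:
 fixes u u' :: "'a::euclidean_space => real"
 assumes \<O>: "open \<O>" and u: "rep \<O> u u'" "loc_int u'" and g: "rep \<O> g g'" "loc_int g'"
 shows "is_weak_gradient \<O> u g \<longleftrightarrow> wgrad \<O> u' g'"
proof -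
 have \<O>' [measurable]: "\<O> : sets borel" using \<O> by simp
 have "integrable (lebesgue_on K) g" if K: "compact K" "K \<subseteq> \<O>" for K
 proof -
  have Kb [measurable]: "K : sets borel" using compact_imp_closed[OF K(1)] by simp
  have "rep K g (%x. indicator K x *\<^sub>R g' x)"
  proof -
   have "AE x in lborel. indicator \<O> x *\<^sub>R g x = g' x" using g by (simp add: rep_def)
   then have "AE x in lborel. indicator K x *\<^sub>R g x = indicator K x *\<^sub>R g' x"
   proof eventually_elim
    case (elim x)
    then show ?case using K(2) by (cases "x : K") auto
   qed
   moreover have "g' : Borel" using g(1) by (rule rep_borel)
   then have "(%x. indicator K x *\<^sub>R g' x) : Borel" by measurable
   ultimately show ?thesis by (simp add: rep_def)
  qed
  from rep_integral(2)[OF this Kb, of "%_. 1"] show ?thesis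
   using loc_int_compact[OF g(2) K(1)] by simp
 qed
 moreover have "(\<integral>x. u x * frechet_derivative \<phi> (at x) b \<partial>lebesgue_on \<O>)
   = (\<integral>x. frechet_derivative \<phi> (at x) b *\<^sub>R u' x \<partial>lborel)"
  "(\<integral>x. (g x \<bullet> b) * \<phi> x \<partial>lebesgue_on \<O>) = (\<integral>x. \<phi> x *\<^sub>R (g' x \<bullet> b) \<partial>lborel)"
  if "\<phi> : test_functions \<O>" "b : Basis" for \<phi> b
 proof -
  have s: "smooth \<phi>" using that(1) by (simp add: test_functions_iff)
  show "(\<integral>x. u x * frechet_derivative \<phi> (at x) b \<partial>lebesgue_on \<O>)
   = (\<integral>x. frechet_derivative \<phi> (at x) b *\<^sub>R u' x \<partial>lborel)"
   using rep_integral(1)[OF u(1) \<O>' smooth_borel[OF smooth_partial[OF s that(2)]]] by (simp add: mult.commute)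
  show "(\<integral>x. (g x \<bullet> b) * \<phi> x \<partial>lebesgue_on \<O>) = (\<integral>x. \<phi> x *\<^sub>R (g' x \<bullet> b) \<partial>lborel)"
   using rep_integral(1)[OF rep_inner[OF g(1)] \<O>' smooth_borel[OF s], of b] by (simp add: mult.commute)
 qed
 ultimately show ?thesis using u(2) g(2) by (auto simp: is_weak_gradient_def wgrad_def)
qed

lemma compact_neighbourhood:
 fixes K :: "'a::euclidean_space set"
 assumes "compact K" "open \<O>" "K \<subseteq> \<O>"
 obtains d where "0 < d" "compact {x + y | x y. x : K & y : cball 0 d}" "{x + y | x y. x : K & y : cball 0 d} \<subseteq> \<O>"
proof -
 obtain d where d: "0 < d" "(\<Union>x\<in>K. cball x d) \<subseteq> \<O>"
  using compact_subset_open_imp_cball_epsilon_subset[OF assms] by blast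
 have "compact {x + y | x y. x : K & y : cball 0 d}" by (rule compact_sums[OF assms(1) compact_cball])
 moreover have "{x + y | x y. x : K & y : cball 0 d} \<subseteq> \<O>"
 proof safe
  fix x y :: 'a assume "x : K" "y : cball 0 d"
  then have "x + y : cball x d" by (simp add: dist_norm)
  then show "x + y : \<O>" using d(2) \<open>x : K\<close> by blast
 qed
 ultimately show ?thesis using d(1) that by blast
qed

lemma conv_mollifier_eq_0:
 assumes \<delta>: "0 < \<delta>" and "!!y. y : ball x \<delta> ==> u y = 0"
 shows "conv (mollifier \<delta>) u x = 0"
proof -
 have "mollifier \<delta> (x - y) *\<^sub>R u y = 0" for y
  using assms(2)[of y] mollifier_eq_0[OF \<delta>, of "x - y"] by (cases "norm (x - y) < \<delta>") (auto simp: dist_norm)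
 then have "(%y. mollifier \<delta> (x - y) *\<^sub>R u y) = (%_. 0)" by (intro ext)
 then show ?thesis by (simp only: conv_def Bochner_Integration.integral_zero)
qed

lemma conv_mollifier_test:
 fixes u :: "'a::euclidean_space => real"
 assumes \<delta>: "0 < \<delta>" and u: "loc_int u" and u0: "!!x. x ~: K ==> u x = 0" and K: "compact K"
  and K\<O>: "{x + y | x y. x : K & y : cball 0 \<delta>} \<subseteq> \<O>"
 shows "conv (mollifier \<delta>) u : test_functions \<O>"
 unfolding test_functions_iff
proof (intro conjI exI)
 show "smooth (conv (mollifier \<delta>) u)" by (rule smooth_conv[OF mollifier_test_UNIV[OF \<delta>] u])
 show "compact {x + y | x y. x : K & y : cball 0 \<delta>}" by (rule compact_sums[OF K compact_cball])
 show "\<forall>x. x ~: {x + y |x y. x : K & y : cball 0 \<delta>} --> conv (mollifier \<delta>) u x = 0"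
 proof (intro allI impI conv_mollifier_eq_0[OF \<delta>] u0 notI)
  fix x y assume a: "x ~: {x + y |x y. x : K & y : cball 0 \<delta>}" "y : ball x \<delta>" "y : K"
  have "x = y + (x - y)" "x - y : cball 0 \<delta>" using a(2) by (auto simp: dist_norm norm_minus_commute)
  with a show False by blast
 qed
qed (rule K\<O>)

text \<open>
Mollifications of \<open>sgn h\<close> on a compact set \<open>K\<close> are bounded test functions that converge a.e. along a
subsequence, so dominated convergence gives \<open>\<integral>\<^sub>K |h| = 0\<close>.
\<close>
lemma fundamental_lemma:
 fixes h :: "'a::euclidean_space => real"
 assumes \<O>: "open \<O>" and [measurable]: "h : Borel"
  and loc: "!!K. compact K ==> K \<subseteq> \<O> ==> integrable lborel (%x. indicator K x *\<^sub>R h x)"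
  and zero: "!!\<phi>. \<phi> : test_functions \<O> ==> (\<integral>x. \<phi> x *\<^sub>R h x \<partial>lborel) = 0"
 shows "AE x in lborel. x : \<O> --> h x = 0"
proof -
 have main: "AE x in lborel. x : K --> h x = 0" if K: "compact K" "K \<subseteq> \<O>" for K
 proof -
  have Kb [measurable]: "K : sets borel" using compact_imp_closed[OF K(1)] by simp
  obtain d where d: "0 < d" "compact {x + y | x y. x : K & y : cball 0 d}" "{x + y | x y. x : K & y : cball 0 d} \<subseteq> \<O>"
   using compact_neighbourhood[OF K(1) \<O> K(2)] by blast
  define K' where "K' = {x + y | x y. x : K & y : cball 0 d}"
  define s where "s = (%x. indicator K x * sgn (h x))"
  have s [measurable]: "s : Borel" unfolding s_def by measurable
  have sb: "\<bar>s x\<bar> <= 1" "x ~: K ==> s x = 0" for x by (auto simp: s_def indicator_def sgn_real_def)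
  have fin: "Lpow 2 UNIV s < \<infinity>"
   by (rule Lpow_bounded_support_finite[of 2 _ 1 K]) (use sb compact_imp_bounded[OF K(1)] in auto)
  have sloc: "loc_int s" by (rule Lpow_finite_loc_int[OF _ s fin]) simp
  define \<delta> where "\<delta> = (%n. min d (1 / real (Suc n)))"
  have \<delta>: "0 < \<delta> n" "\<delta> n <= d" "\<delta> n <= 1 / real (Suc n)" for n using d(1) by (auto simp: \<delta>_def)
  define v where "v = (%n. conv (mollifier (\<delta> n)) s)"
  have vt: "v n : test_functions \<O>" and v0: "x ~: K' ==> v n x = 0" for n x
  proof -
   have sub: "{x + y | x y. x : K & y : cball 0 (\<delta> n)} \<subseteq> K'"
   proof -
    have "cball (0::'a) (\<delta> n) \<subseteq> cball 0 d" using \<delta>(2)[of n] by (rule subset_cball)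
    then show ?thesis unfolding K'_def by blast
   qed
   show "v n : test_functions \<O>"
    unfolding v_def using sub d(3) by (intro conv_mollifier_test[OF \<delta>(1) sloc sb(2) K(1)]) (auto simp: K'_def)
   have "v n : test_functions K'"
    unfolding v_def by (intro conv_mollifier_test[OF \<delta>(1) sloc sb(2) K(1) sub])
   then show "x ~: K' ==> v n x = 0" unfolding test_functions_iff by blast
  qed
  have vm [measurable]: "v n : Borel" for n
   using vt[of n] by (auto simp: test_functions_iff intro: smooth_borel)
  have vb: "\<bar>v n x\<bar> <= 1" for n x
  proof -
   have "\<bar>v n x\<bar> <= (\<integral>y. \<bar>mollifier (\<delta> n) (x - y) *\<^sub>R s y\<bar> \<partial>lborel)"
    unfolding v_def conv_def using integral_norm_bound[of lborel "%y. mollifier (\<delta> n) (x - y) *\<^sub>R s y"] by simp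
   also have "... <= (\<integral>y. mollifier (\<delta> n) (x - y) \<partial>lborel)"
   proof (rule integral_mono)
    show "integrable lborel (%y. \<bar>mollifier (\<delta> n) (x - y) *\<^sub>R s y\<bar>)"
     using integrable_conv[OF mollifier_test_UNIV[OF \<delta>(1)] sloc, of n x] by (rule integrable_abs)
    have "integrable (distr lborel borel (%y. x - y)) (mollifier (\<delta> n))"
     using integrable_mollifier[OF \<delta>(1), where 'a='a] by (simp add: lborel_distr_diff)
    then show "integrable lborel (%y. mollifier (\<delta> n) (x - y))"
     using borel_mollifier[OF \<delta>(1)] by (subst (asm) integrable_distr_eq) auto
    show "\<bar>mollifier (\<delta> n) (x - y) *\<^sub>R s y\<bar> <= mollifier (\<delta> n) (x - y)" for y
     using mollifier_nonneg[OF \<delta>(1), of n "x - y"] sb(1)[of y]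
     by (simp add: abs_mult mult_left_le)
   qed
   also have "... = 1"
    using integral_reflect[OF borel_mollifier[OF \<delta>(1)], of n x] integral_mollifier[OF \<delta>(1), where 'a='a] by simp
   finally show ?thesis .
  qed
  have "(%n. Lpow 2 UNIV (%x. v n x - s x)) \<longlonglongrightarrow> 0"
  proof (rule order_tendstoI)
   fix a :: ennreal assume "0 < a"
   then obtain \<eta> where \<eta>: "0 < ennreal \<eta>" "ennreal \<eta> < a"
    using dense[of 0 a] by (metis ennreal_cases not_le top_greatest)
   then have "0 < \<eta>" by simp
   then obtain \<delta>\<^sub>0 where \<delta>\<^sub>0: "0 < \<delta>\<^sub>0" "!!\<delta>. 0 < \<delta> ==> \<delta> < \<delta>\<^sub>0 ==> Lpow 2 UNIV (%x. conv (mollifier \<delta>) s x - s x) <= ennreal \<eta>"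
    using Lpow_conv_mollifier_approx[OF _ s fin, of \<eta>] by auto
   have "\<forall>\<^sub>F n in sequentially. 1 / real (Suc n) < \<delta>\<^sub>0"
    using LIMSEQ_Suc[OF lim_1_over_n] \<delta>\<^sub>0(1) by (rule order_tendstoD(2))
   then show "\<forall>\<^sub>F n in sequentially. Lpow 2 UNIV (%x. v n x - s x) < a"
   proof eventually_elim
    case (elim n)
    then have "\<delta> n < \<delta>\<^sub>0" using \<delta>(3)[of n] by simp
    from \<delta>\<^sub>0(2)[OF \<delta>(1) this] \<eta>(2) show ?case unfolding v_def by simp
   qed
  qed simp
  then obtain r where r: "strict_mono r" "AE x in lborel. (%k. v (r k) x - s x) \<longlonglongrightarrow> 0"
   using Lpow_tendsto_0_AE_subseq[of 2 "%n x. v n x - s x"] by auto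
  have iK: "integrable lborel (%x. indicator K' x *\<^sub>R h x)" using d unfolding K'_def by (intro loc)
  have K'm [measurable]: "K' : sets borel" using compact_imp_closed[OF d(2)] by (simp add: K'_def)
  have "(%k. \<integral>x. v (r k) x * h x \<partial>lborel) \<longlonglongrightarrow> (\<integral>x. s x * h x \<partial>lborel)"
  proof (rule integral_dominated_convergence[where w="%x. norm (indicator K' x *\<^sub>R h x)"])
   show "integrable lborel (%x. norm (indicator K' x *\<^sub>R h x))" using iK by (rule integrable_norm)
   show "AE x in lborel. (%k. v (r k) x * h x) \<longlonglongrightarrow> s x * h x"
    using r(2)
   proof eventually_elim
    case (elim x)
    from tendsto_mult[OF tendsto_add[OF elim tendsto_const[of "s x"]] tendsto_const[of "h x"]]
    show ?case by simp
   qed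
   show "AE x in lborel. norm (v (r k) x * h x) <= norm (indicator K' x *\<^sub>R h x)" for k
   proof (intro AE_I2)
    fix x
    show "norm (v (r k) x * h x) <= norm (indicator K' x *\<^sub>R h x)"
     using v0[of x "r k"] mult_right_mono[OF vb[of "r k" x], of "\<bar>h x\<bar>"]
     by (cases "x : K'") (auto simp: abs_mult)
   qed
  qed measurable
  moreover have "(\<integral>x. v (r k) x * h x \<partial>lborel) = 0" for k using zero[OF vt[of "r k"]] by simp
  ultimately have "(\<integral>x. s x * h x \<partial>lborel) = 0" using LIMSEQ_unique[OF _ tendsto_const] by simp
  moreover have "s x * h x = norm (indicator K x *\<^sub>R h x)" for x
   by (auto simp: s_def indicator_def sgn_real_def)
  ultimately have "(\<integral>x. norm (indicator K x *\<^sub>R h x) \<partial>lborel) = 0" by simp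
  then have "AE x in lborel. norm (indicator K x *\<^sub>R h x) = 0"
   using loc[OF K] by (subst (asm) integral_nonneg_eq_0_iff_AE) auto
  then show ?thesis by eventually_elim (auto simp: indicator_def)
 qed
 obtain \<D> where \<D>: "countable \<D>" "!!X. X : \<D> ==> \<exists>a b. X = cbox a b" "\<Union>\<D> = \<O>"
  using open_countable_Union_open_cbox[OF \<O>] by metis
 have "AE x in lborel. \<forall>X\<in>\<D>. x : X --> h x = 0"
 proof (subst AE_ball_countable[OF \<D>(1)], intro ballI)
  fix X assume X: "X : \<D>"
  then have "compact X" "X \<subseteq> \<O>" using \<D> compact_cbox by (metis, blast)
  then show "AE x in lborel. x : X --> h x = 0" by (rule main)
 qed
 then show ?thesis by eventually_elim (use \<D>(3) in blast)
qed

section \<open>Sobolev norms of representatives\<close>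

text \<open>
The fundamental lemma is applied to each coordinate of the difference on interiors of compact subsets, since
the competitor \<open>g\<close> is only locally integrable on \<open>\<O>\<close>.
\<close>
lemma wgrad_unique:
 fixes u u' :: "'a::euclidean_space => real"
 assumes \<O>: "open \<O>" and u: "rep \<O> u u'" and wg: "wgrad \<O> u' g'" and g0: "!!x. x ~: \<O> ==> g' x = 0"
  and g: "is_weak_gradient \<O> u g"
 shows "rep \<O> g g'"
proof -
 have \<O>' [measurable]: "\<O> : sets borel" using \<O> by simp
 have lg': "loc_int g'" using wg by (simp add: wgrad_def)
 have g'm [measurable]: "g' : Borel" using lg' by (rule loc_int_borel)
 have main: "AE x in lborel. x : K --> g x = g' x" if K: "compact K" "K \<subseteq> \<O>" for K
 proof -
  obtain d where d: "0 < d" "compact {x + y | x y. x : K & y : cball 0 d}" "{x + y | x y. x : K & y : cball 0 d} \<subseteq> \<O>"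
   using compact_neighbourhood[OF K(1) \<O> K(2)] by blast
  define K' where "K' = {x + y | x y. x : K & y : cball 0 d}"
  have K': "compact K'" "K' \<subseteq> \<O>" using d by (auto simp: K'_def)
  have K'm [measurable]: "K' : sets borel" using compact_imp_closed[OF K'(1)] by simp
  have Kint: "K \<subseteq> interior K'"
  proof
   fix x assume x: "x : K"
   have "ball x d \<subseteq> K'"
   proof
    fix y assume "y : ball x d"
    then have "y - x : cball 0 d" by (simp add: dist_norm norm_minus_commute)
    then show "y : K'" unfolding K'_def using x by (intro CollectI exI[of _ x] exI[of _ "y - x"]) auto
   qed
   then show "x : interior K'" using d(1) by (intro interiorI[of "ball x d"]) auto
  qed
  have gi: "integrable (lebesgue_on K') g" using g K' by (simp add: is_weak_gradient_def)
  then have gm: "g : borel_measurable (lebesgue_on K')" by (rule borel_measurable_integrable)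
  obtain g'' where g'': "rep K' g g''" using ex_rep[OF K'm gm] .
  have [measurable]: "g'' : Borel" using g'' by (rule rep_borel)
  have ig'': "integrable lborel g''"
   using rep_integral(2)[OF g'' K'm, of "%_. 1"] gi by simp
  have "AE x in lborel. x : interior K' --> (g'' x - g' x) \<bullet> b = 0" if b: "b : Basis" for b
  proof (rule fundamental_lemma)
   show "integrable lborel (%x. indicator C x *\<^sub>R ((g'' x - g' x) \<bullet> b))" if C: "compact C" for C
   proof -
    have [measurable]: "C : sets borel" using compact_imp_closed[OF C] by simp
    have "integrable lborel (%x. indicator C x *\<^sub>R g'' x)"
     using ig'' by (intro integrable_mult_indicator) auto
    then have "integrable lborel (%x. (indicator C x *\<^sub>R g'' x - indicator C x *\<^sub>R g' x) \<bullet> b)"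
     using loc_int_compact[OF lg' C] by (intro integrable_inner_left Bochner_Integration.integrable_diff)
    then show ?thesis by (simp add: inner_diff_left right_diff_distrib)
   qed
   fix \<phi> assume \<phi>: "\<phi> : test_functions (interior K')"
   have s: "smooth \<phi>" and [measurable]: "\<phi> : Borel"
    using \<phi> by (auto simp: test_functions_iff intro: smooth_borel)
   have \<phi>0: "\<phi> x = 0" if "x ~: K'" for x
    using \<phi> that interior_subset[of K'] unfolding test_functions_iff by blast
   have \<phi>\<O>: "\<phi> : test_functions \<O>"
    by (rule test_functions_mono[OF _ \<phi>]) (use K'(2) interior_subset[of K'] in blast)
   have "(\<integral>x. \<phi> x *\<^sub>R (g'' x \<bullet> b) \<partial>lborel) = (\<integral>x. \<phi> x *\<^sub>R (g x \<bullet> b) \<partial>lebesgue_on K')"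
    by (rule rep_integral(1)[OF rep_inner[OF g''] K'm, symmetric]) measurable
   also have "... = (\<integral>x. indicator K' x *\<^sub>R (\<phi> x *\<^sub>R (g x \<bullet> b)) \<partial>lebesgue)"
    by (rule integral_restrict_space) simp
   also have "... = (\<integral>x. indicator \<O> x *\<^sub>R (\<phi> x *\<^sub>R (g x \<bullet> b)) \<partial>lebesgue)"
    using \<phi>0 K'(2) by (intro Bochner_Integration.integral_cong refl) (auto simp: indicator_def)
   also have "... = (\<integral>x. \<phi> x *\<^sub>R (g x \<bullet> b) \<partial>lebesgue_on \<O>)"
    by (rule integral_restrict_space[symmetric]) simp
   also have "... = - (\<integral>x. u x * frechet_derivative \<phi> (at x) b \<partial>lebesgue_on \<O>)"
    using g \<phi>\<O> b by (simp add: is_weak_gradient_def mult.commute)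
   also have "(\<integral>x. u x * frechet_derivative \<phi> (at x) b \<partial>lebesgue_on \<O>)
     = (\<integral>x. frechet_derivative \<phi> (at x) b *\<^sub>R u' x \<partial>lborel)"
    using rep_integral(1)[OF u \<O>' smooth_borel[OF smooth_partial[OF s b]]] by (simp add: mult.commute)
   also have "... = - (\<integral>x. \<phi> x *\<^sub>R (g' x \<bullet> b) \<partial>lborel)"
    using wg \<phi>\<O> b by (simp add: wgrad_def)
   finally have eq: "(\<integral>x. \<phi> x *\<^sub>R (g'' x \<bullet> b) \<partial>lborel) = (\<integral>x. \<phi> x *\<^sub>R (g' x \<bullet> b) \<partial>lborel)" by simp
   obtain B R where BR: "0 <= B" "0 < R" "!!x. \<bar>\<phi> x\<bar> <= B" "!!x. R < norm x ==> \<phi> x = 0" "smooth \<phi>"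
    using test_functions_support[OF \<phi>] by blast
   have i1: "integrable lborel (%x. \<phi> x *\<^sub>R g' x)"
    by (rule integrable_mult_loc_int(1)[OF lg', of _ B 0 R]) (use BR in auto)
   have i2: "integrable lborel (%x. \<phi> x *\<^sub>R g'' x)"
   proof (rule Bochner_Integration.integrable_bound)
    show "integrable lborel (%x. B *\<^sub>R g'' x)" using ig'' by simp
    show "AE x in lborel. norm (\<phi> x *\<^sub>R g'' x) <= norm (B *\<^sub>R g'' x)"
     using BR by (auto intro!: mult_right_mono)
   qed measurable
   have "(\<integral>x. \<phi> x *\<^sub>R ((g'' x - g' x) \<bullet> b) \<partial>lborel) = (\<integral>x. (\<phi> x *\<^sub>R g'' x) \<bullet> b - (\<phi> x *\<^sub>R g' x) \<bullet> b \<partial>lborel)"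
    by (simp add: inner_diff_left right_diff_distrib)
   also have "... = (\<integral>x. (\<phi> x *\<^sub>R g'' x) \<bullet> b \<partial>lborel) - (\<integral>x. (\<phi> x *\<^sub>R g' x) \<bullet> b \<partial>lborel)"
    by (intro Bochner_Integration.integral_diff integrable_inner_left i1 i2)
   finally show "(\<integral>x. \<phi> x *\<^sub>R ((g'' x - g' x) \<bullet> b) \<partial>lborel) = 0" using eq by simp
  qed (auto)
  then have "AE x in lborel. \<forall>b\<in>Basis. x : interior K' --> (g'' x - g' x) \<bullet> b = 0"
   by (intro AE_finite_allI) auto
  moreover have "AE x in lborel. indicator K' x *\<^sub>R g x = g'' x" using g'' by (simp add: rep_def)
  ultimately show ?thesis
  proof eventually_elim
   case (elim x)
   show ?case
   proof
    assume x: "x : K"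
    then have "x : interior K'" "x : K'" using Kint interior_subset[of K'] by auto
    with elim have b: "\<forall>b\<in>Basis. (g'' x - g' x) \<bullet> b = 0" and "g x = g'' x" by auto
    from b have "g'' x - g' x = 0" by (simp only: euclidean_all_zero_iff)
    then show "g x = g' x" using \<open>g x = g'' x\<close> by simp
   qed
  qed
 qed
 obtain \<D> where \<D>: "countable \<D>" "!!X. X : \<D> ==> \<exists>a b. X = cbox a b" "\<Union>\<D> = \<O>"
  using open_countable_Union_open_cbox[OF \<O>] by metis
 have "AE x in lborel. \<forall>X\<in>\<D>. x : X --> g x = g' x"
 proof (subst AE_ball_countable[OF \<D>(1)], intro ballI)
  fix X assume X: "X : \<D>"
  then have "compact X" "X \<subseteq> \<O>" using \<D> compact_cbox by (metis, blast)
  then show "AE x in lborel. x : X --> g x = g' x" by (rule main)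
 qed
 then have "AE x in lborel. indicator \<O> x *\<^sub>R g x = g' x"
 proof eventually_elim
  case (elim x)
  then show ?case using \<D>(3) g0[of x] by (cases "x : \<O>") auto
 qed
 then show ?thesis using g0 by (simp add: rep_def)
qed

lemma K_const_nonneg: "0 <= K_const e p"
 unfolding K_const_def by (intro divide_nonneg_nonneg integral_nonneg_AE) auto

text \<open>
Uniqueness of the weak gradient replaces the chosen \<open>weak_gradient\<close> by any convenient one.
\<close>
lemma W1p_rep:
 fixes u u' :: "'a::euclidean_space => real"
 assumes \<O>: "open \<O>" and p: "1 < p" and u: "rep \<O> u u'" "Lpow p UNIV u' < \<infinity>"
  and wg: "wgrad \<O> u' g'" and g0: "!!x. x ~: \<O> ==> g' x = 0" and g: "Lpow p UNIV g' < \<infinity>"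
 shows "u : W1p p \<O>"
  and "ennreal (W1p_norm e p \<O> u powr p) = Lpow p UNIV u' + ennreal (K_const e p) * Lpow p UNIV g'"
proof -
 have \<O>' [measurable]: "\<O> : sets borel" using \<O> by simp
 have loc: "loc_int u'" "loc_int g'" using wg by (auto simp: wgrad_def)
 have g'm [measurable]: "g' : Borel" using loc(2) by (rule loc_int_borel)
 have gg: "rep \<O> g' g'"
 proof -
  have "(%x. indicator \<O> x *\<^sub>R g' x) = g'" using g0 by (auto simp: indicator_def)
  then show ?thesis using rep_self[OF g'm \<O>'] by simp
 qed
 have wk: "is_weak_gradient \<O> u g'"
  using is_weak_gradient_iff_wgrad[OF \<O> u(1) loc(1) gg loc(2)] wg by blast
 have "g' : Lp p \<O>" using Lp_iff_rep[OF gg \<O>' p] g by blast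
 moreover have "u : Lp p \<O>" using Lp_iff_rep[OF u(1) \<O>' p] u(2) by blast
 ultimately show "u : W1p p \<O>" using wk by (auto simp: W1p_def)
 have "is_weak_gradient \<O> u (weak_gradient \<O> u)"
  unfolding weak_gradient_def by (rule someI[of "is_weak_gradient \<O> u", OF wk])
 then have rg: "rep \<O> (weak_gradient \<O> u) g'"
  using wgrad_unique[of \<O> u u' g' "weak_gradient \<O> u"] \<O> u(1) wg g0 by blast
 have "W1p_norm e p \<O> u powr p = Lp_norm p \<O> u powr p + K_const e p * Lp_norm p \<O> (weak_gradient \<O> u) powr p"
  using p K_const_nonneg[of e p] by (simp add: W1p_norm_def powr_powr powr_one')
 then show "ennreal (W1p_norm e p \<O> u powr p) = Lpow p UNIV u' + ennreal (K_const e p) * Lpow p UNIV g'"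
  using K_const_nonneg[of e p]
  by (simp add: ennreal_plus ennreal_mult rep_Lp_norm[OF u(1) \<O>' p u(2)] rep_Lp_norm[OF rg \<O>' p g])
qed

lemma W1pE:
 fixes u :: "'a::euclidean_space => real"
 assumes \<O>: "open \<O>" and p: "1 < p" and u: "u : W1p p \<O>"
 obtains u' g' where "rep \<O> u u'" "Lpow p UNIV u' < \<infinity>" "wgrad \<O> u' g'" "!!x. x ~: \<O> ==> g' x = 0"
  "Lpow p UNIV g' < \<infinity>"
proof -
 have \<O>' [measurable]: "\<O> : sets borel" using \<O> by simp
 obtain g where g: "u : Lp p \<O>" "g : Lp p \<O>" "is_weak_gradient \<O> u g" using u by (auto simp: W1p_def)
 obtain u' where u': "rep \<O> u u'" using ex_rep[OF \<O>', of u] g(1) by (auto simp: Lp_def)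
 obtain g' where g': "rep \<O> g g'" using ex_rep[OF \<O>', of g] g(2) by (auto simp: Lp_def)
 have fin: "Lpow p UNIV u' < \<infinity>" "Lpow p UNIV g' < \<infinity>"
  using g Lp_iff_rep[OF u' \<O>' p] Lp_iff_rep[OF g' \<O>' p] by auto
 have loc: "loc_int u'" "loc_int g'"
  using Lpow_finite_loc_int[OF p rep_borel[OF u'] fin(1)] Lpow_finite_loc_int[OF p rep_borel[OF g'] fin(2)] .
 have "wgrad \<O> u' g'" using is_weak_gradient_iff_wgrad[OF \<O> u' loc(1) g' loc(2)] g(3) by blast
 moreover have "!!x. x ~: \<O> ==> g' x = 0" using g' by (auto simp: rep_def)
 ultimately show ?thesis using that u' fin by blast
qed

lemma integrable_test_mult:
 assumes "\<phi> : test_functions \<O>" "loc_int u" shows "integrable lborel (%x. \<phi> x *\<^sub>R u x)"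
proof -
 obtain B R where BR: "0 <= B" "0 < R" "!!x. \<bar>\<phi> x\<bar> <= B" "!!x. R < norm x ==> \<phi> x = 0" "smooth \<phi>"
  using test_functions_support[OF assms(1)] by blast
 show ?thesis
  by (rule integrable_mult_loc_int(1)[OF assms(2), of _ B 0 R]) (use BR smooth_borel in auto)
qed

lemma loc_int_lincomb:
 assumes u: "loc_int u" and v: "loc_int v" shows "loc_int (%x. a *\<^sub>R u x + b *\<^sub>R v x)"
proof -
 have [measurable]: "u : Borel" "v : Borel" using u v by (auto simp: loc_int_def)
 have "(\<integral>\<^sup>+x\<in>cball 0 R. ennreal (norm (a *\<^sub>R u x + b *\<^sub>R v x)) \<partial>lborel) < \<infinity>" for R
 proof -
  have "(\<integral>\<^sup>+x\<in>cball 0 R. ennreal (norm (a *\<^sub>R u x + b *\<^sub>R v x)) \<partial>lborel)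
   <= (\<integral>\<^sup>+x. ennreal \<bar>a\<bar> * (ennreal (norm (u x)) * indicator (cball 0 R) x)
      + ennreal \<bar>b\<bar> * (ennreal (norm (v x)) * indicator (cball 0 R) x) \<partial>lborel)"
  proof (intro nn_integral_mono)
   fix x
   have "norm (a *\<^sub>R u x + b *\<^sub>R v x) <= \<bar>a\<bar> * norm (u x) + \<bar>b\<bar> * norm (v x)"
    using norm_triangle_ineq[of "a *\<^sub>R u x" "b *\<^sub>R v x"] by simp
   then have "ennreal (norm (a *\<^sub>R u x + b *\<^sub>R v x)) <= ennreal \<bar>a\<bar> * ennreal (norm (u x)) + ennreal \<bar>b\<bar> * ennreal (norm (v x))"
    by (subst ennreal_lincomb) (simp_all only: ennreal_leI norm_ge_zero abs_ge_zero)
   then show "ennreal (norm (a *\<^sub>R u x + b *\<^sub>R v x)) * indicator (cball 0 R) x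
    <= ennreal \<bar>a\<bar> * (ennreal (norm (u x)) * indicator (cball 0 R) x)
      + ennreal \<bar>b\<bar> * (ennreal (norm (v x)) * indicator (cball 0 R) x)"
    by (cases "x : cball 0 R") (simp_all del: mem_cball)
  qed
  also have "... = ennreal \<bar>a\<bar> * (\<integral>\<^sup>+x\<in>cball 0 R. ennreal (norm (u x)) \<partial>lborel)
    + ennreal \<bar>b\<bar> * (\<integral>\<^sup>+x\<in>cball 0 R. ennreal (norm (v x)) \<partial>lborel)"
   by (rule nn_integral_add_cmult) measurable
  also have "... < \<infinity>" using u v by (simp add: loc_int_def ennreal_mult_less_top)
  finally show ?thesis .
 qed
 then show ?thesis by (simp add: loc_int_def)
qed

lemma wgrad_lincomb:
 assumes u: "wgrad \<O> u g" and v: "wgrad \<O> v h"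
 shows "wgrad \<O> (%x. a * u x + b * v x) (%x. a *\<^sub>R g x + b *\<^sub>R h x)"
proof -
 have loc: "loc_int u" "loc_int v" "loc_int g" "loc_int h" using u v by (auto simp: wgrad_def)
 have l1: "loc_int (%x. a * u x + b * v x)" using loc_int_lincomb[OF loc(1,2), of a b] by simp
 have l2: "loc_int (%x. a *\<^sub>R g x + b *\<^sub>R h x)" by (rule loc_int_lincomb[OF loc(3,4)])
 have "(\<integral>x. frechet_derivative \<phi> (at x) c *\<^sub>R (a * u x + b * v x) \<partial>lborel)
   = - (\<integral>x. \<phi> x *\<^sub>R ((a *\<^sub>R g x + b *\<^sub>R h x) \<bullet> c) \<partial>lborel)"
  if \<phi>: "\<phi> : test_functions \<O>" and c: "c : Basis" for \<phi> c
 proof -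
  note i = integrable_test_mult[OF test_functions_partial[OF \<phi> c] loc(1)]
   integrable_test_mult[OF test_functions_partial[OF \<phi> c] loc(2)]
  have j: "integrable lborel (%x. \<phi> x *\<^sub>R (g x \<bullet> c))" "integrable lborel (%x. \<phi> x *\<^sub>R (h x \<bullet> c))"
   using integrable_inner_left[OF integrable_test_mult[OF \<phi> loc(3)], of c]
    integrable_inner_left[OF integrable_test_mult[OF \<phi> loc(4)], of c] by simp_all
  have "(\<integral>x. frechet_derivative \<phi> (at x) c *\<^sub>R (a * u x + b * v x) \<partial>lborel)
    = (\<integral>x. a *\<^sub>R (frechet_derivative \<phi> (at x) c *\<^sub>R u x) + b *\<^sub>R (frechet_derivative \<phi> (at x) c *\<^sub>R v x) \<partial>lborel)"
   by (simp add: algebra_simps)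
  also have "... = a *\<^sub>R (\<integral>x. frechet_derivative \<phi> (at x) c *\<^sub>R u x \<partial>lborel)
    + b *\<^sub>R (\<integral>x. frechet_derivative \<phi> (at x) c *\<^sub>R v x \<partial>lborel)"
   unfolding Bochner_Integration.integral_add[OF integrable_scaleR_right[OF i(1)] integrable_scaleR_right[OF i(2)]]
    Bochner_Integration.integral_scaleR_right ..
  also have "... = - (a *\<^sub>R (\<integral>x. \<phi> x *\<^sub>R (g x \<bullet> c) \<partial>lborel) + b *\<^sub>R (\<integral>x. \<phi> x *\<^sub>R (h x \<bullet> c) \<partial>lborel))"
   using u v \<phi> c by (simp add: wgrad_def)
  also have "... = - (\<integral>x. a *\<^sub>R (\<phi> x *\<^sub>R (g x \<bullet> c)) + b *\<^sub>R (\<phi> x *\<^sub>R (h x \<bullet> c)) \<partial>lborel)"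
   unfolding Bochner_Integration.integral_add[OF integrable_scaleR_right[OF j(1)] integrable_scaleR_right[OF j(2)]]
    Bochner_Integration.integral_scaleR_right ..
  also have "(\<integral>x. a *\<^sub>R (\<phi> x *\<^sub>R (g x \<bullet> c)) + b *\<^sub>R (\<phi> x *\<^sub>R (h x \<bullet> c)) \<partial>lborel)
    = (\<integral>x. \<phi> x *\<^sub>R ((a *\<^sub>R g x + b *\<^sub>R h x) \<bullet> c) \<partial>lborel)"
   by (simp add: inner_add_left algebra_simps)
  finally show ?thesis .
 qed
 with l1 l2 show ?thesis by (simp add: wgrad_def)
qed

lemma grad_conv_wgrad:
 fixes u :: "'a::euclidean_space => real"
 assumes wg: "wgrad \<O> u g" and \<delta>: "0 < \<delta>" and x: "cball x \<delta> \<subseteq> \<O>"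
 shows "grad (conv (mollifier \<delta>) u) x = conv (mollifier \<delta>) g x"
proof (rule euclidean_eqI)
 fix b :: 'a assume b: "b : Basis"
 have loc: "loc_int u" "loc_int g" using wg by (auto simp: wgrad_def)
 note m = mollifier_test_UNIV[OF \<delta>, where 'a='a]
 let ?\<phi> = "%y. mollifier \<delta> (x - y)"
 have \<phi>: "?\<phi> : test_functions \<O>"
  unfolding test_functions_iff
 proof (intro conjI exI[of _ "cball x \<delta>"] allI impI)
  show "smooth ?\<phi>" using smooth_affine[OF smooth_mollifier[OF \<delta>], of x "-1"] by simp
  show "mollifier \<delta> (x - y) = 0" if "y ~: cball x \<delta>" for y
   using that by (intro mollifier_eq_0[OF \<delta>]) (simp add: dist_norm)
 qed (use x in auto)
 have d: "frechet_derivative ?\<phi> (at y) b = - frechet_derivative (mollifier \<delta>) (at (x - y)) b" for y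
 proof -
  have "((%y. x - y) has_derivative (%h. - h)) (at y)" by (auto intro!: derivative_eq_intros)
  note D = has_derivative_compose[OF this smooth_has_derivative_grad[OF smooth_mollifier[OF \<delta>], of "x - y"]]
  show ?thesis
   unfolding frechet_derivative_eqI[OF D] using b by (simp add: grad_inner_Basis)
 qed
 have "grad (conv (mollifier \<delta>) u) x \<bullet> b = conv (partial b (mollifier \<delta>)) u x"
  using b by (simp add: grad_inner_Basis partial_conv[OF m loc(1)])
 also have "... = - (\<integral>y. frechet_derivative ?\<phi> (at y) b *\<^sub>R u y \<partial>lborel)"
  unfolding conv_def d by simp
 also have "... = (\<integral>y. mollifier \<delta> (x - y) *\<^sub>R (g y \<bullet> b) \<partial>lborel)"
  using wg \<phi> b by (simp add: wgrad_def)
 also have "... = (\<integral>y. (mollifier \<delta> (x - y) *\<^sub>R g y) \<bullet> b \<partial>lborel)" by simp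
 also have "... = conv (mollifier \<delta>) g x \<bullet> b"
  unfolding conv_def by (rule integral_inner_left) (use integrable_conv[OF m loc(2)] in auto)
 finally show "grad (conv (mollifier \<delta>) u) x \<bullet> b = conv (mollifier \<delta>) g x \<bullet> b" .
qed

section \<open>Radial kernels\<close>

lemma ennreal_mult_cancel_finite:
 fixes c a b :: ennreal
 assumes "c \<noteq> 0" "c \<noteq> \<infinity>" "c * a = c * b"
 shows "a = b"
proof -
 have "a = c * a / c" "b = c * b / c"
  using assms(1,2) by (simp_all add: ennreal_mult_divide_eq[of c] mult.commute)
 then show ?thesis using assms(3) by simp
qed

lemma emeasure_lborel_ball_ne_0:
 "0 < r ==> emeasure lborel (ball (a::'a::euclidean_space) r) \<noteq> 0"
 "0 < r ==> emeasure lborel (cball (a::'a::euclidean_space) r) \<noteq> 0"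
proof -
 show b: "emeasure lborel (ball a r) \<noteq> 0" if "0 < r"
  using open_not_negligible[of "ball a r"] that by (auto simp: negligible_iff_null_sets null_sets_def)
 have "emeasure lborel (ball a r) <= emeasure lborel (cball a r)"
  by (intro emeasure_mono) auto
 then show "emeasure lborel (cball a r) \<noteq> 0" if "0 < r"
  using b[OF that] by auto
qed

text \<open>
The translation invariant image measure is compared with Lebesgue measure by Tonelli on a product with
the unit ball, which the isometry maps to itself; this also identifies the normalisation.
\<close>
lemma lborel_isometry_invariant:
 fixes T :: "'a::euclidean_space => 'a" and F :: "'a => ennreal"
 assumes T: "orthogonal_transformation T" and F [measurable]: "F : Borel"
 shows "(\<integral>\<^sup>+x. F (T x) \<partial>lborel) = (\<integral>\<^sup>+x. F x \<partial>lborel)"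
proof -
 have lin: "linear T" using T by (rule orthogonal_transformation_linear)
 have Tm [measurable]: "T : Borel"
  using linear_continuous_on[of T UNIV] lin by (intro borel_measurable_continuous_onI) (simp add: linear_conv_bounded_linear)
 have nT: "norm (T x) = norm x" for x using T by (rule orthogonal_transformation_norm)
 have "distr lborel borel T = (lborel :: 'a measure)"
 proof (rule measure_eqI)
  fix A assume "A : sets (distr lborel borel T)"
  then have A [measurable]: "A : sets borel" by simp
  let ?C = "ball (0::'a) 1"
  have C [measurable]: "?C : sets borel" by simp
  \<comment> \<open>by Fubini, the image measure of \<open>A\<close> times the volume of \<open>?C\<close> equals the volume of \<open>A\<close> times that of \<open>?C\<close>\<close>
  define mA where "mA = (\<integral>\<^sup>+x. indicator A (T x) \<partial>(lborel :: 'a measure))"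
  have mC: "(\<integral>\<^sup>+x. indicator ?C (T x) \<partial>lborel) = emeasure lborel ?C"
  proof -
   have "indicator ?C (T x) = (indicator ?C x :: ennreal)" for x by (simp add: indicator_def nT)
   then show ?thesis by simp
  qed
  have tr: "(\<integral>\<^sup>+x. indicator A (T x - y) * indicator ?C (T x) \<partial>lborel)
    = (\<integral>\<^sup>+x. indicator A (T x) * indicator ?C (T x + y) \<partial>lborel)" for y
  proof -
   obtain z where z: "T z = y" using orthogonal_transformation_surj[OF T] by (metis surjD)
   have "(\<integral>\<^sup>+x. indicator A (T x - y) * indicator ?C (T x) \<partial>lborel)
     = (\<integral>\<^sup>+x. indicator A (T (x + z) - y) * indicator ?C (T (x + z)) \<partial>lborel)"
    by (rule nn_integral_translate[symmetric, of "%x. indicator A (T x - y) * indicator ?C (T x)"]) measurable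
   then show ?thesis by (simp add: linear_add[OF lin] z)
  qed
  have "(\<integral>\<^sup>+y. (\<integral>\<^sup>+x. indicator A (T x - y) * indicator ?C (T x) \<partial>lborel) \<partial>lborel)
    = (\<integral>\<^sup>+x. (\<integral>\<^sup>+y. indicator A (T x) * indicator ?C (T x + y) \<partial>lborel) \<partial>lborel)"
   unfolding tr by (rule lborel_pair.Fubini') measurable
  also have "... = (\<integral>\<^sup>+x. indicator A (T x) * emeasure lborel ?C \<partial>lborel)"
  proof (intro nn_integral_cong)
   fix x
   have "(\<integral>\<^sup>+y. indicator A (T x) * indicator ?C (T x + y) \<partial>lborel)
     = indicator A (T x) * (\<integral>\<^sup>+y. indicator ?C (y + T x) \<partial>lborel)"
    by (subst nn_integral_cmult) (auto simp: add.commute)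
   also have "(\<integral>\<^sup>+y. indicator ?C (y + T x) \<partial>lborel) = (\<integral>\<^sup>+y. indicator ?C y \<partial>lborel)"
    by (rule nn_integral_translate) measurable
   finally show "(\<integral>\<^sup>+y. indicator A (T x) * indicator ?C (T x + y) \<partial>lborel) = indicator A (T x) * emeasure lborel ?C"
    by simp
  qed
  also have "... = mA * emeasure lborel ?C" unfolding mA_def by (rule nn_integral_multc) measurable
  finally have e1: "(\<integral>\<^sup>+y. (\<integral>\<^sup>+x. indicator A (T x - y) * indicator ?C (T x) \<partial>lborel) \<partial>lborel) = mA * emeasure lborel ?C" .
  have "(\<integral>\<^sup>+y. (\<integral>\<^sup>+x. indicator A (T x - y) * indicator ?C (T x) \<partial>lborel) \<partial>lborel)
    = (\<integral>\<^sup>+x. (\<integral>\<^sup>+y. indicator A (T x - y) * indicator ?C (T x) \<partial>lborel) \<partial>lborel)"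
   by (rule lborel_pair.Fubini') measurable
  also have "... = (\<integral>\<^sup>+x. emeasure lborel A * indicator ?C (T x) \<partial>lborel)"
  proof (intro nn_integral_cong)
   fix x
   have "(\<integral>\<^sup>+y. indicator A (T x - y) * indicator ?C (T x) \<partial>lborel)
     = (\<integral>\<^sup>+y. indicator A (T x - y) \<partial>lborel) * indicator ?C (T x)"
    by (rule nn_integral_multc) measurable
   also have "(\<integral>\<^sup>+y. indicator A (T x - y) \<partial>lborel) = (\<integral>\<^sup>+y. indicator A y \<partial>lborel)"
    by (rule nn_integral_reflect) measurable
   finally show "(\<integral>\<^sup>+y. indicator A (T x - y) * indicator ?C (T x) \<partial>lborel) = emeasure lborel A * indicator ?C (T x)"
    by simp
  qed
  also have "... = emeasure lborel A * emeasure lborel ?C"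
   by (subst nn_integral_cmult) (auto simp: mC)
  finally have "mA * emeasure lborel ?C = emeasure lborel A * emeasure lborel ?C" using e1 by simp
  moreover have "emeasure lborel ?C \<noteq> 0"
   by (rule emeasure_lborel_ball_ne_0) simp
  moreover have "emeasure lborel ?C \<noteq> \<infinity>" using emeasure_lborel_ball_finite[of "0::'a" 1] by simp
  ultimately have "mA = emeasure lborel A"
   using ennreal_mult_cancel_finite[of "emeasure lborel ?C" mA "emeasure lborel A"] by (simp add: mult.commute)
  moreover have "emeasure (distr lborel borel T) A = mA"
  proof -
   have "emeasure (distr lborel borel T) A = (\<integral>\<^sup>+x. indicator A x \<partial>distr lborel borel T)" by simp
   also have "... = mA" unfolding mA_def by (rule nn_integral_distr) measurable
   finally show ?thesis .
  qed
  ultimately show "emeasure (distr lborel borel T) A = emeasure lborel A" by simp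
 qed simp
 then have "(\<integral>\<^sup>+x. F x \<partial>lborel) = (\<integral>\<^sup>+x. F x \<partial>distr lborel borel T)" by simp
 also have "... = (\<integral>\<^sup>+x. F (T x) \<partial>lborel)" by (rule nn_integral_distr) measurable
 finally show ?thesis ..
qed

text \<open>
Either the identity or the reflection exchanging the two vectors.
\<close>
lemma ex_isometry_unit:
 fixes a b :: "'a::euclidean_space"
 assumes "norm a = 1" "norm b = 1"
 obtains T where "orthogonal_transformation T" "T a = b"
proof (cases "a = b")
 case True
 then show ?thesis using that[of "%x. x"] by simp
next
 case False
 define w where "w = a - b"
 have w: "w \<bullet> w \<noteq> 0" using False by (simp add: w_def)
 define T where "T = (%x. x - (2 * (x \<bullet> w) / (w \<bullet> w)) *\<^sub>R w)"
 have aa: "a \<bullet> a = 1" "b \<bullet> b = 1" using assms by (auto simp: norm_eq_1)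
 have lin: "linear T"
  unfolding T_def by (rule linearI) (auto simp: inner_add_left algebra_simps add_divide_distrib)
 have "T x \<bullet> T x = x \<bullet> x" for x
 proof -
  define c where "c = 2 * (x \<bullet> w) / (w \<bullet> w)"
  have c: "c * (w \<bullet> w) = 2 * (x \<bullet> w)" using w by (simp add: c_def)
  have "T x \<bullet> T x = x \<bullet> x - 2 * c * (x \<bullet> w) + c * (c * (w \<bullet> w))"
   unfolding T_def c_def[symmetric] by (simp add: inner_diff_left inner_diff_right inner_commute algebra_simps)
  then show ?thesis unfolding c by simp
 qed
 then have "norm (T x) = norm x" for x by (simp add: norm_eq_sqrt_inner)
 then have "orthogonal_transformation T" using lin by (simp add: orthogonal_transformation)
 moreover have "2 * (a \<bullet> w) = w \<bullet> w"
  by (simp add: w_def inner_diff_left inner_diff_right aa inner_commute)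
 then have "T a = b" using w by (simp add: T_def w_def)
 ultimately show ?thesis by (rule that)
qed

lemma AE_isometry:
 fixes T :: "'a::euclidean_space => 'a"
 assumes T: "orthogonal_transformation T" and "AE x in lborel. P x"
 shows "AE x in lborel. P (T x)"
proof -
 obtain N where N: "{x. \<not> P x} \<subseteq> N" "N : null_sets lborel"
  using assms(2) by (auto elim!: AE_E simp: null_sets_def)
 then have [measurable]: "N : sets borel" by (auto simp: null_sets_def)
 have Tm [measurable]: "T : Borel"
  using linear_continuous_on[of T UNIV] orthogonal_transformation_linear[OF T]
  by (intro borel_measurable_continuous_onI) (simp add: linear_conv_bounded_linear)
 have "(\<integral>\<^sup>+x. indicator N (T x) \<partial>lborel) = (\<integral>\<^sup>+x. indicator N x \<partial>lborel)"
  by (rule lborel_isometry_invariant[OF T]) measurable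
 also have "... = 0" using N(2) by (simp add: null_sets_def)
 finally have "AE x in lborel. (indicator N (T x) :: ennreal) = 0"
  by (subst (asm) nn_integral_0_iff_AE) auto
 then show ?thesis
 proof eventually_elim
  case (elim x)
  then show ?case using N(1) by (auto simp: indicator_def split: if_splits)
 qed
qed

lemma AE_reflect:
 fixes a :: "'a::euclidean_space"
 assumes "AE x in lborel. P x"
 shows "AE x in lborel. P (a - x)"
proof -
 obtain N where N: "{x. \<not> P x} \<subseteq> N" "N : null_sets lborel"
  using assms by (auto elim!: AE_E simp: null_sets_def)
 then have [measurable]: "N : sets borel" by (auto simp: null_sets_def)
 have "(\<integral>\<^sup>+x. indicator N (a - x) \<partial>lborel) = (\<integral>\<^sup>+x. indicator N x \<partial>lborel)"
  by (rule nn_integral_reflect) measurable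
 also have "... = 0" using N(2) by (simp add: null_sets_def)
 finally have "AE x in lborel. (indicator N (a - x) :: ennreal) = 0"
  by (subst (asm) nn_integral_0_iff_AE) auto
 then show ?thesis
 proof eventually_elim
  case (elim x)
  then show ?case using N(1) by (auto simp: indicator_def split: if_splits)
 qed
qed

text \<open>
Invariance almost everywhere for each isometry survives the passage from a radial Lebesgue measurable kernel
to a Borel one; pointwise radiality need not.
\<close>
definition radial_AE :: "('a::euclidean_space => ennreal) => bool" where
 "radial_AE k \<longleftrightarrow> k : Borel &
   (\<forall>T. orthogonal_transformation T --> (AE h in lborel. k (T h) = k h))"

text \<open>
The push-forward under \<open>sgn\<close> is undone, so that the surface integral becomes a solid one over the ball.
\<close>
lemma K_const_eq:
 fixes e :: "'a::euclidean_space"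
 assumes p: "1 < p"
 shows "ennreal (K_const e p) * emeasure lborel (cball (0::'a) 1)
  = (\<integral>\<^sup>+z\<in>cball 0 1. ennreal (\<bar>sgn z \<bullet> e\<bar> powr p) \<partial>lborel)"
proof -
 let ?B = "cball (0::'a) 1" and ?S = "sphere (0::'a) 1"
 let ?M = "distr (restrict_space lborel (?B - {0})) (restrict_space borel ?S) sgn"
 define A where "A = (\<integral>\<^sup>+z\<in>?B. ennreal (\<bar>sgn z \<bullet> e\<bar> powr p) \<partial>lborel)"
 define V where "V = measure lborel ?B"
 have V: "emeasure lborel ?B = ennreal V"
  unfolding V_def using emeasure_lborel_cball_finite[of "0::'a" 1] by (intro emeasure_eq_ennreal_measure) simp
 have V0: "0 < V"
  using emeasure_lborel_ball_ne_0(2)[of 1 "0::'a"] V by (simp add: V_def measure_nonneg less_le)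
 have sgnm [measurable]: "sgn : measurable (restrict_space lborel (?B - {0})) (restrict_space borel ?S)"
 proof (rule measurable_restrict_space2)
  show "sgn : space (restrict_space lborel (?B - {0})) \<rightarrow> ?S"
   by (auto simp: space_restrict_space norm_sgn)
  show "sgn : measurable (restrict_space lborel (?B - {0})) borel"
   by (rule measurable_restrict_space1) measurable
 qed
 have "emeasure ?M ?S = emeasure (restrict_space lborel (?B - {0})) (?B - {0})"
  by (subst emeasure_distr[OF sgnm])
   (auto simp: sets_restrict_space space_restrict_space norm_sgn intro!: arg_cong[where f="emeasure _"] image_eqI[of _ _ UNIV])
 also have "... = emeasure lborel (?B - {0})"
  by (subst emeasure_restrict_space) auto
 also have "... = ennreal V"
  using V by (subst emeasure_Diff_null_set) auto
 finally have mS: "measure (sphere_measure :: 'a measure) ?S = real DIM('a) * V"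
  using V0 by (simp add: sphere_measure_def measure_def enn2real_mult)
 have fm [measurable]: "(%w. \<bar>w \<bullet> e\<bar> powr p) : borel_measurable (restrict_space borel ?S)"
  by (rule measurable_restrict_space1) measurable
 have "(\<integral>\<^sup>+w. ennreal (\<bar>w \<bullet> e\<bar> powr p) \<partial>?M)
   = (\<integral>\<^sup>+z. ennreal (\<bar>sgn z \<bullet> e\<bar> powr p) \<partial>restrict_space lborel (?B - {0}))"
  by (rule nn_integral_distr[OF sgnm]) measurable
 also have "... = (\<integral>\<^sup>+z. ennreal (\<bar>sgn z \<bullet> e\<bar> powr p) * indicator (?B - {0}) z \<partial>lborel)"
  by (rule nn_integral_restrict_space) auto
 also have "... = A"
  unfolding A_def by (intro nn_integral_cong) (auto simp: indicator_def)
 finally have nA: "(\<integral>\<^sup>+w. ennreal (\<bar>w \<bullet> e\<bar> powr p) \<partial>sphere_measure) = ennreal (real DIM('a)) * A"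
  unfolding sphere_measure_def by (subst nn_integral_scale_measure) auto
 have "(%w. \<bar>w \<bullet> e\<bar> powr p) : borel_measurable sphere_measure"
  by (simp add: sphere_measure_def fm)
 then have iA: "(\<integral>w. \<bar>w \<bullet> e\<bar> powr p \<partial>sphere_measure) = enn2real (ennreal (real DIM('a)) * A)"
  unfolding nA[symmetric] by (intro integral_eq_nn_integral) auto
 have "A <= (\<integral>\<^sup>+z. ennreal (norm e powr p) * indicator ?B z \<partial>lborel)"
  unfolding A_def
 proof (intro nn_integral_mono mult_right_mono ennreal_leI powr_mono2)
  show "\<bar>sgn z \<bullet> e\<bar> <= norm e" for z
   using Cauchy_Schwarz_ineq2[of "sgn z" e] by (cases "z = 0") (auto simp: norm_sgn)
 qed (use p in auto)
 also have "... < \<infinity>" using V by (subst nn_integral_cmult_indicator) (auto simp: ennreal_mult_less_top)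
 finally obtain a where a: "0 <= a" "A = ennreal a" by (cases A) auto
 have "K_const e p = a / V"
  unfolding K_const_def mS iA a(2) using a(1) by (simp flip: ennreal_mult)
 then have "ennreal (K_const e p) * ennreal V = ennreal a"
  using V0 a(1) by (simp flip: ennreal_mult)
 then show ?thesis using V a(2) A_def by simp
qed

text \<open>
By invariance the left side depends on \<open>g\<close> only through its norm. Averaging the unit vector \<open>g\<close> over the
ball with Tonelli replaces \<open>|g \<bullet> h|\<close> by its spherical mean, which is \<open>K_const\<close> times a power of \<open>|h|\<close>; no polar
coordinates are involved.
\<close>
lemma radial_directional_integral:
 fixes e g :: "'a::euclidean_space" and k :: "'a => ennreal"
 assumes p: "1 < p" and e: "e : Basis" and k: "radial_AE k" and [measurable]: "k : Borel"
 shows "(\<integral>\<^sup>+h. k h * ennreal (\<bar>g \<bullet> h\<bar> powr p) \<partial>lborel)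
   = ennreal (K_const e p * norm g powr p) * (\<integral>\<^sup>+h. k h * ennreal (norm h powr p) \<partial>lborel)"
proof -
 let ?B = "cball (0::'a) 1"
 have ne: "norm e = 1" using e by simp
 define A where "A = (\<integral>\<^sup>+z\<in>?B. ennreal (\<bar>sgn z \<bullet> e\<bar> powr p) \<partial>lborel)"
 define G where "G = (%v::'a. \<integral>\<^sup>+h. k h * ennreal (\<bar>v \<bullet> h\<bar> powr p) \<partial>lborel)"
 have Gunit: "G v = G e" if v: "norm v = 1" for v
 proof -
  obtain T where T: "orthogonal_transformation T" "T e = v" using ex_isometry_unit[OF ne v] .
  have Tm [measurable]: "T : Borel"
   using linear_continuous_on[of T UNIV] orthogonal_transformation_linear[OF T(1)]
   by (intro borel_measurable_continuous_onI) (simp add: linear_conv_bounded_linear)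
  have "G v = (\<integral>\<^sup>+h. k (T h) * ennreal (\<bar>v \<bullet> T h\<bar> powr p) \<partial>lborel)"
   unfolding G_def by (rule lborel_isometry_invariant[OF T(1), symmetric]) measurable
  also have "... = (\<integral>\<^sup>+h. k h * ennreal (\<bar>e \<bullet> h\<bar> powr p) \<partial>lborel)"
  proof (intro nn_integral_cong_AE)
   have "AE h in lborel. k (T h) = k h" using k T(1) by (simp add: radial_AE_def)
   then show "AE h in lborel. k (T h) * ennreal (\<bar>v \<bullet> T h\<bar> powr p) = k h * ennreal (\<bar>e \<bullet> h\<bar> powr p)"
   proof eventually_elim
    case (elim h)
    have "v \<bullet> T h = e \<bullet> h" using T by (auto simp: orthogonal_transformation_def)
    then show ?case using elim by simp
   qed
  qed
  finally show ?thesis by (simp add: G_def)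
 qed
 have inner: "(\<integral>\<^sup>+z. indicator ?B z * ennreal (\<bar>sgn z \<bullet> h\<bar> powr p) \<partial>lborel) = A * ennreal (norm h powr p)" for h
 proof (cases "h = 0")
  case True
  then show ?thesis using p by simp
 next
  case False
  have v: "norm (sgn h) = 1" using False by (simp add: norm_sgn)
  obtain T where T: "orthogonal_transformation T" "T e = sgn h" using ex_isometry_unit[OF ne v] .
  have "(\<integral>\<^sup>+z. indicator ?B z * ennreal (\<bar>sgn z \<bullet> h\<bar> powr p) \<partial>lborel)
    = (\<integral>\<^sup>+z. indicator ?B (T z) * ennreal (\<bar>sgn (T z) \<bullet> h\<bar> powr p) \<partial>lborel)"
   by (rule lborel_isometry_invariant[OF T(1), symmetric]) measurable
  also have "... = (\<integral>\<^sup>+z. (ennreal (\<bar>sgn z \<bullet> e\<bar> powr p) * indicator ?B z) * ennreal (norm h powr p) \<partial>lborel)"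
  proof (intro nn_integral_cong)
   fix z
   have nT: "norm (T z) = norm z" using T(1) by (rule orthogonal_transformation_norm)
   have h: "h = norm h *\<^sub>R T e" using False unfolding T(2) by (simp add: sgn_div_norm)
   have "sgn (T z) \<bullet> h = norm h * (sgn z \<bullet> e)"
   proof -
    have "T z \<bullet> T e = z \<bullet> e" using T(1) by (auto simp: orthogonal_transformation_def)
    then show ?thesis by (subst h) (simp add: sgn_div_norm nT)
   qed
   then have "\<bar>sgn (T z) \<bullet> h\<bar> powr p = \<bar>sgn z \<bullet> e\<bar> powr p * norm h powr p"
    by (simp add: abs_mult powr_mult)
   then show "indicator ?B (T z) * ennreal (\<bar>sgn (T z) \<bullet> h\<bar> powr p)
     = (ennreal (\<bar>sgn z \<bullet> e\<bar> powr p) * indicator ?B z) * ennreal (norm h powr p)"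
    by (simp add: indicator_def nT ennreal_mult)
  qed
  also have "... = A * ennreal (norm h powr p)"
   unfolding A_def by (rule nn_integral_multc) measurable
  finally show ?thesis .
 qed
 have "emeasure lborel ?B * G e = (\<integral>\<^sup>+z. indicator ?B z * G e \<partial>lborel)"
  by (subst nn_integral_multc) auto
 also have "... = (\<integral>\<^sup>+z. (\<integral>\<^sup>+h. indicator ?B z * (k h * ennreal (\<bar>sgn z \<bullet> h\<bar> powr p)) \<partial>lborel) \<partial>lborel)"
 proof (intro nn_integral_cong_AE)
  have "AE z in lborel. z \<noteq> (0::'a)" by (rule AE_lborel_singleton)
  then show "AE z in lborel. indicator ?B z * G e = (\<integral>\<^sup>+h. indicator ?B z * (k h * ennreal (\<bar>sgn z \<bullet> h\<bar> powr p)) \<partial>lborel)"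
  proof eventually_elim
   case (elim z)
   then have "G (sgn z) = G e" by (intro Gunit) (simp add: norm_sgn)
   then show ?case unfolding G_def by (subst nn_integral_cmult) auto
  qed
 qed
 also have "... = (\<integral>\<^sup>+h. (\<integral>\<^sup>+z. indicator ?B z * (k h * ennreal (\<bar>sgn z \<bullet> h\<bar> powr p)) \<partial>lborel) \<partial>lborel)"
  by (rule lborel_pair.Fubini'[symmetric]) measurable
 also have "... = (\<integral>\<^sup>+h. A * (k h * ennreal (norm h powr p)) \<partial>lborel)"
 proof (intro nn_integral_cong)
  fix h
  have "(\<integral>\<^sup>+z. indicator ?B z * (k h * ennreal (\<bar>sgn z \<bullet> h\<bar> powr p)) \<partial>lborel)
    = (\<integral>\<^sup>+z. k h * (indicator ?B z * ennreal (\<bar>sgn z \<bullet> h\<bar> powr p)) \<partial>lborel)"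
   by (intro nn_integral_cong) (simp add: mult_ac)
  also have "... = k h * (\<integral>\<^sup>+z. indicator ?B z * ennreal (\<bar>sgn z \<bullet> h\<bar> powr p) \<partial>lborel)"
   by (rule nn_integral_cmult) measurable
  also have "... = A * (k h * ennreal (norm h powr p))" unfolding inner by (simp add: mult_ac)
  finally show "(\<integral>\<^sup>+z. indicator ?B z * (k h * ennreal (\<bar>sgn z \<bullet> h\<bar> powr p)) \<partial>lborel) = A * (k h * ennreal (norm h powr p))" .
 qed
 also have "... = A * (\<integral>\<^sup>+h. k h * ennreal (norm h powr p) \<partial>lborel)" by (rule nn_integral_cmult) measurable
 also have "... = emeasure lborel ?B * (ennreal (K_const e p) * (\<integral>\<^sup>+h. k h * ennreal (norm h powr p) \<partial>lborel))"
  unfolding A_def K_const_eq[OF p, symmetric] by (simp add: mult_ac)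
 finally have "emeasure lborel ?B * G e = emeasure lborel ?B * (ennreal (K_const e p) * (\<integral>\<^sup>+h. k h * ennreal (norm h powr p) \<partial>lborel))" .
 moreover have "emeasure lborel ?B \<noteq> 0"
  by (rule emeasure_lborel_ball_ne_0) simp
 moreover have "emeasure lborel ?B \<noteq> \<infinity>" using emeasure_lborel_cball_finite[of "0::'a" 1] by simp
 ultimately have Ge: "G e = ennreal (K_const e p) * (\<integral>\<^sup>+h. k h * ennreal (norm h powr p) \<partial>lborel)"
  using ennreal_mult_cancel_finite by blast
 show ?thesis
 proof (cases "g = 0")
  case True
  then show ?thesis using p by simp
 next
  case False
  have "(\<integral>\<^sup>+h. k h * ennreal (\<bar>g \<bullet> h\<bar> powr p) \<partial>lborel)
    = (\<integral>\<^sup>+h. ennreal (norm g powr p) * (k h * ennreal (\<bar>sgn g \<bullet> h\<bar> powr p)) \<partial>lborel)"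
  proof (intro nn_integral_cong)
   fix h
   have "g \<bullet> h = norm g * (sgn g \<bullet> h)" using False by (simp add: sgn_div_norm)
   then have "\<bar>g \<bullet> h\<bar> powr p = norm g powr p * \<bar>sgn g \<bullet> h\<bar> powr p" by (simp add: abs_mult powr_mult)
   then show "k h * ennreal (\<bar>g \<bullet> h\<bar> powr p) = ennreal (norm g powr p) * (k h * ennreal (\<bar>sgn g \<bullet> h\<bar> powr p))"
    by (simp add: ennreal_mult mult_ac)
  qed
  also have "... = ennreal (norm g powr p) * G (sgn g)" unfolding G_def by (rule nn_integral_cmult) measurable
  also have "G (sgn g) = G e" using False by (intro Gunit) (simp add: norm_sgn)
  finally show ?thesis unfolding Ge by (simp add: ennreal_mult[OF K_const_nonneg powr_ge_zero] mult_ac)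
 qed
qed

section \<open>Energies and increments\<close>

text \<open>
From here on measurability of smooth functions is supplied where needed: as a conditional rule it makes the
measurability prover attempt a smoothness goal at each function.
\<close>
declare smooth_borel [measurable del]

text \<open>
The \<open>p\<close>-th power of the increment of \<open>u\<close> by \<open>h\<close>, over the pairs \<open>(x, x - h)\<close> in \<open>D\<close>.
\<close>
definition osc :: "real => ('a::euclidean_space \<times> 'a) set => ('a => real) => 'a => ennreal" where
 "osc p D u h = (\<integral>\<^sup>+x. ennreal (\<bar>u x - u (x - h)\<bar> powr p) * indicator D (x, x - h) \<partial>lborel)"

lemma borel_measurable_osc:
 assumes [measurable]: "u : Borel" "D : sets (borel \<Otimes>\<^sub>M borel)"
 shows "osc p D u : Borel"
proof -
 have "(%h. \<integral>\<^sup>+x. ennreal (\<bar>u x - u (x - h)\<bar> powr p) * indicator D (x, x - h) \<partial>lborel) : Borel"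
  by (rule lborel.borel_measurable_nn_integral) measurable
 then show ?thesis by (simp add: osc_def[abs_def])
qed

text \<open>
Tonelli after the substitution \<open>y = x - h\<close>; the value of the kernel at 0 is harmless because the increment
vanishes there.
\<close>
lemma energy_eq_osc:
 fixes u u' :: "'a::euclidean_space => real"
 assumes k [measurable]: "k : Borel" and \<kappa>: "AE h in lborel. ennreal (\<kappa> h) = k h"
  and \<kappa>0: "!!h. h \<noteq> 0 ==> 0 <= \<kappa> h"
  and D [measurable]: "D : sets (borel \<Otimes>\<^sub>M borel)" and u' [measurable]: "u' : Borel"
  and ae: "AE x in lborel. x : S --> u x = u' x" and DS: "D \<subseteq> S \<times> S"
 shows "energy p \<kappa> D u = (\<integral>\<^sup>+h. k h * osc p D u' h \<partial>lborel)"
proof -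
 have inner: "(\<integral>\<^sup>+y. ennreal (\<bar>u x - u y\<bar> powr p * \<kappa> (x - y)) * indicator D (x, y) \<partial>lebesgue)
   = (\<integral>\<^sup>+h. k h * (ennreal (\<bar>u' x - u' (x - h)\<bar> powr p) * indicator D (x, x - h)) \<partial>lborel)"
  if x: "x : S --> u x = u' x" for x
 proof -
  have "AE y in lborel. ennreal (\<kappa> (x - y)) = k (x - y)" by (rule AE_reflect[OF \<kappa>])
  moreover have "AE y in lborel. y \<noteq> x" by (rule AE_lborel_singleton)
  ultimately have "AE y in lborel. ennreal (\<bar>u x - u y\<bar> powr p * \<kappa> (x - y)) * indicator D (x, y)
    = k (x - y) * (ennreal (\<bar>u' x - u' (x - (x - y))\<bar> powr p) * indicator D (x, x - (x - y)))"
   using ae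
  proof eventually_elim
   case (elim y)
   show ?case
   proof (cases "(x, y) : D")
    case True
    then have "u x = u' x" "u y = u' y" using DS x elim by auto
    moreover have "0 <= \<kappa> (x - y)" using elim by (intro \<kappa>0) auto
    ultimately show ?thesis using True elim(1) by (simp add: ennreal_mult mult.commute)
   qed simp
  qed
  then have "(\<integral>\<^sup>+y. ennreal (\<bar>u x - u y\<bar> powr p * \<kappa> (x - y)) * indicator D (x, y) \<partial>lebesgue)
   = (\<integral>\<^sup>+y. k (x - y) * (ennreal (\<bar>u' x - u' (x - (x - y))\<bar> powr p) * indicator D (x, x - (x - y))) \<partial>lebesgue)"
   by (intro nn_integral_cong_AE AE_completion)
  also have "... = (\<integral>\<^sup>+y. k (x - y) * (ennreal (\<bar>u' x - u' (x - (x - y))\<bar> powr p) * indicator D (x, x - (x - y))) \<partial>lborel)"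
   by (rule nn_integral_completion)
  also have "... = (\<integral>\<^sup>+h. k h * (ennreal (\<bar>u' x - u' (x - h)\<bar> powr p) * indicator D (x, x - h)) \<partial>lborel)"
   by (rule nn_integral_reflect[of "%h. k h * (ennreal (\<bar>u' x - u' (x - h)\<bar> powr p) * indicator D (x, x - h))"]) measurable
  finally show ?thesis .
 qed
 have "energy p \<kappa> D u = (\<integral>\<^sup>+x. (\<integral>\<^sup>+h. k h * (ennreal (\<bar>u' x - u' (x - h)\<bar> powr p) * indicator D (x, x - h)) \<partial>lborel) \<partial>lebesgue)"
  unfolding energy_def
 proof (intro nn_integral_cong_AE AE_completion, use ae in eventually_elim)
  case (elim x)
  then show ?case by (rule inner)
 qed
 also have "... = (\<integral>\<^sup>+x. (\<integral>\<^sup>+h. k h * (ennreal (\<bar>u' x - u' (x - h)\<bar> powr p) * indicator D (x, x - h)) \<partial>lborel) \<partial>lborel)"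
  by (rule nn_integral_completion)
 also have "... = (\<integral>\<^sup>+h. (\<integral>\<^sup>+x. k h * (ennreal (\<bar>u' x - u' (x - h)\<bar> powr p) * indicator D (x, x - h)) \<partial>lborel) \<partial>lborel)"
  by (rule lborel_pair.Fubini'[symmetric]) measurable
 also have "... = (\<integral>\<^sup>+h. k h * osc p D u' h \<partial>lborel)"
  unfolding osc_def by (intro nn_integral_cong nn_integral_cmult) measurable
 finally show ?thesis .
qed

text \<open>
Isometries preserve null sets, so a Borel kernel equal a.e. to a radial one is a.e. invariant.
\<close>
lemma ex_borel_kernel:
 fixes \<kappa> :: "'a::euclidean_space => real"
 assumes "\<kappa> : borel_measurable (lebesgue_on (- {0}))"
  and radial: "!!h k. h \<noteq> 0 ==> norm h = norm k ==> \<kappa> h = \<kappa> k"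
 obtains k where "radial_AE k" "AE h in lborel. ennreal (\<kappa> h) = k h"
proof -
 obtain k0 where k0: "rep (- {0}) \<kappa> k0" using ex_rep[OF _ assms(1)] by auto
 have [measurable]: "k0 : Borel" using k0 by (rule rep_borel)
 have "AE h in lborel. h \<noteq> (0::'a)" by (rule AE_lborel_singleton)
 moreover have "AE h in lborel. indicator (- {0}) h *\<^sub>R \<kappa> h = k0 h" using k0 by (simp add: rep_def)
 ultimately have ae: "AE h in lborel. h \<noteq> 0 & \<kappa> h = k0 h" by eventually_elim auto
 have "AE h in lborel. ennreal (k0 (T h)) = ennreal (k0 h)" if T: "orthogonal_transformation T" for T
  using ae AE_isometry[OF T ae]
 proof eventually_elim
  case (elim h)
  then have "\<kappa> h = \<kappa> (T h)" using orthogonal_transformation_norm[OF T, of h] by (intro radial) auto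
  then show ?case using elim by simp
 qed
 then have "radial_AE (%h. ennreal (k0 h))" by (simp add: radial_AE_def)
 moreover have "AE h in lborel. ennreal (\<kappa> h) = ennreal (k0 h)" using ae by eventually_elim simp
 ultimately show ?thesis by (rule that)
qed

definition near :: "real => ('a::euclidean_space => ennreal) => real => ennreal" where
 "near p k r = (\<integral>\<^sup>+h. k h * indicator (cball 0 r) h * ennreal (norm h powr p) \<partial>lborel)"

definition tail :: "('a::euclidean_space => ennreal) => real => ennreal" where
 "tail k r = (\<integral>\<^sup>+h. k h * indicator {h. r < norm h} h \<partial>lborel)"

text \<open>
The normalisation makes \<open>near\<close> tend to 1 when \<open>tail\<close> tends to 0 (\<open>near_le_1\<close>, \<open>near_tail_ge_1\<close>).
\<close>
definition levy :: "real => ('a::euclidean_space => ennreal) => bool" where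
 "levy p k \<longleftrightarrow> radial_AE k & (\<integral>\<^sup>+h. k h * ennreal (min 1 (norm h powr p)) \<partial>lborel) = 1"

lemma levy_borel: "levy p k ==> k : Borel"
 by (simp add: levy_def radial_AE_def)

lemma near_le_1:
 assumes p: "1 < p" and k: "levy p k" and r: "r <= 1" shows "near p k r <= 1"
proof -
 have "near p k r <= (\<integral>\<^sup>+h. k h * ennreal (min 1 (norm h powr p)) \<partial>lborel)"
  unfolding near_def
 proof (intro nn_integral_mono)
  fix h :: 'a
  show "k h * indicator (cball 0 r) h * ennreal (norm h powr p) <= k h * ennreal (min 1 (norm h powr p))"
  proof (cases "norm h <= r")
   case True
   then have "norm h powr p <= 1" using r p by (intro powr_le1) auto
   then show ?thesis using True by (simp add: min_absorb2)
  qed simp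
 qed
 then show ?thesis using k by (simp add: levy_def)
qed

lemma near_tail_ge_1:
 assumes p: "1 < p" and k: "levy p k" shows "1 <= near p k r + tail k r"
proof -
 have [measurable]: "k : Borel" using k by (rule levy_borel)
 have "1 = (\<integral>\<^sup>+h. k h * ennreal (min 1 (norm h powr p)) \<partial>lborel)" using k by (simp add: levy_def)
 also have "... <= (\<integral>\<^sup>+h. k h * indicator (cball 0 r) h * ennreal (norm h powr p) + k h * indicator {h. r < norm h} h \<partial>lborel)"
 proof (intro nn_integral_mono)
  fix h :: 'a
  show "k h * ennreal (min 1 (norm h powr p))
   <= k h * indicator (cball 0 r) h * ennreal (norm h powr p) + k h * indicator {h. r < norm h} h"
  proof (cases "norm h <= r")
   case True
   then show ?thesis by (auto intro!: mult_left_mono ennreal_leI)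
  next
   case False
   have "k h * ennreal (min 1 (norm h powr p)) <= k h * 1"
    by (intro mult_left_mono) (auto simp: ennreal_le_1)
   then show ?thesis using False by simp
  qed
 qed
 also have "... = near p k r + tail k r"
  unfolding near_def tail_def by (rule nn_integral_add) measurable
 finally show ?thesis .
qed

lemma directional_energy:
 fixes g :: "'a::euclidean_space => 'a" and e :: 'a
 assumes p: "1 < p" and e: "e : Basis" and k: "levy p k" and g [measurable]: "g : Borel"
  and A [measurable]: "A : sets borel"
 shows "(\<integral>\<^sup>+h. k h * indicator (cball 0 r) h * (\<integral>\<^sup>+x\<in>A. ennreal (\<bar>g x \<bullet> h\<bar> powr p) \<partial>lborel) \<partial>lborel)
   = ennreal (K_const e p) * near p k r * Lpow p A g"
proof -
 have [measurable]: "k : Borel" using k by (rule levy_borel)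
 let ?k = "%h. k h * indicator (cball 0 r) h"
 have rk: "radial_AE ?k"
  unfolding radial_AE_def
 proof (intro conjI allI impI)
  fix T :: "'a => 'a" assume T: "orthogonal_transformation T"
  have "AE h in lborel. k (T h) = k h" using k T by (simp add: levy_def radial_AE_def)
  then show "AE h in lborel. k (T h) * indicator (cball 0 r) (T h) = k h * indicator (cball 0 r) h"
   by eventually_elim (simp add: indicator_def orthogonal_transformation_norm[OF T])
 qed measurable
 have [measurable]: "?k : Borel" by measurable
 have "(\<integral>\<^sup>+h. ?k h * (\<integral>\<^sup>+x\<in>A. ennreal (\<bar>g x \<bullet> h\<bar> powr p) \<partial>lborel) \<partial>lborel)
  = (\<integral>\<^sup>+h. (\<integral>\<^sup>+x. ?k h * (ennreal (\<bar>g x \<bullet> h\<bar> powr p) * indicator A x) \<partial>lborel) \<partial>lborel)"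
  by (intro nn_integral_cong nn_integral_cmult[symmetric]) measurable
 also have "... = (\<integral>\<^sup>+x. (\<integral>\<^sup>+h. ?k h * (ennreal (\<bar>g x \<bullet> h\<bar> powr p) * indicator A x) \<partial>lborel) \<partial>lborel)"
  by (rule lborel_pair.Fubini') measurable
 also have "... = (\<integral>\<^sup>+x. (ennreal (K_const e p) * near p k r) * (ennreal (norm (g x) powr p) * indicator A x) \<partial>lborel)"
 proof (intro nn_integral_cong)
  fix x
  have "(\<integral>\<^sup>+h. ?k h * (ennreal (\<bar>g x \<bullet> h\<bar> powr p) * indicator A x) \<partial>lborel)
    = (\<integral>\<^sup>+h. (?k h * ennreal (\<bar>g x \<bullet> h\<bar> powr p)) * indicator A x \<partial>lborel)"
   by (simp add: mult.assoc)
  also have "... = (\<integral>\<^sup>+h. ?k h * ennreal (\<bar>g x \<bullet> h\<bar> powr p) \<partial>lborel) * indicator A x"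
   by (rule nn_integral_multc) measurable
  also have "(\<integral>\<^sup>+h. ?k h * ennreal (\<bar>g x \<bullet> h\<bar> powr p) \<partial>lborel)
   = ennreal (K_const e p * norm (g x) powr p) * (\<integral>\<^sup>+h. ?k h * ennreal (norm h powr p) \<partial>lborel)"
   by (rule radial_directional_integral[OF p e rk]) measurable
  finally show "(\<integral>\<^sup>+h. ?k h * (ennreal (\<bar>g x \<bullet> h\<bar> powr p) * indicator A x) \<partial>lborel)
   = (ennreal (K_const e p) * near p k r) * (ennreal (norm (g x) powr p) * indicator A x)"
   by (simp add: near_def ennreal_mult[OF K_const_nonneg powr_ge_zero] mult_ac)
 qed
 also have "... = ennreal (K_const e p) * near p k r * Lpow p A g"
  unfolding Lpow_def by (rule nn_integral_cmult) measurable
 finally show ?thesis .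
qed

lemma conv_translate:
 assumes "\<phi> : Borel" "u : Borel"
 shows "conv \<phi> (%y. u (y - z)) x = conv \<phi> u (x - z)"
proof -
 have "(%y. u (y - z)) : Borel" using assms by measurable
 then show ?thesis using assms by (simp add: conv_reflect algebra_simps)
qed

lemma conv_diff:
 assumes "\<phi> : test_functions \<O>" "loc_int u" "loc_int v"
 shows "conv \<phi> (%y. u y - v y) x = conv \<phi> u x - conv \<phi> v x"
 unfolding conv_def scaleR_diff_right
 by (rule Bochner_Integration.integral_diff) (use integrable_conv[OF assms(1)] assms in auto)

lemma loc_int_translate:
 fixes u :: "'a::euclidean_space => 'b::euclidean_space"
 assumes "loc_int u" shows "loc_int (%x. u (x - z))"
proof -
 have [measurable]: "u : Borel" using assms by (rule loc_int_borel)
 have "(\<integral>\<^sup>+x\<in>cball 0 R. ennreal (norm (u (x - z))) \<partial>lborel) < \<infinity>" for R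
 proof -
  have "(\<integral>\<^sup>+x\<in>cball 0 R. ennreal (norm (u (x - z))) \<partial>lborel)
    = (\<integral>\<^sup>+x. ennreal (norm (u (x + - z))) * indicator (cball (- z) R) (x + - z) \<partial>lborel)"
   by (intro nn_integral_cong) (auto simp: indicator_def dist_norm norm_minus_commute)
  also have "... = (\<integral>\<^sup>+x\<in>cball (- z) R. ennreal (norm (u x)) \<partial>lborel)"
   by (rule nn_integral_translate[of "%x. ennreal (norm (u x)) * indicator (cball (- z) R) x"]) measurable
  also have "... < \<infinity>" by (rule loc_int_cball[OF assms])
  finally show ?thesis .
 qed
 then show ?thesis by (simp add: loc_int_def)
qed

lemma AE_translate:
 fixes h :: "'a::euclidean_space"
 assumes "AE x in lborel. P x" shows "AE x in lborel. P (x - h)"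
 using AE_reflect[OF AE_reflect[OF assms, of 0], of h] by simp

text \<open>
The remainder is the mean over \<open>t\<close> of \<open>(grad v (x - t h) - grad v x) \<bullet> h\<close>.
\<close>
lemma smooth_increment_Lpow:
 fixes v :: "'a::euclidean_space => real"
 assumes p: "1 < p" and v: "smooth v" and \<omega>: "!!t. 0 <= t ==> t <= 1 ==> Lpow p UNIV (%x. grad v (x - t *\<^sub>R h) - grad v x) <= \<omega>"
 shows "Lpow p UNIV (%x. v x - v (x - h) - grad v x \<bullet> h) <= ennreal (norm h powr p) * \<omega>"
proof -
 have gc: "continuous_on UNIV (grad v)"
  unfolding grad_def[abs_def]
  by (intro continuous_on_sum continuous_on_scaleR smooth_continuous smooth_partial[OF v] continuous_on_const)
 then have gm [measurable]: "grad v : Borel" by (rule borel_measurable_continuous_onI)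
 let ?M = "restrict_space lborel {0..1::real}"
 have M1: "emeasure ?M (space ?M) = 1" by (subst emeasure_restrict_space) auto
 have pt: "ennreal (norm (v x - v (x - h) - grad v x \<bullet> h) powr p)
   <= (\<integral>\<^sup>+t. ennreal (norm h powr p) * ennreal (norm (grad v (x - t *\<^sub>R h) - grad v x) powr p) * indicator {0..1} t \<partial>lborel)" for x
 proof -
  let ?f = "%t. (grad v (x - t *\<^sub>R h) - grad v x) \<bullet> h"
  let ?F = "%t. - v (x - t *\<^sub>R h) - t * (grad v x \<bullet> h)"
  have der: "(?F has_vector_derivative ?f t) (at t within {0..1})" for t
  proof -
   have "((%t. x - t *\<^sub>R h) has_derivative (%s. - (s *\<^sub>R h))) (at t)" by (auto intro!: derivative_eq_intros)
   note D = has_derivative_compose[OF this smooth_has_derivative_grad[OF v]]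
   have "(?F has_derivative (%s. - (grad v (x - t *\<^sub>R h) \<bullet> - (s *\<^sub>R h)) - s * (grad v x \<bullet> h))) (at t)"
    by (intro has_derivative_diff has_derivative_minus D) (auto intro!: derivative_eq_intros)
   then have "(?F has_derivative (%s. s *\<^sub>R ?f t)) (at t)"
    by (simp add: inner_diff_left algebra_simps)
   then show ?thesis by (simp add: has_vector_derivative_def has_derivative_at_withinI)
  qed
  have fc: "continuous_on {0..1} ?f"
   by (intro continuous_intros continuous_on_compose2[OF gc]) auto
  have "(\<integral>t. indicator {0..1} t *\<^sub>R ?f t \<partial>lborel) = ?F 1 - ?F 0"
   by (rule integral_FTC_Icc[OF _ der fc]) auto
  then have "v x - v (x - h) - grad v x \<bullet> h = (\<integral>t. ?f t \<partial>?M)"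
   by (subst integral_restrict_space) auto
  then have "ennreal (norm (v x - v (x - h) - grad v x \<bullet> h) powr p) = ennreal (norm (\<integral>t. ?f t \<partial>?M) powr p)" by simp
  also have "... <= (\<integral>\<^sup>+t. ennreal (norm (?f t) powr p) \<partial>?M)"
  proof (rule jensen_norm_powr[OF M1 p])
   have "continuous_on UNIV ?f"
    by (intro continuous_intros continuous_on_compose2[OF gc]) auto
   then have "?f : Borel" by (rule borel_measurable_continuous_onI)
   then show "?f : borel_measurable ?M" by (intro measurable_restrict_space1) simp
  qed
  also have "... = (\<integral>\<^sup>+t. ennreal (norm (?f t) powr p) * indicator {0..1} t \<partial>lborel)"
   by (rule nn_integral_restrict_space) auto
  also have "... <= (\<integral>\<^sup>+t. ennreal (norm h powr p) * ennreal (norm (grad v (x - t *\<^sub>R h) - grad v x) powr p) * indicator {0..1} t \<partial>lborel)"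
  proof (intro nn_integral_mono mult_right_mono)
   fix t
   have "norm (?f t) powr p <= (norm (grad v (x - t *\<^sub>R h) - grad v x) * norm h) powr p"
    using p Cauchy_Schwarz_ineq2 by (intro powr_mono2) auto
   then show "ennreal (norm (?f t) powr p) <= ennreal (norm h powr p) * ennreal (norm (grad v (x - t *\<^sub>R h) - grad v x) powr p)"
    by (simp add: powr_mult mult.commute ennreal_leI flip: ennreal_mult)
  qed simp
  finally show ?thesis .
 qed
 have "Lpow p UNIV (%x. v x - v (x - h) - grad v x \<bullet> h)
  <= (\<integral>\<^sup>+x. (\<integral>\<^sup>+t. ennreal (norm h powr p) * ennreal (norm (grad v (x - t *\<^sub>R h) - grad v x) powr p) * indicator {0..1} t \<partial>lborel) \<partial>lborel)"
  unfolding Lpow_def indicator_UNIV mult_1_right by (intro nn_integral_mono pt)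
 also have "... = (\<integral>\<^sup>+t. (\<integral>\<^sup>+x. ennreal (norm h powr p) * ennreal (norm (grad v (x - t *\<^sub>R h) - grad v x) powr p) * indicator {0..1} t \<partial>lborel) \<partial>lborel)"
  by (rule lborel_pair.Fubini'[symmetric]) measurable
 also have "... <= (\<integral>\<^sup>+t. (ennreal (norm h powr p) * \<omega>) * indicator {0..1} t \<partial>(lborel :: real measure))"
 proof (intro nn_integral_mono)
  fix t :: real
  have "(\<integral>\<^sup>+x. ennreal (norm h powr p) * ennreal (norm (grad v (x - t *\<^sub>R h) - grad v x) powr p) * indicator {0..1} t \<partial>lborel)
   = ennreal (norm h powr p) * Lpow p UNIV (%x. grad v (x - t *\<^sub>R h) - grad v x) * indicator {0..1} t"
   unfolding Lpow_def indicator_UNIV mult_1_right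
   by (subst nn_integral_multc, measurable, subst nn_integral_cmult, measurable)
  also have "... <= (ennreal (norm h powr p) * \<omega>) * indicator {0..1} t"
   using \<omega>[of t] by (cases "t : {0..1}") (auto intro!: mult_left_mono)
  finally show "(\<integral>\<^sup>+x. ennreal (norm h powr p) * ennreal (norm (grad v (x - t *\<^sub>R h) - grad v x) powr p) * indicator {0..1} t \<partial>lborel)
    <= (ennreal (norm h powr p) * \<omega>) * indicator {0..1} t" .
 qed
 also have "... = ennreal (norm h powr p) * \<omega>"
  by (subst nn_integral_cmult) auto
 finally show ?thesis .
qed

text \<open>
Mollification does not enlarge the modulus \<open>\<omega>\<close>, so mollifications satisfy the bound by the smooth case; then
let the mollification radius tend to 0.
\<close>
lemma sobolev_increment_Lpow:
 fixes u :: "'a::euclidean_space => real"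
 assumes p: "1 < p" and wg: "wgrad UNIV u g" and fin: "Lpow p UNIV u < \<infinity>" "Lpow p UNIV g < \<infinity>"
  and \<omega>: "!!t. 0 <= t ==> t <= 1 ==> Lpow p UNIV (%x. g (x - t *\<^sub>R h) - g x) <= \<omega>"
 shows "Lpow p UNIV (%x. u x - u (x - h) - g x \<bullet> h) <= ennreal (norm h powr p) * \<omega>"
proof -
 have loc: "loc_int u" "loc_int g" using wg by (auto simp: wgrad_def)
 have um [measurable]: "u : Borel" and gm [measurable]: "g : Borel"
  using loc by (auto simp: loc_int_def)
 have "\<exists>\<delta>>0. Lpow p UNIV (%x. conv (mollifier \<delta>) u x - u x) <= ennreal ((1/2) ^ n) &
   Lpow p UNIV (%x. conv (mollifier \<delta>) g x - g x) <= ennreal ((1/2) ^ n)" for n :: nat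
 proof -
  have pos: "0 < (1/2 :: real) ^ n" by simp
  obtain d1 where d1: "0 < d1" "!!\<delta>. 0 < \<delta> ==> \<delta> < d1 ==> Lpow p UNIV (%x. conv (mollifier \<delta>) u x - u x) <= ennreal ((1/2) ^ n)"
   using Lpow_conv_mollifier_approx[OF p um fin(1) pos] by blast
  obtain d2 where d2: "0 < d2" "!!\<delta>. 0 < \<delta> ==> \<delta> < d2 ==> Lpow p UNIV (%x. conv (mollifier \<delta>) g x - g x) <= ennreal ((1/2) ^ n)"
   using Lpow_conv_mollifier_approx[OF p gm fin(2) pos] by blast
  show ?thesis using d1 d2 by (intro exI[of _ "min d1 d2 / 2"]) auto
 qed
 then obtain \<delta> where \<delta>: "!!n. 0 < \<delta> n" "!!n. Lpow p UNIV (%x. conv (mollifier (\<delta> n)) u x - u x) <= ennreal ((1/2) ^ n)"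
   "!!n. Lpow p UNIV (%x. conv (mollifier (\<delta> n)) g x - g x) <= ennreal ((1/2) ^ n)"
  by metis
 define v where "v = (%n. conv (mollifier (\<delta> n)) u)"
 define G where "G = (%n. conv (mollifier (\<delta> n)) g)"
 have vm [measurable]: "v n : Borel" and Gm [measurable]: "G n : Borel" for n
  unfolding v_def G_def using borel_mollifier[OF \<delta>(1)] by (auto intro!: borel_measurable_conv)
 have vs: "smooth (v n)" for n unfolding v_def by (rule smooth_conv[OF mollifier_test_UNIV[OF \<delta>(1)] loc(1)])
 have gv: "grad (v n) = G n" for n
  unfolding v_def G_def using grad_conv_wgrad[OF wg \<delta>(1)] by auto
 have ae1: "AE x in lborel. (%n. v n x - u x) \<longlonglongrightarrow> 0"
 proof (rule Lpow_summable_AE_tendsto_0[OF p])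
  show "Lpow p UNIV (%x. v n x - u x) <= ennreal ((1/2) ^ n)" for n unfolding v_def by (rule \<delta>(2))
 qed (rule borel_measurable_diff[OF vm um])
 have ae2: "AE x in lborel. (%n. G n x - g x) \<longlonglongrightarrow> 0"
 proof (rule Lpow_summable_AE_tendsto_0[OF p])
  show "Lpow p UNIV (%x. G n x - g x) <= ennreal ((1/2) ^ n)" for n unfolding G_def by (rule \<delta>(3))
 qed (rule borel_measurable_diff[OF Gm gm])
 show ?thesis
 proof (rule Lpow_Fatou[where p=p and A=UNIV and v="%n x. v n x - v n (x - h) - G n x \<bullet> h"
    and w="%x. u x - u (x - h) - g x \<bullet> h" and c="ennreal (norm h powr p) * \<omega>", OF p])
  show "AE x in lborel. x : UNIV --> (%n. v n x - v n (x - h) - G n x \<bullet> h) \<longlonglongrightarrow> u x - u (x - h) - g x \<bullet> h"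
   using ae1 ae2 AE_translate[OF ae1, of h]
  proof eventually_elim
   case (elim x)
   have "(%n. v n x) \<longlonglongrightarrow> u x" "(%n. G n x) \<longlonglongrightarrow> g x" "(%n. v n (x - h)) \<longlonglongrightarrow> u (x - h)"
    by (rule LIM_zero_cancel, rule elim)+
   then show ?case by (intro impI tendsto_intros)
  qed
  show "\<forall>\<^sub>F n in sequentially. Lpow p UNIV (%x. v n x - v n (x - h) - G n x \<bullet> h) <= ennreal (norm h powr p) * \<omega>"
  proof (intro always_eventually allI)
   fix n
   note mt = mollifier_test_UNIV[OF \<delta>(1)[of n], where 'a='a]
   have "Lpow p UNIV (%x. v n x - v n (x - h) - grad (v n) x \<bullet> h) <= ennreal (norm h powr p) * \<omega>"
   proof (rule smooth_increment_Lpow[OF p vs])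
    fix t :: real assume t: "0 <= t" "t <= 1"
    have "grad (v n) (x - t *\<^sub>R h) - grad (v n) x = conv (mollifier (\<delta> n)) (%y. g (y - t *\<^sub>R h) - g y) x" for x
     unfolding gv G_def conv_diff[OF mt loc_int_translate[OF loc(2)] loc(2)]
      conv_translate[OF borel_mollifier[OF \<delta>(1)] gm] ..
    then have "Lpow p UNIV (%x. grad (v n) (x - t *\<^sub>R h) - grad (v n) x)
      = Lpow p UNIV (conv (mollifier (\<delta> n)) (%y. g (y - t *\<^sub>R h) - g y))" by simp
    also have "... <= Lpow p UNIV (%y. g (y - t *\<^sub>R h) - g y)"
     by (rule Lpow_conv_mollifier_le[OF p \<delta>(1)]) auto
    also have "... <= \<omega>" by (rule \<omega>[OF t])
    finally show "Lpow p UNIV (%x. grad (v n) (x - t *\<^sub>R h) - grad (v n) x) <= \<omega>" .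
   qed
   then show "Lpow p UNIV (%x. v n x - v n (x - h) - G n x \<bullet> h) <= ennreal (norm h powr p) * \<omega>"
    by (simp add: gv)
  qed
 qed measurable
qed

section \<open>Energies compared with gradients\<close>

lemma osc_Times_UNIV: "osc p (A \<times> UNIV) u h = Lpow p A (%x. u x - u (x - h))"
 unfolding osc_def Lpow_def by (intro nn_integral_cong) (auto simp: indicator_def)

text \<open>
Small \<open>h\<close>: the increment is \<open>g \<bullet> h\<close> up to a small multiple of \<open>|h|\<close> in \<open>L\<^sup>p\<close>, and \<open>directional_energy\<close> evaluates
the main term. Large \<open>h\<close>: the increment is bounded in \<open>L\<^sup>p\<close>, which costs a multiple of the tail. The radius
and the constant are chosen before the kernel, hence serve a whole family at once.
\<close>
lemma energy_upper:
 fixes u :: "'a::euclidean_space => real" and e :: 'a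
 assumes p: "1 < p" and e: "e : Basis" and wg: "wgrad UNIV u g"
  and fin: "Lpow p UNIV u < \<infinity>" "Lpow p UNIV g < \<infinity>" and \<eta>: "0 < \<eta>" and \<theta>: "0 < \<theta>"
 shows "\<exists>r C. 0 < r & 0 <= C & (\<forall>k A. levy p k --> A : sets borel -->
   (\<integral>\<^sup>+h. k h * osc p (A \<times> UNIV) u h \<partial>lborel)
    <= ennreal (1 + \<eta>) * (ennreal (K_const e p) * Lpow p A g) + ennreal \<theta> + ennreal C * tail k r)"
proof -
 have loc: "loc_int u" "loc_int g" using wg by (auto simp: wgrad_def)
 have um [measurable]: "u : Borel" and gm [measurable]: "g : Borel"
  using loc by (auto simp: loc_int_def)
 obtain C1 where C1: "0 <= C1" "\<forall>A\<in>sets borel. \<forall>v\<in>Borel. \<forall>w\<in>Borel.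
   Lpow p A (%x::'a. v x + w x :: real) <= ennreal (1 + \<eta>) * Lpow p A v + ennreal C1 * Lpow p A w"
  using Lpow_add_le[OF p \<eta>] by blast
 obtain C2 where C2: "0 <= C2" "\<forall>v w. v : Borel --> w : Borel -->
   Lpow p UNIV (%x::'a. v x + w x :: real) <= ennreal 2 * Lpow p UNIV v + ennreal C2 * Lpow p UNIV w"
  using Lpow_add_le2[OF p] by blast
 define \<omega> where "\<omega> = \<theta> / (C1 + 1)"
 have \<omega>: "0 < \<omega>" using \<theta> C1(1) by (simp add: \<omega>_def)
 have "C1 * \<omega> <= \<omega> * (C1 + 1)" using \<omega> by (simp add: algebra_simps)
 also have "\<omega> * (C1 + 1) = \<theta>" using C1(1) by (simp add: \<omega>_def)
 finally have C1\<omega>: "C1 * \<omega> <= \<theta>" .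
 obtain \<delta> where \<delta>: "0 < \<delta>" "!!h. norm h < \<delta> ==> Lpow p UNIV (%x. g (x + h) - g x) <= ennreal \<omega>"
  using Lpow_translation_continuous[OF p gm fin(2) \<omega>] by blast
 define r where "r = min (\<delta> / 2) 1"
 have r: "0 < r" "r <= 1" "r < \<delta>" using \<delta>(1) by (auto simp: r_def)
 define C where "C = enn2real (ennreal (2 + C2) * Lpow p UNIV u)"
 have C: "ennreal (2 + C2) * Lpow p UNIV u = ennreal C"
  unfolding C_def using fin(1) by (simp add: ennreal_mult_less_top)
 have main: "(\<integral>\<^sup>+h. k h * osc p (A \<times> UNIV) u h \<partial>lborel)
    <= ennreal (1 + \<eta>) * (ennreal (K_const e p) * Lpow p A g) + ennreal \<theta> + ennreal C * tail k r"
  if k: "levy p k" and A [measurable]: "A : sets borel" for k A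
 proof -
  have km [measurable]: "k : Borel" using k by (rule levy_borel)
  let ?I = "%h. \<integral>\<^sup>+x\<in>A. ennreal (\<bar>g x \<bullet> h\<bar> powr p) \<partial>lborel"
  have Im [measurable]: "?I : Borel"
   by (rule lborel.borel_measurable_nn_integral) measurable
  have near: "osc p (A \<times> UNIV) u h <= ennreal (1 + \<eta>) * ?I h + ennreal \<theta> * ennreal (norm h powr p)"
   if h: "norm h <= r" for h
  proof -
   have inc: "Lpow p UNIV (%x. u x - u (x - h) - g x \<bullet> h) <= ennreal (norm h powr p) * ennreal \<omega>"
   proof (rule sobolev_increment_Lpow[OF p wg fin])
    fix t :: real assume t: "0 <= t" "t <= 1"
    have "norm (- (t *\<^sub>R h)) <= 1 * r" unfolding norm_minus_cancel norm_scaleR using t h by (intro mult_mono) auto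
    then show "Lpow p UNIV (%x. g (x - t *\<^sub>R h) - g x) <= ennreal \<omega>"
     using \<delta>(2)[of "- (t *\<^sub>R h)"] r(3) by simp
   qed
   have "osc p (A \<times> UNIV) u h = Lpow p A (%x. g x \<bullet> h + (u x - u (x - h) - g x \<bullet> h))"
    by (simp add: osc_Times_UNIV)
   also have "... <= ennreal (1 + \<eta>) * Lpow p A (%x. g x \<bullet> h) + ennreal C1 * Lpow p A (%x. u x - u (x - h) - g x \<bullet> h)"
    by (rule C1(2)[rule_format, OF A]) measurable
   also have "... <= ennreal (1 + \<eta>) * ?I h + ennreal C1 * (ennreal (norm h powr p) * ennreal \<omega>)"
    by (intro add_mono mult_left_mono order_trans[OF Lpow_mono_set inc]) (auto simp: Lpow_def)
   also have "ennreal C1 * (ennreal (norm h powr p) * ennreal \<omega>) = ennreal (C1 * \<omega>) * ennreal (norm h powr p)"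
    using C1(1) \<omega> by (simp add: ennreal_mult mult_ac)
   also have "ennreal (1 + \<eta>) * ?I h + ... <= ennreal (1 + \<eta>) * ?I h + ennreal \<theta> * ennreal (norm h powr p)"
    using C1\<omega> by (intro add_left_mono mult_right_mono ennreal_leI) auto
   finally show ?thesis .
  qed
  have far: "osc p (A \<times> UNIV) u h <= ennreal C" for h
  proof -
   have "osc p (A \<times> UNIV) u h <= Lpow p UNIV (%x. u x + - u (x - h))"
    unfolding osc_Times_UNIV using Lpow_mono_set[of A UNIV p "%x. u x - u (x - h)"] by simp
   also have "... <= ennreal 2 * Lpow p UNIV u + ennreal C2 * Lpow p UNIV (%x. - u (x - h))"
    by (rule C2(2)[rule_format]) measurable
   also have "Lpow p UNIV (%x. - u (x - h)) = Lpow p UNIV u"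
    using Lpow_translate[OF um, of p "- h"] by (simp add: Lpow_uminus)
   also have "ennreal 2 * Lpow p UNIV u + ennreal C2 * Lpow p UNIV u = ennreal (2 + C2) * Lpow p UNIV u"
    using C2(1) by (simp add: ennreal_plus distrib_right)
   finally show ?thesis unfolding C .
  qed
  have "(\<integral>\<^sup>+h. k h * osc p (A \<times> UNIV) u h \<partial>lborel)
   <= (\<integral>\<^sup>+h. (ennreal (1 + \<eta>) * (k h * indicator (cball 0 r) h * ?I h)
     + ennreal \<theta> * (k h * indicator (cball 0 r) h * ennreal (norm h powr p)))
     + ennreal C * (k h * indicator {h. r < norm h} h) \<partial>lborel)"
  proof (intro nn_integral_mono)
   fix h
   show "k h * osc p (A \<times> UNIV) u h <= (ennreal (1 + \<eta>) * (k h * indicator (cball 0 r) h * ?I h)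
     + ennreal \<theta> * (k h * indicator (cball 0 r) h * ennreal (norm h powr p)))
     + ennreal C * (k h * indicator {h. r < norm h} h)"
   proof (cases "norm h <= r")
    case True
    then have "k h * osc p (A \<times> UNIV) u h <= k h * (ennreal (1 + \<eta>) * ?I h + ennreal \<theta> * ennreal (norm h powr p))"
     by (intro mult_left_mono near) auto
    also have "... = ennreal (1 + \<eta>) * (k h * ?I h) + ennreal \<theta> * (k h * ennreal (norm h powr p))"
     by (simp only: distrib_left mult_ac)
    finally show ?thesis using True by simp
   next
    case False
    have "k h * osc p (A \<times> UNIV) u h <= k h * ennreal C" by (intro mult_left_mono far) auto
    then show ?thesis using False by (simp add: mult.commute)
   qed
  qed
  also have "... = (ennreal (1 + \<eta>) * (\<integral>\<^sup>+h. k h * indicator (cball 0 r) h * ?I h \<partial>lborel) + ennreal \<theta> * near p k r) + ennreal C * tail k r"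
   unfolding near_def tail_def
   by (subst nn_integral_add, measurable, subst nn_integral_add_cmult, measurable, subst nn_integral_cmult, measurable)
  also have "... <= (ennreal (1 + \<eta>) * (ennreal (K_const e p) * 1 * Lpow p A g) + ennreal \<theta> * 1) + ennreal C * tail k r"
   unfolding directional_energy[OF p e k gm A]
   using near_le_1[OF p k r(2)] by (intro add_mono mult_mono mult_left_mono order_refl) auto
  finally show ?thesis by simp
 qed
 have "0 <= C" by (simp add: C_def)
 with r(1) main show ?thesis by blast
qed

text \<open>
The reverse comparison, uniform in \<open>u\<close>. The Taylor expansion of \<open>conv (mollifier \<delta>) u\<close> has an error of order
\<open>|h|\<^sup>2\<close> controlled by the \<open>L\<^sup>p\<close> norm of \<open>u\<close>, and the increments of the mollification on \<open>A\<close> are averages of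
increments of \<open>u\<close> between points of \<open>B\<close>.
\<close>
lemma energy_lower:
 fixes A B :: "'a::euclidean_space set" and e :: 'a
 assumes p: "1 < p" and e: "e : Basis" and \<delta>: "0 < \<delta>"
  and A [measurable]: "A : sets borel" and bA: "bounded A" and B [measurable]: "B : sets borel"
  and AB: "!!x y. x : A ==> norm y < 2 * \<delta> ==> x - y : B" and \<eta>: "0 < \<eta>" and \<theta>: "0 < \<theta>"
 shows "\<exists>r>0. \<forall>k u. levy p k --> u : Borel --> Lpow p UNIV u <= 1 -->
   ennreal (K_const e p) * near p k r * Lpow p A (grad (conv (mollifier \<delta>) u))
    <= ennreal (1 + \<eta>) * (\<integral>\<^sup>+h. k h * osc p (B \<times> B) u h \<partial>lborel) + ennreal \<theta>"
proof -
 note mt = mollifier_test_UNIV[OF \<delta>, where 'a='a]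
 obtain C1 where C1: "0 <= C1" "\<forall>A\<in>sets borel. \<forall>v\<in>Borel. \<forall>w\<in>Borel.
   Lpow p A (%x::'a. v x + w x :: real) <= ennreal (1 + \<eta>) * Lpow p A v + ennreal C1 * Lpow p A w"
  using Lpow_add_le[OF p \<eta>] by blast
 obtain C R where CR: "0 <= C" "!!u :: 'a => real. !!x h. loc_int u ==> norm h <= 1 ==>
   \<bar>conv (mollifier \<delta>) u (x + h) - conv (mollifier \<delta>) u x - (\<Sum>b\<in>Basis. conv (partial b (mollifier \<delta>)) u x *\<^sub>R b) \<bullet> h\<bar>
    <= C * enn2real (\<integral>\<^sup>+y\<in>cball x R. ennreal \<bar>u y\<bar> \<partial>lborel) * (norm h)\<^sup>2"
  using conv_taylor[OF mt] by blast
 define c where "c = C * (measure lborel (cball (0::'a) R) + 1)"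
 have c0: "0 <= c" using CR(1) by (simp add: c_def)
 obtain R0 where R0: "A \<subseteq> cball 0 R0" using bA unfolding bounded_iff by (force simp: subset_iff)
 define V where "V = measure lborel (cball (0::'a) R0)"
 have V: "emeasure lborel (cball (0::'a) R0) = ennreal V"
  unfolding V_def using emeasure_lborel_cball_finite[of "0::'a" R0] by (intro emeasure_eq_ennreal_measure) simp
 have V0: "0 <= V" by (simp add: V_def)
 \<comment> \<open>the Taylor error is at most \<open>s |h|\<close> for \<open>|h| <= r\<close>, and its \<open>p\<close>-th power integrates over \<open>A\<close> to at most \<open>\<theta> / C1\<close>\<close>
 define s where "s = (\<theta> / ((C1 + 1) * (V + 1))) powr (1 / p)"
 have s0: "0 < s" using \<theta> C1(1) V0 by (simp add: s_def)
 have sp: "s powr p = \<theta> / ((C1 + 1) * (V + 1))"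
  using \<theta> C1(1) V0 p by (simp add: s_def powr_powr)
 define r where "r = min (min 1 \<delta>) (s / (c + 1))"
 have r: "0 < r" "r <= 1" "r <= \<delta>" using \<delta> s0 c0 by (auto simp: r_def)
 have cr: "c * r <= s"
 proof -
  have "c * r <= (c + 1) * (s / (c + 1))" using c0 r(1) s0 by (intro mult_mono) (auto simp: r_def)
  also have "... = s" using c0 by simp
  finally show ?thesis .
 qed
 have C1s: "C1 * (s powr p * V) <= \<theta>"
 proof -
  have "C1 * (s powr p * V) <= (C1 + 1) * (s powr p * (V + 1))"
   using C1(1) V0 by (intro mult_mono) auto
  also have "... = \<theta>" unfolding sp using C1(1) V0 by simp
  finally show ?thesis .
 qed
 have main: "ennreal (K_const e p) * near p k r * Lpow p A (grad (conv (mollifier \<delta>) u))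
    <= ennreal (1 + \<eta>) * (\<integral>\<^sup>+h. k h * osc p (B \<times> B) u h \<partial>lborel) + ennreal \<theta>"
  if k: "levy p k" and u [measurable]: "u : Borel" and u1: "Lpow p UNIV u <= 1" for k u
 proof -
  have km [measurable]: "k : Borel" using k by (rule levy_borel)
  have loc: "loc_int u" using u1 by (intro Lpow_finite_loc_int[OF p u]) (auto intro: le_less_trans)
  define v where "v = conv (mollifier \<delta>) u"
  have vs: "smooth v" unfolding v_def by (rule smooth_conv[OF mt loc])
  have vm [measurable]: "v : Borel" using vs by (rule smooth_borel)
  have "continuous_on UNIV (grad v)"
   unfolding grad_def[abs_def]
   by (intro continuous_on_sum continuous_on_scaleR smooth_continuous smooth_partial[OF vs] continuous_on_const)
  then have gm [measurable]: "grad v : Borel" by (rule borel_measurable_continuous_onI)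
  have tay: "\<bar>v (x - h) - v x + grad v x \<bullet> h\<bar> <= c * (norm h)\<^sup>2" if h: "norm h <= 1" for x h
  proof -
   have "(\<integral>\<^sup>+y\<in>cball x R. ennreal \<bar>u y\<bar> \<partial>lborel) <= emeasure lborel (cball x R) + Lpow p UNIV u"
    using nn_integral_cball_le_Lpow[OF p u, of x R] by simp
   also have "... <= ennreal (measure lborel (cball (0::'a) R) + 1)"
   proof -
    have "emeasure lborel (cball x R) = (\<integral>\<^sup>+y. indicator (cball x R) y \<partial>lborel)" by simp
    also have "... = (\<integral>\<^sup>+y. indicator (cball x R) (y + x) \<partial>lborel)"
     by (rule nn_integral_translate[symmetric]) measurable
    also have "... = (\<integral>\<^sup>+y. indicator (cball (0::'a) R) y \<partial>lborel)"
     by (intro nn_integral_cong) (auto simp: indicator_def dist_norm)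
    also have "... = ennreal (measure lborel (cball (0::'a) R))"
     using emeasure_lborel_cball_finite[of "0::'a" R] by (simp add: emeasure_eq_ennreal_measure)
    finally show ?thesis using u1 by (simp add: ennreal_plus add_left_mono)
   qed
   finally have "enn2real (\<integral>\<^sup>+y\<in>cball x R. ennreal \<bar>u y\<bar> \<partial>lborel) <= measure lborel (cball (0::'a) R) + 1"
    by (intro enn2real_leI) auto
   then have "C * enn2real (\<integral>\<^sup>+y\<in>cball x R. ennreal \<bar>u y\<bar> \<partial>lborel) * (norm h)\<^sup>2 <= c * (norm h)\<^sup>2"
    unfolding c_def using CR(1) by (intro mult_right_mono mult_left_mono) auto
   then show ?thesis
    using CR(2)[OF loc, of "- h" x] h unfolding v_def grad_conv[OF mt loc] by simp
  qed
  let ?I = "%h. \<integral>\<^sup>+x\<in>A. ennreal (\<bar>grad v x \<bullet> h\<bar> powr p) \<partial>lborel"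
  have near: "?I h <= ennreal (1 + \<eta>) * osc p (B \<times> B) u h + ennreal \<theta> * ennreal (norm h powr p)"
   if h: "norm h <= r" for h
  proof -
   have rest: "Lpow p A (%x. v (x - h) - v x + grad v x \<bullet> h) <= ennreal (s powr p * V) * ennreal (norm h powr p)"
   proof -
    have "Lpow p A (%x. v (x - h) - v x + grad v x \<bullet> h) \<le>
      (\<integral>\<^sup>+x. ennreal (s powr p * norm h powr p) * indicator (cball (0::'a) R0) x \<partial>lborel)"
     unfolding Lpow_def
    proof (intro nn_integral_mono)
     fix x
     have "norm (v (x - h) - v x + grad v x \<bullet> h) <= c * (norm h)\<^sup>2" using tay[of h x] h r(2) by simp
     also have "... = (c * norm h) * norm h" by (simp add: power2_eq_square)
     also have "... <= s * norm h"
      using mult_left_mono[OF h c0] cr by (intro mult_right_mono) auto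
     finally have "norm (v (x - h) - v x + grad v x \<bullet> h) powr p <= (s * norm h) powr p"
      using p by (intro powr_mono2) auto
     then have "ennreal (norm (v (x - h) - v x + grad v x \<bullet> h) powr p) <= ennreal (s powr p * norm h powr p)"
      by (simp add: powr_mult ennreal_leI)
     then show "ennreal (norm (v (x - h) - v x + grad v x \<bullet> h) powr p) * indicator A x
       <= ennreal (s powr p * norm h powr p) * indicator (cball (0::'a) R0) x"
      using R0 by (cases "x : A") (auto simp: subset_iff)
    qed
    also have "... = ennreal (s powr p * norm h powr p) * ennreal V"
     by (subst nn_integral_cmult_indicator) (simp_all add: V)
    finally show ?thesis using V0 by (simp add: ennreal_mult mult_ac)
   qed
   have inc: "Lpow p A (%x. v x - v (x - h)) <= osc p (B \<times> B) u h"
   proof -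
    let ?B = "{z. z : B & z - h : B}"
    have Bm [measurable]: "?B : sets borel" by measurable
    have "v x - v (x - h) = conv (mollifier \<delta>) (%y. u y - u (y - h)) x" for x
     unfolding v_def conv_diff[OF mt loc loc_int_translate[OF loc]] conv_translate[OF borel_mollifier[OF \<delta>] u] ..
    then have "Lpow p A (%x. v x - v (x - h)) = Lpow p A (conv (mollifier \<delta>) (%y. u y - u (y - h)))" by simp
    also have "... <= Lpow p ?B (%y. u y - u (y - h))"
    proof (rule Lpow_conv_mollifier_le[OF p \<delta> _ A Bm])
     fix x y :: 'a assume xy: "x : A" "norm y < \<delta>"
     have "norm (y + h) < 2 * \<delta>" using norm_triangle_ineq[of y h] xy h r(3) by simp
     then have "x - (y + h) : B" "x - y : B" using AB[OF xy(1)] xy(2) \<delta> by auto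
     then show "x - y : ?B" by (simp add: algebra_simps)
    qed measurable
    also have "... = osc p (B \<times> B) u h"
     unfolding Lpow_def osc_def by (intro nn_integral_cong) (auto simp: indicator_def)
    finally show ?thesis .
   qed
   have "?I h = Lpow p A (%x. (v x - v (x - h)) + (v (x - h) - v x + grad v x \<bullet> h))"
    by (simp add: Lpow_def)
   also have "... <= ennreal (1 + \<eta>) * Lpow p A (%x. v x - v (x - h)) + ennreal C1 * Lpow p A (%x. v (x - h) - v x + grad v x \<bullet> h)"
    by (rule C1(2)[rule_format, OF A]) measurable
   also have "... <= ennreal (1 + \<eta>) * osc p (B \<times> B) u h + ennreal C1 * (ennreal (s powr p * V) * ennreal (norm h powr p))"
    using inc rest by (intro add_mono mult_left_mono) auto
   also have "ennreal C1 * (ennreal (s powr p * V) * ennreal (norm h powr p)) = ennreal (C1 * (s powr p * V)) * ennreal (norm h powr p)"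
    using C1(1) V0 by (simp add: ennreal_mult mult_ac)
   also have "ennreal (1 + \<eta>) * osc p (B \<times> B) u h + ... <= ennreal (1 + \<eta>) * osc p (B \<times> B) u h + ennreal \<theta> * ennreal (norm h powr p)"
    using C1s by (intro add_left_mono mult_right_mono ennreal_leI) auto
   finally show ?thesis .
  qed
  have om [measurable]: "osc p (B \<times> B) u : Borel"
   by (rule borel_measurable_osc) measurable
  have "ennreal (K_const e p) * near p k r * Lpow p A (grad v) = (\<integral>\<^sup>+h. k h * indicator (cball 0 r) h * ?I h \<partial>lborel)"
   by (rule directional_energy[OF p e k gm A, symmetric])
  also have "... <= (\<integral>\<^sup>+h. ennreal (1 + \<eta>) * (k h * osc p (B \<times> B) u h)
    + ennreal \<theta> * (k h * indicator (cball 0 r) h * ennreal (norm h powr p)) \<partial>lborel)"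
  proof (intro nn_integral_mono)
   fix h
   show "k h * indicator (cball 0 r) h * ?I h <= ennreal (1 + \<eta>) * (k h * osc p (B \<times> B) u h)
    + ennreal \<theta> * (k h * indicator (cball 0 r) h * ennreal (norm h powr p))"
   proof (cases "norm h <= r")
    case True
    then have "k h * ?I h <= k h * (ennreal (1 + \<eta>) * osc p (B \<times> B) u h + ennreal \<theta> * ennreal (norm h powr p))"
     by (intro mult_left_mono near) auto
    also have "... = ennreal (1 + \<eta>) * (k h * osc p (B \<times> B) u h) + ennreal \<theta> * (k h * ennreal (norm h powr p))"
     by (simp only: distrib_left mult_ac)
    finally show ?thesis using True by simp
   qed simp
  qed
  also have "... = ennreal (1 + \<eta>) * (\<integral>\<^sup>+h. k h * osc p (B \<times> B) u h \<partial>lborel) + ennreal \<theta> * near p k r"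
   unfolding near_def by (rule nn_integral_add_cmult) measurable
  also have "... <= ennreal (1 + \<eta>) * (\<integral>\<^sup>+h. k h * osc p (B \<times> B) u h \<partial>lborel) + ennreal \<theta> * 1"
   using near_le_1[OF p k r(2)] by (intro add_left_mono mult_left_mono) auto
  finally show ?thesis by (simp add: v_def)
 qed
 with r(1) show ?thesis by blast
qed

section \<open>Limits of mollifications and integration by parts\<close>

lemma nn_integral_Fatou_le:
 assumes [measurable]: "!!k. F k : borel_measurable M"
  and lim: "AE x in M. (%k. F k x) \<longlonglongrightarrow> (G x :: ennreal)"
  and bd: "eventually (%k. (\<integral>\<^sup>+x. F k x \<partial>M) <= c) sequentially"
 shows "(\<integral>\<^sup>+x. G x \<partial>M) <= c"
proof -
 have "(\<integral>\<^sup>+x. G x \<partial>M) <= (\<integral>\<^sup>+x. liminf (%k. F k x) \<partial>M)"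
 proof (intro nn_integral_mono_AE, use lim in eventually_elim)
  case (elim x)
  from lim_imp_Liminf[OF sequentially_bot elim] show ?case by simp
 qed
 also have "... <= liminf (%k. \<integral>\<^sup>+x. F k x \<partial>M)" by (rule nn_integral_liminf) measurable
 also have "... <= limsup (%k. \<integral>\<^sup>+x. F k x \<partial>M)" by (rule Liminf_le_Limsup) simp
 also have "... <= c" using bd by (rule Limsup_bounded)
 finally show ?thesis .
qed

lemma ennreal_le_of_le_add:
 fixes x :: ennreal
 assumes "!!n. x <= ennreal (c + 1 / real (Suc n))" "0 <= c"
 shows "x <= ennreal c"
proof -
 have "(%n. c + 1 / real (Suc n)) \<longlonglongrightarrow> c + 0"
  by (intro tendsto_intros LIMSEQ_Suc[OF lim_1_over_n])
 then have "(%n. ennreal (c + 1 / real (Suc n))) \<longlonglongrightarrow> ennreal c" by (intro tendsto_ennrealI) simp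
 then show ?thesis using assms(1) by (intro Lim_bounded2[of _ _ 0]) auto
qed

lemma loc_int_diff: "loc_int u ==> loc_int v ==> loc_int (%x. u x - v x)"
 using loc_int_lincomb[of u v 1 "-1"] by simp

text \<open>
On a ball of finite volume, \<open>t \<le> \<tau> (1 + (t / \<tau>) powr p)\<close> bounds the integral of the difference
by a multiple of \<open>\<tau>\<close> as soon as its \<open>p\<close>-th power integrates to at most \<open>\<tau> powr p\<close>.
\<close>
lemma integral_mult_tendsto:
 fixes s :: "nat => 'a::euclidean_space => 'b::euclidean_space"
 assumes p: "1 < p" and \<psi> [measurable]: "\<psi> : Borel"
  and B: "!!y. \<bar>\<psi> y\<bar> <= B" and S: "!!y. y ~: cball a R ==> \<psi> y = 0"
  and loc: "!!n. loc_int (s n)" "loc_int w"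
  and lim: "(%n. Lpow p UNIV (%x. s n x - w x)) \<longlonglongrightarrow> 0"
 shows "(%n. \<integral>y. \<psi> y *\<^sub>R s n y \<partial>lborel) \<longlonglongrightarrow> (\<integral>y. \<psi> y *\<^sub>R w y \<partial>lborel)"
proof (rule LIMSEQ_I)
 fix \<epsilon> :: real assume \<epsilon>: "0 < \<epsilon>"
 have B0: "0 <= B" using B[of undefined] by linarith
 have [measurable]: "s n : Borel" "w : Borel" for n using loc by (auto simp: loc_int_def)
 define V where "V = measure lborel (cball a R)"
 have V: "emeasure lborel (cball a R) = ennreal V"
  unfolding V_def using emeasure_lborel_cball_finite[of a R] by (intro emeasure_eq_ennreal_measure) simp
 have V0: "0 <= V" by (simp add: V_def)
 define \<tau> where "\<tau> = \<epsilon> / ((B + 1) * (V + 1) + 1)"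
 have \<tau>: "0 < \<tau>" using \<epsilon> B0 V0 by (simp add: \<tau>_def add_nonneg_pos)
 have lt: "B * (\<tau> * (V + 1)) < \<epsilon>"
 proof -
  have "B * (\<tau> * (V + 1)) = \<tau> * (B * (V + 1))" by simp
  also have "... < \<tau> * ((B + 1) * (V + 1) + 1)" using \<tau> B0 V0
   by (intro mult_strict_left_mono) (auto simp: algebra_simps)
  also have "... = \<epsilon>"
  proof -
   have "(B + 1) * (V + 1) + 1 \<noteq> 0" using B0 V0 by (smt (verit) mult_nonneg_nonneg)
   then show ?thesis by (simp add: \<tau>_def)
  qed
  finally show ?thesis .
 qed
 have "eventually (%n. Lpow p UNIV (%x. s n x - w x) < ennreal (\<tau> powr p)) sequentially"
  using lim \<tau> by (intro order_tendstoD(2)) auto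
 then obtain N where N: "!!n. N <= n ==> Lpow p UNIV (%x. s n x - w x) < ennreal (\<tau> powr p)"
  by (auto simp: eventually_sequentially)
 show "\<exists>no. \<forall>n\<ge>no. norm ((\<integral>y. \<psi> y *\<^sub>R s n y \<partial>lborel) - (\<integral>y. \<psi> y *\<^sub>R w y \<partial>lborel)) < \<epsilon>"
 proof (intro exI allI impI)
  fix n assume n: "N <= n"
  let ?z = "%x. s n x - w x"
  have lz: "loc_int ?z" by (rule loc_int_diff[OF loc])
  have "(\<integral>y. \<psi> y *\<^sub>R s n y \<partial>lborel) - (\<integral>y. \<psi> y *\<^sub>R w y \<partial>lborel) = (\<integral>y. \<psi> y *\<^sub>R ?z y \<partial>lborel)"
   unfolding scaleR_diff_right
   by (rule Bochner_Integration.integral_diff[symmetric, OF integrable_mult_loc_int(1)[OF loc(1) \<psi> B S]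
      integrable_mult_loc_int(1)[OF loc(2) \<psi> B S]])
  also have "norm ... <= B * enn2real (\<integral>\<^sup>+x\<in>cball a R. ennreal (norm (?z x)) \<partial>lborel)"
   by (rule integrable_mult_loc_int(2)[OF lz \<psi> B S])
  also have "... <= B * (\<tau> * (V + 1))"
  proof (intro mult_left_mono B0 enn2real_leI)
   have "(\<integral>\<^sup>+x\<in>cball a R. ennreal (norm (?z x)) \<partial>lborel)
     = (\<integral>\<^sup>+x. ennreal \<tau> * (ennreal (norm ((1 / \<tau>) *\<^sub>R ?z x)) * indicator (cball a R) x) \<partial>lborel)"
   proof (intro nn_integral_cong)
    fix x
    have "norm (?z x) = \<tau> * norm ((1 / \<tau>) *\<^sub>R ?z x)" using \<tau> by simp
    then have "ennreal (norm (?z x)) = ennreal \<tau> * ennreal (norm ((1 / \<tau>) *\<^sub>R ?z x))"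
     using \<tau> by (metis ennreal_mult less_imp_le norm_ge_zero)
    then show "ennreal (norm (?z x)) * indicator (cball a R) x
      = ennreal \<tau> * (ennreal (norm ((1 / \<tau>) *\<^sub>R ?z x)) * indicator (cball a R) x)"
     by (simp only: mult.assoc)
   qed
   also have "... = ennreal \<tau> * (\<integral>\<^sup>+x\<in>cball a R. ennreal (norm ((1 / \<tau>) *\<^sub>R ?z x)) \<partial>lborel)"
    by (rule nn_integral_cmult) measurable
   also have "... <= ennreal \<tau> * (emeasure lborel (cball a R) + Lpow p UNIV (%x. (1 / \<tau>) *\<^sub>R ?z x))"
    by (intro mult_left_mono nn_integral_cball_le_Lpow[OF p]) auto
   also have "Lpow p UNIV (%x. (1 / \<tau>) *\<^sub>R ?z x) = ennreal (\<bar>1 / \<tau>\<bar> powr p) * Lpow p UNIV ?z"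
    by (rule Lpow_scaleR) auto
   also have "... <= ennreal (\<bar>1 / \<tau>\<bar> powr p) * ennreal (\<tau> powr p)"
    using N[OF n] by (intro mult_left_mono) auto
   also have "... = 1" using \<tau> by (simp add: powr_divide flip: ennreal_mult)
   also have "ennreal \<tau> * (emeasure lborel (cball a R) + 1) = ennreal (\<tau> * (V + 1))"
    unfolding V using \<tau> V0 by (simp add: ennreal_mult ennreal_plus)
   finally show "(\<integral>\<^sup>+x\<in>cball a R. ennreal (norm (?z x)) \<partial>lborel) <= ennreal (\<tau> * (V + 1))"
    by (simp add: add_left_mono mult_left_mono)
  qed (use \<tau> V0 in auto)
  also note lt
  finally show "norm ((\<integral>y. \<psi> y *\<^sub>R s n y \<partial>lborel) - (\<integral>y. \<psi> y *\<^sub>R w y \<partial>lborel)) < \<epsilon>" .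
 qed
qed

lemma conv_tendsto:
 fixes s :: "nat => 'a::euclidean_space => 'b::euclidean_space"
 assumes p: "1 < p" and \<phi>: "\<phi> : test_functions \<O>" and loc: "!!n. loc_int (s n)" "loc_int w"
  and lim: "(%n. Lpow p UNIV (%x. s n x - w x)) \<longlonglongrightarrow> 0"
 shows "(%n. conv \<phi> (s n) x) \<longlonglongrightarrow> conv \<phi> w x"
proof -
 obtain B R where BR: "0 <= B" "0 < R" "!!x. \<bar>\<phi> x\<bar> <= B" "!!x. R < norm x ==> \<phi> x = 0" "smooth \<phi>"
  using test_functions_support[OF \<phi>] by blast
 have [measurable]: "\<phi> : Borel" using BR(5) by (rule smooth_borel)
 show ?thesis unfolding conv_def
  by (rule integral_mult_tendsto[OF p _ _ _ loc lim, of _ B x R]) (auto simp: BR dist_norm)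
qed

lemma conv_midpoint:
 assumes "\<phi> : test_functions \<O>" "loc_int u" "loc_int v"
 shows "conv \<phi> (%y. (1/2) *\<^sub>R (u y + v y)) x = (1/2) *\<^sub>R (conv \<phi> u x + conv \<phi> v x)"
proof -
 have "conv \<phi> (%y. (1/2) *\<^sub>R (u y + v y)) x = (\<integral>y. (1/2) *\<^sub>R (\<phi> (x - y) *\<^sub>R u y + \<phi> (x - y) *\<^sub>R v y) \<partial>lborel)"
  unfolding conv_def by (intro Bochner_Integration.integral_cong refl) (simp add: scaleR_add_right mult.commute)
 also have "... = (1/2) *\<^sub>R (\<integral>y. \<phi> (x - y) *\<^sub>R u y + \<phi> (x - y) *\<^sub>R v y \<partial>lborel)"
  by (rule Bochner_Integration.integral_scaleR_right)
 also have "(\<integral>y. \<phi> (x - y) *\<^sub>R u y + \<phi> (x - y) *\<^sub>R v y \<partial>lborel) = conv \<phi> u x + conv \<phi> v x"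
  unfolding conv_def
  by (rule Bochner_Integration.integral_add) (use integrable_conv[OF assms(1)] assms in auto)
 finally show ?thesis .
qed

text \<open>
Translation invariance makes all difference quotients have integral 0.
\<close>
lemma integral_partial_test_0:
 fixes \<psi> :: "'a::euclidean_space => real"
 assumes \<psi>: "\<psi> : test_functions \<O>" and b: "b : Basis"
 shows "(\<integral>x. frechet_derivative \<psi> (at x) b \<partial>lborel) = 0"
proof -
 obtain B R where BR: "0 <= B" "0 < R" "!!x. \<bar>\<psi> x\<bar> <= B" "!!x. R < norm x ==> \<psi> x = 0" "smooth \<psi>"
  using test_functions_support[OF \<psi>] by blast
 have m [measurable]: "\<psi> : Borel" using BR(5) by (rule smooth_borel)
 have dm [measurable]: "partial b \<psi> : Borel" using smooth_partial[OF BR(5) b] by (rule smooth_borel)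
 obtain L where L: "0 <= L" "!!x h. \<bar>\<psi> (x + h) - \<psi> x - grad \<psi> x \<bullet> h\<bar> <= L * (norm h)\<^sup>2"
  using test_functions_taylor[OF \<psi>] by blast
 have one: "loc_int (%_::'a. 1::real)"
  unfolding loc_int_def using emeasure_lborel_cball_finite by auto
 have i1: "integrable lborel \<psi>" using integrable_test_mult[OF \<psi> one] by simp
 have i2: "integrable lborel (partial b \<psi>)" using integrable_test_mult[OF test_functions_partial[OF \<psi> b] one] by simp
 have i3: "integrable lborel (%x. \<psi> (x + h))" for h
 proof -
  have "integrable (distr lborel borel ((+) h)) \<psi>" using i1 by (simp add: lborel_distr_plus)
  then show ?thesis by (subst (asm) integrable_distr_eq) (auto simp: add.commute)
 qed
 define V where "V = enn2real (\<integral>\<^sup>+x\<in>cball (0::'a) (R + 1). ennreal (norm (1::real)) \<partial>lborel)"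
 define I where "I = (\<integral>x. frechet_derivative \<psi> (at x) b \<partial>lborel)"
 have main: "t * \<bar>I\<bar> <= L * t\<^sup>2 * V" if t: "0 < t" "t <= 1" for t
 proof -
  have dz: "grad \<psi> x \<bullet> (t *\<^sub>R b) = t * frechet_derivative \<psi> (at x) b" for x
   using b by (simp add: grad_inner_Basis)
  have "(\<integral>x. \<psi> (x + t *\<^sub>R b) - \<psi> x - t * frechet_derivative \<psi> (at x) b \<partial>lborel)
   = (\<integral>x. \<psi> (x + t *\<^sub>R b) \<partial>lborel) - (\<integral>x. \<psi> x \<partial>lborel) - t * I"
   unfolding I_def using i1 i2 i3 by simp
  also have "... = - (t * I)" using integral_translate[OF m, of "t *\<^sub>R b"] by simp
  finally have "t * \<bar>I\<bar> = norm (\<integral>x. (\<psi> (x + t *\<^sub>R b) - \<psi> x - t * frechet_derivative \<psi> (at x) b) *\<^sub>R (1::real) \<partial>lborel)"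
   using t by (simp add: abs_mult)
  also have "... <= (L * t\<^sup>2) * V"
   unfolding V_def
  proof (rule integrable_mult_loc_int(2)[OF one])
   show "\<bar>\<psi> (x + t *\<^sub>R b) - \<psi> x - t * frechet_derivative \<psi> (at x) b\<bar> <= L * t\<^sup>2" for x
    using L(2)[of x "t *\<^sub>R b"] b unfolding dz by simp
   show "\<psi> (x + t *\<^sub>R b) - \<psi> x - t * frechet_derivative \<psi> (at x) b = 0" if x: "x ~: cball 0 (R + 1)" for x
   proof -
    have "norm x <= norm (x + t *\<^sub>R b) + norm (t *\<^sub>R b)"
     using norm_triangle_ineq4[of "x + t *\<^sub>R b" "t *\<^sub>R b"] by simp
    also have "norm (t *\<^sub>R b) <= 1" using t b by simp
    finally have "R < norm (x + t *\<^sub>R b)" "R < norm x" using x by auto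
    then show ?thesis using BR(4) partial_eq_0_outside[of "cball 0 R" \<psi> x] by simp
   qed
  qed measurable
  finally show ?thesis .
 qed
 have V0: "0 <= V" by (simp add: V_def)
 have "\<bar>I\<bar> <= 0"
 proof (rule field_le_epsilon)
  fix \<epsilon> :: real assume \<epsilon>: "0 < \<epsilon>"
  define t where "t = min 1 (\<epsilon> / (L * V + 1))"
  have LV: "0 <= L * V" using L(1) V0 by simp
  have t: "0 < t" "t <= 1" using \<epsilon> LV by (auto simp: t_def)
  have "t * \<bar>I\<bar> <= t * (t * (L * V))" using main[OF t] by (simp add: power2_eq_square mult_ac)
  then have "\<bar>I\<bar> <= t * (L * V)" using t(1) by simp
  also have "... <= (\<epsilon> / (L * V + 1)) * (L * V + 1)" using LV t \<epsilon> by (intro mult_mono) (auto simp: t_def)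
  also have "... = \<epsilon>" using LV by simp
  finally show "\<bar>I\<bar> <= 0 + \<epsilon>" by simp
 qed
 then show ?thesis by (simp add: I_def)
qed

text \<open>
The product of a smooth function and a test function is a test function.
\<close>
lemma integration_by_parts:
 fixes v :: "'a::euclidean_space => real"
 assumes v: "smooth v" and \<phi>: "\<phi> : test_functions \<O>" and b: "b : Basis"
 shows "(\<integral>x. frechet_derivative \<phi> (at x) b *\<^sub>R v x \<partial>lborel) = - (\<integral>x. \<phi> x *\<^sub>R (grad v x \<bullet> b) \<partial>lborel)"
proof -
 obtain K where K: "smooth \<phi>" "compact K" "K \<subseteq> \<O>" "!!x. x ~: K ==> \<phi> x = 0"
  using \<phi> unfolding test_functions_iff by blast
 have t1: "(%x. \<phi> x * v x) : test_functions \<O>"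
  unfolding test_functions_iff using K smooth_mult[OF K(1) v] by auto
 have d0: "frechet_derivative \<phi> (at x) b = 0" if "x ~: K" for x
  using partial_eq_0_outside[OF compact_imp_closed[OF K(2)] K(4) that] by simp
 have i1: "integrable lborel (%x. frechet_derivative \<phi> (at x) b * v x)"
  by (rule integrable_smooth_compact[OF smooth_mult[OF smooth_partial[OF K(1) b] v] compact_imp_bounded[OF K(2)]])
   (simp add: d0)
 have i2: "integrable lborel (%x. \<phi> x * frechet_derivative v (at x) b)"
  by (rule integrable_smooth_compact[OF smooth_mult[OF K(1) smooth_partial[OF v b]] compact_imp_bounded[OF K(2)]])
   (simp add: K(4))
 have "0 = (\<integral>x. frechet_derivative (%x. \<phi> x * v x) (at x) b \<partial>lborel)"
  by (rule integral_partial_test_0[OF t1 b, symmetric])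
 also have "... = (\<integral>x. \<phi> x * frechet_derivative v (at x) b + frechet_derivative \<phi> (at x) b * v x \<partial>lborel)"
  by (simp add: partial_mult smooth_differentiable[OF K(1)] smooth_differentiable[OF v])
 also have "... = (\<integral>x. \<phi> x * frechet_derivative v (at x) b \<partial>lborel) + (\<integral>x. frechet_derivative \<phi> (at x) b * v x \<partial>lborel)"
  by (rule Bochner_Integration.integral_add[OF i2 i1])
 finally show ?thesis using b by (simp add: grad_inner_Basis)
qed

lemma continuous_loc_int:
 fixes v :: "'a::euclidean_space => 'b::euclidean_space"
 assumes v: "continuous_on UNIV v" shows "loc_int v"
proof -
 have "(\<integral>\<^sup>+x\<in>cball 0 R. ennreal (norm (v x)) \<partial>lborel) < \<infinity>" for R
 proof -
  have "bounded (v ` cball 0 R)"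
   by (intro compact_imp_bounded compact_continuous_image continuous_on_subset[OF v]) auto
  then obtain B where B: "!!x. x : cball 0 R ==> norm (v x) <= B" by (force simp: bounded_iff)
  have "(\<integral>\<^sup>+x\<in>cball 0 R. ennreal (norm (v x)) \<partial>lborel) <= (\<integral>\<^sup>+x. ennreal B * indicator (cball (0::'a) R) x \<partial>lborel)"
   using B by (intro nn_integral_mono) (auto simp: indicator_def intro!: ennreal_leI)
  also have "... < \<infinity>"
   using emeasure_lborel_cball_finite[of "0::'a" R]
   by (subst nn_integral_cmult_indicator) (auto simp: ennreal_mult_less_top)
  finally show ?thesis .
 qed
 then show ?thesis using v by (simp add: loc_int_def borel_measurable_continuous_onI)
qed

lemma continuous_grad: "smooth v ==> continuous_on UNIV (grad v)"
 unfolding grad_def[abs_def]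
 by (intro continuous_on_sum continuous_on_scaleR smooth_continuous smooth_partial continuous_on_const)

lemma wgrad_smooth: "smooth v ==> wgrad \<O> v (grad v)"
 unfolding wgrad_def
 using integration_by_parts continuous_loc_int[OF smooth_continuous] continuous_loc_int[OF continuous_grad]
 by blast

text \<open>
The integrand is positive on an open part of the ball.
\<close>
lemma K_const_pos:
 fixes e :: "'a::euclidean_space"
 assumes p: "1 < p" and e: "e : Basis" shows "0 < K_const e p"
proof (rule ccontr)
 assume "\<not> ?thesis"
 then have "K_const e p = 0" using K_const_nonneg[of e p] by linarith
 then have "(\<integral>\<^sup>+z\<in>cball 0 1. ennreal (\<bar>sgn z \<bullet> e\<bar> powr p) \<partial>lborel) = 0"
  using K_const_eq[OF p, of e] by simp
 then have "AE z in lborel. ennreal (\<bar>sgn z \<bullet> e\<bar> powr p) * indicator (cball 0 1) z = 0"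
  by (subst (asm) nn_integral_0_iff_AE) auto
 then have "AE z in lborel. z ~: ball 0 1 \<inter> {z. 0 < z \<bullet> e}"
 proof eventually_elim
  case (elim z)
  show ?case
  proof
   assume z: "z : ball 0 1 \<inter> {z. 0 < z \<bullet> e}"
   then have "z \<noteq> 0" by auto
   then have "0 < sgn z \<bullet> e" using z by (simp add: sgn_div_norm)
   then show False using elim z by (auto simp: indicator_def)
  qed
 qed
 moreover have op: "open (ball 0 1 \<inter> {z::'a. 0 < z \<bullet> e})"
  by (intro open_Int open_ball open_Collect_less continuous_intros)
 ultimately have "emeasure lborel (ball 0 1 \<inter> {z::'a. 0 < z \<bullet> e}) = 0"
  by (subst (asm) AE_iff_null) (auto simp: null_sets_def ball_def Int_def)
 then have "negligible (ball 0 1 \<inter> {z::'a. 0 < z \<bullet> e})"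
  using op by (simp add: negligible_iff_null_sets null_sets_def)
 moreover have "(1/2) *\<^sub>R e : ball 0 1 \<inter> {z. 0 < z \<bullet> e}" using e by simp
 ultimately show False using open_not_negligible[OF op] by blast
qed

section \<open>Weak gradients from bounds on mollifications\<close>

text \<open>
An exhaustion of \<open>\<O>\<close> by bounded closed sets; the factor 2 leaves room for a mollification of radius
\<open>1 / Suc m\<close> and an increment of the same size.
\<close>
definition inner_part :: "'a::euclidean_space set => nat => 'a set" where
 "inner_part \<O> m = cball 0 (real m) \<inter> {x. ball x (2 / real (Suc m)) \<subseteq> \<O>}"

lemma closed_inner_part: "closed (inner_part \<O> m)"
proof -
 have "{x. ball x (2 / real (Suc m)) \<subseteq> \<O>} = - (\<Union>y\<in>- \<O>. ball y (2 / real (Suc m)))"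
  by (auto simp: dist_commute)
 then show ?thesis unfolding inner_part_def by (auto intro!: closed_Int closed_Compl)
qed

lemma inner_part_borel [measurable]: "inner_part \<O> m : sets borel"
 using closed_inner_part by (rule borel_closed)

lemma inner_part_subset: "inner_part \<O> m \<subseteq> \<O>"
 unfolding inner_part_def by (auto simp: subset_iff)

lemma bounded_inner_part: "bounded (inner_part \<O> m)"
 unfolding inner_part_def by (rule bounded_subset[OF bounded_cball]) auto

lemma inner_part_mono:
 assumes "m <= n" shows "inner_part \<O> m \<subseteq> inner_part \<O> n"
proof -
 have "2 / real (Suc n) <= 2 / real (Suc m)" using assms by (simp add: field_simps)
 then have "ball x (2 / real (Suc n)) \<subseteq> ball x (2 / real (Suc m))" for x :: 'a by (rule subset_ball)
 moreover have "cball 0 (real m) \<subseteq> cball (0::'a) (real n)" using assms by (intro subset_cball) simp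
 ultimately show ?thesis unfolding inner_part_def by blast
qed

lemma inner_part_diff: "x : inner_part \<O> m ==> norm y < 2 * (1 / real (Suc m)) ==> x - y : \<O>"
 unfolding inner_part_def by (auto simp: dist_norm subset_iff)

lemma inner_part_exhausts:
 fixes K :: "'a::euclidean_space set"
 assumes \<O>: "open \<O>" and K: "compact K" "K \<subseteq> \<O>"
 shows "\<exists>m. K \<subseteq> inner_part \<O> m"
proof -
 obtain d where d: "0 < d" "(\<Union>x\<in>K. cball x d) \<subseteq> \<O>"
  using compact_subset_open_imp_cball_epsilon_subset[OF K(1) \<O> K(2)] by blast
 obtain R where R: "!!x. x : K ==> norm x <= R" using compact_imp_bounded[OF K(1)] by (auto simp: bounded_iff)
 obtain m :: nat where m: "max R (2 / d) < real m" using reals_Archimedean2 by blast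
 have "2 / real (Suc m) <= d"
 proof -
  have "2 < real m * d" using m d(1) by (simp add: divide_less_eq)
  also have "... <= d * real (Suc m)" using d(1) by (simp add: algebra_simps)
  finally show ?thesis by (simp add: divide_le_eq)
 qed
 then have sub: "ball x (2 / real (Suc m)) \<subseteq> cball x d" for x :: 'a by auto
 have "x : inner_part \<O> m" if "x : K" for x
 proof -
  have "cball x d \<subseteq> \<O>" using d(2) that by blast
  moreover have "x : cball 0 (real m)" using R[OF that] m by simp
  ultimately show ?thesis unfolding inner_part_def using sub[of x] by blast
 qed
 then have "K \<subseteq> inner_part \<O> m" by blast
 then show ?thesis ..
qed

text \<open>
The \<open>p\<close>-th power of the Sobolev norm on \<open>A\<close>, for a candidate gradient \<open>G\<close>.
\<close>
definition sobmass :: "real => real => 'a::euclidean_space set => ('a => real) => ('a => 'a) => ennreal" where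
 "sobmass p K A v G = Lpow p A v + ennreal K * Lpow p A G"

lemma sobmass_mono_set: "A \<subseteq> B ==> sobmass p K A v G <= sobmass p K B v G"
 unfolding sobmass_def by (intro add_mono mult_left_mono Lpow_mono_set) auto

lemma sobmass_eq:
 assumes [measurable]: "A : sets borel" "v : Borel" "G : Borel"
 shows "sobmass p K A v G = (\<integral>\<^sup>+x. (ennreal (norm (v x) powr p) + ennreal K * ennreal (norm (G x) powr p)) * indicator A x \<partial>lborel)"
proof -
 have "(\<integral>\<^sup>+x. (ennreal (norm (v x) powr p) + ennreal K * ennreal (norm (G x) powr p)) * indicator A x \<partial>lborel)
  = (\<integral>\<^sup>+x. 1 * (ennreal (norm (v x) powr p) * indicator A x) + ennreal K * (ennreal (norm (G x) powr p) * indicator A x) \<partial>lborel)"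
  by (intro nn_integral_cong) (simp add: distrib_right mult.assoc)
 also have "... = 1 * Lpow p A v + ennreal K * Lpow p A G"
  unfolding Lpow_def by (rule nn_integral_add_cmult) measurable
 finally show ?thesis by (simp add: sobmass_def)
qed

lemma sobmass_Fatou:
 assumes p: "1 < p" and [measurable]: "A : sets borel" "!!n. v n : Borel" "!!n. G n : Borel"
   "w : Borel" "g : Borel"
  and lim: "!!x. (%n. v n x) \<longlonglongrightarrow> w x" "!!x. (%n. G n x) \<longlonglongrightarrow> g x"
  and bd: "eventually (%n. sobmass p K A (v n) (G n) <= c) sequentially"
 shows "sobmass p K A w g <= c"
 unfolding sobmass_eq[OF assms(2,5,6)]
proof (rule nn_integral_Fatou_le)
 show "eventually (%n. (\<integral>\<^sup>+x. (ennreal (norm (v n x) powr p) + ennreal K * ennreal (norm (G n x) powr p)) * indicator A x \<partial>lborel) <= c) sequentially"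
  using bd by (simp add: sobmass_eq)
 show "AE x in lborel. (%n. (ennreal (norm (v n x) powr p) + ennreal K * ennreal (norm (G n x) powr p)) * indicator A x)
   \<longlonglongrightarrow> (ennreal (norm (w x) powr p) + ennreal K * ennreal (norm (g x) powr p)) * indicator A x"
 proof (intro AE_I2)
  fix x
  have a: "(%n. ennreal (norm (v n x) powr p)) \<longlonglongrightarrow> ennreal (norm (w x) powr p)"
   using p lim(1)[of x] by (intro tendsto_ennrealI tendsto_powr' tendsto_norm tendsto_const) auto
  have b: "(%n. ennreal (norm (G n x) powr p)) \<longlonglongrightarrow> ennreal (norm (g x) powr p)"
   using p lim(2)[of x] by (intro tendsto_ennrealI tendsto_powr' tendsto_norm tendsto_const) auto
  show "(%n. (ennreal (norm (v n x) powr p) + ennreal K * ennreal (norm (G n x) powr p)) * indicator A x)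
   \<longlonglongrightarrow> (ennreal (norm (w x) powr p) + ennreal K * ennreal (norm (g x) powr p)) * indicator A x"
  proof (cases "x : A")
   case True
   have "(%n. ennreal K * ennreal (norm (G n x) powr p)) \<longlonglongrightarrow> ennreal K * ennreal (norm (g x) powr p)"
    using b by (intro ennreal_tendsto_cmult) auto
   from tendsto_add[OF a this] True show ?thesis by simp
  qed simp
 qed
qed measurable

lemma sobmass_exhaust:
 assumes p: "1 < p" and \<O>: "open \<O>" and [measurable]: "w : Borel" "g : Borel"
  and w0: "!!x. x ~: \<O> ==> w x = 0" and g0: "!!x. x ~: \<O> ==> g x = 0"
  and bd: "!!i. sobmass p K (inner_part \<O> i) w g <= c"
 shows "sobmass p K UNIV w g <= c"
proof (rule sobmass_Fatou[OF p, where v="%i x. indicator (inner_part \<O> i) x *\<^sub>R w x" and G="%i x. indicator (inner_part \<O> i) x *\<^sub>R g x"])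
 have ev: "\<forall>\<^sub>F i in sequentially. indicator (inner_part \<O> i) x = (1::real)" if "x : \<O>" for x
 proof -
  have "{x} \<subseteq> \<O>" using that by simp
  then have "\<exists>m. {x} \<subseteq> inner_part \<O> m" by (rule inner_part_exhausts[OF \<O> compact_sing])
  then obtain m where "{x} \<subseteq> inner_part \<O> m" by blast
  then have "x : inner_part \<O> i" if "m <= i" for i using inner_part_mono[OF that] by blast
  then show ?thesis unfolding eventually_sequentially by (intro exI[of _ m]) auto
 qed
 show "(%i. indicator (inner_part \<O> i) x *\<^sub>R w x) \<longlonglongrightarrow> w x" for x
 proof (cases "x : \<O>")
  case True
  show ?thesis
  proof (rule tendsto_eventually, use ev[OF True] in eventually_elim)
   case (elim i)
   then show ?case by (simp only: scaleR_one)
  qed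
 qed (simp add: w0)
 show "(%i. indicator (inner_part \<O> i) x *\<^sub>R g x) \<longlonglongrightarrow> g x" for x
 proof (cases "x : \<O>")
  case True
  show ?thesis
  proof (rule tendsto_eventually, use ev[OF True] in eventually_elim)
   case (elim i)
   then show ?case by (simp only: scaleR_one)
  qed
 qed (simp add: g0)
 show "\<forall>\<^sub>F i in sequentially. sobmass p K UNIV (%x. indicator (inner_part \<O> i) x *\<^sub>R w x) (%x. indicator (inner_part \<O> i) x *\<^sub>R g x) <= c"
  using bd unfolding sobmass_def Lpow_indicator[OF p] by (intro always_eventually allI)
qed measurable

lemma sobmass_midpoint:
 assumes p: "1 < p" and [measurable]: "A : sets borel" "u : Borel" "v : Borel"
   "G : Borel" "H : Borel"
  and "sobmass p K A u G <= c" "sobmass p K A v H <= c"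
 shows "sobmass p K A (%x. (1/2) *\<^sub>R (u x + v x)) (%x. (1/2) *\<^sub>R (G x + H x)) <= c"
proof -
 have "sobmass p K A (%x. (1/2) *\<^sub>R (u x + v x)) (%x. (1/2) *\<^sub>R (G x + H x))
   <= ennreal (1/2) * (Lpow p A u + Lpow p A v) + ennreal K * (ennreal (1/2) * (Lpow p A G + Lpow p A H))"
  unfolding sobmass_def by (intro add_mono mult_left_mono Lpow_midpoint_le[OF p]) auto
 also have "... = ennreal (1/2) * (sobmass p K A u G + sobmass p K A v H)"
  unfolding sobmass_def by (simp only: distrib_left mult_ac add_ac)
 also have "... <= ennreal (1/2) * (c + c)" using assms by (intro mult_left_mono add_mono) auto
 also have "... = c"
 proof -
  have "ennreal (1/2) * (c + c) = (ennreal (1/2) + ennreal (1/2)) * c" by (simp only: distrib_left distrib_right)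
  also have "ennreal (1/2) + ennreal (1/2) = 1" by (subst ennreal_plus[symmetric]) simp_all
  finally show ?thesis by simp
 qed
 finally show ?thesis .
qed

lemma sobmass_limit:
 assumes p: "1 < p" and A [measurable]: "A : sets borel" and vm [measurable]: "!!n. v n : Borel"
  and Gm [measurable]: "!!n. G n : Borel"
  and wm [measurable]: "w : Borel" and gm [measurable]: "g : Borel"
  and v: "(%n. Lpow p UNIV (%x::'a::euclidean_space. v n x - w x :: real)) \<longlonglongrightarrow> 0"
  and G: "(%n. Lpow p UNIV (%x. G n x - g x :: 'a)) \<longlonglongrightarrow> 0"
  and bd: "eventually (%n. sobmass p K A (v n) (G n) <= 1) sequentially"
 shows "sobmass p K A w g <= 1"
proof -
 have "sobmass p K A w g <= ennreal (1 + 1 / real (Suc j))" for j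
 proof -
  let ?\<eta> = "1 / real (Suc j)"
  have \<eta>: "0 < ?\<eta>" by simp
  obtain C where C: "0 <= C" "\<forall>A\<in>sets borel. \<forall>u\<in>Borel. \<forall>v\<in>Borel.
    Lpow p A (%x::'a. u x + v x :: real) <= ennreal (1 + ?\<eta>) * Lpow p A u + ennreal C * Lpow p A v"
   using Lpow_add_le[OF p \<eta>] by blast
  obtain D where D: "0 <= D" "\<forall>A\<in>sets borel. \<forall>u\<in>Borel. \<forall>v\<in>Borel.
    Lpow p A (%x::'a. u x + v x :: 'a) <= ennreal (1 + ?\<eta>) * Lpow p A u + ennreal D * Lpow p A v"
   using Lpow_add_le[OF p \<eta>] by blast
  have ev: "\<forall>\<^sub>F n in sequentially. sobmass p K A w g <= ennreal (1 + ?\<eta>) +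
    (ennreal C * Lpow p UNIV (%x. v n x - w x) + ennreal K * (ennreal D * Lpow p UNIV (%x. G n x - g x)))"
   using bd
  proof eventually_elim
   case (elim n)
   have "Lpow p A w <= ennreal (1 + ?\<eta>) * Lpow p A (v n) + ennreal C * Lpow p A (%x. w x - v n x)"
    using C(2)[rule_format, OF A vm borel_measurable_diff[OF wm vm], of n n] by simp
   also have "Lpow p A (%x. w x - v n x) <= Lpow p UNIV (%x. v n x - w x)"
    by (subst Lpow_minus_commute) (rule Lpow_mono_set, simp)
   finally have a: "Lpow p A w <= ennreal (1 + ?\<eta>) * Lpow p A (v n) + ennreal C * Lpow p UNIV (%x. v n x - w x)"
    by (simp add: add_left_mono mult_left_mono)
   have "Lpow p A g <= ennreal (1 + ?\<eta>) * Lpow p A (G n) + ennreal D * Lpow p A (%x. g x - G n x)"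
    using D(2)[rule_format, OF A Gm borel_measurable_diff[OF gm Gm], of n n] by simp
   also have "Lpow p A (%x. g x - G n x) <= Lpow p UNIV (%x. G n x - g x)"
    by (subst Lpow_minus_commute) (rule Lpow_mono_set, simp)
   finally have b: "Lpow p A g <= ennreal (1 + ?\<eta>) * Lpow p A (G n) + ennreal D * Lpow p UNIV (%x. G n x - g x)"
    by (simp add: add_left_mono mult_left_mono)
   have "sobmass p K A w g <= (ennreal (1 + ?\<eta>) * Lpow p A (v n) + ennreal C * Lpow p UNIV (%x. v n x - w x))
     + ennreal K * (ennreal (1 + ?\<eta>) * Lpow p A (G n) + ennreal D * Lpow p UNIV (%x. G n x - g x))"
    unfolding sobmass_def by (intro add_mono mult_left_mono a b) auto
   also have "... = ennreal (1 + ?\<eta>) * sobmass p K A (v n) (G n) +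
    (ennreal C * Lpow p UNIV (%x. v n x - w x) + ennreal K * (ennreal D * Lpow p UNIV (%x. G n x - g x)))"
    unfolding sobmass_def by (simp only: distrib_left mult_ac add_ac)
   also have "... <= ennreal (1 + ?\<eta>) * 1 +
    (ennreal C * Lpow p UNIV (%x. v n x - w x) + ennreal K * (ennreal D * Lpow p UNIV (%x. G n x - g x)))"
    by (intro add_right_mono mult_left_mono elim) auto
   finally show ?case by simp
  qed
  have "(%n. ennreal (1 + ?\<eta>) + (ennreal C * Lpow p UNIV (%x. v n x - w x) + ennreal K * (ennreal D * Lpow p UNIV (%x. G n x - g x))))
    \<longlonglongrightarrow> ennreal (1 + ?\<eta>) + (ennreal C * 0 + ennreal K * (ennreal D * 0))"
   by (intro tendsto_add tendsto_const ennreal_tendsto_cmult v G) auto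
  from tendsto_lowerbound[OF this ev] show ?thesis by simp
 qed
 then show ?thesis using ennreal_le_of_le_add[of _ 1] by simp
qed

text \<open>
The gradients of the mollifications are bounded in \<open>L\<^sup>p\<close>, and convex combinations of them converge in
norm. The set \<open>D j\<close> consists of the \<open>G\<close> that serve as gradients, against test functions supported in the \<open>j\<close>-th
part, of some \<open>v\<close> within \<open>1 / Suc j\<close> of \<open>w\<close> and of Sobolev mass at most 1 there. It is midpoint closed
and decreasing, and a limit of its elements is a weak gradient of \<open>w\<close> itself.
\<close>
lemma bounded_mollified_imp_wgrad:
 fixes w :: "'a::euclidean_space => real"
 assumes p: "1 < p" and K: "0 < K" and \<O>: "open \<O>" and w [measurable]: "w : Borel" and w0: "!!x. x ~: \<O> ==> w x = 0"
  and wfin: "Lpow p UNIV w < \<infinity>"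
  and bd: "!!m. sobmass p K (inner_part \<O> m) (conv (mollifier (1 / real (Suc m))) w) (grad (conv (mollifier (1 / real (Suc m))) w)) <= 1"
 obtains g where "wgrad \<O> w g" "!!x. x ~: \<O> ==> g x = 0" "sobmass p K UNIV w g <= 1"
proof -
 have loc: "loc_int w" by (rule Lpow_finite_loc_int[OF p w wfin])
 define ibp where "ibp = (%j (v :: 'a => real) (G :: 'a => 'a). \<forall>\<phi>\<in>test_functions \<O>. (\<forall>x. x ~: inner_part \<O> j --> \<phi> x = 0) -->
   (\<forall>b\<in>Basis. (\<integral>x. frechet_derivative \<phi> (at x) b *\<^sub>R v x \<partial>lborel) = - (\<integral>x. \<phi> x *\<^sub>R (G x \<bullet> b) \<partial>lborel)))"
 define good where "good = (%j v G. v : Borel & Lpow p UNIV (%x. v x - w x) <= ennreal (1 / real (Suc j)) &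
   sobmass p K (inner_part \<O> j) v G <= 1 & ibp j v G)"
 define D where "D = (%j. {G. G : Borel & (\<forall>x. x ~: \<O> --> G x = 0) & Lpow p UNIV G <= ennreal (1 / K) &
   (\<exists>v. good j v G)})"
 have good_loc: "loc_int v" if "good j v G" for j v G
 proof -
  have vm [measurable]: "v : Borel" using that by (simp add: good_def)
  have "Lpow p UNIV (%x. v x - w x) < \<infinity>" using that by (auto simp: good_def intro: le_less_trans)
  then have "loc_int (%x. v x - w x)" by (intro Lpow_finite_loc_int[OF p]) auto
  from loc_int_lincomb[OF this loc, of 1 1] show ?thesis by simp
 qed
 have D_loc: "loc_int G" if "G : D j" for j G
  using that by (intro Lpow_finite_loc_int[OF p]) (auto simp: D_def intro: le_less_trans)
 obtain S g0 where S: "!!j. S j : D j" and g0 [measurable]: "g0 : Borel"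
  and lim0: "(%n. Lpow p UNIV (%x. S n x - g0 x)) \<longlonglongrightarrow> 0"
 proof (rule midpoint_closed_family_convergent[OF p, of D "1 / K"])
  fix s w' assume "!!k. s k : D k" "w' : Borel" "(%n. Lpow p UNIV (%x. s n x - w' x)) \<longlonglongrightarrow> 0"
  then show thesis by (rule that)
 next
  show "D (Suc j) \<subseteq> D j" for j
  proof -
   have sub: "inner_part \<O> j \<subseteq> inner_part \<O> (Suc j)" by (rule inner_part_mono) simp
   have le: "ennreal (1 / real (Suc (Suc j))) <= ennreal (1 / real (Suc j))" by (intro ennreal_leI) (simp add: field_simps)
   have "good j v G" if "good (Suc j) v G" for v G
   proof -
    have a: "v : Borel" "Lpow p UNIV (%x. v x - w x) <= ennreal (1 / real (Suc (Suc j)))"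
     "sobmass p K (inner_part \<O> (Suc j)) v G <= 1" "ibp (Suc j) v G"
     using that by (auto simp only: good_def)
    have "ibp j v G" using a(4) sub unfolding ibp_def by blast
    then show ?thesis
     unfolding good_def using a(1) order_trans[OF a(2) le] order_trans[OF sobmass_mono_set[OF sub] a(3)] by blast
   qed
   then show ?thesis unfolding D_def by blast
  qed
  show "D 0 \<subseteq> Borel" by (auto simp: D_def)
  show "Lpow p UNIV G <= ennreal (1 / K)" if "G : D 0" for G using that by (simp add: D_def)
  show "D j \<noteq> {}" for j
  proof -
   have pos: "0 < 1 / real (Suc j)" by simp
   obtain d where d: "0 < d" "!!\<delta>. 0 < \<delta> ==> \<delta> < d ==> Lpow p UNIV (%x. conv (mollifier \<delta>) w x - w x) <= ennreal (1 / real (Suc j))"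
    using Lpow_conv_mollifier_approx[OF p w wfin pos] by blast
   have "\<forall>\<^sub>F n in sequentially. 1 / real (Suc n) < d"
    using LIMSEQ_Suc[OF lim_1_over_n] d(1) by (rule order_tendstoD(2))
   then have "\<forall>\<^sub>F n in sequentially. 1 / real (Suc n) < d & j <= n"
    using eventually_ge_at_top[of j] by eventually_elim auto
   then obtain m where m: "1 / real (Suc m) < d" "j <= m"
    using eventually_happens'[OF sequentially_bot] by blast
   define \<delta> where "\<delta> = 1 / real (Suc m)"
   have \<delta>: "0 < \<delta>" by (simp add: \<delta>_def)
   define v where "v = conv (mollifier \<delta>) w"
   have vs: "smooth v" unfolding v_def by (rule smooth_conv[OF mollifier_test_UNIV[OF \<delta>] loc])
   have gm [measurable]: "grad v : Borel"
    using continuous_grad[OF vs] by (rule borel_measurable_continuous_onI)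
   define G where "G = (%x. indicator (inner_part \<O> m) x *\<^sub>R grad v x)"
   have sub: "inner_part \<O> j \<subseteq> inner_part \<O> m" using m(2) by (rule inner_part_mono)
   have bdm: "sobmass p K (inner_part \<O> m) v (grad v) <= 1" using bd[of m] by (simp add: v_def \<delta>_def)
   have LG: "Lpow p UNIV G = Lpow p (inner_part \<O> m) (grad v)" unfolding G_def by (rule Lpow_indicator[OF p])
   have KL: "ennreal K * Lpow p (inner_part \<O> m) (grad v) <= 1"
    using order_trans[OF _ bdm, of "ennreal K * Lpow p (inner_part \<O> m) (grad v)"] by (simp add: sobmass_def)
   have LG1: "Lpow p UNIV G <= ennreal (1 / K)"
   proof -
    have "Lpow p UNIV G = ennreal (1 / K) * (ennreal K * Lpow p UNIV G)"
     using K by (simp add: mult.assoc[symmetric] flip: ennreal_mult)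
    also have "... <= ennreal (1 / K) * 1" using KL LG by (intro mult_left_mono) auto
    finally show ?thesis by simp
   qed
   have Gj: "Lpow p (inner_part \<O> j) G = Lpow p (inner_part \<O> j) (grad v)"
    unfolding Lpow_def using sub by (intro nn_integral_cong) (auto simp: G_def indicator_def)
   have sj: "sobmass p K (inner_part \<O> j) v G <= 1"
    using order_trans[OF sobmass_mono_set[OF sub] bdm] by (simp add: sobmass_def Gj)
   have "ibp j v G"
    unfolding ibp_def
   proof (intro ballI impI)
    fix \<phi> b assume \<phi>: "\<phi> : test_functions \<O>" and \<phi>0: "\<forall>x. x ~: inner_part \<O> j --> \<phi> x = 0" and b: "b : (Basis :: 'a set)"
    have eq: "\<phi> x *\<^sub>R (grad v x \<bullet> b) = \<phi> x *\<^sub>R (G x \<bullet> b)" for x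
     using \<phi>0 sub by (cases "x : inner_part \<O> j") (auto simp: G_def)
    show "(\<integral>x. frechet_derivative \<phi> (at x) b *\<^sub>R v x \<partial>lborel) = - (\<integral>x. \<phi> x *\<^sub>R (G x \<bullet> b) \<partial>lborel)"
     using integration_by_parts[OF vs \<phi> b] unfolding eq .
   qed
   moreover have "Lpow p UNIV (%x. v x - w x) <= ennreal (1 / real (Suc j))"
    unfolding v_def using d(2)[OF \<delta>] m(1) by (simp add: \<delta>_def)
   ultimately have "good j v G" using sj smooth_borel[OF vs] by (simp add: good_def)
   moreover have "G : Borel" unfolding G_def by measurable
   moreover have "\<forall>x. x ~: \<O> --> G x = 0" using inner_part_subset[of \<O> m] by (auto simp: G_def indicator_def)
   ultimately have "G : D j" using LG1 unfolding D_def by blast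
   then show ?thesis by blast
  qed
  show "(%x. (1/2) *\<^sub>R (G x + H x)) : D j" if GD: "G : D j" and HD: "H : D j" for j G H
  proof -
   obtain u v where u: "good j u G" and v: "good j v H" using GD HD by (auto simp: D_def)
   have [measurable]: "u : Borel" "v : Borel" using u v by (auto simp: good_def)
   have [measurable]: "G : Borel" "H : Borel" using GD HD by (auto simp: D_def)
   have half: "ennreal (1/2) * (x + y) <= c" if "x <= c" "y <= c" for x y c
   proof -
    have "ennreal (1/2) * (x + y) <= ennreal (1/2) * (c + c)" using that by (intro mult_left_mono add_mono) auto
    also have "... = (ennreal (1/2) + ennreal (1/2)) * c" by (simp only: distrib_left distrib_right)
    also have "ennreal (1/2) + ennreal (1/2) = 1" by (subst ennreal_plus[symmetric]) simp_all
    finally show ?thesis by simp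
   qed
   have c1: "Lpow p UNIV (%x. (1/2) *\<^sub>R (G x + H x)) <= ennreal (1 / K)"
    using GD HD by (intro order_trans[OF Lpow_midpoint_le[OF p]] half) (auto simp: D_def)
   let ?m = "%x. (1/2) *\<^sub>R (u x + v x)"
   have eq: "(1/2) *\<^sub>R (u x + v x) - w x = (1/2) *\<^sub>R ((u x - w x) + (v x - w x))" for x by (simp add: field_simps)
   have c2: "Lpow p UNIV (%x. ?m x - w x) <= ennreal (1 / real (Suc j))"
    unfolding eq using u v by (intro order_trans[OF Lpow_midpoint_le[OF p]] half) (auto simp: good_def)
   have c3: "sobmass p K (inner_part \<O> j) ?m (%x. (1/2) *\<^sub>R (G x + H x)) <= 1"
    using u v by (intro sobmass_midpoint[OF p]) (auto simp: good_def)
   have c4: "ibp j ?m (%x. (1/2) *\<^sub>R (G x + H x))"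
    unfolding ibp_def
   proof (intro ballI impI)
    fix \<phi> b assume \<phi>: "\<phi> : test_functions \<O>" and \<phi>0: "\<forall>x. x ~: inner_part \<O> j --> \<phi> x = 0" and b: "b : (Basis :: 'a set)"
    let ?d = "%x. frechet_derivative \<phi> (at x) b"
    have i1: "integrable lborel (%x. ?d x *\<^sub>R u x)" "integrable lborel (%x. ?d x *\<^sub>R v x)"
     using integrable_test_mult[OF test_functions_partial[OF \<phi> b] good_loc[OF u]]
      integrable_test_mult[OF test_functions_partial[OF \<phi> b] good_loc[OF v]] by auto
    have i2: "integrable lborel (%x. \<phi> x *\<^sub>R (G x \<bullet> b))" "integrable lborel (%x. \<phi> x *\<^sub>R (H x \<bullet> b))"
     using integrable_inner_left[OF integrable_test_mult[OF \<phi> D_loc[OF GD]], of b]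
      integrable_inner_left[OF integrable_test_mult[OF \<phi> D_loc[OF HD]], of b] by auto
    have "(\<integral>x. ?d x *\<^sub>R ?m x \<partial>lborel) = (\<integral>x. (1/2) *\<^sub>R (?d x *\<^sub>R u x + ?d x *\<^sub>R v x) \<partial>lborel)"
     by (intro Bochner_Integration.integral_cong refl) (simp add: algebra_simps)
    also have "... = (1/2) *\<^sub>R ((\<integral>x. ?d x *\<^sub>R u x \<partial>lborel) + (\<integral>x. ?d x *\<^sub>R v x \<partial>lborel))"
     unfolding Bochner_Integration.integral_scaleR_right Bochner_Integration.integral_add[OF i1] ..
    also have "... = - ((1/2) *\<^sub>R ((\<integral>x. \<phi> x *\<^sub>R (G x \<bullet> b) \<partial>lborel) + (\<integral>x. \<phi> x *\<^sub>R (H x \<bullet> b) \<partial>lborel)))"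
    proof -
     have "(\<integral>x. ?d x *\<^sub>R u x \<partial>lborel) = - (\<integral>x. \<phi> x *\<^sub>R (G x \<bullet> b) \<partial>lborel)"
      "(\<integral>x. ?d x *\<^sub>R v x \<partial>lborel) = - (\<integral>x. \<phi> x *\<^sub>R (H x \<bullet> b) \<partial>lborel)"
      using u v \<phi> \<phi>0 b unfolding good_def ibp_def by blast+
     then show ?thesis by (simp only: scaleR_minus_right minus_add_distrib scaleR_add_right)
    qed
    also have "(1/2) *\<^sub>R ((\<integral>x. \<phi> x *\<^sub>R (G x \<bullet> b) \<partial>lborel) + (\<integral>x. \<phi> x *\<^sub>R (H x \<bullet> b) \<partial>lborel))
      = (\<integral>x. (1/2) *\<^sub>R (\<phi> x *\<^sub>R (G x \<bullet> b) + \<phi> x *\<^sub>R (H x \<bullet> b)) \<partial>lborel)"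
     unfolding Bochner_Integration.integral_scaleR_right Bochner_Integration.integral_add[OF i2] ..
    also have "... = (\<integral>x. \<phi> x *\<^sub>R (((1/2) *\<^sub>R (G x + H x)) \<bullet> b) \<partial>lborel)"
     by (intro Bochner_Integration.integral_cong refl) (simp add: inner_add_left algebra_simps)
    finally show "(\<integral>x. ?d x *\<^sub>R ?m x \<partial>lborel) = - (\<integral>x. \<phi> x *\<^sub>R (((1/2) *\<^sub>R (G x + H x)) \<bullet> b) \<partial>lborel)" .
   qed
   have "?m : Borel" by measurable
   then have "good j ?m (%x. (1/2) *\<^sub>R (G x + H x))" unfolding good_def using c2 c3 c4 by blast
   moreover have "(%x. (1/2) *\<^sub>R (G x + H x)) : Borel" by measurable
   moreover have "\<forall>x. x ~: \<O> --> (1/2) *\<^sub>R (G x + H x) = 0" using GD HD by (auto simp: D_def)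
   ultimately show ?thesis unfolding D_def using c1 by blast
  qed
 qed
 define g where "g = (%x. indicator \<O> x *\<^sub>R g0 x)"
 have \<O>m [measurable]: "\<O> : sets borel" using \<O> by simp
 have gm [measurable]: "g : Borel" unfolding g_def by measurable
 have g_0: "g x = 0" if "x ~: \<O>" for x using that by (simp add: g_def)
 have Sm [measurable]: "S n : Borel" for n using S[of n] by (simp add: D_def)
 have limG: "(%n. Lpow p UNIV (%x. S n x - g x)) \<longlonglongrightarrow> 0"
 proof (rule tendsto_sandwich[OF _ _ tendsto_const lim0])
  show "\<forall>\<^sub>F n in sequentially. Lpow p UNIV (%x. S n x - g x) <= Lpow p UNIV (%x. S n x - g0 x)"
  proof (intro always_eventually allI Lpow_mono[OF p])
   fix n x
   have "S n x = 0" if "x ~: \<O>" using S[of n] that by (simp add: D_def)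
   then show "norm (S n x - g x) <= norm (S n x - g0 x)" by (cases "x : \<O>") (auto simp: g_def)
  qed
 qed simp
 have "\<forall>j. \<exists>v. good j v (S j)" using S by (auto simp: D_def)
 then obtain V where V: "!!j. good j (V j) (S j)" by metis
 have Vm [measurable]: "V n : Borel" for n using V[of n] by (simp add: good_def)
 have limV: "(%n. Lpow p UNIV (%x. V n x - w x)) \<longlonglongrightarrow> 0"
 proof (rule tendsto_sandwich[OF _ _ tendsto_const])
  show "\<forall>\<^sub>F n in sequentially. Lpow p UNIV (%x. V n x - w x) <= ennreal (1 / real (Suc n))"
   using V by (auto simp: good_def)
  have "(%n. ennreal (1 / real (Suc n))) \<longlonglongrightarrow> ennreal 0"
   by (intro tendsto_ennrealI LIMSEQ_Suc[OF lim_1_over_n])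
  then show "(%n. ennreal (1 / real (Suc n))) \<longlonglongrightarrow> 0" by simp
 qed simp
 have parts: "sobmass p K (inner_part \<O> i) w g <= 1" for i
 proof (rule sobmass_limit[OF p _ Vm Sm w gm limV limG])
  show "\<forall>\<^sub>F n in sequentially. sobmass p K (inner_part \<O> i) (V n) (S n) <= 1"
   using eventually_ge_at_top[of i]
  proof eventually_elim
   case (elim n)
   have "sobmass p K (inner_part \<O> n) (V n) (S n) <= 1" using V[of n] by (simp only: good_def)
   then show ?case by (rule order_trans[OF sobmass_mono_set[OF inner_part_mono[OF elim]]])
  qed
 qed measurable
 have mass: "sobmass p K UNIV w g <= 1"
  by (rule sobmass_exhaust[OF p \<O> w gm _ _ parts]) (use w0 g_0 in auto)
 have "ennreal K * Lpow p UNIV g <= 1"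
  using order_trans[OF _ mass, of "ennreal K * Lpow p UNIV g"] by (simp add: sobmass_def)
 then have "Lpow p UNIV g < \<infinity>"
 proof -
  have "Lpow p UNIV g = ennreal (1 / K) * (ennreal K * Lpow p UNIV g)"
   using K by (simp add: mult.assoc[symmetric] flip: ennreal_mult)
  also have "... <= ennreal (1 / K) * 1" using \<open>ennreal K * Lpow p UNIV g <= 1\<close> by (intro mult_left_mono) auto
  also have "... < \<infinity>" by simp
  finally show ?thesis .
 qed
 then have gloc: "loc_int g" by (intro Lpow_finite_loc_int[OF p gm])
 have "wgrad \<O> w g"
  unfolding wgrad_def
 proof (intro conjI loc gloc ballI)
  fix \<phi> b assume \<phi>: "\<phi> : test_functions \<O>" and b: "b : (Basis :: 'a set)"
  obtain Kc where Kc: "smooth \<phi>" "compact Kc" "Kc \<subseteq> \<O>" "!!x. x ~: Kc ==> \<phi> x = 0"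
   using \<phi> unfolding test_functions_iff by blast
  obtain i where i: "Kc \<subseteq> inner_part \<O> i" using inner_part_exhausts[OF \<O> Kc(2,3)] by blast
  obtain B R where BR: "0 <= B" "0 < R" "!!x. \<bar>\<phi> x\<bar> <= B" "!!x. R < norm x ==> \<phi> x = 0" "smooth \<phi>"
   using test_functions_support[OF \<phi>] by blast
  obtain B' R' where BR': "0 <= B'" "0 < R'" "!!x. \<bar>frechet_derivative \<phi> (at x) b\<bar> <= B'"
    "!!x. R' < norm x ==> frechet_derivative \<phi> (at x) b = 0" "smooth (partial b \<phi>)"
   using test_functions_support[OF test_functions_partial[OF \<phi> b]] by blast
  have l1: "(%n. \<integral>x. frechet_derivative \<phi> (at x) b *\<^sub>R V n x \<partial>lborel) \<longlonglongrightarrow> (\<integral>x. frechet_derivative \<phi> (at x) b *\<^sub>R w x \<partial>lborel)"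
   by (rule integral_mult_tendsto[OF p smooth_borel[OF BR'(5)] BR'(3), of 0 R']) (use BR' good_loc[OF V] loc limV in auto)
  have l2: "(%n. \<integral>x. \<phi> x *\<^sub>R S n x \<partial>lborel) \<longlonglongrightarrow> (\<integral>x. \<phi> x *\<^sub>R g x \<partial>lborel)"
   by (rule integral_mult_tendsto[OF p smooth_borel[OF BR(5)] BR(3), of 0 R]) (use BR D_loc[OF S] gloc limG in auto)
  have in1: "(\<integral>x. \<phi> x *\<^sub>R (h x \<bullet> b) \<partial>lborel) = (\<integral>x. \<phi> x *\<^sub>R h x \<partial>lborel) \<bullet> b" if "loc_int h" for h :: "'a => 'a"
   using integral_inner_left[OF integrable_test_mult[OF \<phi> that], of b] by simp
  have "\<forall>\<^sub>F n in sequentially. (\<integral>x. frechet_derivative \<phi> (at x) b *\<^sub>R V n x \<partial>lborel) = - ((\<integral>x. \<phi> x *\<^sub>R S n x \<partial>lborel) \<bullet> b)"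
   using eventually_ge_at_top[of i]
  proof eventually_elim
   case (elim n)
   have "\<forall>x. x ~: inner_part \<O> n --> \<phi> x = 0" using Kc(4) i inner_part_mono[OF elim, of \<O>] by blast
   then show ?case using V[of n] \<phi> b in1[OF D_loc[OF S]] by (simp add: good_def ibp_def)
  qed
  moreover have "(%n. - ((\<integral>x. \<phi> x *\<^sub>R S n x \<partial>lborel) \<bullet> b)) \<longlonglongrightarrow> - ((\<integral>x. \<phi> x *\<^sub>R g x \<partial>lborel) \<bullet> b)"
   by (intro tendsto_minus tendsto_inner l2 tendsto_const)
  ultimately have "(%n. \<integral>x. frechet_derivative \<phi> (at x) b *\<^sub>R V n x \<partial>lborel) \<longlonglongrightarrow> - ((\<integral>x. \<phi> x *\<^sub>R g x \<partial>lborel) \<bullet> b)"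
   using tendsto_cong by fast
  from LIMSEQ_unique[OF l1 this]
  show "(\<integral>x. frechet_derivative \<phi> (at x) b *\<^sub>R w x \<partial>lborel) = - (\<integral>x. \<phi> x *\<^sub>R (g x \<bullet> b) \<partial>lborel)"
   by (simp only: in1[OF gloc])
 qed
 then show ?thesis using g_0 mass by (rule that)
qed

section \<open>Limits of functions of bounded energy\<close>

text \<open>
By \<open>energy_lower\<close> with \<open>A\<close> the inner part: the energy of \<open>u n\<close> over \<open>\<O>\<close> dominates the gradient term, and
\<open>near\<close> tends to 1 along the sequence.
\<close>
lemma mollified_mass_eventually:
 fixes u :: "nat => 'a::euclidean_space => real" and e :: 'a
 assumes p: "1 < p" and e: "e : Basis" and \<O>: "open \<O>" and k: "!!n. levy p (k n)"
  and tail: "!!r. 0 < r ==> (%n. tail (k n) r) \<longlonglongrightarrow> 0"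
  and u: "!!n. u n : Borel"
  and mass: "!!n. Lpow p UNIV (u n) + (\<integral>\<^sup>+h. k n h * osc p (\<O> \<times> \<O>) (u n) h \<partial>lborel) <= 1"
  and c: "0 < c" and \<delta>: "\<delta> = 1 / real (Suc m)"
 shows "\<forall>\<^sub>F n in sequentially. sobmass p (K_const e p) (inner_part \<O> m) (conv (mollifier \<delta>) (u n)) (grad (conv (mollifier \<delta>) (u n))) <= ennreal (1 + c)"
proof -
 define s where "s = min (1/2) (c / (3 + c))"
 have s: "0 < s" "s < 1" using c by (auto simp: s_def)
 have sc: "1 + 2 * s <= (1 + c) * (1 - s)"
 proof -
  have "s <= c / (3 + c)" by (simp add: s_def)
  then have "s * (3 + c) <= c" using c by (simp add: pos_le_divide_eq)
  then show ?thesis by (simp add: algebra_simps)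
 qed
 have \<delta>0: "0 < \<delta>" using \<delta> by simp
 have \<O>m [measurable]: "\<O> : sets borel" using \<O> by simp
 have AB: "x - y : \<O>" if "x : inner_part \<O> m" "norm y < 2 * \<delta>" for x y
  using inner_part_diff[of x \<O> m y] that \<delta> by simp
 let ?A = "inner_part \<O> m"
 obtain r where r: "0 < r" "!!k u. levy p k ==> u : Borel ==> Lpow p UNIV u <= 1 ==>
   ennreal (K_const e p) * near p k r * Lpow p ?A (grad (conv (mollifier \<delta>) u))
    <= ennreal (1 + s) * (\<integral>\<^sup>+h. k h * osc p (\<O> \<times> \<O>) u h \<partial>lborel) + ennreal s"
 proof -
  have "\<exists>r>0. \<forall>k u. levy p k --> u : Borel --> Lpow p UNIV u <= 1 -->
   ennreal (K_const e p) * near p k r * Lpow p ?A (grad (conv (mollifier \<delta>) u))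
    <= ennreal (1 + s) * (\<integral>\<^sup>+h. k h * osc p (\<O> \<times> \<O>) u h \<partial>lborel) + ennreal s"
   by (rule energy_lower[OF p e \<delta>0 inner_part_borel bounded_inner_part \<O>m _ s(1) s(1)]) (rule AB)
  then show thesis using that by blast
 qed
 have "\<forall>\<^sub>F n in sequentially. tail (k n) r < ennreal s"
  using tail[OF r(1)] s(1) by (intro order_tendstoD(2)) auto
 then show ?thesis
 proof eventually_elim
  case (elim n)
  define b where "b = Lpow p UNIV (u n)"
  define E where "E = (\<integral>\<^sup>+h. k n h * osc p (\<O> \<times> \<O>) (u n) h \<partial>lborel)"
  define a where "a = Lpow p ?A (conv (mollifier \<delta>) (u n))"
  define X where "X = ennreal (K_const e p) * Lpow p ?A (grad (conv (mollifier \<delta>) (u n)))"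
  have bE: "b + E <= 1" using mass[of n] by (simp add: b_def E_def)
  have b1: "b <= 1" using order_trans[OF _ bE, of b] by simp
  have ab: "a <= b"
   unfolding a_def b_def by (rule Lpow_conv_mollifier_le[OF p \<delta>0 u]) auto
  have "near p (k n) r * X <= ennreal (1 + s) * E + ennreal s"
   using r(2)[OF k u b1[unfolded b_def]] by (simp add: X_def E_def mult_ac)
  moreover have "ennreal (1 - s) <= near p (k n) r"
  proof -
   have "1 <= near p (k n) r + ennreal s"
    using near_tail_ge_1[OF p k, of n r] elim by (meson add_left_mono less_imp_le order_trans)
   then have "1 - ennreal s <= near p (k n) r" by (simp add: ennreal_minus_le_iff add.commute)
   moreover have "ennreal (1 - s) = ennreal 1 - ennreal s"
    by (rule ennreal_minus[symmetric]) (use s in simp)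
   ultimately show ?thesis by simp
  qed
  ultimately have Xb: "ennreal (1 - s) * X <= ennreal (1 + s) * E + ennreal s"
   by (meson mult_right_mono order_trans zero_le)
  have "ennreal (1 - s) * a <= ennreal (1 + s) * b"
   using ab s by (intro mult_mono ennreal_leI) auto
  with Xb have "ennreal (1 - s) * a + ennreal (1 - s) * X <= ennreal (1 + s) * b + (ennreal (1 + s) * E + ennreal s)"
   by (intro add_mono)
  then have "ennreal (1 - s) * (a + X) <= ennreal (1 + s) * (b + E) + ennreal s"
   by (simp only: distrib_left add.assoc)
  also have "... <= ennreal (1 + s) * 1 + ennreal s" using bE by (intro add_right_mono mult_left_mono) auto
  also have "... = ennreal (1 + 2 * s)" using s by (simp flip: ennreal_plus)
  also have "... <= ennreal ((1 + c) * (1 - s))" by (rule ennreal_leI[OF sc])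
  also have "... = ennreal (1 - s) * ennreal (1 + c)" using s c by (simp add: ennreal_mult mult.commute)
  finally have fin: "ennreal (1 - s) * (a + X) <= ennreal (1 - s) * ennreal (1 + c)" .
  have "a + X <= ennreal (1 + c)"
  proof -
   have inv: "ennreal (1 / (1 - s)) * (ennreal (1 - s) * y) = y" for y
    using s by (simp add: mult.assoc[symmetric] flip: ennreal_mult)
   have "ennreal (1 / (1 - s)) * (ennreal (1 - s) * (a + X)) <= ennreal (1 / (1 - s)) * (ennreal (1 - s) * ennreal (1 + c))"
    by (intro mult_left_mono fin) simp
   then show ?thesis by (simp only: inv)
  qed
  then show ?case by (simp add: sobmass_def a_def X_def)
 qed
qed

text \<open>
The property \<open>Q\<close> is any further constraint stable under midpoints; it is meant for a lower bound on a linear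
functional. The sets \<open>C j\<close> ask for \<open>Q\<close> and for Sobolev mass at most \<open>1 + 1 / Suc j\<close> of the first \<open>j\<close>
mollifications on inner parts. These conditions are convex, hold for \<open>u n\<close> with \<open>n\<close> large, and in the limit
give mass at most 1 at every mollification scale.
\<close>
lemma sobolev_limit:
 fixes u :: "nat => 'a::euclidean_space => real" and e :: 'a
 assumes p: "1 < p" and e: "e : Basis" and \<O>: "open \<O>" and k: "!!n. levy p (k n)"
  and tail: "!!r. 0 < r ==> (%n. tail (k n) r) \<longlonglongrightarrow> 0"
  and u: "!!n. u n : Borel" and u0: "!!n x. x ~: \<O> ==> u n x = 0"
  and mass: "!!n. Lpow p UNIV (u n) + (\<integral>\<^sup>+h. k n h * osc p (\<O> \<times> \<O>) (u n) h \<partial>lborel) <= 1"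
  and Q: "!!n. Q (u n)"
  and Qmid: "!!v w. Q v ==> Q w ==> v : Borel ==> w : Borel ==>
    Lpow p UNIV v <= 1 ==> Lpow p UNIV w <= 1 ==> Q (%x. (1/2) *\<^sub>R (v x + w x))"
 obtains s w g where "!!j. Q (s j)" "!!j. s j : Borel" "!!j. Lpow p UNIV (s j) <= 1"
  "w : Borel" "!!x. x ~: \<O> ==> w x = 0" "(%j. Lpow p UNIV (%x. s j x - w x)) \<longlonglongrightarrow> 0"
  "wgrad \<O> w g" "!!x. x ~: \<O> ==> g x = 0" "sobmass p (K_const e p) UNIV w g <= 1"
proof -
 let ?K = "K_const e p"
 define mol where "mol = (%m v. conv (mollifier (1 / real (Suc m))) (v :: 'a => real))"
 define C where "C = (%j. {s. Q s & s : Borel & (\<forall>x. x ~: \<O> --> s x = 0) & Lpow p UNIV s <= 1 &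
   (\<forall>m\<le>j. sobmass p ?K (inner_part \<O> m) (mol m s) (grad (mol m s)) <= ennreal (1 + 1 / real (Suc j)))})"
 have mt: "mollifier (1 / real (Suc m)) : test_functions (UNIV :: 'a set)" for m
  by (rule mollifier_test_UNIV) simp
 have loc: "loc_int s" if "s : Borel" "Lpow p UNIV s <= 1" for s :: "'a => real"
  using that by (intro Lpow_finite_loc_int[OF p]) (auto intro: le_less_trans)
 have molm: "mol m s : Borel" "grad (mol m s) : Borel" if "loc_int s" for m s
 proof -
  have "smooth (mol m s)" unfolding mol_def by (rule smooth_conv[OF mt that])
  then show "mol m s : Borel" "grad (mol m s) : Borel"
   using smooth_borel borel_measurable_continuous_onI[OF continuous_grad] by blast+
 qed
 obtain s w0 where s: "!!j. s j : C j" and w0 [measurable]: "w0 : Borel"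
  and lim0: "(%j. Lpow p UNIV (%x. s j x - w0 x)) \<longlonglongrightarrow> 0"
 proof (rule midpoint_closed_family_convergent[OF p, of C 1])
  fix s w' assume "!!j. s j : C j" "w' : Borel" "(%n. Lpow p UNIV (%x. s n x - w' x)) \<longlonglongrightarrow> 0"
  then show thesis by (rule that)
 next
  show "C (Suc j) \<subseteq> C j" for j
  proof
   fix s assume s: "s : C (Suc j)"
   have le: "ennreal (1 + 1 / real (Suc (Suc j))) <= ennreal (1 + 1 / real (Suc j))"
    by (intro ennreal_leI) (simp add: field_simps)
   have "sobmass p ?K (inner_part \<O> m) (mol m s) (grad (mol m s)) <= ennreal (1 + 1 / real (Suc j))" if "m <= j" for m
   proof (rule order_trans[OF _ le])
    show "sobmass p ?K (inner_part \<O> m) (mol m s) (grad (mol m s)) <= ennreal (1 + 1 / real (Suc (Suc j)))"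
     using s that unfolding C_def by auto
   qed
   then show "s : C j" using s unfolding C_def by blast
  qed
  show "C 0 \<subseteq> Borel" by (auto simp: C_def)
  show "Lpow p UNIV s <= ennreal 1" if "s : C 0" for s using that by (simp add: C_def)
  show "C j \<noteq> {}" for j
  proof -
   have "\<forall>\<^sub>F n in sequentially. \<forall>m\<in>{..j}. sobmass p ?K (inner_part \<O> m) (mol m (u n)) (grad (mol m (u n))) <= ennreal (1 + 1 / real (Suc j))"
    unfolding mol_def
    by (intro eventually_ball_finite ballI mollified_mass_eventually[OF p e \<O> k tail u mass]) auto
   then obtain n where n: "\<forall>m\<in>{..j}. sobmass p ?K (inner_part \<O> m) (mol m (u n)) (grad (mol m (u n))) <= ennreal (1 + 1 / real (Suc j))"
    using eventually_happens'[OF sequentially_bot] by blast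
   have "Lpow p UNIV (u n) <= 1" using order_trans[OF _ mass[of n], of "Lpow p UNIV (u n)"] by simp
   then have "u n : C j" using n Q[of n] u[of n] u0[of _ n] by (auto simp: C_def)
   then show ?thesis by blast
  qed
  show "(%x. (1/2) *\<^sub>R (a x + b x)) : C j" if a: "a : C j" and b: "b : C j" for j a b
  proof -
   let ?c = "%x. (1/2) *\<^sub>R (a x + b x)"
   have am [measurable]: "a : Borel" and bm [measurable]: "b : Borel"
    and ab1: "Lpow p UNIV a <= 1" "Lpow p UNIV b <= 1" and ab0: "!!x. x ~: \<O> ==> a x = 0" "!!x. x ~: \<O> ==> b x = 0"
    and Qab: "Q a" "Q b"
    using a b by (auto simp: C_def)
   have la: "loc_int a" "loc_int b" using loc am bm ab1 by auto
   have "Lpow p UNIV ?c <= ennreal (1/2) * (Lpow p UNIV a + Lpow p UNIV b)"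
    by (rule Lpow_midpoint_le[OF p]) auto
   also have "... <= ennreal (1/2) * (1 + 1)" using ab1 by (intro mult_left_mono add_mono) auto
   also have "... = ennreal (1/2) * ennreal 2" by simp
   also have "... = 1" by (subst ennreal_mult[symmetric]) simp_all
   finally have c1: "Lpow p UNIV ?c <= 1" .
   have c2: "sobmass p ?K (inner_part \<O> m) (mol m ?c) (grad (mol m ?c)) <= ennreal (1 + 1 / real (Suc j))" if m: "m <= j" for m
   proof -
    have e1: "mol m ?c = (%x. (1/2) *\<^sub>R (mol m a x + mol m b x))"
     unfolding mol_def by (intro ext conv_midpoint[OF mt la])
    have lc: "loc_int ?c" using loc_int_lincomb[OF la, of "1/2" "1/2"] by (simp add: scaleR_add_right add_divide_distrib)
    have e2: "grad (mol m ?c) = (%x. (1/2) *\<^sub>R (grad (mol m a) x + grad (mol m b) x))"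
    proof
     fix x
     show "grad (mol m ?c) x = (1/2) *\<^sub>R (grad (mol m a) x + grad (mol m b) x)"
      unfolding mol_def grad_conv[OF mt lc] grad_conv[OF mt la(1)] grad_conv[OF mt la(2)]
       sum.distrib[symmetric] scaleR_sum_right
     proof (intro sum.cong refl)
      fix i :: 'a assume "i : Basis"
      from conv_midpoint[OF test_functions_partial[OF mt this] la]
      show "conv (partial i (mollifier (1 / real (Suc m)))) ?c x *\<^sub>R i
       = (1/2) *\<^sub>R (conv (partial i (mollifier (1 / real (Suc m)))) a x *\<^sub>R i + conv (partial i (mollifier (1 / real (Suc m)))) b x *\<^sub>R i)"
       by (simp add: scaleR_add_left algebra_simps)
     qed
    qed
    show ?thesis
     unfolding e2 unfolding e1 by (rule sobmass_midpoint[OF p]) (use a b m molm[OF la(1)] molm[OF la(2)] in \<open>auto simp: C_def\<close>)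
   qed
   have "Q ?c" by (rule Qmid[OF Qab am bm ab1])
   moreover have "?c : Borel" by measurable
   ultimately show ?thesis using c1 c2 ab0 unfolding C_def by simp
  qed
 qed
 have sm [measurable]: "s j : Borel" and s1: "Lpow p UNIV (s j) <= 1" and s0: "!!x. x ~: \<O> ==> s j x = 0"
  and sQ: "Q (s j)" for j using s[of j] by (auto simp: C_def)
 define w where "w = (%x. indicator \<O> x *\<^sub>R w0 x)"
 have \<O>m [measurable]: "\<O> : sets borel" using \<O> by simp
 have wm [measurable]: "w : Borel" unfolding w_def by measurable
 have w_0: "w x = 0" if "x ~: \<O>" for x using that by (simp add: w_def)
 have lim: "(%j. Lpow p UNIV (%x. s j x - w x)) \<longlonglongrightarrow> 0"
 proof (rule tendsto_sandwich[OF _ _ tendsto_const lim0])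
  show "\<forall>\<^sub>F j in sequentially. Lpow p UNIV (%x. s j x - w x) <= Lpow p UNIV (%x. s j x - w0 x)"
  proof (intro always_eventually allI Lpow_mono[OF p])
   fix j x
   show "norm (s j x - w x) <= norm (s j x - w0 x)" using s0[of x j] by (cases "x : \<O>") (auto simp: w_def)
  qed
 qed simp
 have wfin: "Lpow p UNIV w < \<infinity>"
 proof -
  obtain D where D: "0 <= D" "\<forall>v w. v : Borel --> w : Borel -->
    Lpow p UNIV (%x::'a. v x + w x :: real) <= ennreal 2 * Lpow p UNIV v + ennreal D * Lpow p UNIV w"
   using Lpow_add_le2[OF p] by blast
  have "\<forall>\<^sub>F j in sequentially. Lpow p UNIV (%x. s j x - w x) < 1" using lim by (rule order_tendstoD(2)) simp
  then obtain j where j: "Lpow p UNIV (%x. s j x - w x) < 1" using eventually_happens'[OF sequentially_bot] by blast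
  have "Lpow p UNIV w <= ennreal 2 * Lpow p UNIV (s j) + ennreal D * Lpow p UNIV (%x. w x - s j x)"
   using D(2)[rule_format, OF sm borel_measurable_diff[OF wm sm], of j j] by simp
  also have "... <= ennreal 2 * 1 + ennreal D * 1"
   using s1[of j] j by (subst Lpow_minus_commute) (intro add_mono mult_left_mono; simp)
  also have "... < \<infinity>" by simp
  finally show ?thesis .
 qed
 have wl: "loc_int w" by (rule Lpow_finite_loc_int[OF p wm wfin])
 have sl: "loc_int (s j)" for j by (rule loc[OF sm s1])
 have bd: "sobmass p ?K (inner_part \<O> m) (conv (mollifier (1 / real (Suc m))) w) (grad (conv (mollifier (1 / real (Suc m))) w)) <= 1" for m
 proof -
  have "sobmass p ?K (inner_part \<O> m) (mol m w) (grad (mol m w)) <= ennreal (1 + 1 / real (Suc i))" for i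
  proof (rule sobmass_Fatou[OF p inner_part_borel, where v="%j. mol m (s j)" and G="%j. grad (mol m (s j))"])
   show "mol m (s j) : Borel" "grad (mol m (s j)) : Borel" for j
    by (rule molm[OF sl])+
   show "mol m w : Borel" "grad (mol m w) : Borel" by (rule molm[OF wl])+
   show "(%j. mol m (s j) x) \<longlonglongrightarrow> mol m w x" for x
    unfolding mol_def by (rule conv_tendsto[OF p mt sl wl lim])
   show "(%j. grad (mol m (s j)) x) \<longlonglongrightarrow> grad (mol m w) x" for x
    unfolding mol_def grad_conv[OF mt sl] grad_conv[OF mt wl]
    by (intro tendsto_sum tendsto_scaleR tendsto_const conv_tendsto[OF p test_functions_partial[OF mt] sl wl lim])
   show "\<forall>\<^sub>F j in sequentially. sobmass p ?K (inner_part \<O> m) (mol m (s j)) (grad (mol m (s j))) <= ennreal (1 + 1 / real (Suc i))"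
    using eventually_ge_at_top[of "max m i"]
   proof eventually_elim
    case (elim j)
    have "sobmass p ?K (inner_part \<O> m) (mol m (s j)) (grad (mol m (s j))) <= ennreal (1 + 1 / real (Suc j))"
     using s[of j] elim by (simp add: C_def)
    also have "... <= ennreal (1 + 1 / real (Suc i))" using elim by (intro ennreal_leI) (simp add: field_simps)
    finally show ?case .
   qed
  qed
  then show ?thesis using ennreal_le_of_le_add[of _ 1] by (simp add: mol_def)
 qed
 obtain g where g: "wgrad \<O> w g" "!!x. x ~: \<O> ==> g x = 0" "sobmass p ?K UNIV w g <= 1"
  using bounded_mollified_imp_wgrad[OF p K_const_pos[OF p e] \<O> wm w_0 wfin bd] by blast
 show ?thesis by (rule that[OF sQ sm s1 wm w_0 lim g])
qed

section \<open>Approximation by test functions\<close>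

text \<open>
Membership in the closure of the test functions, for a given gradient.
\<close>
definition approximable :: "real => 'a::euclidean_space set => ('a => real) => ('a => 'a) => bool" where
 "approximable p \<O> w g \<longleftrightarrow> (\<forall>\<eta>>0. \<exists>\<phi>\<in>test_functions \<O>.
   Lpow p UNIV (%x. w x - \<phi> x) <= ennreal \<eta> & Lpow p UNIV (%x. g x - grad \<phi> x) <= ennreal \<eta>)"

lemma grad_borel: "smooth \<phi> ==> grad \<phi> : Borel"
 using continuous_grad by (rule borel_measurable_continuous_onI)

lemma grad_add: "smooth \<phi> ==> smooth \<psi> ==> grad (%x. \<phi> x + \<psi> x) x = grad \<phi> x + grad \<psi> x"
 unfolding grad_def by (simp add: partial_add smooth_differentiable scaleR_add_left sum.distrib)

lemma test_functions_add:
 assumes "\<phi> : test_functions \<O>" "\<psi> : test_functions \<O>"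
 shows "(%x. \<phi> x + \<psi> x) : test_functions \<O>"
proof -
 obtain K where K: "smooth \<phi>" "compact K" "K \<subseteq> \<O>" "!!x. x ~: K ==> \<phi> x = 0"
  using assms(1) unfolding test_functions_iff by blast
 obtain L where L: "smooth \<psi>" "compact L" "L \<subseteq> \<O>" "!!x. x ~: L ==> \<psi> x = 0"
  using assms(2) unfolding test_functions_iff by blast
 show ?thesis unfolding test_functions_iff
  using smooth_add[OF K(1) L(1)] K L by (intro conjI exI[of _ "K \<union> L"]) auto
qed

lemma Lpow_sum_small:
 fixes p :: real
 assumes p: "1 < p"
 obtains C where "0 < C" "!!(u :: 'a::euclidean_space => 'b::euclidean_space) v \<eta>. u : Borel ==> v : Borel ==>
  0 <= \<eta> ==> Lpow p UNIV u <= ennreal \<eta> ==> Lpow p UNIV v <= ennreal \<eta> ==> Lpow p UNIV (%x. u x + v x) <= ennreal (C * \<eta>)"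
proof -
 obtain D where D: "0 <= D" "\<forall>u v. u : Borel --> v : Borel -->
   Lpow p UNIV (%x::'a. u x + v x :: 'b) <= ennreal 2 * Lpow p UNIV u + ennreal D * Lpow p UNIV v"
  using Lpow_add_le2[OF p] by blast
 have "Lpow p UNIV (%x. u x + v x) <= ennreal ((2 + D) * \<eta>)"
  if "u : Borel" "v : Borel" "0 <= \<eta>" "Lpow p UNIV u <= ennreal \<eta>" "Lpow p UNIV v <= ennreal \<eta>"
  for u v :: "'a => 'b" and \<eta>
 proof -
  have "Lpow p UNIV (%x. u x + v x) <= ennreal 2 * Lpow p UNIV u + ennreal D * Lpow p UNIV v"
   using D(2) that by blast
  also have "... <= ennreal 2 * ennreal \<eta> + ennreal D * ennreal \<eta>"
   using that by (intro add_mono mult_left_mono) auto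
  also have "... = ennreal (2 * \<eta> + D * \<eta>)" using that D by (intro ennreal_lincomb) auto
  finally show ?thesis by (simp add: distrib_right)
 qed
 then show ?thesis using D(1) by (intro that[of "2 + D"]) auto
qed

lemma approximable_close:
 fixes w :: "'a::euclidean_space => real"
 assumes p: "1 < p" and w: "w : Borel" "g : Borel"
  and close: "!!\<eta>. 0 < \<eta> ==> \<exists>v h. v : Borel & h : Borel & approximable p \<O> v h &
    Lpow p UNIV (%x. w x - v x) <= ennreal \<eta> & Lpow p UNIV (%x. g x - h x) <= ennreal \<eta>"
 shows "approximable p \<O> w g"
 unfolding approximable_def
proof (intro allI impI)
 fix \<eta> :: real assume \<eta>: "0 < \<eta>"
 obtain C1 where C1: "0 < C1" "!!(u :: 'a => real) v \<eta>. u : Borel ==> v : Borel ==>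
  0 <= \<eta> ==> Lpow p UNIV u <= ennreal \<eta> ==> Lpow p UNIV v <= ennreal \<eta> ==> Lpow p UNIV (%x. u x + v x) <= ennreal (C1 * \<eta>)"
  using Lpow_sum_small[OF p] by blast
 obtain C2 where C2: "0 < C2" "!!(u :: 'a => 'a) v \<eta>. u : Borel ==> v : Borel ==>
  0 <= \<eta> ==> Lpow p UNIV u <= ennreal \<eta> ==> Lpow p UNIV v <= ennreal \<eta> ==> Lpow p UNIV (%x. u x + v x) <= ennreal (C2 * \<eta>)"
  using Lpow_sum_small[OF p] by blast
 define \<theta> where "\<theta> = \<eta> / max C1 C2"
 have \<theta>: "0 < \<theta>" "C1 * \<theta> <= \<eta>" "C2 * \<theta> <= \<eta>"
 proof -
  have "0 < max C1 C2" using C1(1) by simp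
  then show "0 < \<theta>" using \<eta> by (simp add: \<theta>_def)
  have "max C1 C2 * \<theta> = \<eta>" using \<open>0 < max C1 C2\<close> by (simp add: \<theta>_def)
  moreover have "C1 * \<theta> <= max C1 C2 * \<theta>" "C2 * \<theta> <= max C1 C2 * \<theta>"
   using \<open>0 < \<theta>\<close> by (intro mult_right_mono; simp)+
  ultimately show "C1 * \<theta> <= \<eta>" "C2 * \<theta> <= \<eta>" by auto
 qed
 obtain v h where v: "v : Borel" "h : Borel" "approximable p \<O> v h"
   "Lpow p UNIV (%x. w x - v x) <= ennreal \<theta>" "Lpow p UNIV (%x. g x - h x) <= ennreal \<theta>"
  using close[OF \<theta>(1)] by blast
 obtain \<phi> where \<phi>: "\<phi> : test_functions \<O>" "Lpow p UNIV (%x. v x - \<phi> x) <= ennreal \<theta>" "Lpow p UNIV (%x. h x - grad \<phi> x) <= ennreal \<theta>"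
  using v(3) \<theta>(1) unfolding approximable_def by blast
 have s: "smooth \<phi>" using \<phi>(1) by (simp add: test_functions_iff)
 have "Lpow p UNIV (%x. (w x - v x) + (v x - \<phi> x)) <= ennreal (C1 * \<theta>)"
  using w v \<phi> \<theta> smooth_borel[OF s] by (intro C1(2)) auto
 then have 1: "Lpow p UNIV (%x. w x - \<phi> x) <= ennreal \<eta>" using \<theta>(2) by (simp add: order_trans[OF _ ennreal_leI])
 have "Lpow p UNIV (%x. (g x - h x) + (h x - grad \<phi> x)) <= ennreal (C2 * \<theta>)"
  using w v \<phi> \<theta> grad_borel[OF s] by (intro C2(2)) auto
 then have 2: "Lpow p UNIV (%x. g x - grad \<phi> x) <= ennreal \<eta>" using \<theta>(3) by (simp add: order_trans[OF _ ennreal_leI])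
 show "\<exists>\<phi>\<in>test_functions \<O>. Lpow p UNIV (%x. w x - \<phi> x) <= ennreal \<eta> & Lpow p UNIV (%x. g x - grad \<phi> x) <= ennreal \<eta>"
  using \<phi>(1) 1 2 by blast
qed

lemma approximable_add:
 fixes w v :: "'a::euclidean_space => real"
 assumes p: "1 < p" and m: "w : Borel" "g : Borel" "v : Borel" "h : Borel"
  and a: "approximable p \<O> w g" "approximable p \<O> v h"
 shows "approximable p \<O> (%x. w x + v x) (%x. g x + h x)"
 unfolding approximable_def
proof (intro allI impI)
 fix \<eta> :: real assume \<eta>: "0 < \<eta>"
 obtain C1 where C1: "0 < C1" "!!(u :: 'a => real) v \<eta>. u : Borel ==> v : Borel ==>
  0 <= \<eta> ==> Lpow p UNIV u <= ennreal \<eta> ==> Lpow p UNIV v <= ennreal \<eta> ==> Lpow p UNIV (%x. u x + v x) <= ennreal (C1 * \<eta>)"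
  using Lpow_sum_small[OF p] by blast
 obtain C2 where C2: "0 < C2" "!!(u :: 'a => 'a) v \<eta>. u : Borel ==> v : Borel ==>
  0 <= \<eta> ==> Lpow p UNIV u <= ennreal \<eta> ==> Lpow p UNIV v <= ennreal \<eta> ==> Lpow p UNIV (%x. u x + v x) <= ennreal (C2 * \<eta>)"
  using Lpow_sum_small[OF p] by blast
 define \<theta> where "\<theta> = \<eta> / max C1 C2"
 have \<theta>: "0 < \<theta>" "C1 * \<theta> <= \<eta>" "C2 * \<theta> <= \<eta>"
 proof -
  have "0 < max C1 C2" using C1(1) by simp
  then show "0 < \<theta>" using \<eta> by (simp add: \<theta>_def)
  have "max C1 C2 * \<theta> = \<eta>" using \<open>0 < max C1 C2\<close> by (simp add: \<theta>_def)
  moreover have "C1 * \<theta> <= max C1 C2 * \<theta>" "C2 * \<theta> <= max C1 C2 * \<theta>"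
   using \<open>0 < \<theta>\<close> by (intro mult_right_mono; simp)+
  ultimately show "C1 * \<theta> <= \<eta>" "C2 * \<theta> <= \<eta>" by auto
 qed
 obtain \<phi> where \<phi>: "\<phi> : test_functions \<O>" "Lpow p UNIV (%x. w x - \<phi> x) <= ennreal \<theta>" "Lpow p UNIV (%x. g x - grad \<phi> x) <= ennreal \<theta>"
  using a(1) \<theta>(1) unfolding approximable_def by blast
 obtain \<psi> where \<psi>: "\<psi> : test_functions \<O>" "Lpow p UNIV (%x. v x - \<psi> x) <= ennreal \<theta>" "Lpow p UNIV (%x. h x - grad \<psi> x) <= ennreal \<theta>"
  using a(2) \<theta>(1) unfolding approximable_def by blast
 have s: "smooth \<phi>" "smooth \<psi>" using \<phi>(1) \<psi>(1) by (simp_all add: test_functions_iff)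
 have "Lpow p UNIV (%x. (w x - \<phi> x) + (v x - \<psi> x)) <= ennreal (C1 * \<theta>)"
  using m \<phi> \<psi> \<theta> smooth_borel[OF s(1)] smooth_borel[OF s(2)] by (intro C1(2)) auto
 then have 1: "Lpow p UNIV (%x. (w x + v x) - (\<phi> x + \<psi> x)) <= ennreal \<eta>"
  using order_trans[OF _ ennreal_leI[OF \<theta>(2)]] by (simp add: algebra_simps)
 have "Lpow p UNIV (%x. (g x - grad \<phi> x) + (h x - grad \<psi> x)) <= ennreal (C2 * \<theta>)"
  using m \<phi> \<psi> \<theta> grad_borel[OF s(1)] grad_borel[OF s(2)] by (intro C2(2)) auto
 then have 2: "Lpow p UNIV (%x. (g x + h x) - grad (%x. \<phi> x + \<psi> x) x) <= ennreal \<eta>"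
  unfolding grad_add[OF s] using order_trans[OF _ ennreal_leI[OF \<theta>(3)]] by (simp add: algebra_simps)
 show "\<exists>\<zeta>\<in>test_functions \<O>. Lpow p UNIV (%x. (w x + v x) - \<zeta> x) <= ennreal \<eta> & Lpow p UNIV (%x. (g x + h x) - grad \<zeta> x) <= ennreal \<eta>"
  using test_functions_add[OF \<phi>(1) \<psi>(1)] 1 2 by (intro bexI[of _ "%x. \<phi> x + \<psi> x"] conjI)
qed

text \<open>
Mollify; the support stays inside \<open>\<O>\<close>.
\<close>
lemma approximable_compact_support:
 fixes w :: "'a::euclidean_space => real"
 assumes p: "1 < p" and \<O>: "open \<O>" and wg: "wgrad UNIV w g" and fin: "Lpow p UNIV w < \<infinity>" "Lpow p UNIV g < \<infinity>"
  and K: "compact K" "K \<subseteq> \<O>" and w0: "!!x. x ~: K ==> w x = 0"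
 shows "approximable p \<O> w g"
 unfolding approximable_def
proof (intro allI impI)
 fix \<eta> :: real assume \<eta>: "0 < \<eta>"
 have loc: "loc_int w" "loc_int g" using wg by (auto simp: wgrad_def)
 have wm: "w : Borel" "g : Borel" using loc by (auto simp: loc_int_def)
 obtain d where d: "0 < d" "{x + y | x y. x : K & y : cball 0 d} \<subseteq> \<O>"
  by (rule compact_neighbourhood[OF K(1) \<O> K(2)])
 obtain d1 where d1: "0 < d1" "!!\<delta>. 0 < \<delta> ==> \<delta> < d1 ==> Lpow p UNIV (%x. conv (mollifier \<delta>) w x - w x) <= ennreal \<eta>"
  using Lpow_conv_mollifier_approx[OF p wm(1) fin(1) \<eta>] by blast
 obtain d2 where d2: "0 < d2" "!!\<delta>. 0 < \<delta> ==> \<delta> < d2 ==> Lpow p UNIV (%x. conv (mollifier \<delta>) g x - g x) <= ennreal \<eta>"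
  using Lpow_conv_mollifier_approx[OF p wm(2) fin(2) \<eta>] by blast
 define \<delta> where "\<delta> = min d (min d1 d2) / 2"
 have \<delta>: "0 < \<delta>" "\<delta> <= d" "\<delta> < d1" "\<delta> < d2" using d(1) d1(1) d2(1) by (auto simp: \<delta>_def)
 have "cball (0::'a) \<delta> \<subseteq> cball 0 d" using \<delta>(2) by (rule subset_cball)
 then have sub: "{x + y | x y. x : K & y : cball 0 \<delta>} \<subseteq> \<O>" using d(2) by blast
 have gr: "grad (conv (mollifier \<delta>) w) x = conv (mollifier \<delta>) g x" for x
  by (rule grad_conv_wgrad[OF wg \<delta>(1)]) simp
 show "\<exists>\<phi>\<in>test_functions \<O>. Lpow p UNIV (%x. w x - \<phi> x) <= ennreal \<eta> & Lpow p UNIV (%x. g x - grad \<phi> x) <= ennreal \<eta>"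
 proof (intro bexI conjI)
  show "conv (mollifier \<delta>) w : test_functions \<O>" by (rule conv_mollifier_test[OF \<delta>(1) loc(1) w0 K(1) sub])
  show "Lpow p UNIV (%x. w x - conv (mollifier \<delta>) w x) <= ennreal \<eta>"
   by (subst Lpow_minus_commute) (rule d1(2)[OF \<delta>(1,3)])
  show "Lpow p UNIV (%x. g x - grad (conv (mollifier \<delta>) w) x) <= ennreal \<eta>"
   unfolding gr by (subst Lpow_minus_commute) (rule d2(2)[OF \<delta>(1,4)])
 qed
qed

lemma wgrad_translate:
 fixes w :: "'a::euclidean_space => real"
 assumes wg: "wgrad UNIV w g" shows "wgrad UNIV (%x. w (x - a)) (%x. g (x - a))"
 unfolding wgrad_def
proof (intro conjI ballI)
 have loc: "loc_int w" "loc_int g" using wg by (auto simp: wgrad_def)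
 have wm [measurable]: "w : Borel" "g : Borel" using loc by (auto simp: loc_int_def)
 show "loc_int (%x. w (x - a))" "loc_int (%x. g (x - a))" using loc by (auto intro: loc_int_translate)
 fix \<phi> :: "'a => real" and b :: 'a assume \<phi>: "\<phi> : test_functions UNIV" and b: "b : Basis"
 have s: "smooth \<phi>" using \<phi> by (simp add: test_functions_iff)
 let ?\<phi> = "%x. \<phi> (x + a)"
 have s': "smooth ?\<phi>" using smooth_affine[OF s, of a 1] by (simp add: add.commute)
 obtain B R where BR: "0 <= B" "0 < R" "!!x. \<bar>\<phi> x\<bar> <= B" "!!x. R < norm x ==> \<phi> x = 0" "smooth \<phi>"
  using test_functions_support[OF \<phi>] by blast
 have \<phi>': "?\<phi> : test_functions UNIV"
  unfolding test_functions_iff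
 proof (intro conjI s' exI[of _ "cball (- a) R"] allI impI)
  fix x assume "x ~: cball (- a) R"
  then have "R < norm (x + a)" by (simp add: dist_norm norm_minus_commute[of "- a" x])
  then show "\<phi> (x + a) = 0" by (rule BR(4))
 qed auto
 have d: "frechet_derivative ?\<phi> (at x) b = frechet_derivative \<phi> (at (x + a)) b" for x
 proof -
  have "((%x. x + a) has_derivative (%h. h)) (at x)" by (auto intro!: derivative_eq_intros)
  note D = has_derivative_compose[OF this smooth_has_derivative[OF s]]
  show ?thesis unfolding frechet_derivative_eqI[OF D] ..
 qed
 have dm: "partial b \<phi> : Borel" using smooth_partial[OF s b] by (rule smooth_borel)
 note [measurable] = dm smooth_borel[OF s]
 have "(\<integral>x. frechet_derivative \<phi> (at x) b *\<^sub>R w (x - a) \<partial>lborel) = (\<integral>x. frechet_derivative \<phi> (at (x + a)) b *\<^sub>R w (x + a - a) \<partial>lborel)"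
  by (rule integral_translate[symmetric, of "%x. frechet_derivative \<phi> (at x) b *\<^sub>R w (x - a)"]) measurable
 also have "... = (\<integral>x. frechet_derivative ?\<phi> (at x) b *\<^sub>R w x \<partial>lborel)" unfolding d by simp
 also have "... = - (\<integral>x. \<phi> (x + a) *\<^sub>R (g x \<bullet> b) \<partial>lborel)" using wg \<phi>' b by (simp add: wgrad_def)
 also have "(\<integral>x. \<phi> (x + a) *\<^sub>R (g x \<bullet> b) \<partial>lborel) = (\<integral>x. \<phi> (x + a) *\<^sub>R (g (x + a - a) \<bullet> b) \<partial>lborel)" by simp
 also have "... = (\<integral>x. \<phi> x *\<^sub>R (g (x - a) \<bullet> b) \<partial>lborel)"
  by (rule integral_translate[of "%x. \<phi> x *\<^sub>R (g (x - a) \<bullet> b)"]) measurable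
 finally show "(\<integral>x. frechet_derivative \<phi> (at x) b *\<^sub>R w (x - a) \<partial>lborel) = - (\<integral>x. \<phi> x *\<^sub>R (g (x - a) \<bullet> b) \<partial>lborel)" .
qed

lemma test_functions_mult:
 assumes "\<phi> : test_functions \<O>" "smooth \<psi>" shows "(%x. \<phi> x * \<psi> x) : test_functions \<O>"
proof -
 obtain K where K: "smooth \<phi>" "compact K" "K \<subseteq> \<O>" "!!x. x ~: K ==> \<phi> x = 0"
  using assms(1) unfolding test_functions_iff by blast
 show ?thesis unfolding test_functions_iff
  using smooth_mult[OF K(1) assms(2)] K by (intro conjI exI[of _ K]) auto
qed

lemma Lpow_mult_bounded_finite:
 fixes u :: "'a::euclidean_space => 'b::euclidean_space" and \<psi> :: "'a => 'c::euclidean_space" and F :: "'a => 'd::euclidean_space"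
 assumes p: "1 < p" and u: "u : Borel" "Lpow p UNIV u < \<infinity>"
  and F: "!!x. norm (F x) <= B * norm (u x)"
 shows "Lpow p UNIV F < \<infinity>"
proof -
 have "Lpow p UNIV F <= Lpow p UNIV (%x. \<bar>B\<bar> *\<^sub>R u x)"
 proof (rule Lpow_mono[OF p])
  fix x show "norm (F x) <= norm (\<bar>B\<bar> *\<^sub>R u x)"
   using order_trans[OF F[of x] mult_right_mono[OF abs_ge_self[of B] norm_ge_zero[of "u x"]]] by simp
 qed
 also have "... = ennreal (\<bar>\<bar>B\<bar>\<bar> powr p) * Lpow p UNIV u" by (rule Lpow_scaleR[OF u(1)]) simp
 also have "... < \<infinity>" using u(2) by (simp add: ennreal_mult_less_top)
 finally show ?thesis .
qed

lemma Lpow_add_finite: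
 fixes u v :: "'a::euclidean_space => 'b::euclidean_space"
 assumes p: "1 < p" and "u : Borel" "v : Borel" "Lpow p UNIV u < \<infinity>" "Lpow p UNIV v < \<infinity>"
 shows "Lpow p UNIV (%x. u x + v x) < \<infinity>"
proof -
 obtain D where D: "0 <= D" "\<forall>u v. u : Borel --> v : Borel -->
   Lpow p UNIV (%x::'a. u x + v x :: 'b) <= ennreal 2 * Lpow p UNIV u + ennreal D * Lpow p UNIV v"
  using Lpow_add_le2[OF p] by blast
 have "Lpow p UNIV (%x. u x + v x) <= ennreal 2 * Lpow p UNIV u + ennreal D * Lpow p UNIV v" using D assms by blast
 also have "... < \<infinity>" using assms by (simp add: ennreal_mult_less_top)
 finally show ?thesis .
qed

text \<open>
Leibniz rule, tested with the product of the two test functions.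
\<close>
lemma wgrad_mult_test:
 fixes w :: "'a::euclidean_space => real"
 assumes p: "1 < p" and wg: "wgrad UNIV w g" and \<psi>: "\<psi> : test_functions UNIV" and fin: "Lpow p UNIV w < \<infinity>" "Lpow p UNIV g < \<infinity>"
 shows "wgrad UNIV (%x. \<psi> x * w x) (%x. \<psi> x *\<^sub>R g x + w x *\<^sub>R grad \<psi> x)"
  and "Lpow p UNIV (%x. \<psi> x * w x) < \<infinity>" and "Lpow p UNIV (%x. \<psi> x *\<^sub>R g x + w x *\<^sub>R grad \<psi> x) < \<infinity>"
proof -
 have loc: "loc_int w" "loc_int g" using wg by (auto simp: wgrad_def)
 have wm [measurable]: "w : Borel" and gm [measurable]: "g : Borel" using loc by (auto simp: loc_int_def)
 have s: "smooth \<psi>" using \<psi> by (simp add: test_functions_iff)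
 note [measurable] = smooth_borel[OF s] grad_borel[OF s]
 obtain B where B: "0 <= B" "!!x. \<bar>\<psi> x\<bar> <= B" using test_functions_bounded[OF \<psi>] by blast
 have "\<forall>b\<in>Basis. \<exists>B\<ge>0. \<forall>x. \<bar>frechet_derivative \<psi> (at x) b\<bar> <= B"
  using test_functions_bounded[OF test_functions_partial[OF \<psi>]] by blast
 then obtain C where C: "!!b x. b : Basis ==> \<bar>frechet_derivative \<psi> (at x) b\<bar> <= C b" by metis
 have gb: "norm (grad \<psi> x) <= (\<Sum>b\<in>Basis. C b)" for x
  by (rule order_trans[OF norm_le_l1]) (auto intro!: sum_mono simp: grad_inner_Basis C)
 show f1: "Lpow p UNIV (%x. \<psi> x * w x) < \<infinity>"
  by (rule Lpow_mult_bounded_finite[OF p wm fin(1), of _ B]) (use B in \<open>auto simp: abs_mult intro!: mult_right_mono\<close>)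
 have f2: "Lpow p UNIV (%x. \<psi> x *\<^sub>R g x) < \<infinity>"
  by (rule Lpow_mult_bounded_finite[OF p gm fin(2), of _ B]) (use B in \<open>auto intro!: mult_right_mono\<close>)
 have f3: "Lpow p UNIV (%x. w x *\<^sub>R grad \<psi> x) < \<infinity>"
 proof (rule Lpow_mult_bounded_finite[OF p wm fin(1)])
  fix x show "norm (w x *\<^sub>R grad \<psi> x) <= (\<Sum>b\<in>Basis. C b) * norm (w x)"
   using mult_left_mono[OF gb[of x] norm_ge_zero[of "w x"]] by (simp add: mult.commute)
 qed
 show f4: "Lpow p UNIV (%x. \<psi> x *\<^sub>R g x + w x *\<^sub>R grad \<psi> x) < \<infinity>"
  by (rule Lpow_add_finite[OF p _ _ f2 f3]) measurable
 show "wgrad UNIV (%x. \<psi> x * w x) (%x. \<psi> x *\<^sub>R g x + w x *\<^sub>R grad \<psi> x)"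
  unfolding wgrad_def
 proof (intro conjI ballI)
  show "loc_int (%x. \<psi> x * w x)" by (rule Lpow_finite_loc_int[OF p _ f1]) measurable
  show "loc_int (%x. \<psi> x *\<^sub>R g x + w x *\<^sub>R grad \<psi> x)" by (rule Lpow_finite_loc_int[OF p _ f4]) measurable
  fix \<phi> :: "'a => real" and b :: 'a assume \<phi>: "\<phi> : test_functions UNIV" and b: "b : Basis"
  have s\<phi>: "smooth \<phi>" using \<phi> by (simp add: test_functions_iff)
  let ?d = "%f x. frechet_derivative f (at x) b"
  have t1: "(%x. \<phi> x * \<psi> x) : test_functions UNIV" by (rule test_functions_mult[OF \<phi> s])
  have t2: "(%x. \<phi> x * ?d \<psi> x) : test_functions UNIV" by (rule test_functions_mult[OF \<phi> smooth_partial[OF s b]])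
  have d1: "?d (%x. \<phi> x * \<psi> x) x = \<phi> x * ?d \<psi> x + ?d \<phi> x * \<psi> x" for x
   by (rule partial_mult[OF smooth_differentiable[OF s\<phi>] smooth_differentiable[OF s]])
  have i1: "integrable lborel (%x. ?d (%x. \<phi> x * \<psi> x) x *\<^sub>R w x)"
   by (rule integrable_test_mult[OF test_functions_partial[OF t1 b] loc(1)])
  have i2: "integrable lborel (%x. (\<phi> x * ?d \<psi> x) *\<^sub>R w x)"
   by (rule integrable_test_mult[OF t2 loc(1)])
  have i3: "integrable lborel (%x. (\<phi> x * \<psi> x) *\<^sub>R (g x \<bullet> b))"
   using integrable_inner_left[OF integrable_test_mult[OF t1 loc(2)], of b] by simp
  have "(\<integral>x. ?d \<phi> x *\<^sub>R (\<psi> x * w x) \<partial>lborel) = (\<integral>x. ?d (%x. \<phi> x * \<psi> x) x *\<^sub>R w x - (\<phi> x * ?d \<psi> x) *\<^sub>R w x \<partial>lborel)"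
   unfolding d1 by (simp add: algebra_simps)
  also have "... = (\<integral>x. ?d (%x. \<phi> x * \<psi> x) x *\<^sub>R w x \<partial>lborel) - (\<integral>x. (\<phi> x * ?d \<psi> x) *\<^sub>R w x \<partial>lborel)"
   by (rule Bochner_Integration.integral_diff[OF i1 i2])
  also have "(\<integral>x. ?d (%x. \<phi> x * \<psi> x) x *\<^sub>R w x \<partial>lborel) = - (\<integral>x. (\<phi> x * \<psi> x) *\<^sub>R (g x \<bullet> b) \<partial>lborel)"
   using wg t1 b unfolding wgrad_def by blast
  also have "- (\<integral>x. (\<phi> x * \<psi> x) *\<^sub>R (g x \<bullet> b) \<partial>lborel) - (\<integral>x. (\<phi> x * ?d \<psi> x) *\<^sub>R w x \<partial>lborel)
    = - ((\<integral>x. (\<phi> x * \<psi> x) *\<^sub>R (g x \<bullet> b) \<partial>lborel) + (\<integral>x. (\<phi> x * ?d \<psi> x) *\<^sub>R w x \<partial>lborel))" by simp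
  also have "(\<integral>x. (\<phi> x * \<psi> x) *\<^sub>R (g x \<bullet> b) \<partial>lborel) + (\<integral>x. (\<phi> x * ?d \<psi> x) *\<^sub>R w x \<partial>lborel)
    = (\<integral>x. (\<phi> x * \<psi> x) *\<^sub>R (g x \<bullet> b) + (\<phi> x * ?d \<psi> x) *\<^sub>R w x \<partial>lborel)"
   by (rule Bochner_Integration.integral_add[OF i3 i2, symmetric])
  also have "... = (\<integral>x. \<phi> x *\<^sub>R ((\<psi> x *\<^sub>R g x + w x *\<^sub>R grad \<psi> x) \<bullet> b) \<partial>lborel)"
   using b by (intro Bochner_Integration.integral_cong refl) (simp add: inner_add_left grad_inner_Basis algebra_simps)
  finally show "(\<integral>x. ?d \<phi> x *\<^sub>R (\<psi> x * w x) \<partial>lborel) = - (\<integral>x. \<phi> x *\<^sub>R ((\<psi> x *\<^sub>R g x + w x *\<^sub>R grad \<psi> x) \<bullet> b) \<partial>lborel)" .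
 qed
qed

text \<open>
A mollified indicator function of a neighbourhood of \<open>K\<close>.
\<close>
lemma ex_cutoff:
 fixes K :: "'a::euclidean_space set"
 assumes K: "compact K" and U: "open U" "K \<subseteq> U"
 obtains \<psi> V where "\<psi> : test_functions U" "open V" "K \<subseteq> V" "!!x. x : V ==> \<psi> x = 1"
proof -
 obtain d where d: "0 < d" "{x + y | x y. x : K & y : cball 0 d} \<subseteq> U"
  by (rule compact_neighbourhood[OF K U])
 define K1 where "K1 = {x + y | x y. x : K & y : cball 0 (2 * d / 3)}"
 have K1: "compact K1" unfolding K1_def by (rule compact_sums[OF K compact_cball])
 have K1m [measurable]: "K1 : sets borel" using compact_imp_closed[OF K1] by simp
 let ?s = "indicator K1 :: 'a => real"
 define \<delta> where "\<delta> = d / 3"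
 have \<delta>: "0 < \<delta>" using d by (simp add: \<delta>_def)
 have sfin: "Lpow 2 UNIV ?s < \<infinity>"
  by (rule Lpow_bounded_support_finite[of 2 _ 1 K1]) (use compact_imp_bounded[OF K1] in \<open>auto simp: indicator_def\<close>)
 have sl: "loc_int ?s" by (rule Lpow_finite_loc_int[OF _ _ sfin]) auto
 define V where "V = (\<Union>x\<in>K. ball x \<delta>)"
 have t: "conv (mollifier \<delta>) ?s : test_functions U"
 proof (rule conv_mollifier_test[OF \<delta> sl _ K1])
  show "{x + y |x y. x : K1 & y : cball 0 \<delta>} \<subseteq> U"
  proof safe
   fix x y :: 'a assume "x : K1" "y : cball 0 \<delta>"
   then obtain x' z where x': "x' : K" "norm z <= 2 * d / 3" "x = x' + z" by (auto simp: K1_def)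
   have "norm (z + y) <= d" using x'(2) \<open>y : cball 0 \<delta>\<close> norm_triangle_ineq[of z y] by (simp add: \<delta>_def)
   then have "x' + (z + y) : {x + y | x y. x : K & y : cball 0 d}" using x'(1) by auto
   then show "x + y : U" using d(2) x'(3) by (auto simp: add.assoc)
  qed
 qed simp
 have one: "conv (mollifier \<delta>) ?s x = 1" if x: "x : V" for x
 proof -
  obtain x0 where x0: "x0 : K" "dist x0 x < \<delta>" using x by (auto simp: V_def)
  have "mollifier \<delta> y *\<^sub>R ?s (x - y) = mollifier \<delta> y" for y
  proof (cases "norm y < \<delta>")
   case True
   have "norm (x - y - x0) <= norm (x - x0) + norm y" using norm_triangle_ineq4[of "x - x0" y] by (simp add: algebra_simps)
   also have "... <= 2 * d / 3" using x0(2) True by (simp add: \<delta>_def dist_norm norm_minus_commute)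
   finally have "x - y : K1" unfolding K1_def using x0(1) by (intro CollectI exI[of _ x0] exI[of _ "x - y - x0"]) simp
   then show ?thesis by simp
  next
   case False
   then show ?thesis using mollifier_eq_0[OF \<delta>, of y] by simp
  qed
  then have eq: "(%y. mollifier \<delta> y *\<^sub>R ?s (x - y)) = mollifier \<delta>" by (intro ext)
  have "conv (mollifier \<delta>) ?s x = (\<integral>y. mollifier \<delta> y *\<^sub>R ?s (x - y) \<partial>lborel)"
   by (rule conv_reflect[OF borel_mollifier[OF \<delta>] borel_measurable_indicator[OF K1m]])
  then show ?thesis unfolding eq using integral_mollifier[OF \<delta>, where 'a='a] by simp
 qed
 have V: "open V" "K \<subseteq> V" using \<delta> by (auto simp: V_def)
 show ?thesis by (rule that[OF t V one])
qed

section \<open>Lipschitz domains\<close>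

text \<open>
The support of \<open>w\<close> lies in the closure of \<open>\<O>\<close> within the chart, that is on or above the graph of
\<open>\<gamma>\<close>. Moving upwards by \<open>t n\<close> makes it a compact subset of \<open>\<O>\<close>, and translations are continuous in \<open>L\<^sup>p\<close>.
\<close>
lemma approximable_in_chart:
 fixes w :: "'a::euclidean_space => real"
 assumes p: "1 < p" and \<O>: "open \<O>" and n: "norm n = 1" and \<gamma>: "L-lipschitz_on {z. z \<bullet> n = 0} \<gamma>"
  and chart: "\<O> \<inter> ball x r = {y : ball x r. \<gamma> (y - (y \<bullet> n) *\<^sub>R n) < y \<bullet> n}"
  and wg: "wgrad UNIV w g" and fin: "Lpow p UNIV w < \<infinity>" "Lpow p UNIV g < \<infinity>"
  and w0: "!!y. y ~: \<O> ==> w y = 0" and K: "compact K" "K \<subseteq> ball x r" and wK: "!!y. y ~: K ==> w y = 0"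
 shows "approximable p \<O> w g"
proof -
 have loc: "loc_int w" "loc_int g" using wg by (auto simp: wgrad_def)
 have wm [measurable]: "w : Borel" and gm [measurable]: "g : Borel" using loc by (auto simp: loc_int_def)
 have nn: "n \<bullet> n = 1" using n by (simp add: norm_eq_1)
 define K' where "K' = K \<inter> closure \<O>"
 have K': "compact K'" "K' \<subseteq> ball x r" using K by (auto simp: K'_def intro: compact_Int_closed)
 have wK': "w y = 0" if "y ~: K'" for y
  using that w0[of y] wK[of y] closure_subset[of \<O>] by (auto simp: K'_def)
 define \<pi> where "\<pi> = (%y. y - (y \<bullet> n) *\<^sub>R n)"
 have \<pi>n: "\<pi> y \<bullet> n = 0" for y by (simp add: \<pi>_def inner_diff_left nn)
 have \<pi>t: "\<pi> (y + t *\<^sub>R n) = \<pi> y" for y t by (simp add: \<pi>_def inner_add_left nn algebra_simps)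
 have c\<gamma>: "continuous_on UNIV (%y. \<gamma> (\<pi> y))"
 proof (rule continuous_on_compose2[OF lipschitz_on_continuous_on[OF \<gamma>]])
  show "continuous_on UNIV \<pi>" unfolding \<pi>_def by (intro continuous_intros)
  show "range \<pi> \<subseteq> {z. z \<bullet> n = 0}" using \<pi>n by auto
 qed
 have above: "\<gamma> (\<pi> y) <= y \<bullet> n" if y: "y : K'" for y
 proof (rule ccontr)
  assume a: "\<not> \<gamma> (\<pi> y) <= y \<bullet> n"
  have op: "open (ball x r \<inter> {z. z \<bullet> n < \<gamma> (\<pi> z)})"
   using c\<gamma> by (intro open_Int open_ball open_Collect_less continuous_intros) auto
  moreover have "y : ball x r \<inter> {z. z \<bullet> n < \<gamma> (\<pi> z)}" using a y K'(2) by auto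
  moreover have "y : closure \<O>" using y by (simp add: K'_def)
  ultimately have "\<O> \<inter> (ball x r \<inter> {z. z \<bullet> n < \<gamma> (\<pi> z)}) \<noteq> {}"
   using open_Int_closure_eq_empty[OF op, of \<O>] by blast
  then obtain z where "z : \<O>" "z : ball x r" "z \<bullet> n < \<gamma> (\<pi> z)" by blast
  moreover from this have "\<gamma> (\<pi> z) < z \<bullet> n" using chart unfolding \<pi>_def by blast
  ultimately show False by simp
 qed
 obtain d where d: "0 < d" "(\<Union>y\<in>K'. cball y d) \<subseteq> ball x r"
  by (rule compact_subset_open_imp_cball_epsilon_subset[OF K'(1) open_ball K'(2)])
 have shift: "approximable p \<O> (%y. w (y - t *\<^sub>R n)) (%y. g (y - t *\<^sub>R n))" if t: "0 < t" "t <= d" for t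
 proof (rule approximable_compact_support[OF p \<O> wgrad_translate[OF wg]])
  show "Lpow p UNIV (%y. w (y - t *\<^sub>R n)) < \<infinity>" "Lpow p UNIV (%y. g (y - t *\<^sub>R n)) < \<infinity>"
   using fin Lpow_translate[OF wm, of p "- (t *\<^sub>R n)"] Lpow_translate[OF gm, of p "- (t *\<^sub>R n)"] by auto
  show "compact ((%y. y + t *\<^sub>R n) ` K')" using K'(1) by (intro compact_continuous_image continuous_intros)
  show "(%y. y + t *\<^sub>R n) ` K' \<subseteq> \<O>"
  proof safe
   fix y assume y: "y : K'"
   have "y + t *\<^sub>R n : cball y d" using t n by (simp add: dist_norm)
   then have b: "y + t *\<^sub>R n : ball x r" using d(2) y by blast
   have "\<gamma> (\<pi> (y + t *\<^sub>R n)) < (y + t *\<^sub>R n) \<bullet> n"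
    unfolding \<pi>t using above[OF y] t by (simp add: inner_add_left nn)
   then have "y + t *\<^sub>R n : \<O> \<inter> ball x r" unfolding chart using b by (simp add: \<pi>_def)
   then show "y + t *\<^sub>R n : \<O>" by blast
  qed
  show "w (y - t *\<^sub>R n) = 0" if "y ~: (%y. y + t *\<^sub>R n) ` K'" for y
  proof (rule wK', rule notI)
   assume "y - t *\<^sub>R n : K'"
   then have "y - t *\<^sub>R n + t *\<^sub>R n : (%y. y + t *\<^sub>R n) ` K'" by blast
   then show False using that by simp
  qed
 qed
 show ?thesis
 proof (rule approximable_close[OF p wm gm])
  fix \<eta> :: real assume \<eta>: "0 < \<eta>"
  obtain d1 where d1: "0 < d1" "!!h. norm h < d1 ==> Lpow p UNIV (%y. w (y + h) - w y) <= ennreal \<eta>"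
   using Lpow_translation_continuous[OF p wm fin(1) \<eta>] by blast
  obtain d2 where d2: "0 < d2" "!!h. norm h < d2 ==> Lpow p UNIV (%y. g (y + h) - g y) <= ennreal \<eta>"
   using Lpow_translation_continuous[OF p gm fin(2) \<eta>] by blast
  define t where "t = min d (min d1 d2) / 2"
  have t: "0 < t" "t <= d" "t < d1" "t < d2" using d(1) d1(1) d2(1) by (auto simp: t_def)
  have nt: "norm (- (t *\<^sub>R n)) = t" using t(1) n by simp
  have 1: "Lpow p UNIV (%y. w y - w (y - t *\<^sub>R n)) <= ennreal \<eta>"
   using d1(2)[of "- (t *\<^sub>R n)"] nt t(3) by (subst Lpow_minus_commute) simp
  have 2: "Lpow p UNIV (%y. g y - g (y - t *\<^sub>R n)) <= ennreal \<eta>"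
   using d2(2)[of "- (t *\<^sub>R n)"] nt t(4) by (subst Lpow_minus_commute) simp
  have m: "(%y. w (y - t *\<^sub>R n)) : Borel" "(%y. g (y - t *\<^sub>R n)) : Borel" by measurable
  show "\<exists>v h. v : Borel & h : Borel & approximable p \<O> v h &
    Lpow p UNIV (%x. w x - v x) <= ennreal \<eta> & Lpow p UNIV (%x. g x - h x) <= ennreal \<eta>"
   using m shift[OF t(1,2)] 1 2 by blast
 qed
qed

text \<open>
Finitely many chart balls cover the frontier. Induction on their number: cut off in one ball the part
of \<open>w\<close> that the others and \<open>\<O>\<close> do not cover, so that the rest needs one ball fewer; when no ball is left
the support is a compact subset of \<open>\<O>\<close>.
\<close>
lemma approximable_Lipschitz:
 fixes w :: "'a::euclidean_space => real"
 assumes p: "1 < p" and \<O>: "open \<O>" and b\<O>: "bounded \<O>" and Lip: "Lipschitz_boundary \<O>"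
  and wg: "wgrad UNIV w g" and fin: "Lpow p UNIV w < \<infinity>" "Lpow p UNIV g < \<infinity>"
  and w0: "!!y. y ~: \<O> ==> w y = 0"
 shows "approximable p \<O> w g"
proof -
 define chart where "chart = (%x r. \<exists>n. norm n = 1 &
   (\<exists>\<gamma> :: 'a => real. \<exists>L. L-lipschitz_on {z. z \<bullet> n = 0} \<gamma> &
    \<O> \<inter> ball x r = {y : ball x r. \<gamma> (y - (y \<bullet> n) *\<^sub>R n) < y \<bullet> n}))"
 have "\<forall>x\<in>frontier \<O>. \<exists>r>0. chart x r"
  using Lip unfolding Lipschitz_boundary_def chart_def .
 then obtain r where r: "!!x. x : frontier \<O> ==> 0 < r x" "!!x. x : frontier \<O> ==> chart x (r x)"
  by metis
 have claim: "approximable p \<O> w g"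
  if "finite F" "F \<subseteq> frontier \<O>" "wgrad UNIV w g" "Lpow p UNIV w < \<infinity>" "Lpow p UNIV g < \<infinity>"
   "!!y. y ~: \<O> ==> w y = 0" "compact K" "K \<subseteq> \<O> \<union> (\<Union>x\<in>F. ball x (r x))" "!!y. y ~: K ==> w y = 0"
  for F K and w :: "'a => real" and g
  using that
 proof (induction F arbitrary: w g K)
  case empty
  show ?case
   by (rule approximable_compact_support[OF p \<O> empty(2,3,4) empty(6) _ empty(8)]) (use empty(7) in simp)
 next
  case (insert x F)
  note wg = insert.prems(2) and fin = insert.prems(3,4) and w0 = insert.prems(5)
   and K = insert.prems(6,7) and wK = insert.prems(8)
  let ?O = "\<O> \<union> (\<Union>x\<in>F. ball x (r x))"
  have opO: "open ?O" using \<O> by auto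
  have loc: "loc_int w" "loc_int g" using wg by (auto simp: wgrad_def)
  have wm [measurable]: "w : Borel" and gm [measurable]: "g : Borel" using loc by (auto simp: loc_int_def)
  \<comment> \<open>the part of the support that only the ball around \<open>x\<close> covers\<close>
  define K1 where "K1 = K - ?O"
  have K1: "compact K1" "K1 \<subseteq> ball x (r x)" using K compact_diff[OF K(1) opO] by (auto simp: K1_def)
  obtain \<psi> V where \<psi>: "\<psi> : test_functions (ball x (r x))" "open V" "K1 \<subseteq> V" "!!y. y : V ==> \<psi> y = 1"
   by (rule ex_cutoff[OF K1(1) open_ball K1(2)]) blast
  have \<psi>U: "\<psi> : test_functions UNIV" by (rule test_functions_mono[OF _ \<psi>(1)]) simp
  have s: "smooth \<psi>" using \<psi>(1) by (simp add: test_functions_iff)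
  note [measurable] = smooth_borel[OF s] grad_borel[OF s]
  obtain C where C: "compact C" "C \<subseteq> ball x (r x)" "!!y. y ~: C ==> \<psi> y = 0"
   using \<psi>(1) unfolding test_functions_iff by blast
  define w1 where "w1 = (%y. \<psi> y * w y)"
  define g1 where "g1 = (%y. \<psi> y *\<^sub>R g y + w y *\<^sub>R grad \<psi> y)"
  have wg1: "wgrad UNIV w1 g1" and fin1: "Lpow p UNIV w1 < \<infinity>" "Lpow p UNIV g1 < \<infinity>"
   unfolding w1_def g1_def by (rule wgrad_mult_test[OF p wg \<psi>U fin])+
  have m1 [measurable]: "w1 : Borel" "g1 : Borel"
   unfolding w1_def g1_def by measurable
  define w2 where "w2 = (%y. 1 * w y + (- 1) * w1 y)"
  define g2 where "g2 = (%y. 1 *\<^sub>R g y + (- 1) *\<^sub>R g1 y)"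
  have wg2: "wgrad UNIV w2 g2" unfolding w2_def g2_def by (rule wgrad_lincomb[OF wg wg1])
  have m2 [measurable]: "w2 : Borel" "g2 : Borel"
   unfolding w2_def g2_def by measurable
  have fin2: "Lpow p UNIV w2 < \<infinity>" "Lpow p UNIV g2 < \<infinity>"
   using Lpow_add_finite[OF p wm _ fin(1), of "%y. - w1 y"] Lpow_add_finite[OF p gm _ fin(2), of "%y. - g1 y"] fin1
   by (simp_all add: w2_def g2_def Lpow_uminus)
  obtain n \<gamma> L where ch: "norm n = 1" "L-lipschitz_on {z. z \<bullet> n = 0} \<gamma>"
    "\<O> \<inter> ball x (r x) = {y : ball x (r x). \<gamma> (y - (y \<bullet> n) *\<^sub>R n) < y \<bullet> n}"
  proof -
   have "chart x (r x)" using r(2)[of x] insert.prems(1) by simp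
   then show ?thesis unfolding chart_def using that by blast
  qed
  have a1: "approximable p \<O> w1 g1"
   by (rule approximable_in_chart[OF p \<O> ch wg1 fin1 _ C(1,2)]) (use w0 C(3) in \<open>auto simp: w1_def\<close>)
  have a2: "approximable p \<O> w2 g2"
  proof (rule insert.IH[OF _ wg2 fin2, of "K - V"])
   show "F \<subseteq> frontier \<O>" using insert.prems(1) by simp
   show "w2 y = 0" if "y ~: \<O>" for y using w0[OF that] by (simp add: w2_def w1_def)
   show "compact (K - V)" by (rule compact_diff[OF K(1) \<psi>(2)])
   show "K - V \<subseteq> ?O" using \<psi>(3) by (auto simp: K1_def)
   show "w2 y = 0" if "y ~: K - V" for y
    using that wK[of y] \<psi>(4)[of y] by (auto simp: w2_def w1_def)
  qed
  have "approximable p \<O> (%y. w1 y + w2 y) (%y. g1 y + g2 y)"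
   by (rule approximable_add[OF p m1 m2 a1 a2])
  then show ?case by (simp add: w2_def g2_def)
 qed
 have cf: "compact (frontier \<O>)" using b\<O> by (rule compact_frontier_bounded)
 obtain F where F: "finite F" "F \<subseteq> frontier \<O>" "frontier \<O> \<subseteq> (\<Union>x\<in>F. ball x (r x))"
 proof (rule compactE_image[OF cf, of "frontier \<O>" "%x. ball x (r x)"])
  show "frontier \<O> \<subseteq> (\<Union>x\<in>frontier \<O>. ball x (r x))" using r(1) by force
 qed (auto intro: that)
 have clo: "closure \<O> \<subseteq> \<O> \<union> frontier \<O>" using interior_open[OF \<O>] by (auto simp: frontier_def)
 show ?thesis
 proof (rule claim[OF F(1,2) wg fin w0, of "closure \<O>"])
  show "compact (closure \<O>)" using b\<O> by (simp add: compact_closure)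
  show "closure \<O> \<subseteq> \<O> \<union> (\<Union>x\<in>F. ball x (r x))" using clo F(3) by blast
  show "w y = 0" if "y ~: closure \<O>" for y using w0[of y] that closure_subset[of \<O>] by blast
 qed auto
qed

section \<open>Unit balls in terms of representatives\<close>

lemma rep_refl:
 "u : Borel ==> (!!x. x ~: \<O> ==> u x = 0) ==> rep \<O> u u"
 unfolding rep_def by (auto simp: indicator_def)

lemma rep_scale: "rep \<O> u u' ==> rep \<O> (%x. c * u x) (%x. c * u' x)" for u :: "'a::euclidean_space => real"
 using rep_lincomb[of \<O> u u' u u' c 0] by simp

lemma rep_diff: "rep \<O> u u' ==> rep \<O> v v' ==> rep \<O> (%x. u x - v x) (%x. u' x - v' x)"
 using rep_lincomb[of \<O> u u' v v' 1 "-1"] by simp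

lemma wgrad_cong_AE:
 assumes wg: "wgrad \<O> u g" and [measurable]: "v : Borel" and ae: "AE x in lborel. u x = v x"
 shows "wgrad \<O> v g"
proof -
 have [measurable]: "u : Borel" using wg by (auto simp: wgrad_def loc_int_def)
 have "(\<integral>\<^sup>+x\<in>cball 0 R. ennreal (norm (v x)) \<partial>lborel) = (\<integral>\<^sup>+x\<in>cball 0 R. ennreal (norm (u x)) \<partial>lborel)" for R
  by (rule nn_integral_cong_AE) (use ae in eventually_elim, simp)
 then have l: "loc_int v" using wg by (auto simp: wgrad_def loc_int_def)
 have "(\<integral>x. frechet_derivative \<phi> (at x) b *\<^sub>R v x \<partial>lborel) = (\<integral>x. frechet_derivative \<phi> (at x) b *\<^sub>R u x \<partial>lborel)"
  if "\<phi> : test_functions \<O>" "b : Basis" for \<phi> b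
 proof (rule integral_cong_AE)
  have "smooth (partial b \<phi>)" using that test_functions_partial[of \<phi> \<O> b] by (simp add: test_functions_iff)
  note [measurable] = smooth_borel[OF this]
  show "(%x. frechet_derivative \<phi> (at x) b *\<^sub>R v x) : borel_measurable lborel"
   "(%x. frechet_derivative \<phi> (at x) b *\<^sub>R u x) : borel_measurable lborel" by measurable
  show "AE x in lborel. frechet_derivative \<phi> (at x) b *\<^sub>R v x = frechet_derivative \<phi> (at x) b *\<^sub>R u x"
   using ae by eventually_elim simp
 qed
 then show ?thesis using wg l unfolding wgrad_def by simp
qed

lemma loc_int_restrict:
 assumes u: "loc_int u" and [measurable]: "\<O> : sets borel"
 shows "loc_int (%x. indicator \<O> x *\<^sub>R u x)"
proof -
 have [measurable]: "u : Borel" using u by (simp add: loc_int_def)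
 have "(\<integral>\<^sup>+x\<in>cball 0 R. ennreal (norm (indicator \<O> x *\<^sub>R u x)) \<partial>lborel)
   <= (\<integral>\<^sup>+x\<in>cball 0 R. ennreal (norm (u x)) \<partial>lborel)" for R
  by (intro nn_integral_mono) (auto simp: indicator_def)
 then show ?thesis using u unfolding loc_int_def by (auto intro: le_less_trans)
qed

lemma test_functions_eq_0: "\<phi> : test_functions \<O> ==> x ~: \<O> ==> \<phi> x = 0"
 unfolding test_functions_iff by blast

lemma grad_test_eq_0:
 assumes "\<phi> : test_functions \<O>" "x ~: \<O>" shows "grad \<phi> x = 0"
 unfolding grad_def
 by (rule sum.neutral) (use test_functions_eq_0[OF test_functions_partial[OF assms(1)] assms(2)] in simp)

text \<open>
Test functions on \<open>\<O>\<close> do not see the values off \<open>\<O>\<close>.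
\<close>
lemma wgrad_restrict:
 assumes wg: "wgrad UNIV u g" and \<O>: "\<O> : sets borel"
 shows "wgrad \<O> (%x. indicator \<O> x *\<^sub>R u x) (%x. indicator \<O> x *\<^sub>R g x)"
proof -
 have loc: "loc_int u" "loc_int g"
  and int: "!!\<phi> b. \<phi> : test_functions UNIV ==> b : Basis ==>
   (\<integral>x. frechet_derivative \<phi> (at x) b *\<^sub>R u x \<partial>lborel) = - (\<integral>x. \<phi> x *\<^sub>R (g x \<bullet> b) \<partial>lborel)"
  using wg by (auto simp: wgrad_def)
 have eq: "(\<integral>x. frechet_derivative \<phi> (at x) b *\<^sub>R (indicator \<O> x *\<^sub>R u x) \<partial>lborel)
   = - (\<integral>x. \<phi> x *\<^sub>R ((indicator \<O> x *\<^sub>R g x) \<bullet> b) \<partial>lborel)"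
  if \<phi>: "\<phi> : test_functions \<O>" and b: "b : Basis" for \<phi> b
 proof -
  have 1: "frechet_derivative \<phi> (at x) b *\<^sub>R (indicator \<O> x *\<^sub>R u x) = frechet_derivative \<phi> (at x) b *\<^sub>R u x" for x
   using test_functions_eq_0[OF test_functions_partial[OF \<phi> b], of x] by (cases "x : \<O>") auto
  have 2: "\<phi> x *\<^sub>R ((indicator \<O> x *\<^sub>R g x) \<bullet> b) = \<phi> x *\<^sub>R (g x \<bullet> b)" for x
   using test_functions_eq_0[OF \<phi>, of x] by (cases "x : \<O>") auto
  show ?thesis unfolding 1 2 by (rule int[OF test_functions_mono[OF subset_UNIV \<phi>] b])
 qed
 show ?thesis unfolding wgrad_def by (intro conjI ballI loc_int_restrict[OF _ \<O>] loc eq)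
qed

text \<open>
The working form of a kernel family: Borel versions with their normalisation and vanishing tails.
\<close>
lemma kernel_family_levy:
 fixes \<nu> :: "real => 'a::euclidean_space => real"
 assumes \<nu>: "kernel_family p \<nu>" and p: "1 < p"
 obtains k where "!!\<epsilon>. 0 < \<epsilon> ==> levy p (k \<epsilon>)" "!!\<epsilon>. 0 < \<epsilon> ==> AE h in lborel. ennreal (\<nu> \<epsilon> h) = k \<epsilon> h"
  "!!\<epsilon> h. 0 < \<epsilon> ==> h \<noteq> 0 ==> 0 <= \<nu> \<epsilon> h" "!!r. 0 < r ==> ((%\<epsilon>. tail (k \<epsilon>) r) \<longlongrightarrow> 0) (at_right 0)"
proof -
 have m: "\<nu> \<epsilon> : borel_measurable (lebesgue_on (- {0}))" and nn: "!!h. h \<noteq> 0 ==> 0 <= \<nu> \<epsilon> h"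
  and rad: "!!h k. h \<noteq> 0 ==> norm h = norm k ==> \<nu> \<epsilon> h = \<nu> \<epsilon> k"
  and one: "(\<integral>\<^sup>+h. ennreal (min 1 (norm h powr p) * \<nu> \<epsilon> h) \<partial>lebesgue) = 1" if "0 < \<epsilon>" for \<epsilon>
  using \<nu> that unfolding kernel_family_def by blast+
 have tl: "((%\<epsilon>. \<integral>\<^sup>+h\<in>{h. norm h > \<delta>}. ennreal (\<nu> \<epsilon> h) \<partial>lebesgue) \<longlongrightarrow> 0) (at_right 0)" if "0 < \<delta>" for \<delta>
  using \<nu> that unfolding kernel_family_def by blast
 have "\<exists>k. radial_AE k & (AE h in lborel. ennreal (\<nu> \<epsilon> h) = k h)" if \<epsilon>: "0 < \<epsilon>" for \<epsilon>
  by (rule ex_borel_kernel[OF m[OF \<epsilon>] rad[OF \<epsilon>]]) blast+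
 then obtain k where k: "!!\<epsilon>. 0 < \<epsilon> ==> radial_AE (k \<epsilon>)" "!!\<epsilon>. 0 < \<epsilon> ==> AE h in lborel. ennreal (\<nu> \<epsilon> h) = k \<epsilon> h"
  by metis
 show ?thesis
 proof (rule that[OF _ k(2) nn])
  fix \<epsilon> :: real assume \<epsilon>: "0 < \<epsilon>"
  have "(\<integral>\<^sup>+h. k \<epsilon> h * ennreal (min 1 (norm h powr p)) \<partial>lborel)
    = (\<integral>\<^sup>+h. ennreal (min 1 (norm h powr p) * \<nu> \<epsilon> h) \<partial>lborel)"
  proof (rule nn_integral_cong_AE, use k(2)[OF \<epsilon>] in eventually_elim)
   fix h assume e: "ennreal (\<nu> \<epsilon> h) = k \<epsilon> h"
   show "k \<epsilon> h * ennreal (min 1 (norm h powr p)) = ennreal (min 1 (norm h powr p) * \<nu> \<epsilon> h)"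
   proof (cases "h = 0")
    case False
    then show ?thesis using nn[OF \<epsilon> False] by (simp flip: e add: ennreal_mult mult.commute)
   qed simp
  qed
  then show "levy p (k \<epsilon>)" using one[OF \<epsilon>] k(1)[OF \<epsilon>] by (simp add: levy_def nn_integral_completion)
 next
  fix r :: real assume r: "0 < r"
  have "\<forall>\<^sub>F \<epsilon> in at_right 0. (\<integral>\<^sup>+h\<in>{h. norm h > r}. ennreal (\<nu> \<epsilon> h) \<partial>lebesgue) = tail (k \<epsilon>) r"
   using eventually_at_right_less[of "0::real"]
  proof eventually_elim
   fix \<epsilon> :: real assume \<epsilon>: "0 < \<epsilon>"
   show "(\<integral>\<^sup>+h\<in>{h. norm h > r}. ennreal (\<nu> \<epsilon> h) \<partial>lebesgue) = tail (k \<epsilon>) r"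
    unfolding tail_def nn_integral_completion
    by (rule nn_integral_cong_AE) (use k(2)[OF \<epsilon>] in eventually_elim, simp)
  qed
  then show "((%\<epsilon>. tail (k \<epsilon>) r) \<longlongrightarrow> 0) (at_right 0)" by (rule Lim_transform_eventually[OF tl[OF r]])
 qed
qed

lemma powr_le_1_iff:
 fixes x q :: real
 assumes "0 <= x" "0 < q" shows "x powr q <= 1 \<longleftrightarrow> x <= 1"
proof
 assume le: "x powr q <= 1"
 have "\<not> 1 < x"
 proof
  assume "1 < x"
  then have "1 powr q < x powr q" using assms(2) by (intro powr_less_mono2) auto
  then show False using le powr_one_eq_one[of q] by linarith
 qed
 then show "x <= 1" by simp
next
 assume "x <= 1"
 then show "x powr q <= 1" using powr_mono2[of q x 1] assms by simp
qed

lemma powr_inverse_le_1_iff: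
 assumes p: "1 < p" and a: "0 <= a" "ennreal a = A" and E: "E < \<infinity>"
 shows "(a + enn2real E) powr (1 / p) <= 1 \<longleftrightarrow> A + E <= 1"
proof -
 obtain b where b: "0 <= b" "E = ennreal b" using E by (cases E) auto
 have AE: "A + E = ennreal (a + b)" using a b by (simp flip: a(2) add: ennreal_plus)
 have "(a + b) powr (1 / p) <= 1 \<longleftrightarrow> a + b <= 1"
  using p a(1) b(1) by (intro powr_le_1_iff) auto
 then show ?thesis unfolding AE using b by (simp add: ennreal_le_1)
qed

lemma W\<nu>_unit_ball_iff:
 fixes u :: "'a::euclidean_space => real"
 assumes p: "1 < p" and \<O>: "open \<O>" and k: "levy p k" "AE h in lborel. ennreal (\<kappa> h) = k h" "!!h. h \<noteq> 0 ==> 0 <= \<kappa> h"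
  and r: "rep \<O> u u'"
 shows "u : W\<nu> p \<kappa> \<O> & W\<nu>_norm p \<kappa> \<O> u <= 1 \<longleftrightarrow>
  Lpow p UNIV u' + (\<integral>\<^sup>+h. k h * osc p (\<O> \<times> \<O>) u' h \<partial>lborel) <= 1"
proof -
 have \<O>b [measurable]: "\<O> : sets borel" using \<O> by simp
 have D: "\<O> \<times> \<O> : sets (borel \<Otimes>\<^sub>M borel)" by measurable
 have ae: "AE x in lborel. x : \<O> --> u x = u' x"
 proof -
  have "AE x in lborel. indicator \<O> x *\<^sub>R u x = u' x" using r by (simp add: rep_def)
  then show ?thesis by eventually_elim auto
 qed
 have en: "energy p \<kappa> (\<O> \<times> \<O>) u = (\<integral>\<^sup>+h. k h * osc p (\<O> \<times> \<O>) u' h \<partial>lborel)" (is "_ = ?E")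
  by (rule energy_eq_osc[OF levy_borel[OF k(1)] k(2,3) D rep_borel[OF r] ae]) auto
 show ?thesis
 proof (cases "Lpow p UNIV u' < \<infinity> & ?E < \<infinity>")
  case True
  then show ?thesis
   using powr_inverse_le_1_iff[OF p _ rep_Lp_norm[OF r \<O>b p], of ?E] Lp_iff_rep[OF r \<O>b p]
   by (simp add: W\<nu>_def W\<nu>_norm_def en)
 next
  case False
  then have "Lpow p UNIV u' + ?E = \<infinity>" by (auto simp: less_top[symmetric])
  then have "\<not> Lpow p UNIV u' + ?E <= 1" using top_unique[of "1::ennreal"] by auto
  moreover have "u ~: W\<nu> p \<kappa> \<O>" using False Lp_iff_rep[OF r \<O>b p] by (auto simp: W\<nu>_def en)
  ultimately show ?thesis by blast
 qed
qed

lemma osc_cong: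
 assumes "!!x. x : A ==> u x = v x" shows "osc p (A \<times> A) u h = osc p (A \<times> A) v h"
 unfolding osc_def by (intro nn_integral_cong) (auto simp: indicator_def assms)

lemma osc_mono: "D \<subseteq> D' ==> osc p D u h <= osc p D' u h"
 unfolding osc_def by (intro nn_integral_mono) (auto simp: indicator_def)

text \<open>
Pairs of points that are both off \<open>\<O>\<close> contribute nothing.
\<close>
lemma osc_zero_outside:
 assumes p: "1 < p" and "!!x. x ~: \<O> ==> u x = 0"
 shows "osc p (- ((- \<O>) \<times> (- \<O>))) u h = osc p (UNIV \<times> UNIV) u h"
 unfolding osc_def using assms by (intro nn_integral_cong) (auto simp: indicator_def)

lemma W\<nu>_zero_unit_ball_iff:
 fixes u :: "'a::euclidean_space => real"
 assumes p: "1 < p" and \<O>: "open \<O>" and k: "levy p k" "AE h in lborel. ennreal (\<kappa> h) = k h" "!!h. h \<noteq> 0 ==> 0 <= \<kappa> h"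
  and r: "rep \<O> u u'" and u: "u : borel_measurable lebesgue" "AE x in lebesgue. x : - \<O> --> u x = 0"
 shows "u : W\<nu>_zero p \<kappa> \<O> & W\<nu>_zero_norm p \<kappa> \<O> u <= 1 \<longleftrightarrow>
  Lpow p UNIV u' + (\<integral>\<^sup>+h. k h * osc p (UNIV \<times> UNIV) u' h \<partial>lborel) <= 1"
proof -
 have \<O>b [measurable]: "\<O> : sets borel" using \<O> by simp
 let ?D = "- ((- \<O>) \<times> (- \<O>))"
 have "?D = space (borel \<Otimes>\<^sub>M borel) - (- \<O>) \<times> (- \<O>)" by (auto simp: space_pair_measure)
 then have D: "?D : sets (borel \<Otimes>\<^sub>M borel)" by (simp only:) measurable
 have ae: "AE x in lborel. x : UNIV --> u x = u' x"
 proof -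
  have "AE x in lborel. indicator \<O> x *\<^sub>R u x = u' x" using r by (simp add: rep_def)
  moreover have "AE x in lborel. x : - \<O> --> u x = 0" using u(2) by (simp add: AE_completion_iff)
  ultimately show ?thesis by eventually_elim (auto simp: indicator_def split: if_splits)
 qed
 have "energy p \<kappa> ?D u = (\<integral>\<^sup>+h. k h * osc p ?D u' h \<partial>lborel)"
  by (rule energy_eq_osc[OF levy_borel[OF k(1)] k(2,3) D rep_borel[OF r] ae]) auto
 then have en: "energy p \<kappa> ?D u = (\<integral>\<^sup>+h. k h * osc p (UNIV \<times> UNIV) u' h \<partial>lborel)" (is "_ = ?E")
  using r by (simp add: osc_zero_outside[OF p] rep_def)
 show ?thesis
 proof (cases "Lpow p UNIV u' < \<infinity> & ?E < \<infinity>")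
  case True
  then show ?thesis
   using powr_inverse_le_1_iff[OF p _ rep_Lp_norm[OF r \<O>b p], of ?E] Lp_iff_rep[OF r \<O>b p] u
   by (simp add: W\<nu>_zero_def W\<nu>_zero_norm_def en)
 next
  case False
  then have "Lpow p UNIV u' + ?E = \<infinity>" by (auto simp: less_top[symmetric])
  then have "\<not> Lpow p UNIV u' + ?E <= 1" using top_unique[of "1::ennreal"] by auto
  moreover have "u ~: W\<nu>_zero p \<kappa> \<O>" using False Lp_iff_rep[OF r \<O>b p] by (auto simp: W\<nu>_zero_def en)
  ultimately show ?thesis by blast
 qed
qed

lemma W1p_norm_le_1_iff:
 assumes p: "1 < p" shows "W1p_norm e p \<O> u <= 1 \<longleftrightarrow> ennreal (W1p_norm e p \<O> u powr p) <= 1"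
proof -
 have "0 <= W1p_norm e p \<O> u" by (simp add: W1p_norm_def)
 then have "W1p_norm e p \<O> u powr p <= 1 \<longleftrightarrow> W1p_norm e p \<O> u <= 1" using p by (intro powr_le_1_iff) auto
 then show ?thesis by (simp add: ennreal_le_1)
qed

text \<open>
Boundedness in terms of representatives; \<open>\<eta> = 0\<close> says that the functional respects equality a.e. on \<open>\<O>\<close>.
\<close>
lemma Lp_dual_modulus:
 fixes f :: "('a::euclidean_space => real) => real"
 assumes f: "f : Lp_dual p \<O>" and p: "1 < p" and \<O>: "open \<O>"
 obtains C where "0 <= C" "!!u v u' v' \<eta>. [|rep \<O> u u'; rep \<O> v v'; Lpow p UNIV u' < \<infinity>; Lpow p UNIV v' < \<infinity>; 0 <= \<eta>;
   Lpow p UNIV (%x. u' x - v' x) <= ennreal \<eta>|] ==> \<bar>f u - f v\<bar> <= C * \<eta> powr (1 / p)"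
proof -
 have \<O>b: "\<O> : sets borel" using \<O> by simp
 obtain C0 where add: "!!u v. u : Lp p \<O> ==> v : Lp p \<O> ==> f (%x. u x + v x) = f u + f v"
  and scale: "!!c u. u : Lp p \<O> ==> f (%x. c * u x) = c * f u"
  and bound: "!!u. u : Lp p \<O> ==> \<bar>f u\<bar> <= C0 * Lp_norm p \<O> u"
 proof -
  obtain C where "\<forall>u\<in>Lp p \<O>. \<bar>f u\<bar> <= C * Lp_norm p \<O> u" using f unfolding Lp_dual_def by blast
  moreover have "\<forall>u\<in>Lp p \<O>. \<forall>v\<in>Lp p \<O>. f (%x. u x + v x) = f u + f v"
   "\<forall>c. \<forall>u\<in>Lp p \<O>. f (%x. c * u x) = c * f u" using f unfolding Lp_dual_def by blast+
  ultimately show ?thesis using that[of C] by blast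
 qed
 show ?thesis
 proof (rule that[of "\<bar>C0\<bar>"])
  fix u v u' v' :: "'a => real" and \<eta> :: real
  assume u: "rep \<O> u u'" and v: "rep \<O> v v'" and fu: "Lpow p UNIV u' < \<infinity>" and fv: "Lpow p UNIV v' < \<infinity>"
   and \<eta>: "0 <= \<eta>" "Lpow p UNIV (%x. u' x - v' x) <= ennreal \<eta>"
  define w where "w = (%x. u x + (-1) * v x)"
  have rw: "rep \<O> w (%x. u' x - v' x)" using rep_diff[OF u v] by (simp add: w_def)
  have fw: "Lpow p UNIV (%x. u' x - v' x) < \<infinity>" using \<eta>(2) by (simp add: le_less_trans)
  have uL: "u : Lp p \<O>" and vL: "v : Lp p \<O>" and wL: "w : Lp p \<O>"
   using Lp_iff_rep[OF u \<O>b p] Lp_iff_rep[OF v \<O>b p] Lp_iff_rep[OF rw \<O>b p] fu fv fw by auto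
  have v1L: "(%x. (-1) * v x) : Lp p \<O>"
   using Lp_iff_rep[OF rep_scale[OF v, of "-1"] \<O>b p] fv Lpow_uminus[of p UNIV v'] by simp
  have fw_eq: "f w = f u - f v" unfolding w_def using add[OF uL v1L] scale[OF vL, of "-1"] by simp
  have "ennreal (Lp_norm p \<O> w powr p) <= ennreal \<eta>" using rep_Lp_norm[OF rw \<O>b p fw] \<eta>(2) by simp
  then have "Lp_norm p \<O> w powr p <= \<eta>" using \<eta>(1) by simp
  moreover have nn: "0 <= Lp_norm p \<O> w" by (simp add: Lp_norm_def)
  ultimately have "Lp_norm p \<O> w <= \<eta> powr (1 / p)"
   using powr_mono2[of "1 / p" "Lp_norm p \<O> w powr p" \<eta>] p by (simp add: powr_powr)
  have "\<bar>f w\<bar> <= C0 * Lp_norm p \<O> w" by (rule bound[OF wL])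
  also have "... <= \<bar>C0\<bar> * Lp_norm p \<O> w" using nn by (intro mult_right_mono) auto
  also have "... <= \<bar>C0\<bar> * \<eta> powr (1 / p)" using \<open>Lp_norm p \<O> w <= \<eta> powr (1 / p)\<close> by (intro mult_left_mono) auto
  finally show "\<bar>f u - f v\<bar> <= \<bar>C0\<bar> * \<eta> powr (1 / p)" by (simp add: fw_eq)
 qed simp
qed

lemma test_functions_Lpow_finite:
 fixes \<phi> :: "'a::euclidean_space => real"
 assumes p: "1 < p" and \<phi>: "\<phi> : test_functions \<O>"
 shows "Lpow p UNIV \<phi> < \<infinity>" "Lpow p UNIV (grad \<phi>) < \<infinity>"
proof -
 have s: "smooth \<phi>" using \<phi> by (simp add: test_functions_iff)
 note m = smooth_borel[OF s] grad_borel[OF s]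
 obtain K where K: "compact K" "K \<subseteq> \<O>" "!!x. x ~: K ==> \<phi> x = 0"
  using \<phi> unfolding test_functions_iff by blast
 have \<phi>K: "\<phi> : test_functions K" using s K unfolding test_functions_iff by blast
 obtain B where B: "0 <= B" "!!x. \<bar>\<phi> x\<bar> <= B" using test_functions_bounded[OF \<phi>] by blast
 have "\<exists>B. \<forall>b\<in>Basis. \<forall>x. \<bar>partial b \<phi> x\<bar> <= B b"
  using test_functions_bounded[OF test_functions_partial[OF \<phi>]] by (intro bchoice) blast
 then obtain D where D: "!!b x. b : Basis ==> \<bar>partial b \<phi> x\<bar> <= D b" by blast
 have g: "norm (grad \<phi> x) <= sum D Basis" for x
  unfolding grad_def by (rule sum_norm_le) (simp add: D)
 show "Lpow p UNIV \<phi> < \<infinity>"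
  by (rule Lpow_bounded_support_finite[of p _ B K]) (use p m B K compact_imp_bounded[OF K(1)] in auto)
 show "Lpow p UNIV (grad \<phi>) < \<infinity>"
  by (rule Lpow_bounded_support_finite[of p _ "sum D Basis" K])
   (use p m g compact_imp_bounded[OF K(1)] grad_test_eq_0[OF \<phi>K] in auto)
qed

text \<open>
Positivity of \<open>K_const\<close> makes smallness of the Sobolev norm equivalent to smallness of both terms.
\<close>
lemma W1p_zero_iff_approximable:
 fixes u :: "'a::euclidean_space => real"
 assumes p: "1 < p" and e: "e : Basis" and \<O>: "open \<O>" and u: "rep \<O> u u'" "Lpow p UNIV u' < \<infinity>"
  and wg: "wgrad \<O> u' g'" and g0: "!!x. x ~: \<O> ==> g' x = 0" and g: "Lpow p UNIV g' < \<infinity>"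
 shows "u : W1p_zero e p \<O> \<longleftrightarrow> approximable p \<O> u' g'"
proof -
 let ?K = "K_const e p"
 have K: "0 < ?K" by (rule K_const_pos[OF p e])
 have um: "u' : Borel" and gm: "g' : Borel" using wg by (auto simp: wgrad_def loc_int_def)
 have mass: "ennreal (W1p_norm e p \<O> (%x. u x - \<phi> x) powr p)
   = Lpow p UNIV (%x. u' x - \<phi> x) + ennreal ?K * Lpow p UNIV (%x. g' x - grad \<phi> x)"
  if \<phi>: "\<phi> : test_functions \<O>" for \<phi>
 proof (cases "Lpow p UNIV \<phi> < \<infinity> & Lpow p UNIV (grad \<phi>) < \<infinity>")
  case True
  have s: "smooth \<phi>" using \<phi> by (simp add: test_functions_iff)
  note m = smooth_borel[OF s] grad_borel[OF s]
  have r: "rep \<O> (%x. u x - \<phi> x) (%x. u' x - \<phi> x)"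
   by (rule rep_diff[OF u(1) rep_refl[OF m(1) test_functions_eq_0[OF \<phi>]]])
  have wd: "wgrad \<O> (%x. u' x - \<phi> x) (%x. g' x - grad \<phi> x)"
   using wgrad_lincomb[OF wg wgrad_smooth[OF s], of 1 "-1"] by simp
  have "Lpow p UNIV (%x. u' x - \<phi> x) < \<infinity>" "Lpow p UNIV (%x. g' x - grad \<phi> x) < \<infinity>"
   using Lpow_add_finite[OF p um _ u(2), of "%x. - \<phi> x"] Lpow_add_finite[OF p gm _ g, of "%x. - grad \<phi> x"]
    True m by (simp_all add: Lpow_uminus)
  from W1p_rep(2)[OF \<O> p r this(1) wd _ this(2)] show ?thesis using g0 grad_test_eq_0[OF \<phi>] by simp
 next
  case False
  then show ?thesis using test_functions_Lpow_finite[OF p \<phi>] by simp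
 qed
 have uW: "u : W1p p \<O>" by (rule W1p_rep(1)[OF \<O> p u wg g0 g])
 show ?thesis
 proof
  assume "u : W1p_zero e p \<O>"
  then have ap: "!!\<eta>. 0 < \<eta> ==> \<exists>\<phi>\<in>test_functions \<O>. W1p_norm e p \<O> (%x. u x - \<phi> x) < \<eta>"
   by (auto simp: W1p_zero_def)
  show "approximable p \<O> u' g'" unfolding approximable_def
  proof (intro allI impI)
   fix \<eta> :: real assume \<eta>: "0 < \<eta>"
   define \<tau> where "\<tau> = min \<eta> (?K * \<eta>)"
   have \<tau>: "0 < \<tau>" using \<eta> K by (simp add: \<tau>_def)
   obtain \<phi> where \<phi>: "\<phi> : test_functions \<O>" "W1p_norm e p \<O> (%x. u x - \<phi> x) < \<tau> powr (1 / p)"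
    using ap[of "\<tau> powr (1 / p)"] \<tau> by auto
   have "W1p_norm e p \<O> (%x. u x - \<phi> x) powr p <= (\<tau> powr (1 / p)) powr p"
    using \<phi>(2) p by (intro powr_mono2) (auto simp: W1p_norm_def)
   then have le: "Lpow p UNIV (%x. u' x - \<phi> x) + ennreal ?K * Lpow p UNIV (%x. g' x - grad \<phi> x) <= ennreal \<tau>"
    unfolding mass[OF \<phi>(1), symmetric] using p \<tau> by (simp add: powr_powr ennreal_leI)
   have 1: "Lpow p UNIV (%x. u' x - \<phi> x) <= ennreal \<eta>"
    by (rule order_trans[OF _ order_trans[OF le]]) (auto simp: \<tau>_def intro!: ennreal_leI)
   have "ennreal ?K * Lpow p UNIV (%x. g' x - grad \<phi> x) <= ennreal \<tau>"
    by (rule order_trans[OF _ le]) simp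
   also have "... <= ennreal ?K * ennreal \<eta>"
    using K \<eta> by (simp flip: ennreal_mult add: \<tau>_def ennreal_leI)
   finally have 2: "Lpow p UNIV (%x. g' x - grad \<phi> x) <= ennreal \<eta>"
    using K by (simp add: ennreal_mult_le_mult_iff)
   show "\<exists>\<phi>\<in>test_functions \<O>. Lpow p UNIV (%x. u' x - \<phi> x) <= ennreal \<eta> & Lpow p UNIV (%x. g' x - grad \<phi> x) <= ennreal \<eta>"
    using \<phi>(1) 1 2 by blast
  qed
 next
  assume ap: "approximable p \<O> u' g'"
  have "\<exists>\<phi>\<in>test_functions \<O>. W1p_norm e p \<O> (%x. u x - \<phi> x) < \<eta>" if \<eta>: "0 < \<eta>" for \<eta>
  proof -
   define \<tau> where "\<tau> = (\<eta> / 2) powr p / (1 + ?K)"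
   have \<tau>: "0 < \<tau>" using \<eta> K by (simp add: \<tau>_def)
   obtain \<phi> where \<phi>: "\<phi> : test_functions \<O>" "Lpow p UNIV (%x. u' x - \<phi> x) <= ennreal \<tau>"
     "Lpow p UNIV (%x. g' x - grad \<phi> x) <= ennreal \<tau>"
    using ap \<tau> unfolding approximable_def by blast
   have "ennreal (W1p_norm e p \<O> (%x. u x - \<phi> x) powr p) <= ennreal \<tau> + ennreal ?K * ennreal \<tau>"
    unfolding mass[OF \<phi>(1)] by (intro add_mono mult_left_mono \<phi>) auto
   also have "... = ennreal ((\<eta> / 2) powr p)"
   proof -
    have "\<tau> * (1 + ?K) = (\<eta> / 2) powr p" using K by (simp add: \<tau>_def)
    then have "\<tau> + ?K * \<tau> = (\<eta> / 2) powr p" by (simp add: algebra_simps)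
    then show ?thesis using ennreal_plus[of \<tau> "?K * \<tau>"] ennreal_mult[of ?K \<tau>] \<tau> K by simp
   qed
   finally have "W1p_norm e p \<O> (%x. u x - \<phi> x) powr p <= (\<eta> / 2) powr p" by simp
   moreover have "0 <= W1p_norm e p \<O> (%x. u x - \<phi> x)" by (simp add: W1p_norm_def)
   ultimately have "W1p_norm e p \<O> (%x. u x - \<phi> x) <= \<eta> / 2"
    using powr_less_mono2[of p "\<eta> / 2" "W1p_norm e p \<O> (%x. u x - \<phi> x)"] p \<eta>
    by (cases "\<eta> / 2 < W1p_norm e p \<O> (%x. u x - \<phi> x)") auto
   then show ?thesis using \<phi>(1) \<eta> by (intro bexI[of _ \<phi>]) auto
  qed
  then show "u : W1p_zero e p \<O>" using uW by (simp add: W1p_zero_def)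
 qed
qed

section \<open>Dual norms and perturbations of the unit ball\<close>

text \<open>
It is enough to find, for each competitor and each smaller value \<open>y\<close>, one \<open>v\<close> that exceeds \<open>y\<close> and belongs to
the unit balls for all small parameters.
\<close>
lemma dual_norm_le_Liminf:
 assumes "!!u y. u : X ==> N u <= 1 ==> y < \<bar>f u\<bar> ==>
   \<exists>v. y < \<bar>f v\<bar> & (\<forall>\<^sub>F \<epsilon> in F. v : X' \<epsilon> & N' \<epsilon> v <= 1)"
 shows "dual_norm X N f <= Liminf F (%\<epsilon>. dual_norm (X' \<epsilon>) (N' \<epsilon>) f)"
 unfolding dual_norm_def[of X]
proof (rule SUP_least)
 fix u assume "u : {u : X. N u <= 1}"
 then have u: "u : X" "N u <= 1" by auto
 show "ereal \<bar>f u\<bar> <= Liminf F (%\<epsilon>. dual_norm (X' \<epsilon>) (N' \<epsilon>) f)"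
 proof (rule dense_le)
  fix y' :: ereal assume y': "y' < ereal \<bar>f u\<bar>"
  obtain y where y: "y' <= ereal y" "y < \<bar>f u\<bar>"
  proof (cases y')
   case (real r)
   then show ?thesis using that[of r] y' by simp
  next
   case MInf
   then show ?thesis using that[of "\<bar>f u\<bar> - 1"] by simp
  qed (use y' in simp)
  obtain v where v: "y < \<bar>f v\<bar>" "\<forall>\<^sub>F \<epsilon> in F. v : X' \<epsilon> & N' \<epsilon> v <= 1"
   using assms[OF u y(2)] by blast
  have "\<forall>\<^sub>F \<epsilon> in F. ereal y <= dual_norm (X' \<epsilon>) (N' \<epsilon>) f"
   using v(2)
  proof eventually_elim
   case (elim \<epsilon>)
   have "ereal \<bar>f v\<bar> <= dual_norm (X' \<epsilon>) (N' \<epsilon>) f"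
    unfolding dual_norm_def by (rule SUP_upper) (use elim in simp)
   moreover have "ereal y <= ereal \<bar>f v\<bar>" using v(1) by simp
   ultimately show ?case by (rule order_trans[rotated])
  qed
  then have "ereal y <= Liminf F (%\<epsilon>. dual_norm (X' \<epsilon>) (N' \<epsilon>) f)" by (rule Liminf_bounded)
  then show "y' <= Liminf F (%\<epsilon>. dual_norm (X' \<epsilon>) (N' \<epsilon>) f)" using y(1) by simp
 qed
qed

text \<open>
If the dual norms do not stay below a number larger than the claimed limit, there are elements of the unit
balls with large values for a frequent set of parameters, and \<open>upper\<close> produces a contradicting limit.
The hypothesis \<open>zero\<close> ensures that the supremum is not over the empty set.
\<close>
lemma dual_norm_tendsto:
 assumes lower: "dual_norm X N f <= Liminf F (%\<epsilon>. dual_norm (X' \<epsilon>) (N' \<epsilon>) f)"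
  and upper: "!!L. 0 < L ==> (\<exists>\<^sub>F \<epsilon> in F. \<exists>u\<in>X' \<epsilon>. N' \<epsilon> u <= 1 & L <= \<bar>f u\<bar>) ==> \<exists>u\<in>X. N u <= 1 & L <= \<bar>f u\<bar>"
  and zero: "\<exists>u\<in>X. N u <= 1"
 shows "((%\<epsilon>. dual_norm (X' \<epsilon>) (N' \<epsilon>) f) \<longlongrightarrow> dual_norm X N f) F"
proof (rule order_tendstoI)
 fix a assume "a < dual_norm X N f"
 then show "\<forall>\<^sub>F \<epsilon> in F. a < dual_norm (X' \<epsilon>) (N' \<epsilon>) f"
  using lower unfolding le_Liminf_iff by blast
next
 fix a assume a: "dual_norm X N f < a"
 have up: "ereal \<bar>f u\<bar> <= dual_norm X N f" if "u : X" "N u <= 1" for u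
  unfolding dual_norm_def by (rule SUP_upper) (use that in simp)
 have nn: "0 <= dual_norm X N f"
 proof -
  obtain u where "u : X" "N u <= 1" using zero by blast
  then show ?thesis using up[of u] by (meson abs_ge_zero ereal_less_eq(5) order_trans)
 qed
 obtain L where L: "dual_norm X N f < ereal L" "ereal L < a" using ereal_dense2[OF a] by blast
 have L0: "0 < L" using le_less_trans[OF nn L(1)] by simp
 have "\<not> (\<exists>u\<in>X. N u <= 1 & L <= \<bar>f u\<bar>)"
 proof
  assume "\<exists>u\<in>X. N u <= 1 & L <= \<bar>f u\<bar>"
  then obtain u where u: "u : X" "N u <= 1" "L <= \<bar>f u\<bar>" by blast
  have "ereal L <= dual_norm X N f" using order_trans[OF _ up[OF u(1,2)], of "ereal L"] u(3) by simp
  then show False using L(1) by simp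
 qed
 then have "\<not> (\<exists>\<^sub>F \<epsilon> in F. \<exists>u\<in>X' \<epsilon>. N' \<epsilon> u <= 1 & L <= \<bar>f u\<bar>)" using upper[OF L0] by blast
 then have "\<forall>\<^sub>F \<epsilon> in F. \<forall>u\<in>X' \<epsilon>. N' \<epsilon> u <= 1 --> \<bar>f u\<bar> < L"
  unfolding not_frequently by (rule eventually_mono) (auto simp: not_le)
 then show "\<forall>\<^sub>F \<epsilon> in F. dual_norm (X' \<epsilon>) (N' \<epsilon>) f < a"
 proof eventually_elim
  case (elim \<epsilon>)
  have "dual_norm (X' \<epsilon>) (N' \<epsilon>) f <= ereal L"
   unfolding dual_norm_def by (rule SUP_least) (use elim in force)
  then show ?case using L(2) by (rule le_less_trans)
 qed
qed

text \<open>
The strict inequality leaves room for the errors in \<open>energy_upper\<close>.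
\<close>
lemma energy_eventually_le_1:
 fixes v :: "'a::euclidean_space => real" and e :: 'a
 assumes p: "1 < p" and e: "e : Basis" and wg: "wgrad UNIV v g"
  and fin: "Lpow p UNIV v < \<infinity>" "Lpow p UNIV g < \<infinity>" and A: "A : sets borel"
  and mass: "sobmass p (K_const e p) A v g < 1"
  and k: "!!\<epsilon>. 0 < \<epsilon> ==> levy p (k \<epsilon>)" and tail: "!!r. 0 < r ==> ((%\<epsilon>. tail (k \<epsilon>) r) \<longlongrightarrow> 0) (at_right 0)"
 shows "\<forall>\<^sub>F \<epsilon> in at_right (0::real). Lpow p A v + (\<integral>\<^sup>+h. k \<epsilon> h * osc p (A \<times> UNIV) v h \<partial>lborel) <= 1"
proof -
 let ?G = "ennreal (K_const e p) * Lpow p A g"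
 have sm: "Lpow p A v + ?G < 1" using mass by (simp add: sobmass_def)
 have "Lpow p A v < \<infinity>" by (rule less_trans[OF le_less_trans[OF _ sm]]) auto
 moreover have "?G < \<infinity>" by (rule less_trans[OF le_less_trans[OF _ sm]]) auto
 ultimately obtain a b where a: "0 <= a" "Lpow p A v = ennreal a" and b: "0 <= b" "?G = ennreal b"
  by (cases "Lpow p A v"; cases ?G) auto
 have "ennreal (a + b) < 1" using sm a b by simp
 then have ab: "a + b < 1" using ennreal_leI[of 1 "a + b"] by (cases "1 <= a + b") (auto simp del: ennreal_plus)
 define \<theta> where "\<theta> = (1 - a - b) / 3"
 define \<eta> where "\<eta> = \<theta> / (b + 1)"
 have \<theta>: "0 < \<theta>" using ab by (simp add: \<theta>_def)
 have \<eta>: "0 < \<eta>" "\<eta> * b <= \<theta>" using \<theta> b(1) by (auto simp: \<eta>_def divide_simps mult_left_mono)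
 obtain r C where r: "0 < r" "0 <= C" and up: "!!k A. levy p k ==> A : sets borel ==>
   (\<integral>\<^sup>+h. k h * osc p (A \<times> UNIV) v h \<partial>lborel)
    <= ennreal (1 + \<eta>) * (ennreal (K_const e p) * Lpow p A g) + ennreal \<theta> + ennreal C * tail k r"
  using energy_upper[OF p e wg fin \<eta>(1) \<theta>] by blast
 have "((%\<epsilon>. ennreal C * tail (k \<epsilon>) r) \<longlongrightarrow> ennreal C * 0) (at_right 0)"
  by (rule ennreal_tendsto_cmult[OF _ tail[OF r(1)]]) simp
 then have "\<forall>\<^sub>F \<epsilon> in at_right 0. ennreal C * tail (k \<epsilon>) r < ennreal \<theta>"
  using \<theta> by (intro order_tendstoD) auto
 then show ?thesis using eventually_at_right_less[of "0::real"]
 proof eventually_elim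
  case (elim \<epsilon>)
  have "Lpow p A v + (\<integral>\<^sup>+h. k \<epsilon> h * osc p (A \<times> UNIV) v h \<partial>lborel)
    <= ennreal a + (ennreal (1 + \<eta>) * ennreal b + ennreal \<theta> + ennreal \<theta>)"
   unfolding a(2) b(2)[symmetric]
   by (rule add_left_mono, rule order_trans[OF up[OF k[OF elim(2)] A]], rule add_left_mono) (use elim(1) in simp)
  also have "... = ennreal (a + ((1 + \<eta>) * b + \<theta> + \<theta>))"
  proof -
   have "ennreal (1 + \<eta>) * ennreal b = ennreal ((1 + \<eta>) * b)" using \<eta>(1) b(1) by (simp only: ennreal_mult)
   moreover have "0 <= (1 + \<eta>) * b" using \<eta>(1) b(1) by simp
   ultimately show ?thesis using a(1) less_imp_le[OF \<theta>] by (simp only: ennreal_plus add_nonneg_nonneg)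
  qed
  also have "... <= 1"
  proof -
   have "a + ((1 + \<eta>) * b + \<theta> + \<theta>) = a + b + \<eta> * b + 2 * \<theta>" by (simp add: algebra_simps)
   also have "... <= 1"
   proof -
    have "3 * \<theta> = 1 - a - b" by (simp add: \<theta>_def)
    then show ?thesis using \<eta>(2) by linarith
   qed
   finally show ?thesis by (simp add: ennreal_le_1)
  qed
  finally show ?case .
 qed
qed

text \<open>
Shrinking a competitor by a factor \<open>c\<close> turns norm at most 1 into norm less than 1 and keeps the functional
above \<open>y\<close>.
\<close>
lemma ex_contraction:
 fixes y a :: real
 assumes "y < a" "0 <= a"
 obtains c where "0 < c" "c < 1" "y < c * a"
proof -
 have "((%c. c * a) \<longlongrightarrow> 1 * a) (at_left 1)" by (intro tendsto_intros)
 then have "\<forall>\<^sub>F c in at_left 1. y < c * a" using assms(1) by (intro order_tendstoD) auto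
 moreover have "\<forall>\<^sub>F c in at_left 1. c : {0<..<1::real}" by (rule eventually_at_left_real) simp
 ultimately have "\<forall>\<^sub>F c in at_left (1::real). y < c * a & c : {0<..<1}" by (rule eventually_conj)
 from eventually_happens'[OF _ this] have "\<exists>c. y < c * a & c : {0<..<1}" by simp
 then show ?thesis using that by auto
qed

lemma sobmass_scale:
 assumes m: "v : Borel" "g : Borel" "A : sets borel"
 shows "sobmass p K A (%x. c * v x) (%x. c *\<^sub>R g x) = ennreal (\<bar>c\<bar> powr p) * sobmass p K A v g"
 unfolding sobmass_def using Lpow_scaleR[OF m(1,3), of p c] Lpow_scaleR[OF m(2,3), of p c]
 by (simp add: distrib_left mult.left_commute)

lemma sobmass_perturb:
 fixes v :: "'a::euclidean_space => real"
 assumes p: "1 < p" and K: "0 <= K" and m: "v : Borel" "g : Borel"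
  and mass: "sobmass p K UNIV v g < 1"
 obtains \<tau> where "0 < \<tau>" "!!w h. w : Borel ==> h : Borel ==>
  Lpow p UNIV (%x. v x - w x) <= ennreal \<tau> ==> Lpow p UNIV (%x. g x - h x) <= ennreal \<tau> ==> sobmass p K UNIV w h < 1"
proof -
 obtain M where M: "0 <= M" "sobmass p K UNIV v g = ennreal M"
  using mass by (cases "sobmass p K UNIV v g") auto
 have M1: "M < 1" using mass unfolding M(2) using ennreal_leI[of 1 M] by (cases "1 <= M") auto
 define \<eta> where "\<eta> = (1 - M) / 2"
 have \<eta>: "0 < \<eta>" using M1 by (simp add: \<eta>_def)
 have U: "(UNIV :: 'a set) : sets borel" by simp
 obtain C1 where C1: "0 <= C1" "!!u w. u : Borel ==> w : Borel ==>
   Lpow p UNIV (%x::'a. u x + w x :: real) <= ennreal (1 + \<eta>) * Lpow p UNIV u + ennreal C1 * Lpow p UNIV w"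
  using Lpow_add_le[OF p \<eta>, where 'a='a and 'b=real] by (metis U)
 obtain C2 where C2: "0 <= C2" "!!u w. u : Borel ==> w : Borel ==>
   Lpow p UNIV (%x::'a. u x + w x :: 'a) <= ennreal (1 + \<eta>) * Lpow p UNIV u + ennreal C2 * Lpow p UNIV w"
  using Lpow_add_le[OF p \<eta>, where 'a='a and 'b='a] by (metis U)
 define D where "D = C1 + K * C2"
 have D: "0 <= D" using C1(1) C2(1) K by (simp add: D_def)
 \<comment> \<open>the error \<open>D * \<tau>\<close> then stays below \<open>\<eta>\<close>, half of the available gap\<close>
 define q where "q = (1 - M) / 4"
 have q: "0 < q" using M1 by (simp add: q_def)
 define \<tau> where "\<tau> = q / (1 + D)"
 have \<tau>: "0 < \<tau>" using q D by (simp add: \<tau>_def)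
 have D\<tau>: "D * \<tau> < \<eta>"
 proof -
  have "D * \<tau> <= (1 + D) * \<tau>" using \<tau> by (intro mult_right_mono) auto
  also have "... = q" using D by (simp add: \<tau>_def)
  finally show ?thesis using q by (simp add: \<eta>_def q_def)
 qed
 show ?thesis
 proof (rule that[OF \<tau>])
  fix w :: "'a => real" and h :: "'a => 'a"
  assume wm: "w : Borel" and hm: "h : Borel"
   and w: "Lpow p UNIV (%x. v x - w x) <= ennreal \<tau>" and h: "Lpow p UNIV (%x. g x - h x) <= ennreal \<tau>"
  have "Lpow p UNIV w <= ennreal (1 + \<eta>) * Lpow p UNIV v + ennreal C1 * Lpow p UNIV (%x. w x - v x)"
   using C1(2)[OF m(1), of "%x. w x - v x"] wm m(1) by simp
  also have "... <= ennreal (1 + \<eta>) * Lpow p UNIV v + ennreal C1 * ennreal \<tau>"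
   using w unfolding Lpow_minus_commute[of p UNIV v] by (intro add_left_mono mult_left_mono) auto
  finally have 1: "Lpow p UNIV w <= ennreal (1 + \<eta>) * Lpow p UNIV v + ennreal C1 * ennreal \<tau>" .
  have "Lpow p UNIV h <= ennreal (1 + \<eta>) * Lpow p UNIV g + ennreal C2 * Lpow p UNIV (%x. h x - g x)"
   using C2(2)[OF m(2), of "%x. h x - g x"] hm m(2) by simp
  also have "... <= ennreal (1 + \<eta>) * Lpow p UNIV g + ennreal C2 * ennreal \<tau>"
   using h unfolding Lpow_minus_commute[of p UNIV g] by (intro add_left_mono mult_left_mono) auto
  finally have 2: "Lpow p UNIV h <= ennreal (1 + \<eta>) * Lpow p UNIV g + ennreal C2 * ennreal \<tau>" .
  have "sobmass p K UNIV w h <= (ennreal (1 + \<eta>) * Lpow p UNIV v + ennreal C1 * ennreal \<tau>)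
    + ennreal K * (ennreal (1 + \<eta>) * Lpow p UNIV g + ennreal C2 * ennreal \<tau>)"
   unfolding sobmass_def by (intro add_mono mult_left_mono 1 2) auto
  also have "... = ennreal (1 + \<eta>) * sobmass p K UNIV v g + (ennreal C1 * ennreal \<tau> + ennreal K * (ennreal C2 * ennreal \<tau>))"
   unfolding sobmass_def by (simp only: distrib_left ac_simps)
  also have "ennreal C1 * ennreal \<tau> + ennreal K * (ennreal C2 * ennreal \<tau>) = ennreal (D * \<tau>)"
  proof -
   have "ennreal K * (ennreal C2 * ennreal \<tau>) = ennreal (K * C2 * \<tau>)"
    using ennreal_mult[of C2 \<tau>] ennreal_mult[of K "C2 * \<tau>"] C2(1) K \<tau> by (simp add: mult.assoc)
   moreover have "ennreal C1 * ennreal \<tau> = ennreal (C1 * \<tau>)" using ennreal_mult[of C1 \<tau>] C1(1) \<tau> by simp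
   moreover have "0 <= C1 * \<tau>" "0 <= K * C2 * \<tau>" using C1(1) C2(1) K \<tau> by auto
   ultimately show ?thesis unfolding D_def distrib_right by (simp add: ennreal_plus)
  qed
  also have "ennreal (1 + \<eta>) * sobmass p K UNIV v g + ennreal (D * \<tau>) = ennreal ((1 + \<eta>) * M + D * \<tau>)"
  proof -
   have "ennreal (1 + \<eta>) * ennreal M = ennreal ((1 + \<eta>) * M)" using ennreal_mult[of "1 + \<eta>" M] \<eta> M(1) by simp
   moreover have "0 <= (1 + \<eta>) * M" "0 <= D * \<tau>" using \<eta> M(1) D \<tau> by auto
   ultimately show ?thesis unfolding M(2) by (simp only: ennreal_plus)
  qed
  also have "... < 1"
  proof -
   have "\<eta> * M <= \<eta> * 1" using \<eta> M1 by (intro mult_left_mono) auto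
   then have "(1 + \<eta>) * M + D * \<tau> < M + \<eta> + \<eta>" using D\<tau> by (simp add: distrib_right)
   also have "... = 1" by (simp add: \<eta>_def)
   finally show ?thesis using ennreal_lessI[of 1 "(1 + \<eta>) * M + D * \<tau>"] by (simp only: ennreal_1)
  qed
  finally show "sobmass p K UNIV w h < 1" .
 qed
qed

lemma contracted_mass_lt_1:
 assumes "1 < p" "0 < c" "c < 1" "M <= 1" shows "ennreal (\<bar>c\<bar> powr p) * M < 1"
proof -
 have "ennreal (\<bar>c\<bar> powr p) * M <= ennreal (c powr p) * 1" using assms by (intro mult_mono) auto
 also have "... < 1"
 proof -
  have "c powr p < 1" using powr_less_mono2[of p c 1] assms by simp
  then have "ennreal (c powr p) < ennreal 1" by (intro ennreal_lessI) auto
  then show ?thesis by simp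
 qed
 finally show ?thesis .
qed

section \<open>Asymptotic lower bounds for the nonlocal dual norms\<close>

text \<open>
The competitor is a multiple of a test function close to \<open>u\<close>, for which \<open>energy_upper\<close> holds on the whole space.
\<close>
lemma liminf_zero:
 fixes e :: "'a::euclidean_space" and f :: "('a => real) => real"
 assumes p: "1 < p" and e: "e : Basis" and \<nu>: "kernel_family p \<nu>" and \<O>: "open \<O>" and f: "f : Lp_dual p \<O>"
 shows "dual_norm (W1p_zero e p \<O>) (W1p_norm e p \<O>) f
    <= Liminf (at_right 0) (%\<epsilon>. dual_norm (W\<nu>_zero p (\<nu> \<epsilon>) \<O>) (W\<nu>_zero_norm p (\<nu> \<epsilon>) \<O>) f)"
proof (rule dual_norm_le_Liminf)
 have \<O>b: "\<O> : sets borel" using \<O> by simp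
 obtain k where k: "!!\<epsilon>. 0 < \<epsilon> ==> levy p (k \<epsilon>)" "!!\<epsilon>. 0 < \<epsilon> ==> AE h in lborel. ennreal (\<nu> \<epsilon> h) = k \<epsilon> h"
  "!!\<epsilon> h. 0 < \<epsilon> ==> h \<noteq> 0 ==> 0 <= \<nu> \<epsilon> h" "!!r. 0 < r ==> ((%\<epsilon>. tail (k \<epsilon>) r) \<longlongrightarrow> 0) (at_right 0)"
  by (rule kernel_family_levy[OF \<nu> p]) (rule that, blast+)
 obtain M where M: "0 <= M" "!!u v u' v' \<eta>. [|rep \<O> u u'; rep \<O> v v'; Lpow p UNIV u' < \<infinity>; Lpow p UNIV v' < \<infinity>; 0 <= \<eta>;
   Lpow p UNIV (%x. u' x - v' x) <= ennreal \<eta>|] ==> \<bar>f u - f v\<bar> <= M * \<eta> powr (1 / p)"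
  by (rule Lp_dual_modulus[OF f p \<O>]) (rule that, blast+)
 fix u y assume u: "u : W1p_zero e p \<O>" "W1p_norm e p \<O> u <= 1" and y: "y < \<bar>f u\<bar>"
 have uW: "u : W1p p \<O>" using u(1) by (simp add: W1p_zero_def)
 obtain u' g' where ug: "rep \<O> u u'" "Lpow p UNIV u' < \<infinity>" "wgrad \<O> u' g'" "!!x. x ~: \<O> ==> g' x = 0" "Lpow p UNIV g' < \<infinity>"
  by (rule W1pE[OF \<O> p uW]) (rule that, blast+)
 have ap: "approximable p \<O> u' g'" using W1p_zero_iff_approximable[OF p e \<O> ug] u(1) by simp
 have um: "u' : Borel" and gm: "g' : Borel" using ug(3) by (auto simp: wgrad_def loc_int_def)
 let ?K = "K_const e p"
 have mass: "sobmass p ?K UNIV u' g' <= 1"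
  using u(2) W1p_rep(2)[OF \<O> p ug, of e] by (simp add: W1p_norm_le_1_iff[OF p] sobmass_def)
 obtain c where c: "0 < c" "c < 1" "y < c * \<bar>f u\<bar>" by (rule ex_contraction[OF y]) auto
 define v where "v = (%x. c * u' x)"
 define G where "G = (%x. c *\<^sub>R g' x)"
 have vm [measurable]: "v : Borel" and Gm [measurable]: "G : Borel"
  using um gm by (simp_all add: v_def G_def)
 have vmass: "sobmass p ?K UNIV v G < 1"
  unfolding v_def G_def sobmass_scale[OF um gm borel_open[OF open_UNIV]] by (rule contracted_mass_lt_1[OF p c(1,2) mass])
 have K0: "0 <= ?K" by (rule K_const_nonneg)
 obtain \<tau> where \<tau>: "0 < \<tau>" "!!w h. w : Borel ==> h : Borel ==>
   Lpow p UNIV (%x. v x - w x) <= ennreal \<tau> ==> Lpow p UNIV (%x. G x - h x) <= ennreal \<tau> ==> sobmass p ?K UNIV w h < 1"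
  by (rule sobmass_perturb[OF p K0 vm Gm vmass]) blast
 define q where "q = (c * \<bar>f u\<bar> - y) / (2 * (M + 1))"
 have q: "0 < q" using c(3) M(1) by (simp add: q_def)
 have "(2 * (M + 1)) * q = c * \<bar>f u\<bar> - y" using M(1) by (simp add: q_def)
 then have Mq: "M * q < c * \<bar>f u\<bar> - y" using q c(3) by (simp add: algebra_simps)
 define \<gamma> where "\<gamma> = q powr p"
 have \<gamma>: "0 < \<gamma>" using q by (simp add: \<gamma>_def)
 have \<gamma>M: "M * \<gamma> powr (1 / p) < c * \<bar>f u\<bar> - y" using Mq q p by (simp add: \<gamma>_def powr_powr)
 have "0 < min \<tau> \<gamma>" using \<tau>(1) \<gamma> by simp
 then obtain \<phi> where \<phi>: "\<phi> : test_functions \<O>" and \<phi>u: "Lpow p UNIV (%x. u' x - \<phi> x) <= ennreal (min \<tau> \<gamma>)"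
   and \<phi>g: "Lpow p UNIV (%x. g' x - grad \<phi> x) <= ennreal (min \<tau> \<gamma>)"
  using ap unfolding approximable_def by blast
 have s: "smooth \<phi>" using \<phi> by (simp add: test_functions_iff)
 note m = smooth_borel[OF s] grad_borel[OF s]
 define \<psi> where "\<psi> = (%x. c * \<phi> x)"
 define H where "H = (%x. c *\<^sub>R grad \<phi> x)"
 have \<psi>m: "\<psi> : Borel" and Hm: "H : Borel" using m by (simp_all add: \<psi>_def H_def)
 have \<psi>0: "\<psi> x = 0" if "x ~: \<O>" for x using test_functions_eq_0[OF \<phi> that] by (simp add: \<psi>_def)
 have shrink: "Lpow p UNIV (%x. c *\<^sub>R w x) <= Lpow p UNIV w" for w :: "'a => 'b::euclidean_space"
  by (rule Lpow_mono[OF p]) (use c in \<open>auto intro: mult_left_le_one_le\<close>)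
 have fin\<psi>: "Lpow p UNIV \<psi> < \<infinity>" "Lpow p UNIV H < \<infinity>"
  using le_less_trans[OF shrink[of \<phi>] test_functions_Lpow_finite(1)[OF p \<phi>]]
   le_less_trans[OF shrink[of "grad \<phi>"] test_functions_Lpow_finite(2)[OF p \<phi>]] by (simp_all add: \<psi>_def H_def)
 have wg: "wgrad UNIV \<psi> H"
  using wgrad_lincomb[OF wgrad_smooth[OF s] wgrad_smooth[OF s], of UNIV c 0] by (simp add: \<psi>_def H_def)
 have \<psi>mass: "sobmass p ?K UNIV \<psi> H < 1"
 proof (rule \<tau>(2)[OF \<psi>m Hm])
  have "Lpow p UNIV (%x. v x - \<psi> x) <= ennreal (min \<tau> \<gamma>)"
   using order_trans[OF shrink[of "%x. u' x - \<phi> x"] \<phi>u] by (simp add: v_def \<psi>_def right_diff_distrib)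
  then show "Lpow p UNIV (%x. v x - \<psi> x) <= ennreal \<tau>" by (rule order_trans) (auto intro: ennreal_leI)
  have "Lpow p UNIV (%x. G x - H x) <= ennreal (min \<tau> \<gamma>)"
   using order_trans[OF shrink[of "%x. g' x - grad \<phi> x"] \<phi>g] by (simp add: G_def H_def scaleR_diff_right)
  then show "Lpow p UNIV (%x. G x - H x) <= ennreal \<tau>" by (rule order_trans) (auto intro: ennreal_leI)
 qed
 have r\<psi>: "rep \<O> \<psi> \<psi>" by (rule rep_refl[OF \<psi>m \<psi>0])
 have E: "\<forall>\<^sub>F \<epsilon> in at_right 0. Lpow p UNIV \<psi> + (\<integral>\<^sup>+h. k \<epsilon> h * osc p (UNIV \<times> UNIV) \<psi> h \<partial>lborel) <= 1"
  by (rule energy_eventually_le_1[OF p e wg fin\<psi> _ \<psi>mass k(1,4)]) simp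
 have ev: "\<forall>\<^sub>F \<epsilon> in at_right 0. \<psi> : W\<nu>_zero p (\<nu> \<epsilon>) \<O> & W\<nu>_zero_norm p (\<nu> \<epsilon>) \<O> \<psi> <= 1"
  using E eventually_at_right_less[of "0::real"]
 proof eventually_elim
  case (elim \<epsilon>)
  have "\<psi> : borel_measurable lebesgue" using \<psi>m by (simp add: measurable_completion)
  then show ?case
   using W\<nu>_zero_unit_ball_iff[OF p \<O> k(1)[OF elim(2)] k(2,3)[OF elim(2)] r\<psi>] \<psi>0 elim(1) by simp
 qed
 have "y < \<bar>f \<psi>\<bar>"
 proof -
  have "\<bar>f u - f \<phi>\<bar> <= M * \<gamma> powr (1 / p)"
  proof (rule M(2)[OF ug(1) rep_refl[OF m(1) test_functions_eq_0[OF \<phi>]] ug(2) test_functions_Lpow_finite(1)[OF p \<phi>]])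
   show "Lpow p UNIV (%x. u' x - \<phi> x) <= ennreal \<gamma>" by (rule order_trans[OF \<phi>u]) (auto intro: ennreal_leI)
  qed (use \<gamma> in simp_all)
  moreover have "f \<psi> = c * f \<phi>"
  proof -
   have "\<phi> : Lp p \<O>"
    using Lp_iff_rep[OF rep_refl[OF m(1) test_functions_eq_0[OF \<phi>]] \<O>b p] test_functions_Lpow_finite(1)[OF p \<phi>] by simp
   then show ?thesis using f unfolding Lp_dual_def \<psi>_def by blast
  qed
  ultimately have 1: "c * \<bar>f u\<bar> - \<bar>f \<psi>\<bar> <= c * (M * \<gamma> powr (1 / p))"
  proof -
   have "\<bar>f u\<bar> - \<bar>f \<phi>\<bar> <= M * \<gamma> powr (1 / p)" using \<open>\<bar>f u - f \<phi>\<bar> <= M * \<gamma> powr (1 / p)\<close> by linarith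
   then have "c * (\<bar>f u\<bar> - \<bar>f \<phi>\<bar>) <= c * (M * \<gamma> powr (1 / p))" using c(1) by (intro mult_left_mono) auto
   then show ?thesis using \<open>f \<psi> = c * f \<phi>\<close> c(1) by (simp add: abs_mult right_diff_distrib)
  qed
  have "c * (M * \<gamma> powr (1 / p)) <= M * \<gamma> powr (1 / p)" using c M(1) by (intro mult_left_le_one_le) auto
  then show ?thesis using 1 \<gamma>M by linarith
 qed
 then show "\<exists>v. y < \<bar>f v\<bar> & (\<forall>\<^sub>F \<epsilon> in at_right 0. v : W\<nu>_zero p (\<nu> \<epsilon>) \<O> & W\<nu>_zero_norm p (\<nu> \<epsilon>) \<O> v <= 1)"
  using ev by blast
qed

text \<open>
The energy over \<open>\<O> \<times> \<O>\<close> only sees \<open>u\<close>, but \<open>energy_upper\<close> uses an extension of \<open>u\<close>; the increments that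
leave \<open>\<O>\<close> are added for the upper bound.
\<close>
lemma liminf_extension:
 fixes e :: "'a::euclidean_space" and f :: "('a => real) => real"
 assumes p: "1 < p" and e: "e : Basis" and \<nu>: "kernel_family p \<nu>" and \<O>: "open \<O>" and f: "f : Lp_dual p \<O>"
  and ext: "!!u. u : W1p p \<O> ==> \<exists>U\<in>W1p p UNIV. AE x in lebesgue_on \<O>. U x = u x"
 shows "dual_norm (W1p p \<O>) (W1p_norm e p \<O>) f
    <= Liminf (at_right 0) (%\<epsilon>. dual_norm (W\<nu> p (\<nu> \<epsilon>) \<O>) (W\<nu>_norm p (\<nu> \<epsilon>) \<O>) f)"
proof (rule dual_norm_le_Liminf)
 have \<O>b [measurable]: "\<O> : sets borel" using \<O> by simp
 obtain k where k: "!!\<epsilon>. 0 < \<epsilon> ==> levy p (k \<epsilon>)" "!!\<epsilon>. 0 < \<epsilon> ==> AE h in lborel. ennreal (\<nu> \<epsilon> h) = k \<epsilon> h"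
  "!!\<epsilon> h. 0 < \<epsilon> ==> h \<noteq> 0 ==> 0 <= \<nu> \<epsilon> h" "!!r. 0 < r ==> ((%\<epsilon>. tail (k \<epsilon>) r) \<longlongrightarrow> 0) (at_right 0)"
  by (rule kernel_family_levy[OF \<nu> p]) (rule that, blast+)
 fix u y assume u: "u : W1p p \<O>" "W1p_norm e p \<O> u <= 1" and y: "y < \<bar>f u\<bar>"
 let ?K = "K_const e p"
 obtain U where U: "U : W1p p UNIV" "AE x in lebesgue_on \<O>. U x = u x" using ext[OF u(1)] by blast
 obtain U' G' where UG: "rep UNIV U U'" "Lpow p UNIV U' < \<infinity>" "wgrad UNIV U' G'" "Lpow p UNIV G' < \<infinity>"
  by (rule W1pE[OF open_UNIV p U(1)]) (rule that, blast+)
 have m [measurable]: "U' : Borel" "G' : Borel" using UG(3) by (auto simp: wgrad_def loc_int_def)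
 define w where "w = (%x. indicator \<O> x *\<^sub>R U' x)"
 define h where "h = (%x. indicator \<O> x *\<^sub>R G' x)"
 have [measurable]: "w : Borel" by (simp add: w_def)
 have rw: "rep \<O> u w"
 proof -
  have "AE x in lebesgue. x : \<O> --> U x = u x" using U(2) by (simp add: AE_restrict_space_iff)
  then have "AE x in lborel. x : \<O> --> U x = u x" by (simp add: AE_completion_iff)
  moreover have "AE x in lborel. U x = U' x" using UG(1) by (simp add: rep_def)
  ultimately have "AE x in lborel. indicator \<O> x *\<^sub>R u x = w x" by eventually_elim (auto simp: w_def indicator_def)
  then show ?thesis by (auto simp: rep_def w_def)
 qed
 have fw: "Lpow p UNIV w < \<infinity>" "Lpow p UNIV h < \<infinity>"
  unfolding w_def h_def Lpow_indicator[OF p]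
  using le_less_trans[OF Lpow_mono_set[OF subset_UNIV] UG(2)] le_less_trans[OF Lpow_mono_set[OF subset_UNIV] UG(4)] by auto
 have "ennreal (W1p_norm e p \<O> u powr p) = Lpow p UNIV w + ennreal ?K * Lpow p UNIV h"
  by (rule W1p_rep(2)[OF \<O> p rw fw(1) _ _ fw(2)]) (use wgrad_restrict[OF UG(3) \<O>b] in \<open>auto simp: w_def h_def\<close>)
 then have mass: "sobmass p ?K \<O> U' G' <= 1"
  using u(2) Lpow_indicator[OF p, of \<O> U'] unfolding W1p_norm_le_1_iff[OF p]
  by (simp add: w_def h_def Lpow_indicator[OF p] sobmass_def)
 obtain c where c: "0 < c" "c < 1" "y < c * \<bar>f u\<bar>" by (rule ex_contraction[OF y]) auto
 let ?v = "%x. c * U' x" and ?G = "%x. c *\<^sub>R G' x"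
 have vmass: "sobmass p ?K \<O> ?v ?G < 1"
  unfolding sobmass_scale[OF m \<O>b] by (rule contracted_mass_lt_1[OF p c(1,2) mass])
 have wg: "wgrad UNIV ?v ?G" using wgrad_lincomb[OF UG(3) UG(3), of c 0] by simp
 have fin: "Lpow p UNIV ?v < \<infinity>" "Lpow p UNIV ?G < \<infinity>"
  using Lpow_scaleR[OF m(1), of UNIV p c] Lpow_scaleR[OF m(2), of UNIV p c] UG(2,4) by (simp_all add: ennreal_mult_less_top)
 have wv: "c * w x = indicator \<O> x *\<^sub>R ?v x" for x by (simp add: w_def)
 have E: "\<forall>\<^sub>F \<epsilon> in at_right 0. Lpow p \<O> ?v + (\<integral>\<^sup>+h. k \<epsilon> h * osc p (\<O> \<times> UNIV) ?v h \<partial>lborel) <= 1"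
  by (rule energy_eventually_le_1[OF p e wg fin \<O>b vmass k(1,4)])
 have ev: "\<forall>\<^sub>F \<epsilon> in at_right 0. (%x. c * u x) : W\<nu> p (\<nu> \<epsilon>) \<O> & W\<nu>_norm p (\<nu> \<epsilon>) \<O> (%x. c * u x) <= 1"
  using E eventually_at_right_less[of "0::real"]
 proof eventually_elim
  case (elim \<epsilon>)
  have "Lpow p UNIV (%x. c * w x) = Lpow p \<O> ?v" unfolding wv by (rule Lpow_indicator[OF p])
  moreover have "(\<integral>\<^sup>+h. k \<epsilon> h * osc p (\<O> \<times> \<O>) (%x. c * w x) h \<partial>lborel) <= (\<integral>\<^sup>+h. k \<epsilon> h * osc p (\<O> \<times> UNIV) ?v h \<partial>lborel)"
  proof (intro nn_integral_mono mult_left_mono)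
   fix h
   have "osc p (\<O> \<times> \<O>) (%x. c * w x) h = osc p (\<O> \<times> \<O>) ?v h" by (rule osc_cong) (simp add: w_def)
   also have "... <= osc p (\<O> \<times> UNIV) ?v h" by (rule osc_mono) auto
   finally show "osc p (\<O> \<times> \<O>) (%x. c * w x) h <= osc p (\<O> \<times> UNIV) ?v h" .
  qed simp
  ultimately have "Lpow p UNIV (%x. c * w x) + (\<integral>\<^sup>+h. k \<epsilon> h * osc p (\<O> \<times> \<O>) (%x. c * w x) h \<partial>lborel) <= 1"
   by (intro order_trans[OF add_mono elim(1)]) simp_all
  then show ?case using W\<nu>_unit_ball_iff[OF p \<O> k(1)[OF elim(2)] k(2,3)[OF elim(2)] rep_scale[OF rw]] by simp
 qed
 have "u : Lp p \<O>" using u(1) by (simp add: W1p_def)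
 then have "f (%x. c * u x) = c * f u" using f unfolding Lp_dual_def by blast
 then have "y < \<bar>f (%x. c * u x)\<bar>" using c by (simp add: abs_mult)
 then show "\<exists>v. y < \<bar>f v\<bar> & (\<forall>\<^sub>F \<epsilon> in at_right 0. v : W\<nu> p (\<nu> \<epsilon>) \<O> & W\<nu>_norm p (\<nu> \<epsilon>) \<O> v <= 1)"
  using ev by blast
qed

section \<open>Limits of nearly extremal functions\<close>

lemma osc_uminus: "osc p D (%x. - u x) h = osc p D u h"
 unfolding osc_def by (intro nn_integral_cong) (simp add: abs_minus_commute)

text \<open>
The case \<open>\<O>0 = \<O>\<close> serves \<open>W\<^sup>1\<^sup>,\<^sup>p(\<O>)\<close>, and the case of the whole space, where functions still vanish off \<open>\<O>\<close>,
serves \<open>W\<^sub>0\<^sup>1\<^sup>,\<^sup>p(\<O>)\<close>. After a change of sign the condition \<open>L \<le> f u\<close> is convex and closed, so it can be carried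
through \<open>sobolev_limit\<close>.
\<close>
lemma dual_limit:
 fixes e :: "'a::euclidean_space" and f :: "('a => real) => real"
 assumes p: "1 < p" and e: "e : Basis" and \<O>: "open \<O>" and \<O>0: "open \<O>0" "\<O> \<subseteq> \<O>0" and f: "f : Lp_dual p \<O>"
  and k: "!!\<epsilon>. 0 < \<epsilon> ==> levy p (k \<epsilon>)" and tail: "!!r. 0 < r ==> ((%\<epsilon>. tail (k \<epsilon>) r) \<longlongrightarrow> 0) (at_right (0::real))"
  and freq: "\<exists>\<^sub>F \<epsilon> in at_right 0. \<exists>u\<in>Borel. (\<forall>x. x ~: \<O> --> u x = 0) &
   Lpow p UNIV u + (\<integral>\<^sup>+h. k \<epsilon> h * osc p (\<O>0 \<times> \<O>0) u h \<partial>lborel) <= 1 & L <= \<bar>f u\<bar>"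
 obtains w g where "w : Borel" "!!x. x ~: \<O> ==> w x = 0" "L <= f w"
  "wgrad \<O>0 w g" "!!x. x ~: \<O>0 ==> g x = 0" "sobmass p (K_const e p) UNIV w g <= 1"
proof -
 have \<O>b [measurable]: "\<O> : sets borel" using \<O> by simp
 have add: "!!u v. u : Lp p \<O> ==> v : Lp p \<O> ==> f (%x. u x + v x) = f u + f v"
  and scale: "!!c u. u : Lp p \<O> ==> f (%x. c * u x) = c * f u"
  using f unfolding Lp_dual_def by auto
 obtain M where M: "0 <= M" "!!u v u' v' \<eta>. [|rep \<O> u u'; rep \<O> v v'; Lpow p UNIV u' < \<infinity>; Lpow p UNIV v' < \<infinity>; 0 <= \<eta>;
   Lpow p UNIV (%x. u' x - v' x) <= ennreal \<eta>|] ==> \<bar>f u - f v\<bar> <= M * \<eta> powr (1 / p)"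
  by (rule Lp_dual_modulus[OF f p \<O>]) (rule that, blast+)
 define Z where "Z = {u :: 'a => real. u : Borel & (\<forall>x. x ~: \<O> --> u x = 0)}"
 have Zrep: "rep \<O> u u" if "u : Z" for u using that by (intro rep_refl) (auto simp: Z_def)
 have ZLp: "u : Lp p \<O>" if "u : Z" "Lpow p UNIV u < \<infinity>" for u
  using Lp_iff_rep[OF Zrep[OF that(1)] \<O>b p] that(2) by simp
 define P where "P = (%\<epsilon> u. u : Z & Lpow p UNIV u + (\<integral>\<^sup>+h. k \<epsilon> h * osc p (\<O>0 \<times> \<O>0) u h \<partial>lborel) <= 1 & L <= f u)"
 have Pabs: "\<exists>v. P \<epsilon> v" if "u : Z" "Lpow p UNIV u + (\<integral>\<^sup>+h. k \<epsilon> h * osc p (\<O>0 \<times> \<O>0) u h \<partial>lborel) <= 1" "L <= \<bar>f u\<bar>" for u \<epsilon>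
 proof (cases "0 <= f u")
  case True
  then show ?thesis using that unfolding P_def by (intro exI[of _ u]) simp
 next
  case False
  have "Lpow p UNIV u <= 1" by (rule order_trans[OF _ that(2)]) simp
  then have "u : Lp p \<O>" using that(1) by (intro ZLp) (auto intro: le_less_trans)
  from scale[OF this, of "-1"] have "f (%x. - u x) = - f u" by simp
  then show ?thesis using that False unfolding P_def Z_def
   by (intro exI[of _ "%x. - u x"]) (simp add: Lpow_uminus osc_uminus)
 qed
 have "\<exists>\<epsilon> u. 0 < \<epsilon> & \<epsilon> < inverse (real (Suc n)) & P \<epsilon> u" for n
 proof -
  have "\<forall>\<^sub>F \<epsilon> in at_right 0. \<epsilon> : {0<..<inverse (real (Suc n))}" by (rule eventually_at_right_real) simp
  from frequently_ex[OF frequently_eventually_frequently[OF freq this]]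
  obtain \<epsilon> u where "\<epsilon> : {0<..<inverse (real (Suc n))}" "u : Z"
   "Lpow p UNIV u + (\<integral>\<^sup>+h. k \<epsilon> h * osc p (\<O>0 \<times> \<O>0) u h \<partial>lborel) <= 1" "L <= \<bar>f u\<bar>"
   unfolding Z_def by blast
  with Pabs[of u \<epsilon>] show ?thesis by auto
 qed
 then obtain eps u where eps: "!!n. 0 < eps n" "!!n. eps n < inverse (real (Suc n))" and u: "!!n. P (eps n) (u n)" by metis
 have "eps \<longlonglongrightarrow> 0"
  by (rule tendsto_sandwich[OF _ _ tendsto_const LIMSEQ_inverse_real_of_nat])
   (use eps in \<open>auto intro!: always_eventually less_imp_le\<close>)
 then have fl: "filterlim eps (at_right 0) sequentially" using eps(1) less_imp_neq[OF eps(1)]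
  by (auto simp: filterlim_at intro!: always_eventually)
 define Q where "Q = (%s. s : Z & L <= f s)"
 have um: "u n : Borel" and u0: "x ~: \<O>0 ==> u n x = 0"
  and umass: "Lpow p UNIV (u n) + (\<integral>\<^sup>+h. k (eps n) h * osc p (\<O>0 \<times> \<O>0) (u n) h \<partial>lborel) <= 1" and uQ: "Q (u n)" for n x
  using u[of n] \<O>0(2) by (auto simp: P_def Z_def Q_def)
 have Qmid: "Q (%x. (1/2) *\<^sub>R (v x + w x))"
  if Q: "Q v" "Q w" and m: "v : Borel" "w : Borel"
   and le: "Lpow p UNIV v <= 1" "Lpow p UNIV w <= 1" for v w
 proof -
  have fin: "Lpow p UNIV v < \<infinity>" "Lpow p UNIV w < \<infinity>" using le by (auto intro: le_less_trans)
  have Z: "v : Z" "w : Z" "(%x. v x + w x) : Z" using Q m by (auto simp: Q_def Z_def)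
  have L: "v : Lp p \<O>" "w : Lp p \<O>" "(%x. v x + w x) : Lp p \<O>"
   using ZLp[OF Z(1) fin(1)] ZLp[OF Z(2) fin(2)] ZLp[OF Z(3) Lpow_add_finite[OF p m fin]] by auto
  have "f (%x. (1/2) *\<^sub>R (v x + w x)) = (1/2) * (f v + f w)"
   using scale[OF L(3), of "1/2"] add[OF L(1,2)] by simp
  then show ?thesis using Q Z by (simp add: Q_def Z_def)
 qed
 obtain s w0 g where s: "!!j. Q (s j)" "!!j. s j : Borel" "!!j. Lpow p UNIV (s j) <= 1"
  and w0: "w0 : Borel" "!!x. x ~: \<O>0 ==> w0 x = 0" and lim: "(%j. Lpow p UNIV (%x. s j x - w0 x)) \<longlonglongrightarrow> 0"
  and wg: "wgrad \<O>0 w0 g" and g0: "!!x. x ~: \<O>0 ==> g x = 0" and mass: "sobmass p (K_const e p) UNIV w0 g <= 1"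
  by (rule sobolev_limit[where Q=Q, OF p e \<O>0(1) k[OF eps(1)] filterlim_compose[OF tail fl] um u0 umass uQ Qmid])
   (assumption+, rule that, blast+)
 note [measurable] = w0(1) s(2)
 \<comment> \<open>the limit vanishes off \<open>\<O>\<close> only almost everywhere\<close>
 define w where "w = (%x. indicator \<O> x *\<^sub>R w0 x)"
 have wm [measurable]: "w : Borel" by (simp add: w_def)
 have "Lpow p (- \<O>) w0 <= Lpow p UNIV (%x. s j x - w0 x)" for j
 proof -
  have "s j x = 0" if "x ~: \<O>" for x using s(1)[of j] that by (simp add: Q_def Z_def)
  then have "Lpow p (- \<O>) w0 <= Lpow p (- \<O>) (%x. s j x - w0 x)" by (intro Lpow_mono[OF p]) auto
  also have "... <= Lpow p UNIV (%x. s j x - w0 x)" by (rule Lpow_mono_set) simp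
  finally show ?thesis .
 qed
 then have "Lpow p (- \<O>) w0 <= 0" by (intro LIMSEQ_le_const[OF lim]) auto
 then have "AE x in lborel. ennreal (norm (w0 x) powr p) * indicator (- \<O>) x = 0"
  unfolding Lpow_def by (subst nn_integral_0_iff_AE[symmetric]) auto
 then have ae: "AE x in lborel. w0 x = w x" by eventually_elim (auto simp: w_def indicator_def split: if_splits)
 have wZ: "w : Z" by (simp add: Z_def w_def)
 have Lw: "Lpow p UNIV w0 = Lpow p UNIV w" by (rule Lpow_cong_AE) (use ae in eventually_elim, simp)
 have mass': "sobmass p (K_const e p) UNIV w g <= 1" using mass by (simp add: sobmass_def Lw)
 have "Lpow p UNIV w <= 1" by (rule order_trans[OF _ mass']) (simp add: sobmass_def)
 then have wfin: "Lpow p UNIV w < \<infinity>" by (auto intro: le_less_trans)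
 have "L <= f w"
 proof (rule field_le_epsilon)
  fix d :: real assume d: "0 < d"
  define \<eta> where "\<eta> = (d / (M + 1)) powr p"
  have \<eta>: "0 < \<eta>" using d M(1) by (simp add: \<eta>_def)
  have "M * \<eta> powr (1 / p) = M * (d / (M + 1))" using p d M(1) by (simp add: \<eta>_def powr_powr)
  also have "... <= d" using d M(1) by (simp add: field_simps)
  finally have M\<eta>: "M * \<eta> powr (1 / p) <= d" .
  have "\<forall>\<^sub>F j in sequentially. Lpow p UNIV (%x. s j x - w0 x) < ennreal \<eta>"
   using \<eta> by (intro order_tendstoD(2)[OF lim]) simp
  then obtain j where j: "Lpow p UNIV (%x. s j x - w0 x) < ennreal \<eta>"
   using eventually_happens'[OF sequentially_bot] by blast
  have "Lpow p UNIV (%x. s j x - w x) = Lpow p UNIV (%x. s j x - w0 x)"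
   by (rule Lpow_cong_AE) (use ae in eventually_elim, simp)
  then have "Lpow p UNIV (%x. s j x - w x) <= ennreal \<eta>" using j by simp
  moreover have "s j : Z" "L <= f (s j)" using s(1)[of j] by (auto simp: Q_def)
  moreover have "Lpow p UNIV (s j) < \<infinity>" using s(3)[of j] by (auto intro: le_less_trans)
  ultimately have "\<bar>f (s j) - f w\<bar> <= M * \<eta> powr (1 / p)"
   by (intro M(2)[OF Zrep Zrep[OF wZ] _ wfin]) (use \<eta> in auto)
  then show "L <= f w + d" using M\<eta> \<open>L <= f (s j)\<close> by linarith
 qed
 moreover have "wgrad \<O>0 w g" by (rule wgrad_cong_AE[OF wg wm ae])
 ultimately show ?thesis using that[OF wm _ _ _ g0 mass'] wZ by (simp add: Z_def)
qed

section \<open>Convergence of the dual norms\<close>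

lemma Lp_dual_rep:
 assumes f: "f : Lp_dual p \<O>" and p: "1 < p" and \<O>: "open \<O>" and r: "rep \<O> u u'" "Lpow p UNIV u' < \<infinity>"
 shows "f u = f u'"
proof -
 obtain M where "!!u v u' v' \<eta>. [|rep \<O> u u'; rep \<O> v v'; Lpow p UNIV u' < \<infinity>; Lpow p UNIV v' < \<infinity>; 0 <= \<eta>;
   Lpow p UNIV (%x. u' x - v' x) <= ennreal \<eta>|] ==> \<bar>f u - f v\<bar> <= M * \<eta> powr (1 / p)"
  by (rule Lp_dual_modulus[OF f p \<O>]) (rule that, blast+)
 from this[OF r(1) rep_refl r(2) r(2), of 0] show ?thesis using r(1) by (simp add: rep_def Lpow_def)
qed

lemma sobmass_finite:
 assumes K: "0 < K" and le: "sobmass p K UNIV w g <= 1"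
 shows "Lpow p UNIV w < \<infinity>" "Lpow p UNIV g < \<infinity>"
proof -
 have "Lpow p UNIV w <= 1" by (rule order_trans[OF _ le]) (simp add: sobmass_def)
 then show "Lpow p UNIV w < \<infinity>" by (auto intro: le_less_trans)
 have "ennreal K * Lpow p UNIV g <= 1" by (rule order_trans[OF _ le]) (simp add: sobmass_def)
 then show "Lpow p UNIV g < \<infinity>" using K by (cases "Lpow p UNIV g") (auto simp: ennreal_mult_top top_unique)
qed

lemma W1p_limit:
 fixes e :: "'a::euclidean_space" and f :: "('a => real) => real"
 assumes p: "1 < p" and e: "e : Basis" and \<nu>: "kernel_family p \<nu>" and \<O>: "open \<O>" and f: "f : Lp_dual p \<O>"
  and freq: "\<exists>\<^sub>F \<epsilon> in at_right 0. \<exists>u\<in>W\<nu> p (\<nu> \<epsilon>) \<O>. W\<nu>_norm p (\<nu> \<epsilon>) \<O> u <= 1 & L <= \<bar>f u\<bar>"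
 shows "\<exists>u\<in>W1p p \<O>. W1p_norm e p \<O> u <= 1 & L <= \<bar>f u\<bar>"
proof -
 have \<O>b: "\<O> : sets borel" using \<O> by simp
 obtain k where k: "!!\<epsilon>. 0 < \<epsilon> ==> levy p (k \<epsilon>)" "!!\<epsilon>. 0 < \<epsilon> ==> AE h in lborel. ennreal (\<nu> \<epsilon> h) = k \<epsilon> h"
  "!!\<epsilon> h. 0 < \<epsilon> ==> h \<noteq> 0 ==> 0 <= \<nu> \<epsilon> h" "!!r. 0 < r ==> ((%\<epsilon>. tail (k \<epsilon>) r) \<longlongrightarrow> 0) (at_right 0)"
  by (rule kernel_family_levy[OF \<nu> p]) (rule that, blast+)
 have "\<exists>\<^sub>F \<epsilon> in at_right 0. (\<exists>u\<in>W\<nu> p (\<nu> \<epsilon>) \<O>. W\<nu>_norm p (\<nu> \<epsilon>) \<O> u <= 1 & L <= \<bar>f u\<bar>) & 0 < \<epsilon>"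
  by (rule frequently_eventually_frequently[OF freq eventually_at_right_less])
 then have fr: "\<exists>\<^sub>F \<epsilon> in at_right 0. \<exists>u\<in>Borel. (\<forall>x. x ~: \<O> --> u x = 0) &
   Lpow p UNIV u + (\<integral>\<^sup>+h. k \<epsilon> h * osc p (\<O> \<times> \<O>) u h \<partial>lborel) <= 1 & L <= \<bar>f u\<bar>"
 proof (rule frequently_elim1)
  fix \<epsilon> assume "(\<exists>u\<in>W\<nu> p (\<nu> \<epsilon>) \<O>. W\<nu>_norm p (\<nu> \<epsilon>) \<O> u <= 1 & L <= \<bar>f u\<bar>) & 0 < \<epsilon>"
  then obtain u where \<epsilon>: "0 < \<epsilon>" and u: "u : W\<nu> p (\<nu> \<epsilon>) \<O>" "W\<nu>_norm p (\<nu> \<epsilon>) \<O> u <= 1" "L <= \<bar>f u\<bar>" by blast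
  have "u : borel_measurable (lebesgue_on \<O>)" using u(1) by (simp add: W\<nu>_def Lp_def)
  then obtain u' where r: "rep \<O> u u'" by (rule ex_rep[OF \<O>b])
  have le: "Lpow p UNIV u' + (\<integral>\<^sup>+h. k \<epsilon> h * osc p (\<O> \<times> \<O>) u' h \<partial>lborel) <= 1"
   using W\<nu>_unit_ball_iff[OF p \<O> k(1)[OF \<epsilon>] k(2,3)[OF \<epsilon>] r] u(1,2) by simp
  have "Lpow p UNIV u' <= 1" by (rule order_trans[OF _ le]) simp
  then have "Lpow p UNIV u' < \<infinity>" by (auto intro: le_less_trans)
  with r have "f u = f u'" by (rule Lp_dual_rep[OF f p \<O>])
  then show "\<exists>u\<in>Borel. (\<forall>x. x ~: \<O> --> u x = 0) &
   Lpow p UNIV u + (\<integral>\<^sup>+h. k \<epsilon> h * osc p (\<O> \<times> \<O>) u h \<partial>lborel) <= 1 & L <= \<bar>f u\<bar>"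
   using r le u(3) by (intro bexI[of _ u']) (auto simp: rep_def)
 qed
 obtain w g where w: "w : Borel" "!!x. x ~: \<O> ==> w x = 0" "L <= f w"
  "wgrad \<O> w g" "!!x. x ~: \<O> ==> g x = 0" "sobmass p (K_const e p) UNIV w g <= 1"
  by (rule dual_limit[OF p e \<O> \<O> order_refl f k(1,4) fr]) (assumption+, rule that, blast+)
 have fin: "Lpow p UNIV w < \<infinity>" "Lpow p UNIV g < \<infinity>" using sobmass_finite[OF K_const_pos[OF p e] w(6)] by auto
 note W = W1p_rep[OF \<O> p rep_refl[OF w(1,2)] fin(1) w(4,5) fin(2)]
 have "W1p_norm e p \<O> w <= 1" using w(6) W(2)[of e] by (simp add: W1p_norm_le_1_iff[OF p] sobmass_def)
 then show ?thesis using W(1) w(3) by (intro bexI[of _ w]) auto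
qed

text \<open>
The limit is a Sobolev function on the whole space that vanishes off \<open>\<O>\<close>, hence approximable by test functions
when the boundary is Lipschitz.
\<close>
lemma W1p_zero_limit:
 fixes e :: "'a::euclidean_space" and f :: "('a => real) => real"
 assumes p: "1 < p" and e: "e : Basis" and \<nu>: "kernel_family p \<nu>" and \<O>: "open \<O>" and f: "f : Lp_dual p \<O>"
  and bd: "bounded \<O>" "Lipschitz_boundary \<O>"
  and freq: "\<exists>\<^sub>F \<epsilon> in at_right 0. \<exists>u\<in>W\<nu>_zero p (\<nu> \<epsilon>) \<O>. W\<nu>_zero_norm p (\<nu> \<epsilon>) \<O> u <= 1 & L <= \<bar>f u\<bar>"
 shows "\<exists>u\<in>W1p_zero e p \<O>. W1p_norm e p \<O> u <= 1 & L <= \<bar>f u\<bar>"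
proof -
 have \<O>b [measurable]: "\<O> : sets borel" using \<O> by simp
 obtain k where k: "!!\<epsilon>. 0 < \<epsilon> ==> levy p (k \<epsilon>)" "!!\<epsilon>. 0 < \<epsilon> ==> AE h in lborel. ennreal (\<nu> \<epsilon> h) = k \<epsilon> h"
  "!!\<epsilon> h. 0 < \<epsilon> ==> h \<noteq> 0 ==> 0 <= \<nu> \<epsilon> h" "!!r. 0 < r ==> ((%\<epsilon>. tail (k \<epsilon>) r) \<longlongrightarrow> 0) (at_right 0)"
  by (rule kernel_family_levy[OF \<nu> p]) (rule that, blast+)
 have "\<exists>\<^sub>F \<epsilon> in at_right 0. (\<exists>u\<in>W\<nu>_zero p (\<nu> \<epsilon>) \<O>. W\<nu>_zero_norm p (\<nu> \<epsilon>) \<O> u <= 1 & L <= \<bar>f u\<bar>) & 0 < \<epsilon>"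
  by (rule frequently_eventually_frequently[OF freq eventually_at_right_less])
 then have fr: "\<exists>\<^sub>F \<epsilon> in at_right 0. \<exists>u\<in>Borel. (\<forall>x. x ~: \<O> --> u x = 0) &
   Lpow p UNIV u + (\<integral>\<^sup>+h. k \<epsilon> h * osc p (UNIV \<times> UNIV) u h \<partial>lborel) <= 1 & L <= \<bar>f u\<bar>"
 proof (rule frequently_elim1)
  fix \<epsilon> assume "(\<exists>u\<in>W\<nu>_zero p (\<nu> \<epsilon>) \<O>. W\<nu>_zero_norm p (\<nu> \<epsilon>) \<O> u <= 1 & L <= \<bar>f u\<bar>) & 0 < \<epsilon>"
  then obtain u where \<epsilon>: "0 < \<epsilon>" and u: "u : W\<nu>_zero p (\<nu> \<epsilon>) \<O>" "W\<nu>_zero_norm p (\<nu> \<epsilon>) \<O> u <= 1" "L <= \<bar>f u\<bar>" by blast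
  have um: "u : borel_measurable (lebesgue_on \<O>)" and ul: "u : borel_measurable lebesgue"
   and u0: "AE x in lebesgue. x : - \<O> --> u x = 0" using u(1) by (auto simp: W\<nu>_zero_def Lp_def)
  obtain u' where r: "rep \<O> u u'" using um by (rule ex_rep[OF \<O>b])
  have le: "Lpow p UNIV u' + (\<integral>\<^sup>+h. k \<epsilon> h * osc p (UNIV \<times> UNIV) u' h \<partial>lborel) <= 1"
   using W\<nu>_zero_unit_ball_iff[OF p \<O> k(1)[OF \<epsilon>] k(2,3)[OF \<epsilon>] r ul u0] u(1,2) by simp
  have "Lpow p UNIV u' <= 1" by (rule order_trans[OF _ le]) simp
  then have "Lpow p UNIV u' < \<infinity>" by (auto intro: le_less_trans)
  with r have "f u = f u'" by (rule Lp_dual_rep[OF f p \<O>])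
  then show "\<exists>u\<in>Borel. (\<forall>x. x ~: \<O> --> u x = 0) &
   Lpow p UNIV u + (\<integral>\<^sup>+h. k \<epsilon> h * osc p (UNIV \<times> UNIV) u h \<partial>lborel) <= 1 & L <= \<bar>f u\<bar>"
   using r le u(3) by (intro bexI[of _ u']) (auto simp: rep_def)
 qed
 obtain w g where w: "w : Borel" "!!x. x ~: \<O> ==> w x = 0" "L <= f w"
  "wgrad UNIV w g" "sobmass p (K_const e p) UNIV w g <= 1"
  by (rule dual_limit[OF p e \<O> open_UNIV subset_UNIV f k(1,4) fr]) (assumption+, rule that, blast+)
 have fin: "Lpow p UNIV w < \<infinity>" "Lpow p UNIV g < \<infinity>" using sobmass_finite[OF K_const_pos[OF p e] w(5)] by auto
 have ap: "approximable p \<O> w g" by (rule approximable_Lipschitz[OF p \<O> bd w(4) fin w(2)])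
 have [measurable]: "g : Borel" using w(4) by (auto simp: wgrad_def loc_int_def)
 define h where "h = (%x. indicator \<O> x *\<^sub>R g x)"
 have h0: "h x = 0" if "x ~: \<O>" for x using that by (simp add: h_def)
 have hg: "Lpow p UNIV h <= Lpow p UNIV g" by (rule Lpow_mono[OF p]) (simp add: h_def indicator_def)
 then have hfin: "Lpow p UNIV h < \<infinity>" using fin(2) by (rule le_less_trans)
 have wh: "wgrad \<O> w h"
 proof -
  have "(%x. indicator \<O> x *\<^sub>R w x) = w" using w(2) by (intro ext) (auto simp: indicator_def)
  then show ?thesis using wgrad_restrict[OF w(4) \<O>b] by (simp only: h_def)
 qed
 note rw = rep_refl[OF w(1,2)]
 have "approximable p \<O> w h" unfolding approximable_def
 proof (intro allI impI)
  fix \<eta> :: real assume "0 < \<eta>"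
  then obtain \<phi> where \<phi>: "\<phi> : test_functions \<O>" "Lpow p UNIV (%x. w x - \<phi> x) <= ennreal \<eta>"
   "Lpow p UNIV (%x. g x - grad \<phi> x) <= ennreal \<eta>" using ap unfolding approximable_def by blast
  have "Lpow p UNIV (%x. h x - grad \<phi> x) <= Lpow p UNIV (%x. g x - grad \<phi> x)"
   by (rule Lpow_mono[OF p]) (auto simp: h_def indicator_def grad_test_eq_0[OF \<phi>(1)])
  then show "\<exists>\<phi>\<in>test_functions \<O>. Lpow p UNIV (%x. w x - \<phi> x) <= ennreal \<eta> & Lpow p UNIV (%x. h x - grad \<phi> x) <= ennreal \<eta>"
   using \<phi> order_trans by blast
 qed
 then have wz: "w : W1p_zero e p \<O>" using W1p_zero_iff_approximable[OF p e \<O> rw fin(1) wh h0 hfin] by simp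
 have "sobmass p (K_const e p) UNIV w h <= sobmass p (K_const e p) UNIV w g"
  unfolding sobmass_def by (intro add_left_mono mult_left_mono hg) simp
 then have "sobmass p (K_const e p) UNIV w h <= 1" using w(5) by (rule order_trans)
 then have "W1p_norm e p \<O> w <= 1"
  using W1p_rep(2)[OF \<O> p rw fin(1) wh h0 hfin, of e] by (simp add: W1p_norm_le_1_iff[OF p] sobmass_def)
 then show ?thesis using wz w(3) by (intro bexI[of _ w]) auto
qed

lemma zero_in_W1p_zero:
 fixes e :: "'a::euclidean_space"
 assumes p: "1 < p" and e: "e : Basis" and \<O>: "open \<O>"
 shows "(%_. 0) : W1p_zero e p \<O>" "W1p_norm e p \<O> (%_. 0) <= 1"
proof -
 have s: "smooth (%_::'a. 0)" by (rule smooth_const)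
 then have t: "(%_::'a. 0) : test_functions \<O>" unfolding test_functions_iff by (auto intro!: exI[of _ "{}"])
 have g: "grad (%_::'a. 0) x = 0" for x by (rule grad_test_eq_0[of _ "{}"]) (use s in \<open>auto simp: test_functions_iff\<close>)
 have r: "rep \<O> (%_::'a. 0::real) (%_. 0)" by (rule rep_refl) auto
 have fin: "Lpow p UNIV (%_::'a. 0::real) = 0" "Lpow p UNIV (grad (%_::'a. 0)) = 0" by (simp_all add: Lpow_def g)
 have "approximable p \<O> (%_::'a. 0) (grad (%_::'a. 0))"
  unfolding approximable_def using t fin by (auto intro!: bexI[of _ "%_. 0"] simp: Lpow_def)
 then show "(%_. 0) : W1p_zero e p \<O>"
  using W1p_zero_iff_approximable[OF p e \<O> r _ wgrad_smooth[OF s]] fin g by simp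
 show "W1p_norm e p \<O> (%_. 0) <= 1"
  using W1p_rep(2)[OF \<O> p r _ wgrad_smooth[OF s], of e] fin g by (simp add: W1p_norm_le_1_iff[OF p])
qed

theorem theorem3p9:
  fixes p :: real
    and e :: "'a::euclidean_space"
    and \<Omega> :: "'a set"
    and \<nu> :: "real \<Rightarrow> 'a \<Rightarrow> real"
    and f :: "('a \<Rightarrow> real) \<Rightarrow> real"
  assumes "1 < p"
    and "e \<in> Basis"
    and "kernel_family p \<nu>"
    and "open \<Omega>"
    and "f \<in> Lp_dual p \<Omega>"
  shows
    "dual_norm (W1p_zero e p \<Omega>) (W1p_norm e p \<Omega>) f
       \<le> Liminf (at_right 0) (\<lambda>\<epsilon>. dual_norm (W\<nu>_zero p (\<nu> \<epsilon>) \<Omega>) (W\<nu>_zero_norm p (\<nu> \<epsilon>) \<Omega>) f)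
     \<and>
     (W1p_extension_domain e p \<Omega> \<longrightarrow>
        dual_norm (W1p p \<Omega>) (W1p_norm e p \<Omega>) f
          \<le> Liminf (at_right 0) (\<lambda>\<epsilon>. dual_norm (W\<nu> p (\<nu> \<epsilon>) \<Omega>) (W\<nu>_norm p (\<nu> \<epsilon>) \<Omega>) f))
     \<and>
     (W1p_extension_domain e p \<Omega> \<and> bounded \<Omega> \<and> Lipschitz_boundary \<Omega> \<longrightarrow>
        ((\<lambda>\<epsilon>. dual_norm (W\<nu> p (\<nu> \<epsilon>) \<Omega>) (W\<nu>_norm p (\<nu> \<epsilon>) \<Omega>) f)
           \<longlongrightarrow> dual_norm (W1p p \<Omega>) (W1p_norm e p \<Omega>) f) (at_right 0) \<and>
        ((\<lambda>\<epsilon>. dual_norm (W\<nu>_zero p (\<nu> \<epsilon>) \<Omega>) (W\<nu>_zero_norm p (\<nu> \<epsilon>) \<Omega>) f)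
           \<longlongrightarrow> dual_norm (W1p_zero e p \<Omega>) (W1p_norm e p \<Omega>) f) (at_right 0))"
proof (intro conjI impI)
  note f = assms(5) and p = assms(1) and e = assms(2) and \<nu> = assms(3) and \<Omega> = assms(4)
  show lz: "dual_norm (W1p_zero e p \<Omega>) (W1p_norm e p \<Omega>) f
       \<le> Liminf (at_right 0) (\<lambda>\<epsilon>. dual_norm (W\<nu>_zero p (\<nu> \<epsilon>) \<Omega>) (W\<nu>_zero_norm p (\<nu> \<epsilon>) \<Omega>) f)"
    by (rule liminf_zero[OF p e \<nu> \<Omega> f])
  have l: "dual_norm (W1p p \<Omega>) (W1p_norm e p \<Omega>) f
       \<le> Liminf (at_right 0) (\<lambda>\<epsilon>. dual_norm (W\<nu> p (\<nu> \<epsilon>) \<Omega>) (W\<nu>_norm p (\<nu> \<epsilon>) \<Omega>) f)"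
    if "W1p_extension_domain e p \<Omega>"
    by (rule liminf_extension[OF p e \<nu> \<Omega> f]) (use that in \<open>unfold W1p_extension_domain_def, blast\<close>)
  show "dual_norm (W1p p \<Omega>) (W1p_norm e p \<Omega>) f
       \<le> Liminf (at_right 0) (\<lambda>\<epsilon>. dual_norm (W\<nu> p (\<nu> \<epsilon>) \<Omega>) (W\<nu>_norm p (\<nu> \<epsilon>) \<Omega>) f)"
    if "W1p_extension_domain e p \<Omega>" using that by (rule l)
  note z = zero_in_W1p_zero[OF p e \<Omega>]
  assume ext: "W1p_extension_domain e p \<Omega> \<and> bounded \<Omega> \<and> Lipschitz_boundary \<Omega>"
  show "((\<lambda>\<epsilon>. dual_norm (W\<nu> p (\<nu> \<epsilon>) \<Omega>) (W\<nu>_norm p (\<nu> \<epsilon>) \<Omega>) f)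
           \<longlongrightarrow> dual_norm (W1p p \<Omega>) (W1p_norm e p \<Omega>) f) (at_right 0)"
  proof (rule dual_norm_tendsto[OF l])
    show "W1p_extension_domain e p \<Omega>" using ext by simp
    show "\<exists>u\<in>W1p p \<Omega>. W1p_norm e p \<Omega> u \<le> 1" using z by (auto simp: W1p_zero_def)
  qed (rule W1p_limit[OF p e \<nu> \<Omega> f])
  show "((\<lambda>\<epsilon>. dual_norm (W\<nu>_zero p (\<nu> \<epsilon>) \<Omega>) (W\<nu>_zero_norm p (\<nu> \<epsilon>) \<Omega>) f)
           \<longlongrightarrow> dual_norm (W1p_zero e p \<Omega>) (W1p_norm e p \<Omega>) f) (at_right 0)"
  proof (rule dual_norm_tendsto[OF lz])
    show "\<exists>u\<in>W1p_zero e p \<Omega>. W1p_norm e p \<Omega> u \<le> 1" using z by auto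
  qed (rule W1p_zero_limit[OF p e \<nu> \<Omega> f], use ext in simp_all)
qed

end
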